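(* Let $\mathfrak{g}$ be one of the classical Lie algebras $\mathfrak{sl}(n+1,\mathbb{C})$, $\mathfrak{o}(2n+1,\mathbb{C})$, $\mathfrak{sp}(2n,\mathbb{C})$, $\mathfrak{o}(2n,\mathbb{C})$ $(n\ge 2$ in the last case$)$, with a Chevalley basis. Let $\phi:\mathfrak{g}\to\mathfrak{gl}(V)$ be the irreducible representation with highest weight $\lambda$, let $\mu_1,\dots,\mu_s$ be the distinct dominant weights of $V$, and let $k_i=|O_{\mu_i}|$ be the size of the orbit of $\mu_i$ under the Weyl group $\mathscr{W}$. Then $$f_\phi(z_0,L)=(f_{\mu_1})^{m_\lambda(\mu_1)}\cdots(f_{\mu_s})^{m_\lambda(\mu_s)},$$ where each $f_{\mu_i}$ is irreducible of degree $k_i$.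
   Context: $f_\phi(z_0,L)=\det(z_0I+\phi(L))$, viewed as a polynomial in $z_0$ and the coordinates of $L$ with respect to the Chevalley basis. $m_\lambda(\mu)$ is the dimension of the $\mu$-weight space of $V$. Let $\mathfrak{h}$ be a Cartan subalgebra, $\mathscr{W}$ the Weyl group acting on $\mathfrak{h}^*$, $O_\mu=\mathscr{W}\mu$. Orbital factor: for semisimple $L\in\mathfrak{g}$ choose $h\in\mathfrak{h}$ conjugate to $L$ under the adjoint group (unique up to $\mathscr{W}$) and set $f_\mu(z_0,L)=\prod_{\nu\in O_\mu}(z_0+\nu(h))$; this extends uniquely to a polynomial function on $\mathbb{C}\times\mathfrak{g}$. Irreducibility is over $\mathbb{C}$ in the polynomial ring in $z_0$ and the coordinates of $L$. *)

theory Defs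
  imports "HOL-Analysis.Analysis" "HOL-Library.Poly_Mapping"
    "HOL-Computational_Algebra.Factorial_Ring"
begin

type_synonym cmat = "nat \<Rightarrow> nat \<Rightarrow> complex"

definition is_mat :: "nat \<Rightarrow> cmat \<Rightarrow> bool" where
  "is_mat N A \<longleftrightarrow> (\<forall>i j. (N \<le> i \<or> N \<le> j) \<longrightarrow> A i j = 0)"

definition mmul :: "nat \<Rightarrow> cmat \<Rightarrow> cmat \<Rightarrow> cmat" where
  "mmul N A B = (\<lambda>i j. if i < N \<and> j < N then (\<Sum>k<N. A i k * B k j) else 0)"

definition mzero :: cmat where "mzero = (\<lambda>i j. 0)"

definition mT :: "cmat \<Rightarrow> cmat" where "mT A = (\<lambda>i j. A j i)"

definition idm :: "nat \<Rightarrow> cmat" where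
  "idm N = (\<lambda>i j. if i < N \<and> i = j then 1 else 0)"

definition mdet :: "nat \<Rightarrow> cmat \<Rightarrow> complex" where
  "mdet N A = (\<Sum>p | p permutes {..<N}. of_int (sign p) * (\<Prod>i<N. A i (p i)))"

definition brk :: "nat \<Rightarrow> cmat \<Rightarrow> cmat \<Rightarrow> cmat" where
  "brk N A B = (\<lambda>i j. mmul N A B i j - mmul N B A i j)"

datatype ctype = TA | TB | TC | TD

text \<open>A = sl(n+1), B = o(2n+1), C = sp(2n), D = o(2n).\<close>
fun dimN :: "ctype \<Rightarrow> nat \<Rightarrow> nat" where
  "dimN TA n = n + 1"
| "dimN TB n = 2 * n + 1"
| "dimN TC n = 2 * n"
| "dimN TD n = 2 * n"

text \<open>The bilinear forms (antidiagonal, so that diagonal matrices form a Cartan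
  subalgebra and upper triangular matrices a Borel subalgebra).\<close>
definition Jorth :: "nat \<Rightarrow> cmat" where
  "Jorth N = (\<lambda>i j. if i < N \<and> j < N \<and> i + j = N - 1 then 1 else 0)"

definition Jsp :: "nat \<Rightarrow> cmat" where
  "Jsp n = (\<lambda>i j. if i < 2*n \<and> j < 2*n \<and> i + j = 2*n - 1
                   then (if i < n then 1 else -1) else 0)"

fun Jform :: "ctype \<Rightarrow> nat \<Rightarrow> cmat" where
  "Jform TA n = idm (n + 1)"
| "Jform TB n = Jorth (2 * n + 1)"
| "Jform TC n = Jsp n"
| "Jform TD n = Jorth (2 * n)"

definition lie_alg :: "ctype \<Rightarrow> nat \<Rightarrow> cmat set" where
  "lie_alg t n = {A. is_mat (dimN t n) A \<and>
     (if t = TA then (\<Sum>i<dimN t n. A i i) = 0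
      else (\<lambda>i j. mmul (dimN t n) (mT A) (Jform t n) i j
                   + mmul (dimN t n) (Jform t n) A i j) = mzero)}"

definition cartan :: "ctype \<Rightarrow> nat \<Rightarrow> cmat set" where
  "cartan t n = {A \<in> lie_alg t n. \<forall>i j. i \<noteq> j \<longrightarrow> A i j = 0}"

text \<open>The connected group whose adjoint action is the adjoint group:
  SL(n+1), SO(2n+1), Sp(2n), SO(2n).\<close>
definition grp :: "ctype \<Rightarrow> nat \<Rightarrow> cmat set" where
  "grp t n = {g. is_mat (dimN t n) g \<and> mdet (dimN t n) g = 1 \<and>
     (t \<noteq> TA \<longrightarrow> mmul (dimN t n) (mmul (dimN t n) (mT g) (Jform t n)) g = Jform t n)}"

definition conj_by :: "ctype \<Rightarrow> nat \<Rightarrow> cmat \<Rightarrow> cmat \<Rightarrow> cmat \<Rightarrow> bool" where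
  "conj_by t n g L H \<longleftrightarrow> g \<in> grp t n \<and> mmul (dimN t n) g L = mmul (dimN t n) H g"

definition lincomb :: "nat \<Rightarrow> (nat \<Rightarrow> cmat) \<Rightarrow> (nat \<Rightarrow> complex) \<Rightarrow> cmat" where
  "lincomb r B c = (\<lambda>i k. \<Sum>j<r. c j * B j i k)"

definition is_basis :: "ctype \<Rightarrow> nat \<Rightarrow> nat \<Rightarrow> (nat \<Rightarrow> cmat) \<Rightarrow> bool" where
  "is_basis t n r B \<longleftrightarrow> (\<forall>j<r. B j \<in> lie_alg t n) \<and>
     (\<forall>L \<in> lie_alg t n. \<exists>c. L = lincomb r B c) \<and>
     (\<forall>c. lincomb r B c = mzero \<longrightarrow> (\<forall>j<r. c j = 0))"

definition is_rep :: "ctype \<Rightarrow> nat \<Rightarrow> (cmat \<Rightarrow> complex^'d^'d) \<Rightarrow> bool" where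
  "is_rep t n \<phi> \<longleftrightarrow>
     (\<forall>A \<in> lie_alg t n. \<forall>B \<in> lie_alg t n. \<forall>a b.
        \<phi> (\<lambda>i j. a * A i j + b * B i j) = mat a ** \<phi> A + mat b ** \<phi> B) \<and>
     (\<forall>A \<in> lie_alg t n. \<forall>B \<in> lie_alg t n.
        \<phi> (brk (dimN t n) A B) = \<phi> A ** \<phi> B - \<phi> B ** \<phi> A)"

definition irreducible_rep :: "ctype \<Rightarrow> nat \<Rightarrow> (cmat \<Rightarrow> complex^'d^'d) \<Rightarrow> bool" where
  "irreducible_rep t n \<phi> \<longleftrightarrow> is_rep t n \<phi> \<and>
     (\<forall>W. vec.subspace W \<and> (\<forall>A \<in> lie_alg t n. \<forall>v \<in> W. \<phi> A *v v \<in> W)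
        \<longrightarrow> W = {0} \<or> W = UNIV)"

text \<open>Weights are functions on the Cartan subalgebra (extended by 0).\<close>
definition wspace :: "ctype \<Rightarrow> nat \<Rightarrow> (cmat \<Rightarrow> complex^'d^'d) \<Rightarrow> (cmat \<Rightarrow> complex)
   \<Rightarrow> (complex^'d) set" where
  "wspace t n \<phi> \<mu> = {v. \<forall>H \<in> cartan t n. \<phi> H *v v = \<mu> H *s v}"

definition is_weight :: "ctype \<Rightarrow> nat \<Rightarrow> (cmat \<Rightarrow> complex^'d^'d) \<Rightarrow> (cmat \<Rightarrow> complex) \<Rightarrow> bool" where
  "is_weight t n \<phi> \<mu> \<longleftrightarrow> (\<forall>H. H \<notin> cartan t n \<longrightarrow> \<mu> H = 0) \<and> wspace t n \<phi> \<mu> \<noteq> {0}"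

definition wmult :: "ctype \<Rightarrow> nat \<Rightarrow> (cmat \<Rightarrow> complex^'d^'d) \<Rightarrow> (cmat \<Rightarrow> complex) \<Rightarrow> nat" where
  "wmult t n \<phi> \<mu> = vec.dim (wspace t n \<phi> \<mu>)"

text \<open>Dominance with respect to the Borel subalgebra of upper triangular elements:
  mu(H_alpha) is a nonnegative real for every positive root alpha, where the coroot
  H_alpha = [X,Y] with X in g_alpha (X strictly upper triangular), Y in g_{-alpha},
  alpha([X,Y]) = 2.\<close>
definition dominant :: "ctype \<Rightarrow> nat \<Rightarrow> (cmat \<Rightarrow> complex) \<Rightarrow> bool" where
  "dominant t n \<mu> \<longleftrightarrow>
     (\<forall>X Y \<alpha>. X \<in> lie_alg t n \<and> Y \<in> lie_alg t n \<and> X \<noteq> mzero \<and>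
        (\<forall>i j. j \<le> i \<longrightarrow> X i j = 0) \<and>
        (\<forall>H \<in> cartan t n. brk (dimN t n) H X = (\<lambda>i j. \<alpha> H * X i j) \<and>
                            brk (dimN t n) H Y = (\<lambda>i j. - \<alpha> H * Y i j)) \<and>
        \<alpha> (brk (dimN t n) X Y) = 2
      \<longrightarrow> \<mu> (brk (dimN t n) X Y) \<in> \<real> \<and> 0 \<le> Re (\<mu> (brk (dimN t n) X Y)))"

text \<open>Weyl group orbit: w = Ad(g) restricted to h, for g normalizing h;
  (w mu)(g H' g^-1) = mu(H').\<close>
definition weyl_orbit :: "ctype \<Rightarrow> nat \<Rightarrow> (cmat \<Rightarrow> complex) \<Rightarrow> (cmat \<Rightarrow> complex) set" where
  "weyl_orbit t n \<mu> = {\<nu>. (\<forall>H. H \<notin> cartan t n \<longrightarrow> \<nu> H = 0) \<and>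
     (\<exists>g \<in> grp t n. (\<forall>H' \<in> cartan t n. \<exists>H \<in> cartan t n. conj_by t n g H' H) \<and>
        (\<forall>H' \<in> cartan t n. \<forall>H \<in> cartan t n. conj_by t n g H' H \<longrightarrow> \<nu> H = \<mu> H'))}"

section \<open>Multivariate polynomials: variable 0 is z0, variable j+1 is the j-th coordinate\<close>

type_synonym mpoly = "(nat \<Rightarrow>\<^sub>0 nat) \<Rightarrow>\<^sub>0 complex"

definition mpeval :: "mpoly \<Rightarrow> (nat \<Rightarrow> complex) \<Rightarrow> complex" where
  "mpeval p x = (\<Sum>m \<in> Poly_Mapping.keys p. Poly_Mapping.lookup p m * (\<Prod>i \<in> Poly_Mapping.keys m. x i ^ Poly_Mapping.lookup m i))"

definition mpdeg :: "mpoly \<Rightarrow> nat" where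
  "mpdeg p = Max (insert 0 ((\<lambda>m. \<Sum>i \<in> Poly_Mapping.keys m. Poly_Mapping.lookup m i) ` Poly_Mapping.keys p))"

definition coordL :: "nat \<Rightarrow> (nat \<Rightarrow> cmat) \<Rightarrow> (nat \<Rightarrow> complex) \<Rightarrow> cmat" where
  "coordL r B x = lincomb r B (\<lambda>j. x (Suc j))"

definition f_phi :: "nat \<Rightarrow> (nat \<Rightarrow> cmat) \<Rightarrow> (cmat \<Rightarrow> complex^'d^'d) \<Rightarrow> mpoly" where
  "f_phi r B \<phi> = (THE p. \<forall>x. mpeval p x = det (mat (x 0) + \<phi> (coordL r B x)))"

definition f_orb :: "ctype \<Rightarrow> nat \<Rightarrow> nat \<Rightarrow> (nat \<Rightarrow> cmat) \<Rightarrow> (cmat \<Rightarrow> complex) \<Rightarrow> mpoly" where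
  "f_orb t n r B \<mu> = (THE p. \<forall>x g H. H \<in> cartan t n \<and> conj_by t n g (coordL r B x) H \<longrightarrow>
      mpeval p x = (\<Prod>\<nu> \<in> weyl_orbit t n \<mu>. x 0 + \<nu> H))"

end

theory Submission
  imports Defs "HOL-Library.Function_Algebras" "HOL-Computational_Algebra.Fundamental_Theorem_Algebra"
begin

text \<open>
  The elements of \<open>\<gg>\<close> reached from the Cartan subalgebra \<open>\<hh>\<close> by root subgroups are Zariski dense,
  because the ideal of polynomials vanishing on them is stable under all derivatives along \<open>\<gg>\<close>.
  So identities between invariant polynomials may be checked on \<open>\<hh>\<close>. There \<open>det (z + \<phi> H)\<close>
  is the product of \<open>z + \<nu> H\<close> over the weights; it is Weyl invariant, hence multiplicities are
  constant on orbits, and each orbit contains exactly one dominant weight. The orbital factors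
  exist since Weyl invariant polynomials on \<open>\<hh>\<close> are polynomials in power sums of the
  coordinates (together with the Pfaffian in type D), and these extend to \<open>\<gg>\<close>.

  If \<open>f\<^sub>\<mu> = a b\<close>, then \<open>a\<close> and \<open>b\<close> are invariant under root subgroups, since along such
  a subgroup they are univariate polynomials with constant product. One of them, say \<open>a\<close>, vanishes
  on the hyperplane \<open>z = - \<mu> H\<close> of \<open>\<complex> \<times> \<hh>\<close>, hence by invariance at \<open>z = - \<tau> H\<close> for every \<open>\<tau>\<close> in
  the orbit of \<open>\<mu>\<close>. Comparing degrees in \<open>z\<close> shows that \<open>b\<close> does not depend on \<open>z\<close>. As \<open>f\<^sub>\<mu>\<close> is
  homogeneous, \<open>b\<close> divides a monomial on each line through \<open>0\<close>, and it does not vanish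
  at \<open>0\<close>, so it is constant.
\<close>

section \<open>Polynomial functions\<close>

text \<open>The obstacle is that \<open>f_phi\<close> and \<open>f_orb\<close> are definite
  descriptions and that \<open>weyl_orbit\<close> is defined by the normaliser of
  \<open>\<hh>\<close> in the group. So existence, uniqueness and the comparison of the normaliser
  with the group \<open>WG\<close> generated by reflections all have to be proved. Uniqueness is
  density, existence is Chevalley restriction, and the comparison moves a regular element back to
  the dominant chamber, where its permutation of the coordinates becomes trivial. Stability of the
  vanishing ideal comes from the velocity of the curve \<open>Ad i j s H\<close> at
  \<open>s = 0\<close>, which is \<open>- al i j H\<close> times the root vector. It is nonzero off
  a hyperplane, and a polynomial that vanishes off a hyperplane vanishes on it. All root vectors
  used satisfy \<open>X\<^sup>3 = 0\<close>, so these curves are polynomial in \<open>s\<close>.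
  Weights are not assumed real or integral. Differences of weights are sums of roots, hence real on
  real elements, and a reflection turns this into reality on the coroots. The dominance arguments
  then compare real parts.\<close>

inductive_set polyf :: "('a \<Rightarrow> complex) set \<Rightarrow> ('a \<Rightarrow> complex) set" for G where
  polyf_const: "(\<lambda>_. c) \<in> polyf G"
| polyf_gen: "g \<in> G \<Longrightarrow> g \<in> polyf G"
| polyf_add: "f \<in> polyf G \<Longrightarrow> g \<in> polyf G \<Longrightarrow> (\<lambda>x. f x + g x) \<in> polyf G"
| polyf_mult: "f \<in> polyf G \<Longrightarrow> g \<in> polyf G \<Longrightarrow> (\<lambda>x. f x * g x) \<in> polyf G"

lemma polyf_cmult: "f \<in> polyf G \<Longrightarrow> (\<lambda>x. c * f x) \<in> polyf G"
  by (intro polyf_mult polyf_const)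

lemma polyf_uminus: "f \<in> polyf G \<Longrightarrow> (\<lambda>x. - f x) \<in> polyf G"
  using polyf_cmult[of f G "-1"] by simp

lemma polyf_diff: "f \<in> polyf G \<Longrightarrow> g \<in> polyf G \<Longrightarrow> (\<lambda>x. f x - g x) \<in> polyf G"
  using polyf_add[OF _ polyf_uminus, of f G g] by simp

lemma polyf_sum: "(\<And>i. i \<in> I \<Longrightarrow> f i \<in> polyf G) \<Longrightarrow> (\<lambda>x. \<Sum>i\<in>I. f i x) \<in> polyf G"
  by (induction I rule: infinite_finite_induct) (auto intro: polyf_const polyf_add)

lemma polyf_prod: "(\<And>i. i \<in> I \<Longrightarrow> f i \<in> polyf G) \<Longrightarrow> (\<lambda>x. \<Prod>i\<in>I. f i x) \<in> polyf G"
  by (induction I rule: infinite_finite_induct) (auto intro: polyf_const polyf_mult)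

lemma polyf_power: "f \<in> polyf G \<Longrightarrow> (\<lambda>x. f x ^ k) \<in> polyf G"
  by (induction k) (auto intro: polyf_const polyf_mult)

lemma polyf_comp:
  assumes "f \<in> polyf G" "\<And>g. g \<in> G \<Longrightarrow> (\<lambda>x. g (\<psi> x)) \<in> polyf G'"
  shows "(\<lambda>x. f (\<psi> x)) \<in> polyf G'"
  using assms(1)
  by induction (auto intro: polyf_const polyf_add polyf_mult assms(2))

text \<open>\<open>D g\<close> plays the role of the partial derivative of \<open>f\<close> in the
  generator \<open>g\<close>. It is stated as a chain rule along complex curves, so the underlying
  type \<open>'a\<close> carries no differentiable structure of its own.\<close>

definition is_gradient :: "('a \<Rightarrow> complex) set \<Rightarrow> ('a \<Rightarrow> complex) \<Rightarrow> (('a \<Rightarrow> complex) \<Rightarrow> 'a \<Rightarrow> complex) \<Rightarrow> bool" where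
  "is_gradient G f D \<longleftrightarrow> (\<forall>g\<in>G. D g \<in> polyf G) \<and>
    (\<forall>c a v. (\<forall>g\<in>G. ((\<lambda>s. g (c s)) has_field_derivative v g) (at a)) \<longrightarrow>
      ((\<lambda>s. f (c s)) has_field_derivative (\<Sum>g\<in>G. v g * D g (c a))) (at (a::complex)))"

lemma is_gradient_deriv:
  assumes "is_gradient G f D" "\<And>g. g \<in> G \<Longrightarrow> ((\<lambda>s. g (c s)) has_field_derivative v g) (at a)"
  shows "((\<lambda>s. f (c s)) has_field_derivative (\<Sum>g\<in>G. v g * D g (c a))) (at a)"
  using assms unfolding is_gradient_def by blast

lemma is_gradient_polyf: "is_gradient G f D \<Longrightarrow> g \<in> G \<Longrightarrow> D g \<in> polyf G"
  unfolding is_gradient_def by blast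

lemma polyf_gradient:
  assumes "finite G" "f \<in> polyf G"
  shows "\<exists>D. is_gradient G f D"
  using assms(2)
proof induction
  case (polyf_const c)
  show ?case unfolding is_gradient_def
    by (rule exI[of _ "\<lambda>_ _. 0"]) (auto intro: polyf.polyf_const)
next
  case (polyf_gen g)
  have *: "(\<Sum>h\<in>G. v h * (if h = g then 1 else 0)) = v g" for v :: "('a \<Rightarrow> complex) \<Rightarrow> complex"
    using polyf_gen assms(1) by (simp add: if_distrib sum.delta cong: if_cong)
  show ?case unfolding is_gradient_def
    by (rule exI[of _ "\<lambda>h _. if h = g then 1 else 0"])
      (use polyf_gen in \<open>auto simp: * intro: polyf.polyf_const\<close>)
next
  case (polyf_add f1 f2)
  then obtain D1 D2 where D: "is_gradient G f1 D1" "is_gradient G f2 D2"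
    by blast
  show ?case unfolding is_gradient_def
  proof (rule exI[of _ "\<lambda>g x. D1 g x + D2 g x"], intro conjI ballI allI impI)
    fix g assume "g \<in> G" then show "(\<lambda>x. D1 g x + D2 g x) \<in> polyf G"
      by (intro polyf.polyf_add is_gradient_polyf[OF D(1)] is_gradient_polyf[OF D(2)])
  next
    fix c v and a :: complex
    assume "\<forall>g\<in>G. ((\<lambda>s. g (c s)) has_field_derivative v g) (at a)"
    then have d: "\<And>g. g \<in> G \<Longrightarrow> ((\<lambda>s. g (c s)) has_field_derivative v g) (at a)" by blast
    from DERIV_add[OF is_gradient_deriv[OF D(1) d] is_gradient_deriv[OF D(2) d]]
    show "((\<lambda>s. f1 (c s) + f2 (c s)) has_field_derivative (\<Sum>g\<in>G. v g * (D1 g (c a) + D2 g (c a)))) (at a)"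
      by (simp add: distrib_left sum.distrib)
  qed
next
  case (polyf_mult f1 f2)
  then obtain D1 D2 where D: "is_gradient G f1 D1" "is_gradient G f2 D2"
    by blast
  show ?case unfolding is_gradient_def
  proof (rule exI[of _ "\<lambda>g x. D1 g x * f2 x + D2 g x * f1 x"], intro conjI ballI allI impI)
    fix g assume "g \<in> G" then show "(\<lambda>x. D1 g x * f2 x + D2 g x * f1 x) \<in> polyf G"
      by (intro polyf.polyf_add polyf.polyf_mult is_gradient_polyf[OF D(1)] is_gradient_polyf[OF D(2)] polyf_mult.hyps)
  next
    fix c v and a :: complex
    assume "\<forall>g\<in>G. ((\<lambda>s. g (c s)) has_field_derivative v g) (at a)"
    then have d: "\<And>g. g \<in> G \<Longrightarrow> ((\<lambda>s. g (c s)) has_field_derivative v g) (at a)" by blast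
    from DERIV_mult[OF is_gradient_deriv[OF D(1) d] is_gradient_deriv[OF D(2) d]]
    show "((\<lambda>s. f1 (c s) * f2 (c s)) has_field_derivative
       (\<Sum>g\<in>G. v g * (D1 g (c a) * f2 (c a) + D2 g (c a) * f1 (c a)))) (at a)"
      by (simp add: distrib_left sum.distrib sum_distrib_right mult.assoc)
  qed
qed

lemma polyf_univariate:
  assumes "f \<in> polyf {\<lambda>s. s}"
  shows "\<exists>p. f = poly p"
  using assms
proof induction
  case (polyf_const c)
  show ?case by (rule exI[of _ "[:c:]"]) auto
next
  case (polyf_gen g)
  then show ?case by (intro exI[of _ "[:0,1:]"]) auto
next
  case (polyf_add f g)
  then obtain p q where "f = poly p" "g = poly q" by blast
  then show ?case by (intro exI[of _ "p + q"]) auto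
next
  case (polyf_mult f g)
  then obtain p q where "f = poly p" "g = poly q" by blast
  then show ?case by (intro exI[of _ "p * q"]) auto
qed

lemma polyf_curve_poly:
  assumes "f \<in> polyf G" "\<And>g. g \<in> G \<Longrightarrow> (\<lambda>s. g (c s)) \<in> polyf {\<lambda>s::complex. s}"
  shows "\<exists>p. \<forall>s. f (c s) = poly p s"
proof -
  have "(\<lambda>s. f (c s)) \<in> polyf {\<lambda>s. s}" by (rule polyf_comp[OF assms])
  then show ?thesis using polyf_univariate by (metis)
qed

section \<open>Univariate polynomials without roots\<close>

lemma poly_no_roots_const:
  fixes p :: "complex poly"
  assumes "\<And>s. poly p s \<noteq> 0"
  shows "poly p s = poly p t"
proof -
  have "constant (poly p)" using fundamental_theorem_of_algebra assms by blast
  then show ?thesis by (simp add: constant_def)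
qed

lemma poly_product_const:
  fixes p q :: "complex poly"
  assumes "\<And>s. poly p s * poly q s = c" "c \<noteq> 0"
  shows "poly p s = poly p t"
  by (rule poly_no_roots_const) (use assms in force)

text \<open>The equation leaves \<open>0\<close> as the only possible root of \<open>p\<close>, and
  the last assumption excludes it.\<close>

lemma poly_dvd_power_const:
  fixes p q :: "complex poly"
  assumes "\<And>s. poly p s * poly q s = c * s ^ k" "c \<noteq> 0" "poly p 0 \<noteq> 0"
  shows "poly p s = poly p t"
proof (rule poly_no_roots_const)
  fix s show "poly p s \<noteq> 0"
    using assms(1)[of s] assms(2,3) by (cases "s = 0") auto
qed

lemma poly_eq_cofinite:
  fixes p q :: "complex poly"
  assumes "\<And>s. s \<notin> A \<Longrightarrow> poly p s = poly q s" "finite A"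
  shows "p = q"
proof (rule ccontr)
  assume "p \<noteq> q"
  then have "finite {s. poly (p - q) s = 0}" by (intro poly_roots_finite) auto
  moreover have "- A \<subseteq> {s. poly (p - q) s = 0}" using assms(1) by auto
  ultimately have "finite (- A)" by (rule finite_subset[rotated])
  with assms(2) have "finite (UNIV :: complex set)"
    by (metis finite_Un Compl_partition)
  then show False using infinite_UNIV_char_0 by blast
qed

section \<open>Evaluation of multivariate polynomials\<close>

definition mon_eval :: "(nat \<Rightarrow>\<^sub>0 nat) \<Rightarrow> (nat \<Rightarrow> complex) \<Rightarrow> complex" where
  "mon_eval m x = (\<Prod>i \<in> Poly_Mapping.keys m. x i ^ Poly_Mapping.lookup m i)"

definition mon_deg :: "(nat \<Rightarrow>\<^sub>0 nat) \<Rightarrow> nat" where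
  "mon_deg m = (\<Sum>i \<in> Poly_Mapping.keys m. Poly_Mapping.lookup m i)"

lemma mpeval_mon: "mpeval p x = (\<Sum>m \<in> Poly_Mapping.keys p. Poly_Mapping.lookup p m * mon_eval m x)"
  by (simp add: mpeval_def mon_eval_def)

lemma mpdeg_mon: "mpdeg p = Max (insert 0 (mon_deg ` Poly_Mapping.keys p))"
  by (simp add: mpdeg_def mon_deg_def[abs_def])

lemma mon_eval_superset:
  assumes "finite S" "Poly_Mapping.keys m \<subseteq> S"
  shows "mon_eval m x = (\<Prod>i \<in> S. x i ^ Poly_Mapping.lookup m i)"
  unfolding mon_eval_def
  by (rule prod.mono_neutral_left) (use assms in \<open>auto simp: in_keys_iff\<close>)

lemma mon_eval_add: "mon_eval (m + m') x = mon_eval m x * mon_eval m' x"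
proof -
  let ?S = "Poly_Mapping.keys m \<union> Poly_Mapping.keys m'"
  have "mon_eval (m + m') x = (\<Prod>i \<in> ?S. x i ^ Poly_Mapping.lookup (m + m') i)"
    by (rule mon_eval_superset) (auto simp: keys_add)
  also have "\<dots> = (\<Prod>i \<in> ?S. x i ^ Poly_Mapping.lookup m i) * (\<Prod>i \<in> ?S. x i ^ Poly_Mapping.lookup m' i)"
    by (simp add: lookup_add power_add prod.distrib)
  also have "\<dots> = mon_eval m x * mon_eval m' x"
    by (simp add: mon_eval_superset[of ?S])
  finally show ?thesis .
qed

lemma mpeval_superset:
  assumes "finite S" "Poly_Mapping.keys p \<subseteq> S"
  shows "mpeval p x = (\<Sum>m \<in> S. Poly_Mapping.lookup p m * mon_eval m x)"
  unfolding mpeval_mon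
  by (rule sum.mono_neutral_left) (use assms in \<open>auto simp: in_keys_iff\<close>)

lemma mpeval_add: "mpeval (p + q) x = mpeval p x + mpeval q x"
proof -
  let ?S = "Poly_Mapping.keys p \<union> Poly_Mapping.keys q"
  have "mpeval (p + q) x = (\<Sum>m \<in> ?S. Poly_Mapping.lookup (p + q) m * mon_eval m x)"
    by (rule mpeval_superset) (auto simp: keys_add)
  also have "\<dots> = mpeval p x + mpeval q x"
    by (simp add: lookup_add distrib_right sum.distrib mpeval_superset[of ?S])
  finally show ?thesis .
qed

lemma mpeval_single: "mpeval (Poly_Mapping.single m c) x = c * mon_eval m x"
  by (simp add: mpeval_mon)

lemma mpeval_zero: "mpeval 0 x = 0"
  by (simp add: mpeval_mon)

lemma mpeval_sum: "mpeval (\<Sum>i\<in>I. p i) x = (\<Sum>i\<in>I. mpeval (p i) x)"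
  by (induction I rule: infinite_finite_induct) (auto simp: mpeval_zero mpeval_add)

lemma mpoly_sum_singles:
  "(p :: mpoly) = (\<Sum>m \<in> Poly_Mapping.keys p. Poly_Mapping.single m (Poly_Mapping.lookup p m))"
proof (rule poly_mapping_eqI)
  fix k
  show "Poly_Mapping.lookup p k =
    Poly_Mapping.lookup (\<Sum>m \<in> Poly_Mapping.keys p. Poly_Mapping.single m (Poly_Mapping.lookup p m)) k"
    by (cases "k \<in> Poly_Mapping.keys p") (auto simp: lookup_sum lookup_single when_def in_keys_iff)
qed

lemma mpeval_mult: "mpeval (p * q) x = mpeval p x * mpeval q x"
proof -
  have "p * q = (\<Sum>m \<in> Poly_Mapping.keys p. \<Sum>m' \<in> Poly_Mapping.keys q.
      Poly_Mapping.single m (Poly_Mapping.lookup p m) * Poly_Mapping.single m' (Poly_Mapping.lookup q m'))"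
    by (subst mpoly_sum_singles[of p], subst mpoly_sum_singles[of q]) (simp add: sum_product)
  then show ?thesis
    by (simp add: mpeval_sum mult_single mpeval_single mon_eval_add mpeval_mon[of p] mpeval_mon[of q]
      sum_product mult_ac)
qed

lemma mpeval_one: "mpeval 1 x = 1"
  using mpeval_single[of 0 1 x] by (simp add: mon_eval_def)

lemma mpeval_const: "mpeval (Poly_Mapping.single 0 c) x = c"
  using mpeval_single[of 0 c x] by (simp add: mon_eval_def)

lemma mpeval_power: "mpeval (p ^ k) x = mpeval p x ^ k"
  by (induction k) (auto simp: mpeval_one mpeval_mult)

lemma mpeval_prod: "mpeval (\<Prod>i\<in>I. p i) x = (\<Prod>i\<in>I. mpeval (p i) x)"
  by (induction I rule: infinite_finite_induct) (auto simp: mpeval_one mpeval_mult)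

lemma mpeval_var: "mpeval (Poly_Mapping.single (Poly_Mapping.single i 1) 1) x = x i"
  by (simp add: mpeval_single mon_eval_def)

abbreviation vars :: "((nat \<Rightarrow> complex) \<Rightarrow> complex) set" where
  "vars \<equiv> range (\<lambda>i x. x i)"

lemma mon_eval_polyf: "mon_eval m \<in> polyf vars"
  unfolding mon_eval_def[abs_def]
  by (intro polyf_prod polyf_power polyf_gen) auto

lemma mpeval_polyf: "mpeval p \<in> polyf vars"
  unfolding mpeval_mon[abs_def]
  by (intro polyf_sum polyf_cmult mon_eval_polyf)

lemma polyf_mpeval:
  assumes "f \<in> polyf vars"
  shows "\<exists>p. f = mpeval p"
  using assms
proof induction
  case (polyf_const c)
  show ?case by (rule exI[of _ "Poly_Mapping.single 0 c"]) (auto simp: mpeval_const)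
next
  case (polyf_gen g)
  then obtain i where "g = (\<lambda>x. x i)" by auto
  then show ?case
    by (intro exI[of _ "Poly_Mapping.single (Poly_Mapping.single i 1) 1"]) (use mpeval_var in auto)
next
  case (polyf_add f g)
  then obtain p q where "f = mpeval p" "g = mpeval q" by blast
  then show ?case by (intro exI[of _ "p + q"]) (auto simp: mpeval_add)
next
  case (polyf_mult f g)
  then obtain p q where "f = mpeval p" "g = mpeval q" by blast
  then show ?case by (intro exI[of _ "p * q"]) (auto simp: mpeval_mult)
qed

text \<open>A Kronecker substitution: for a suitable base \<open>d\<close> the monomials of a finite set
  get distinct weights \<open>\<Sum>i. m i * d ^ i\<close>.\<close>
lemma monomials_separating_weight:
  assumes "finite (M :: (nat \<Rightarrow>\<^sub>0 nat) set)"
  shows "\<exists>d. inj_on (\<lambda>m. \<Sum>i\<in>Poly_Mapping.keys m. Poly_Mapping.lookup m i * d ^ i) M"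
proof -
  \<comment> \<open>The exponents of \<open>m\<close> become coefficients, so the weight of
    \<open>m\<close> in base \<open>d\<close> is the value at \<open>d\<close>. A base is bad for
    two monomials only if it is a root of the difference of their polynomials.\<close>
  define q :: "(nat \<Rightarrow>\<^sub>0 nat) \<Rightarrow> complex poly" where
    "q m = (\<Sum>i\<in>Poly_Mapping.keys m. monom (of_nat (Poly_Mapping.lookup m i)) i)" for m
  have coeff_q: "coeff (q m) i = of_nat (Poly_Mapping.lookup m i)" for m i
    by (auto simp: q_def coeff_sum in_keys_iff)
  have poly_q: "poly (q m) (of_nat d) = of_nat (\<Sum>i\<in>Poly_Mapping.keys m. Poly_Mapping.lookup m i * d ^ i)" for m d
    by (simp add: q_def poly_sum poly_monom)
  have q_inj: "q m \<noteq> q m'" if "m \<noteq> m'" for m m'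
  proof
    assume "q m = q m'"
    then have "Poly_Mapping.lookup m i = Poly_Mapping.lookup m' i" for i
      using coeff_q[of m i] coeff_q[of m' i] by simp
    then have "m = m'" by (intro poly_mapping_eqI)
    with that show False by simp
  qed
  define Z where "Z = (\<Union>x\<in>{x\<in>M\<times>M. fst x \<noteq> snd x}. {z. poly (q (fst x) - q (snd x)) z = 0})"
  have "finite Z" unfolding Z_def
  proof (rule finite_UN_I)
    show "finite {x \<in> M \<times> M. fst x \<noteq> snd x}" using assms by simp
    show "finite {z. poly (q (fst x) - q (snd x)) z = 0}" if "x \<in> {x \<in> M \<times> M. fst x \<noteq> snd x}" for x
      using q_inj that by (intro poly_roots_finite) simp
  qed
  moreover have "infinite (range (of_nat :: nat \<Rightarrow> complex))"
    by (simp add: range_inj_infinite inj_of_nat)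
  ultimately obtain d :: nat where d: "of_nat d \<notin> Z"
    using finite_subset[of "range (of_nat :: nat \<Rightarrow> complex)" Z] by blast
  have "inj_on (\<lambda>m. \<Sum>i\<in>Poly_Mapping.keys m. Poly_Mapping.lookup m i * d ^ i) M"
  proof (rule inj_onI, rule ccontr)
    fix m m' assume "m \<in> M" "m' \<in> M" "m \<noteq> m'"
      and "(\<Sum>i\<in>Poly_Mapping.keys m. Poly_Mapping.lookup m i * d ^ i) =
           (\<Sum>i\<in>Poly_Mapping.keys m'. Poly_Mapping.lookup m' i * d ^ i)"
    then have "poly (q m) (of_nat d) = poly (q m') (of_nat d)" by (simp only: poly_q)
    with \<open>m \<in> M\<close> \<open>m' \<in> M\<close> \<open>m \<noteq> m'\<close> have "of_nat d \<in> Z" unfolding Z_def by force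
    with d show False by simp
  qed
  then show ?thesis by blast
qed

text \<open>Substituting \<open>s ^ (d ^ i)\<close> for the variables with a separating base
  \<open>d\<close> sends distinct monomials to distinct powers of \<open>s\<close>, so no
  coefficients merge and a nonzero univariate polynomial remains.\<close>

lemma mpeval_nonzero:
  assumes "p \<noteq> 0"
  shows "\<exists>x. mpeval p x \<noteq> 0"
proof -
  obtain d where inj: "inj_on (\<lambda>m. \<Sum>i\<in>Poly_Mapping.keys m. Poly_Mapping.lookup m i * d ^ i) (Poly_Mapping.keys p)"
    using monomials_separating_weight[of "Poly_Mapping.keys p"] by auto
  define e where "e m = (\<Sum>i\<in>Poly_Mapping.keys m. Poly_Mapping.lookup m i * d ^ i)" for m :: "nat \<Rightarrow>\<^sub>0 nat"
  have inj: "inj_on e (Poly_Mapping.keys p)" using inj by (simp add: e_def[abs_def])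
  define P where "P = (\<Sum>m\<in>Poly_Mapping.keys p. monom (Poly_Mapping.lookup p m) (e m))"
  have ev: "mpeval p (\<lambda>i. s ^ (d ^ i)) = poly P s" for s
    by (simp add: mpeval_mon P_def poly_sum poly_monom mon_eval_def e_def power_sum power_mult
        mult.commute[of "Poly_Mapping.lookup _ _"] flip: power_mult)
  obtain m0 where m0: "m0 \<in> Poly_Mapping.keys p" using assms keys_eq_empty by blast
  have "coeff P (e m0) = (\<Sum>m\<in>Poly_Mapping.keys p. if m = m0 then Poly_Mapping.lookup p m else 0)"
    unfolding P_def coeff_sum by (rule sum.cong) (use inj m0 in \<open>auto simp: inj_on_def\<close>)
  also have "\<dots> \<noteq> 0" using m0 by (simp add: in_keys_iff)
  finally have "P \<noteq> 0" by auto
  then obtain s where "poly P s \<noteq> 0" using poly_all_0_iff_0 by blast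
  then show ?thesis using ev by metis
qed

lemma mpeval_inject: "(\<And>x. mpeval p x = mpeval q x) \<Longrightarrow> p = q"
proof (rule ccontr)
  assume eq: "\<And>x. mpeval p x = mpeval q x" and "p \<noteq> q"
  then obtain x where "mpeval (p - q) x \<noteq> 0" using mpeval_nonzero[of "p - q"] by auto
  moreover have "mpeval (p - q) x + mpeval q x = mpeval p x"
    by (simp flip: mpeval_add)
  ultimately show False using eq[of x] by simp
qed

lemma mon_eval_scale: "mon_eval m (\<lambda>i. s * x i) = s ^ mon_deg m * mon_eval m x"
  by (simp add: mon_eval_def mon_deg_def power_mult_distrib prod.distrib power_sum)

text \<open>For fixed \<open>x\<close> the function \<open>s \<mapsto> p (s x)\<close> is a single
  power of \<open>s\<close>. Hence every homogeneous component of a degree other than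
  \<open>k\<close> vanishes as a function, and so as a polynomial.\<close>

lemma homogeneous_mpdeg:
  assumes "p \<noteq> 0" "\<And>s x. mpeval p (\<lambda>i. s * x i) = s ^ k * mpeval p x"
  shows "mpdeg p = k"
proof -
  have "mon_deg m0 = k" if m0: "m0 \<in> Poly_Mapping.keys p" for m0
  proof (rule ccontr)
    assume ne: "mon_deg m0 \<noteq> k"
    let ?K = "{m \<in> Poly_Mapping.keys p. mon_deg m = mon_deg m0}"
    \<comment> \<open>The homogeneous component of \<open>p\<close> that contains the monomial
      \<open>m0\<close>.\<close>
    define q where "q = (\<Sum>m\<in>?K. Poly_Mapping.single m (Poly_Mapping.lookup p m))"
    have "Poly_Mapping.lookup q m0 = Poly_Mapping.lookup p m0"
      using m0 by (simp add: q_def lookup_sum lookup_single when_def)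
    then have "q \<noteq> 0" using m0 by (auto simp: in_keys_iff)
    then obtain x where x: "mpeval q x \<noteq> 0" using mpeval_nonzero by blast
    define P where "P = (\<Sum>m\<in>Poly_Mapping.keys p. monom (Poly_Mapping.lookup p m * mon_eval m x) (mon_deg m))"
    have "poly P s = poly (monom (mpeval p x) k) s" for s
      using assms(2)[of s x]
      by (simp add: P_def poly_sum poly_monom mpeval_mon mon_eval_scale mult_ac)
    then have "P = monom (mpeval p x) k" using poly_eq_poly_eq_iff by blast
    then have "coeff P (mon_deg m0) = 0" using ne by simp
    moreover have "coeff P (mon_deg m0) = mpeval q x"
      unfolding P_def coeff_sum q_def mpeval_sum
      by (rule sum.mono_neutral_cong_right) (auto simp: mpeval_single)
    ultimately show False using x by simp
  qed
  moreover have "Poly_Mapping.keys p \<noteq> {}" using assms(1) by simp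
  ultimately have "mon_deg ` Poly_Mapping.keys p = {k}" by (auto simp: image_constant_conv)
  then show ?thesis unfolding mpdeg_mon by simp
qed

lemma mpoly_unit_of_const:
  assumes "\<And>x. mpeval q x = c" "c \<noteq> 0"
  shows "q dvd 1"
proof -
  have "1 = q * Poly_Mapping.single 0 (inverse c)"
    by (rule mpeval_inject) (simp add: mpeval_mult mpeval_const mpeval_one assms)
  then show ?thesis by (rule dvdI)
qed

section \<open>Square matrices of size \<open>N\<close>\<close>

definition smul :: "complex \<Rightarrow> cmat \<Rightarrow> cmat" (infixr "*\<^sub>m" 75) where
  "c *\<^sub>m A = (\<lambda>i j. c * A i j)"

lemma smul_apply [simp]: "(c *\<^sub>m A) i j = c * A i j"
  by (simp add: smul_def)

lemma cmat_minus_apply: "(A - B) i j = A i j - (B :: cmat) i j"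
  by (simp add: fun_diff_def)

lemma cmat_uminus_apply: "(- A) i j = - (A :: cmat) i j"
  by (simp add: fun_Compl_def)

lemma cmat_sum_apply: "(\<Sum>k\<in>K. A k) i j = (\<Sum>k\<in>K. (A k :: cmat) i j)"
  by (induction K rule: infinite_finite_induct) auto

lemmas cmat_apply = cmat_minus_apply cmat_uminus_apply cmat_sum_apply

lemma smul_simps:
  "c *\<^sub>m (A + B) = c *\<^sub>m A + c *\<^sub>m B" "c *\<^sub>m (A - B) = c *\<^sub>m A - c *\<^sub>m B"
  "(a + b) *\<^sub>m A = a *\<^sub>m A + b *\<^sub>m A" "(a - b) *\<^sub>m A = a *\<^sub>m A - b *\<^sub>m A"
  "a *\<^sub>m b *\<^sub>m A = (a * b) *\<^sub>m A" "c *\<^sub>m (- A) = - (c *\<^sub>m A)" "(- c) *\<^sub>m A = - (c *\<^sub>m A)"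
  "0 *\<^sub>m A = 0" "1 *\<^sub>m A = A" "c *\<^sub>m 0 = 0"
  by (auto simp: fun_eq_iff cmat_apply algebra_simps)

lemma mzero_zero: "mzero = 0"
  by (simp add: mzero_def fun_eq_iff)

locale mats =
  fixes N :: nat
begin

abbreviation mm (infixl "\<odot>" 70) where "A \<odot> B \<equiv> mmul N A B"

abbreviation "I\<^sub>m \<equiv> idm N"

lemma mm_apply: "i < N \<Longrightarrow> j < N \<Longrightarrow> (A \<odot> B) i j = (\<Sum>k<N. A i k * B k j)"
  by (simp add: mmul_def)

lemma mm_is_mat [simp]: "is_mat N (A \<odot> B)"
  by (simp add: is_mat_def mmul_def)

lemma idm_is_mat [simp]: "is_mat N I\<^sub>m"
  by (simp add: is_mat_def idm_def)

lemma is_mat_add: "is_mat N A \<Longrightarrow> is_mat N B \<Longrightarrow> is_mat N (A + B)"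
  and is_mat_diff: "is_mat N A \<Longrightarrow> is_mat N B \<Longrightarrow> is_mat N (A - B)"
  and is_mat_uminus: "is_mat N A \<Longrightarrow> is_mat N (- A)"
  and is_mat_smul: "is_mat N A \<Longrightarrow> is_mat N (c *\<^sub>m A)"
  and is_mat_zero: "is_mat N 0"
  and is_mat_mT: "is_mat N A \<Longrightarrow> is_mat N (mT A)"
  by (auto simp: is_mat_def cmat_apply mT_def)

lemmas is_mat_intros = is_mat_add is_mat_diff is_mat_uminus is_mat_smul is_mat_zero is_mat_mT

lemma is_mat_eqI:
  assumes "is_mat N A" "is_mat N B" "\<And>i j. i < N \<Longrightarrow> j < N \<Longrightarrow> A i j = B i j"
  shows "A = B"
  using assms unfolding is_mat_def by (metis ext linorder_not_less)

lemma mm_assoc: "A \<odot> B \<odot> C = A \<odot> (B \<odot> C)"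
proof (rule is_mat_eqI)
  fix i j assume ij: "i < N" "j < N"
  have "(A \<odot> B \<odot> C) i j = (\<Sum>k<N. \<Sum>l<N. A i l * B l k * C k j)"
    using ij by (simp add: mm_apply sum_distrib_right)
  also have "\<dots> = (\<Sum>l<N. \<Sum>k<N. A i l * B l k * C k j)" by (rule sum.swap)
  also have "\<dots> = (A \<odot> (B \<odot> C)) i j"
    using ij by (simp add: mm_apply sum_distrib_left mult.assoc)
  finally show "(A \<odot> B \<odot> C) i j = (A \<odot> (B \<odot> C)) i j" .
qed auto

lemma mm_linear:
  "(A + B) \<odot> C = A \<odot> C + B \<odot> C" "C \<odot> (A + B) = C \<odot> A + C \<odot> B"
  "(A - B) \<odot> C = A \<odot> C - B \<odot> C" "C \<odot> (A - B) = C \<odot> A - C \<odot> B"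
  "(- A) \<odot> C = - (A \<odot> C)" "C \<odot> (- A) = - (C \<odot> A)"
  "(c *\<^sub>m A) \<odot> C = c *\<^sub>m (A \<odot> C)" "C \<odot> (c *\<^sub>m A) = c *\<^sub>m (C \<odot> A)"
  "0 \<odot> C = 0" "C \<odot> 0 = 0"
  by (auto simp: fun_eq_iff cmat_apply mmul_def sum.distrib sum_subtractf sum_negf sum_distrib_left
      algebra_simps)

lemma mm_idm [simp]: "is_mat N A \<Longrightarrow> I\<^sub>m \<odot> A = A" "is_mat N A \<Longrightarrow> A \<odot> I\<^sub>m = A"
  by (auto intro!: is_mat_eqI simp: mm_apply idm_def if_distrib[of "\<lambda>x. x * _"] if_distrib[of "\<lambda>x. _ * x"]
      sum.delta' sum.delta cong: if_cong)

lemma mT_mm: "mT (A \<odot> B) = mT B \<odot> mT A"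
  proof (rule is_mat_eqI)
  show "is_mat N (mT (A \<odot> B))" by (intro is_mat_mT mm_is_mat)
qed (auto simp: mT_def mm_apply mult.commute)

lemma mT_idm [simp]: "mT I\<^sub>m = I\<^sub>m"
  by (auto simp: mT_def idm_def fun_eq_iff)

lemma mT_linear: "mT (A + B) = mT A + mT B" "mT (A - B) = mT A - mT B" "mT (- A) = - mT A"
  "mT (c *\<^sub>m A) = c *\<^sub>m mT A" "mT (mT A) = A"
  by (auto simp: mT_def fun_eq_iff cmat_apply)

subsection \<open>Determinants and inverses\<close>

lemma mdet_cong: "(\<And>i j. i < N \<Longrightarrow> j < N \<Longrightarrow> A i j = B i j) \<Longrightarrow> mdet N A = mdet N B"
  unfolding mdet_def
  by (intro sum.cong refl arg_cong2[where f="(*)"] prod.cong) (auto dest: permutes_in_image)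

text \<open>Composing each permutation with the transposition of \<open>a\<close> and
  \<open>b\<close> keeps the product, since the two selected rows coincide, but reverses the sign.
  The sum is its own negative.\<close>

lemma row_det_noninj:
  assumes "f ` {..<N} \<subseteq> {..<N}" "a < N" "b < N" "a \<noteq> b" "f a = f b"
  shows "(\<Sum>p | p permutes {..<N}. of_int (sign p) * (\<Prod>i<N. B (f i) (p i))) = (0 :: complex)"
    (is "?S = 0")
proof -
  let ?t = "Transposition.transpose a b"
  have t: "?t permutes {..<N}" using assms by (intro permutes_swap_id) auto
  have "?S = (\<Sum>p | p permutes {..<N}. of_int (sign (p \<circ> ?t)) * (\<Prod>i<N. B (f i) ((p \<circ> ?t) i)))"
    by (rule sum_permutations_compose_right[OF t])
  also have "\<dots> = (\<Sum>p | p permutes {..<N}. - (of_int (sign p) * (\<Prod>i<N. B (f i) (p i))))"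
  proof (rule sum.cong[OF refl])
    fix p assume p: "p \<in> {p. p permutes {..<N}}"
    have "(\<Prod>i<N. B (f i) ((p \<circ> ?t) i)) = (\<Prod>i<N. B (f (?t i)) (p (?t i)))"
      using assms by (intro prod.cong) (auto simp: Transposition.transpose_def)
    also have "\<dots> = (\<Prod>i<N. B (f i) (p i))"
      using prod.permute[OF t, of "\<lambda>i. B (f i) (p i)"] by (simp add: o_def)
    finally have "(\<Prod>i<N. B (f i) ((p \<circ> ?t) i)) = (\<Prod>i<N. B (f i) (p i))" .
    moreover have "sign (p \<circ> ?t) = - sign p"
      using p assms by (subst sign_compose) (auto simp: sign_swap_id intro: permutation_permutes[THEN iffD2] permutation_swap_id)
    ultimately show "of_int (sign (p \<circ> ?t)) * (\<Prod>i<N. B (f i) ((p \<circ> ?t) i)) =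
       - (of_int (sign p) * (\<Prod>i<N. B (f i) (p i)))" by simp
  qed
  also have "\<dots> = - ?S" by (simp add: sum_negf)
  finally show ?thesis by simp
qed

lemma row_det_perm:
  assumes q: "q permutes {..<N}"
  shows "(\<Sum>p | p permutes {..<N}. of_int (sign p) * (\<Prod>i<N. B (q i) (p i))) = of_int (sign q) * mdet N B"
    (is "?S = _")
proof -
  have "?S = (\<Sum>p | p permutes {..<N}. of_int (sign (p \<circ> q)) * (\<Prod>i<N. B (q i) ((p \<circ> q) i)))"
    by (rule sum_permutations_compose_right[OF q])
  also have "\<dots> = (\<Sum>p | p permutes {..<N}. of_int (sign q) * (of_int (sign p) * (\<Prod>i<N. B i (p i))))"
  proof (rule sum.cong[OF refl])
    fix p assume p: "p \<in> {p. p permutes {..<N}}"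
    have "(\<Prod>i<N. B (q i) ((p \<circ> q) i)) = (\<Prod>i<N. B i (p i))"
      using prod.permute[OF q, of "\<lambda>i. B i (p i)"] by (simp add: o_def)
    moreover have "sign (p \<circ> q) = sign p * sign q"
      using p q by (intro sign_compose) (auto intro: permutes_imp_permutation)
    ultimately show "of_int (sign (p \<circ> q)) * (\<Prod>i<N. B (q i) ((p \<circ> q) i)) =
      of_int (sign q) * (of_int (sign p) * (\<Prod>i<N. B i (p i)))" by simp
  qed
  also have "\<dots> = of_int (sign q) * mdet N B" by (simp add: mdet_def sum_distrib_left)
  finally show ?thesis .
qed

text \<open>The factor \<open>e\<close> is the sign of \<open>f\<close>, or \<open>0\<close> if
  \<open>f\<close> repeats a row. What matters is that one \<open>e\<close> serves every
  \<open>B\<close>: this makes determinants of products factor.\<close>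

lemma row_det:
  assumes "f ` {..<N} \<subseteq> {..<N}"
  shows "\<exists>e. \<forall>B. (\<Sum>p | p permutes {..<N}. of_int (sign p) * (\<Prod>i<N. B (f i) (p i))) = e * mdet N B"
proof (cases "inj_on f {..<N}")
  case False
  then obtain a b where "a < N" "b < N" "a \<noteq> b" "f a = f b" by (auto simp: inj_on_def)
  from row_det_noninj[OF assms this] show ?thesis by (intro exI[of _ 0]) simp
next
  case True
  define q where "q i = (if i < N then f i else i)" for i
  have "f ` {..<N} = {..<N}" using True assms by (intro endo_inj_surj) auto
  with True have "bij_betw f {..<N} {..<N}" by (simp add: bij_betw_def)
  then have "bij_betw q {..<N} {..<N}" by (rule bij_betw_cong[THEN iffD1, rotated]) (simp add: q_def)
  then have q: "q permutes {..<N}" by (rule bij_imp_permutes) (simp add: q_def)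
  show ?thesis
  proof (rule exI, rule allI)
    fix B
    show "(\<Sum>p | p permutes {..<N}. of_int (sign p) * (\<Prod>i<N. B (f i) (p i))) = of_int (sign q) * mdet N B"
      using row_det_perm[OF q, of B] by (simp add: q_def)
  qed
qed

lemma mdet_idm [simp]: "mdet N I\<^sub>m = 1"
proof -
  have "(\<Prod>i<N. I\<^sub>m i (p i)) = (if p = id then 1 else 0)" if p: "p permutes {..<N}" for p
  proof (cases "p = id")
    case False
    then obtain i where i: "p i \<noteq> i" by (auto simp: fun_eq_iff)
    with p have "i < N" by (metis permutes_not_in lessThan_iff)
    with i show ?thesis using False by (auto simp: idm_def intro!: prod_zero bexI[of _ i])
  qed (auto simp: idm_def)
  then have "mdet N I\<^sub>m = (\<Sum>p | p permutes {..<N}. if p = id then of_int (sign p) else 0)"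
    unfolding mdet_def by (intro sum.cong) auto
  also have "\<dots> = 1" by (simp add: sum.delta' finite_permutations permutes_id sum.delta)
  finally show ?thesis .
qed

text \<open>Expanding the rows of the product over choice functions leaves row-selected determinants
  of \<open>B\<close>, so the result is a constant depending only on \<open>A\<close> times
  \<open>mdet N B\<close>. Taking the identity for \<open>B\<close> identifies the constant.\<close>

lemma mdet_mm: "mdet N (A \<odot> B) = mdet N A * mdet N B"
proof -
  let ?F = "{..<N} \<rightarrow>\<^sub>E {..<N}"
  have "\<forall>f\<in>?F. \<exists>e. \<forall>B. (\<Sum>p | p permutes {..<N}. of_int (sign p) * (\<Prod>i<N. B (f i) (p i))) = e * mdet N B"
    by (intro ballI row_det) (auto simp: PiE_iff)
  from bchoice[OF this] obtain e where e: "\<forall>f\<in>?F. \<forall>B.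
      (\<Sum>p | p permutes {..<N}. of_int (sign p) * (\<Prod>i<N. B (f i) (p i))) = e f * mdet N B" ..
  have *: "mdet N (A \<odot> B) = (\<Sum>f\<in>?F. (\<Prod>i<N. A i (f i)) * e f) * mdet N B" for B
  proof -
    have "mdet N (A \<odot> B) = (\<Sum>p | p permutes {..<N}. of_int (sign p) * (\<Prod>i<N. \<Sum>k<N. A i k * B k (p i)))"
      unfolding mdet_def
    proof (rule sum.cong[OF refl])
      fix p assume "p \<in> {p. p permutes {..<N}}"
      then have "p i < N" if "i < N" for i using that permutes_in_image[of p "{..<N}" i] by simp
      then have "(\<Prod>i<N. (A \<odot> B) i (p i)) = (\<Prod>i<N. \<Sum>k<N. A i k * B k (p i))"
        by (intro prod.cong) (simp_all add: mm_apply)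
      then show "of_int (sign p) * (\<Prod>i<N. (A \<odot> B) i (p i)) =
        of_int (sign p) * (\<Prod>i<N. \<Sum>k<N. A i k * B k (p i))" by simp
    qed
    also have "\<dots> = (\<Sum>p | p permutes {..<N}. \<Sum>f\<in>?F. of_int (sign p) * (\<Prod>i<N. A i (f i) * B (f i) (p i)))"
      by (subst prod_sum_PiE) (auto simp: sum_distrib_left)
    also have "\<dots> = (\<Sum>f\<in>?F. \<Sum>p | p permutes {..<N}. of_int (sign p) * (\<Prod>i<N. A i (f i) * B (f i) (p i)))"
      by (rule sum.swap)
    also have "\<dots> = (\<Sum>f\<in>?F. (\<Prod>i<N. A i (f i)) * (e f * mdet N B))"
    proof (rule sum.cong[OF refl])
      fix f assume f: "f \<in> ?F"
      have "(\<Sum>p | p permutes {..<N}. of_int (sign p) * (\<Prod>i<N. A i (f i) * B (f i) (p i))) =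
        (\<Prod>i<N. A i (f i)) * (\<Sum>p | p permutes {..<N}. of_int (sign p) * (\<Prod>i<N. B (f i) (p i)))"
        by (simp add: prod.distrib sum_distrib_left mult_ac)
      then show "(\<Sum>p | p permutes {..<N}. of_int (sign p) * (\<Prod>i<N. A i (f i) * B (f i) (p i))) =
        (\<Prod>i<N. A i (f i)) * (e f * mdet N B)" using e f by simp
    qed
    finally show ?thesis by (simp add: sum_distrib_left sum_distrib_right mult_ac)
  qed
  have "mdet N (A \<odot> I\<^sub>m) = mdet N A"
    by (rule mdet_cong) (simp add: mm_apply idm_def if_distrib sum.delta' sum.delta cong: if_cong)
  with *[of B] *[of "I\<^sub>m"] show ?thesis by simp
qed

text \<open>Cofactor formula: the sum over permutations with \<open>p j = k\<close>, with the factor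
  of row \<open>j\<close> left out, is the cofactor. Multiplying by row \<open>i\<close> of
  \<open>A\<close> yields the determinant of \<open>A\<close> with row \<open>j\<close> replaced by
  row \<open>i\<close>.\<close>

lemma right_inverse_exists:
  assumes "mdet N A \<noteq> 0"
  shows "\<exists>B. is_mat N B \<and> A \<odot> B = I\<^sub>m"
proof -
  define B where "B k j = (if k < N \<and> j < N then (\<Sum>p | p permutes {..<N} \<and> p j = k.
     of_int (sign p) * (\<Prod>l\<in>{..<N}-{j}. A l (p l))) / mdet N A else 0)" for k j
  have "A \<odot> B = I\<^sub>m"
  proof (rule is_mat_eqI)
    fix i j assume ij: "i < N" "j < N"
    let ?P = "{p. p permutes {..<N}}"
    let ?f = "\<lambda>l. if l = j then i else l"
    have "mdet N A * (A \<odot> B) i j = (\<Sum>k<N. \<Sum>p | p permutes {..<N} \<and> p j = k.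
       of_int (sign p) * (A i (p j) * (\<Prod>l\<in>{..<N}-{j}. A l (p l))))"
    proof -
      have "mdet N A * (A i k * B k j) = (\<Sum>p | p permutes {..<N} \<and> p j = k.
         of_int (sign p) * (A i (p j) * (\<Prod>l\<in>{..<N}-{j}. A l (p l))))" if "k < N" for k
      proof -
        have "mdet N A * (A i k * B k j) = A i k * (\<Sum>p | p permutes {..<N} \<and> p j = k.
         of_int (sign p) * (\<Prod>l\<in>{..<N}-{j}. A l (p l)))" using that ij assms by (simp add: B_def)
        then show ?thesis by (simp add: sum_distrib_left mult_ac)
      qed
      then show ?thesis using ij by (simp add: mm_apply sum_distrib_left)
    qed
    also have "\<dots> = (\<Sum>p\<in>?P. of_int (sign p) * (A i (p j) * (\<Prod>l\<in>{..<N}-{j}. A l (p l))))"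
    proof -
      have "(\<lambda>p. p j) ` ?P \<subseteq> {..<N}" using ij permutes_in_image[of _ "{..<N}" j] by auto
      from sum.group[OF _ _ this, of "\<lambda>p. of_int (sign p) * (A i (p j) * (\<Prod>l\<in>{..<N}-{j}. A l (p l)))"]
      show ?thesis by (simp add: finite_permutations)
    qed
    also have "\<dots> = (\<Sum>p\<in>?P. of_int (sign p) * (\<Prod>l<N. A (?f l) (p l)))"
    proof (rule sum.cong[OF refl])
      fix p
      have "(\<Prod>l<N. A (?f l) (p l)) = A (?f j) (p j) * (\<Prod>l\<in>{..<N}-{j}. A (?f l) (p l))"
        using ij by (intro prod.remove) auto
      also have "(\<Prod>l\<in>{..<N}-{j}. A (?f l) (p l)) = (\<Prod>l\<in>{..<N}-{j}. A l (p l))"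
        by (rule prod.cong) auto
      finally show "of_int (sign p) * (A i (p j) * (\<Prod>l\<in>{..<N}-{j}. A l (p l))) =
        of_int (sign p) * (\<Prod>l<N. A (?f l) (p l))" by simp
    qed
    also have "\<dots> = (if i = j then mdet N A else 0)"
    proof (cases "i = j")
      case True
      then have f: "A (?f l) = A l" for l by simp
      show ?thesis unfolding f using True by (simp add: mdet_def)
    next
      case False
      then show ?thesis using ij row_det_noninj[of ?f i j A] by auto
    qed
    finally show "(A \<odot> B) i j = I\<^sub>m i j" using assms ij by (auto simp: idm_def)
  qed auto
  then show ?thesis by (intro exI[of _ B]) (auto simp: is_mat_def B_def)
qed

lemma inverse_exists:
  assumes "is_mat N A" "mdet N A \<noteq> 0"
  shows "\<exists>B. is_mat N B \<and> A \<odot> B = I\<^sub>m \<and> B \<odot> A = I\<^sub>m"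
proof -
  obtain B where B: "is_mat N B" "A \<odot> B = I\<^sub>m" using right_inverse_exists assms by blast
  have "mdet N A * mdet N B = 1" using mdet_mm[of A B] B by simp
  then have "mdet N B \<noteq> 0" by auto
  then obtain C where C: "is_mat N C" "B \<odot> C = I\<^sub>m" using right_inverse_exists by blast
  have "A = A \<odot> B \<odot> C" using assms C by (simp add: mm_assoc)
  then have "A = C" using B C by simp
  then show ?thesis using B C by auto
qed

subsection \<open>Traces\<close>

definition mtr :: "cmat \<Rightarrow> complex" where "mtr A = (\<Sum>i<N. A i i)"

lemma mtr_mm_commute: "mtr (A \<odot> B) = mtr (B \<odot> A)"
proof -
  have "mtr (A \<odot> B) = (\<Sum>i<N. \<Sum>k<N. A i k * B k i)" by (simp add: mtr_def mm_apply)
  also have "\<dots> = (\<Sum>k<N. \<Sum>i<N. A i k * B k i)" by (rule sum.swap)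
  finally show ?thesis by (simp add: mtr_def mm_apply mult.commute)
qed

fun mpow :: "nat \<Rightarrow> cmat \<Rightarrow> cmat" where
  "mpow 0 A = I\<^sub>m"
| "mpow (Suc k) A = A \<odot> mpow k A"

lemma mpow_is_mat [simp]: "is_mat N (mpow k A)"
  by (cases k) auto

lemma mpow_intertwine: "is_mat N g \<Longrightarrow> g \<odot> L = H \<odot> g \<Longrightarrow> g \<odot> mpow k L = mpow k H \<odot> g"
proof (induction k)
  case (Suc k)
  have "g \<odot> mpow (Suc k) L = g \<odot> L \<odot> mpow k L" by (simp add: mm_assoc)
  also have "\<dots> = H \<odot> (g \<odot> mpow k L)" using Suc.prems by (simp add: mm_assoc)
  also have "\<dots> = H \<odot> mpow k H \<odot> g" using Suc by (simp add: mm_assoc)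
  finally show ?case by simp
qed simp

lemma mtr_mpow_similar:
  assumes "is_mat N g" "mdet N g \<noteq> 0" "g \<odot> L = H \<odot> g"
  shows "mtr (mpow k L) = mtr (mpow k H)"
proof -
  obtain a where a: "is_mat N a" "g \<odot> a = I\<^sub>m" "a \<odot> g = I\<^sub>m" using inverse_exists assms by blast
  have "mpow k L = a \<odot> (g \<odot> mpow k L)" using a by (simp flip: mm_assoc)
  also have "\<dots> = a \<odot> (mpow k H \<odot> g)" using mpow_intertwine assms by simp
  finally have "mtr (mpow k L) = mtr (mpow k H \<odot> g \<odot> a)" using mtr_mm_commute by metis
  also have "\<dots> = mtr (mpow k H)" using a by (simp add: mm_assoc)
  finally show ?thesis .
qed

definition is_diag :: "cmat \<Rightarrow> bool" where
  "is_diag H \<longleftrightarrow> is_mat N H \<and> (\<forall>i j. i \<noteq> j \<longrightarrow> H i j = 0)"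

lemma diag_mm: "is_diag H \<Longrightarrow> i < N \<Longrightarrow> j < N \<Longrightarrow> (H \<odot> A) i j = H i i * A i j"
proof -
  assume H: "is_diag H" and ij: "i < N" "j < N"
  have "(\<Sum>k<N. H i k * A k j) = (\<Sum>k<N. if k = i then H i i * A i j else 0)"
    using H by (intro sum.cong) (auto simp: is_diag_def)
  then show ?thesis using ij by (simp add: mm_apply)
qed

lemma mm_diag: "is_diag H \<Longrightarrow> i < N \<Longrightarrow> j < N \<Longrightarrow> (A \<odot> H) i j = A i j * H j j"
proof -
  assume H: "is_diag H" and ij: "i < N" "j < N"
  have "(\<Sum>k<N. A i k * H k j) = (\<Sum>k<N. if k = j then A i j * H j j else 0)"
    using H by (intro sum.cong) (auto simp: is_diag_def)
  then show ?thesis using ij by (simp add: mm_apply)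
qed

lemma diag_eqI:
  assumes "is_diag A" "is_diag B" "\<And>i. i < N \<Longrightarrow> A i i = B i i"
  shows "A = B"
  by (rule is_mat_eqI) (use assms in \<open>auto simp: is_diag_def, metis\<close>)

lemma mpow_diag:
  assumes "is_diag H" "i < N"
  shows "mpow k H i i = H i i ^ k"
  by (induction k) (use assms in \<open>auto simp: diag_mm idm_def\<close>)

end

section \<open>The classical Lie algebras and their root vectors\<close>

context mats
begin

definition Em :: "nat \<Rightarrow> nat \<Rightarrow> cmat" where
  "Em i j = (\<lambda>a b. if a = i \<and> b = j then 1 else 0)"

lemma Em_is_mat: "i < N \<Longrightarrow> j < N \<Longrightarrow> is_mat N (Em i j)"
  by (auto simp: is_mat_def Em_def)

lemma Em_mm: "i < N \<Longrightarrow> j < N \<Longrightarrow> k < N \<Longrightarrow> l < N \<Longrightarrow>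
    Em i j \<odot> Em k l = (if j = k then Em i l else 0)"
proof (rule is_mat_eqI)
  assume *: "i < N" "j < N" "k < N" "l < N"
  then show "is_mat N (if j = k then Em i l else 0)" by (simp add: is_mat_zero Em_is_mat)
  fix a b assume "a < N" "b < N"
  then have "(Em i j \<odot> Em k l) a b = (\<Sum>m<N. if m = j then (if a = i \<and> j = k \<and> b = l then 1 else 0) else 0)"
    unfolding mm_apply[OF \<open>a < N\<close> \<open>b < N\<close>] by (intro sum.cong) (simp_all add: Em_def)
  then show "(Em i j \<odot> Em k l) a b = (if j = k then Em i l else 0) a b"
    using * by (auto simp: Em_def)
qed simp

text \<open>The exponential series of a matrix with \<open>X\<^sup>3 = 0\<close>.\<close>
definition ex :: "cmat \<Rightarrow> cmat" where
  "ex X = I\<^sub>m + X + (1/2) *\<^sub>m (X \<odot> X)"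

lemma ex_is_mat: "is_mat N X \<Longrightarrow> is_mat N (ex X)"
  unfolding ex_def by (intro is_mat_intros) auto

lemma ex_inverse:
  assumes "is_mat N X" "X \<odot> (X \<odot> X) = 0"
  shows "ex X \<odot> ex (- X) = I\<^sub>m"
proof -
  have "X \<odot> (X \<odot> (X \<odot> X)) = 0" using assms by (simp add: mm_linear)
  then show ?thesis using assms
    by (simp add: ex_def mm_linear mm_assoc smul_simps is_mat_intros)
      (simp add: fun_eq_iff cmat_apply)
qed

text \<open>Since the series stops, \<open>ex (s *\<^sub>m X)\<close> is quadratic in
  \<open>s\<close> and its derivative is \<open>X\<close> times itself. The product rule then gives
  the commutator of \<open>X\<close> with the conjugated matrix.\<close>

lemma ex_curve_deriv:
  assumes "is_mat N X" "X \<odot> (X \<odot> X) = 0"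
  shows "((\<lambda>s. (ex (s *\<^sub>m X) \<odot> L \<odot> ex (- (s *\<^sub>m X))) i j) has_field_derivative
    (X \<odot> (ex (a *\<^sub>m X) \<odot> L \<odot> ex (- (a *\<^sub>m X))) - ex (a *\<^sub>m X) \<odot> L \<odot> ex (- (a *\<^sub>m X)) \<odot> X) i j) (at a)"
proof (cases "i < N \<and> j < N")
  case False
  then have "(A \<odot> B) i j = 0" for A B using mm_is_mat[of A B] unfolding is_mat_def by auto
  then show ?thesis by (simp add: cmat_apply)
next
  case True
  have e: "((\<lambda>s. ex (s *\<^sub>m X) k l) has_field_derivative (X \<odot> ex (a *\<^sub>m X)) k l) (at a)" for k l a
  proof -
    have "(X \<odot> ex (a *\<^sub>m X)) = X + a *\<^sub>m (X \<odot> X)" using assms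
      by (simp add: ex_def mm_linear mm_assoc smul_simps)
    moreover have "(\<lambda>s. ex (s *\<^sub>m X) k l) = (\<lambda>s. I\<^sub>m k l + s * X k l + s * s / 2 * (X \<odot> X) k l)"
      by (simp add: ex_def mm_linear smul_simps)
    moreover have "((\<lambda>s. c + s * d + s * s / 2 * e) has_field_derivative d + a * e) (at a)" for c d e :: complex
      by (auto intro!: derivative_eq_intros simp: field_simps)
    ultimately show ?thesis by simp
  qed
  have e': "((\<lambda>s. ex (- (s *\<^sub>m X)) k l) has_field_derivative - (ex (- (a *\<^sub>m X)) \<odot> X) k l) (at a)" for k l
  proof -
    have "(ex (- (a *\<^sub>m X)) \<odot> X) = X - a *\<^sub>m (X \<odot> X)" using assms
      by (simp add: ex_def mm_linear mm_assoc smul_simps)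
    moreover have "(\<lambda>s. ex (- (s *\<^sub>m X)) k l) = (\<lambda>s. I\<^sub>m k l - s * X k l + s * s / 2 * (X \<odot> X) k l)"
      by (simp add: ex_def mm_linear smul_simps cmat_apply)
    moreover have "((\<lambda>s. c - s * d + s * s / 2 * e) has_field_derivative - (d - a * e)) (at a)" for c d e :: complex
      by (auto intro!: derivative_eq_intros simp: field_simps)
    ultimately show ?thesis by (simp add: cmat_apply)
  qed
  have L: "((\<lambda>s. (ex (s *\<^sub>m X) \<odot> L) k l) has_field_derivative (X \<odot> (ex (a *\<^sub>m X) \<odot> L)) k l) (at a)"
    if "k < N" "l < N" for k l
  proof -
    have "((\<lambda>s. \<Sum>m<N. ex (s *\<^sub>m X) k m * L m l) has_field_derivative
       (\<Sum>m<N. (X \<odot> ex (a *\<^sub>m X)) k m * L m l)) (at a)"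
      by (intro DERIV_sum DERIV_cmult_right e)
    then show ?thesis using that by (simp add: mm_apply[of k l] flip: mm_assoc)
  qed
  have "((\<lambda>s. \<Sum>m<N. (ex (s *\<^sub>m X) \<odot> L) i m * ex (- (s *\<^sub>m X)) m j) has_field_derivative
     (\<Sum>m<N. (X \<odot> (ex (a *\<^sub>m X) \<odot> L)) i m * ex (- (a *\<^sub>m X)) m j +
        (- (ex (- (a *\<^sub>m X)) \<odot> X) m j) * (ex (a *\<^sub>m X) \<odot> L) i m)) (at a)"
    using True by (intro DERIV_sum DERIV_mult L e') auto
  also have "(\<Sum>m<N. (X \<odot> (ex (a *\<^sub>m X) \<odot> L)) i m * ex (- (a *\<^sub>m X)) m j +
        (- (ex (- (a *\<^sub>m X)) \<odot> X) m j) * (ex (a *\<^sub>m X) \<odot> L) i m) =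
     ((X \<odot> (ex (a *\<^sub>m X) \<odot> L)) \<odot> ex (- (a *\<^sub>m X))) i j - ((ex (a *\<^sub>m X) \<odot> L) \<odot> (ex (- (a *\<^sub>m X)) \<odot> X)) i j"
    using True by (simp add: mm_apply[of i j] sum.distrib sum_negf sum_subtractf mult.commute)
  finally have D: "((\<lambda>s. \<Sum>m<N. (ex (s *\<^sub>m X) \<odot> L) i m * ex (- (s *\<^sub>m X)) m j) has_field_derivative
     ((X \<odot> (ex (a *\<^sub>m X) \<odot> L)) \<odot> ex (- (a *\<^sub>m X))) i j - ((ex (a *\<^sub>m X) \<odot> L) \<odot> (ex (- (a *\<^sub>m X)) \<odot> X)) i j) (at a)" .
  have "(\<lambda>s. (ex (s *\<^sub>m X) \<odot> L \<odot> ex (- (s *\<^sub>m X))) i j) =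
    (\<lambda>s. \<Sum>m<N. (ex (s *\<^sub>m X) \<odot> L) i m * ex (- (s *\<^sub>m X)) m j)"
    using True by (intro ext mm_apply) auto
  with D show ?thesis by (simp only: cmat_minus_apply mm_assoc)
qed

abbreviation entries :: "(cmat \<Rightarrow> complex) set" where
  "entries \<equiv> (\<lambda>(i, j) A. A i j) ` ({..<N} \<times> {..<N})"

lemma entry_polyf: "i < N \<Longrightarrow> j < N \<Longrightarrow> (\<lambda>A. A i j) \<in> polyf entries"
  by (rule polyf_gen) force

lemma mm_entry_polyf:
  assumes "\<And>i j. i < N \<Longrightarrow> j < N \<Longrightarrow> (\<lambda>x. A x i j) \<in> polyf G"
    "\<And>i j. i < N \<Longrightarrow> j < N \<Longrightarrow> (\<lambda>x. B x i j) \<in> polyf G"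
  shows "(\<lambda>x. (A x \<odot> B x) i j) \<in> polyf G"
proof (cases "i < N \<and> j < N")
  case True
  then show ?thesis by (auto simp: mm_apply intro!: polyf_sum polyf_mult assms)
qed (auto simp: mmul_def polyf_const)

lemma mdet_polyf:
  assumes "\<And>i j. i < N \<Longrightarrow> j < N \<Longrightarrow> (\<lambda>x. A x i j) \<in> polyf G"
  shows "(\<lambda>x. mdet N (A x)) \<in> polyf G"
  unfolding mdet_def
proof (intro polyf_sum polyf_mult polyf_const polyf_prod)
  fix p i assume "p \<in> {p. p permutes {..<N}}" "i \<in> {..<N}"
  then show "(\<lambda>x. A x i (p i)) \<in> polyf G"
    using permutes_in_image[of p "{..<N}" i] by (intro assms) auto
qed

lemma ex_entry_polyf: "(\<lambda>s. ex (s *\<^sub>m X) i j) \<in> polyf {\<lambda>s. s}"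
proof -
  have "(\<lambda>s. ex (s *\<^sub>m X) i j) = (\<lambda>s. I\<^sub>m i j + s * X i j + 1/2 * (s * (s * (X \<odot> X) i j)))"
    by (simp add: ex_def mm_linear)
  then show ?thesis by (simp only:) (intro polyf_add polyf_mult polyf_const polyf_gen; simp)
qed

text \<open>The determinant of \<open>ex (s *\<^sub>m X)\<close> is a polynomial in \<open>s\<close>
  without roots, because the matrix is invertible for every \<open>s\<close>. So it keeps its value
  \<open>1\<close> at \<open>s = 0\<close>.\<close>

lemma ex_det:
  assumes "is_mat N X" "X \<odot> (X \<odot> X) = 0"
  shows "mdet N (ex X) = 1"
proof -
  have "(\<lambda>s. mdet N (ex (s *\<^sub>m X))) \<in> polyf {\<lambda>s. s}"
    by (intro mdet_polyf ex_entry_polyf)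
  then obtain p where p: "\<And>s. mdet N (ex (s *\<^sub>m X)) = poly p s" using polyf_univariate by metis
  have "poly p s * mdet N (ex (- (s *\<^sub>m X))) = 1" for s
    using mdet_mm[of "ex (s *\<^sub>m X)" "ex (- (s *\<^sub>m X))"] assms
    by (simp add: ex_inverse is_mat_intros mm_linear smul_simps p)
  then have "poly p s \<noteq> 0" for s by (metis mult_zero_left zero_neq_one)
  then have "poly p 1 = poly p 0" by (rule poly_no_roots_const)
  moreover have "poly p 0 = 1" using p[of 0] by (simp add: smul_simps ex_def mm_linear)
  moreover have "poly p 1 = mdet N (ex X)" using p[of 1] by (simp add: smul_simps)
  ultimately show ?thesis by simp
qed

text \<open>The Weyl reflection as conjugation by \<open>exp X exp (-Y) exp X\<close> for an
  \<open>sl\<^sub>2\<close>-triple \<open>(X, K, Y)\<close>.\<close>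
lemma sl2_reflection:
  assumes X: "is_mat N X" "X \<odot> (X \<odot> X) = 0" and Y: "is_mat N Y" "Y \<odot> (Y \<odot> Y) = 0"
    and H: "is_mat N H" and K: "is_mat N K"
    and XY: "X \<odot> Y = Y \<odot> X + K" and KX: "K \<odot> X = X \<odot> K + 2 *\<^sub>m X" and KY: "K \<odot> Y = Y \<odot> K - 2 *\<^sub>m Y"
    and HX: "H \<odot> X = X \<odot> H + a *\<^sub>m X" and HY: "H \<odot> Y = Y \<odot> H - a *\<^sub>m Y"
  shows "ex X \<odot> ex (- Y) \<odot> ex X \<odot> H = (H - a *\<^sub>m K) \<odot> (ex X \<odot> ex (- Y) \<odot> ex X)"
proof -
  have exH: "ex X \<odot> H' = (H' - b *\<^sub>m X) \<odot> ex X"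
    if H': "is_mat N H'" and HX: "H' \<odot> X = X \<odot> H' + b *\<^sub>m X" for H' b
  proof -
    have XH: "X \<odot> H' = H' \<odot> X - b *\<^sub>m X" using HX by simp
    have XHZ: "X \<odot> (H' \<odot> Z) = H' \<odot> (X \<odot> Z) - b *\<^sub>m (X \<odot> Z)" for Z
      by (simp add: XH mm_linear flip: mm_assoc)
    show ?thesis using X H'
      by (simp add: ex_def mm_linear mm_assoc XH XHZ smul_simps)
        (simp add: fun_eq_iff cmat_apply algebra_simps)
  qed
  have exYH: "ex (- Y) \<odot> H = (H - a *\<^sub>m Y) \<odot> ex (- Y)"
  proof -
    have YH: "Y \<odot> H = H \<odot> Y + a *\<^sub>m Y" using HY by simp
    have YHZ: "Y \<odot> (H \<odot> Z) = H \<odot> (Y \<odot> Z) + a *\<^sub>m (Y \<odot> Z)" for Z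
      by (simp add: YH mm_linear flip: mm_assoc)
    show ?thesis using Y H
      by (simp add: ex_def mm_linear mm_assoc YH YHZ smul_simps)
        (simp add: fun_eq_iff cmat_apply algebra_simps)
  qed
  have exYX: "ex (- Y) \<odot> X = (X + K - Y) \<odot> ex (- Y)"
  proof -
    have YX: "Y \<odot> X = X \<odot> Y - K" using XY by simp
    have YK: "Y \<odot> K = K \<odot> Y + 2 *\<^sub>m Y" using KY by simp
    have YXZ: "Y \<odot> (X \<odot> Z) = X \<odot> (Y \<odot> Z) - K \<odot> Z" for Z
      by (simp add: YX mm_linear flip: mm_assoc)
    have YKZ: "Y \<odot> (K \<odot> Z) = K \<odot> (Y \<odot> Z) + 2 *\<^sub>m (Y \<odot> Z)" for Z
      by (simp add: YK mm_linear flip: mm_assoc)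
    \<comment> \<open>Moving \<open>X\<close> through \<open>Y\<^sup>3 = 0\<close> yields this
      relation. Without it the two sides of \<open>exYX\<close> differ by \<open>Y \<odot> Y\<close>
      plus half of \<open>K \<odot> (Y \<odot> Y)\<close>.\<close>
    have KYY: "K \<odot> (Y \<odot> Y) = - 2 *\<^sub>m (Y \<odot> Y)"
    proof -
      have "Y \<odot> (Y \<odot> X) = X \<odot> (Y \<odot> Y) - K \<odot> Y - Y \<odot> K"
        by (simp add: YX YXZ mm_linear mm_assoc)
      also have "\<dots> = X \<odot> (Y \<odot> Y) - 2 *\<^sub>m (K \<odot> Y) - 2 *\<^sub>m Y"
        unfolding YK by (simp add: fun_eq_iff cmat_apply)
      finally have "Y \<odot> (Y \<odot> (Y \<odot> X)) = Y \<odot> (X \<odot> (Y \<odot> Y)) - 2 *\<^sub>m (Y \<odot> (K \<odot> Y)) - 2 *\<^sub>m (Y \<odot> Y)"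
        by (simp add: mm_linear)
      also have "Y \<odot> (X \<odot> (Y \<odot> Y)) = - (K \<odot> (Y \<odot> Y))" using Y by (simp add: YXZ mm_linear mm_assoc)
      also have "Y \<odot> (K \<odot> Y) = K \<odot> (Y \<odot> Y) + 2 *\<^sub>m (Y \<odot> Y)" by (rule YKZ)
      also have "Y \<odot> (Y \<odot> (Y \<odot> X)) = (Y \<odot> (Y \<odot> Y)) \<odot> X" by (simp only: mm_assoc)
      also have "\<dots> = 0" using Y by (simp add: mm_linear)
      finally have "3 *\<^sub>m (K \<odot> (Y \<odot> Y)) + 6 *\<^sub>m (Y \<odot> Y) = 0"
        by (simp add: fun_eq_iff cmat_apply algebra_simps)
      then have e: "(3 *\<^sub>m (K \<odot> (Y \<odot> Y)) + 6 *\<^sub>m (Y \<odot> Y)) i j = (0 :: cmat) i j" for i j by simp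
      have "(K \<odot> (Y \<odot> Y)) i j = - 2 * (Y \<odot> Y) i j" for i j
      proof -
        have "3 * ((K \<odot> (Y \<odot> Y)) i j + 2 * (Y \<odot> Y) i j) = 0" using e[of i j] by (simp add: algebra_simps)
        then show ?thesis by (simp add: add_eq_0_iff2)
      qed
      then show ?thesis by (intro ext) simp
    qed
    show ?thesis using X Y K
      by (simp add: ex_def mm_linear mm_assoc YX YXZ YK YKZ KYY smul_simps)
        (simp add: fun_eq_iff cmat_apply algebra_simps)
  qed
  have "ex X \<odot> H = (H - a *\<^sub>m X) \<odot> ex X" by (rule exH[OF H HX])
  then have "ex X \<odot> ex (- Y) \<odot> ex X \<odot> H = ex X \<odot> (ex (- Y) \<odot> (H - a *\<^sub>m X)) \<odot> ex X"
    by (simp add: mm_assoc)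
  also have "ex (- Y) \<odot> (H - a *\<^sub>m X) = (H - a *\<^sub>m X - a *\<^sub>m K) \<odot> ex (- Y)"
    using exYH exYX by (simp add: mm_linear smul_simps)
  also have "ex X \<odot> ((H - a *\<^sub>m X - a *\<^sub>m K) \<odot> ex (- Y)) = (ex X \<odot> (H - a *\<^sub>m X - a *\<^sub>m K)) \<odot> ex (- Y)"
    by (simp add: mm_assoc)
  also have "ex X \<odot> (H - a *\<^sub>m X - a *\<^sub>m K) = (H - a *\<^sub>m K) \<odot> ex X"
  proof -
    \<comment> \<open>On \<open>X\<close> the summand \<open>- a *\<^sub>m K\<close> acts with
      eigenvalue \<open>- 2 * a\<close>, so the total is \<open>- a\<close>. The second conjugation
      by \<open>ex X\<close> therefore cancels exactly the term \<open>- a *\<^sub>m X\<close>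
      produced by the first one.\<close>
    have "(H - a *\<^sub>m X - a *\<^sub>m K) \<odot> X = X \<odot> (H - a *\<^sub>m X - a *\<^sub>m K) + (a - 2 * a) *\<^sub>m X"
      by (simp add: mm_linear HX KX smul_simps) (simp add: fun_eq_iff cmat_apply algebra_simps)
    then have "ex X \<odot> (H - a *\<^sub>m X - a *\<^sub>m K) = (H - a *\<^sub>m X - a *\<^sub>m K - (a - 2 * a) *\<^sub>m X) \<odot> ex X"
      using H K X by (intro exH is_mat_intros)
    then show ?thesis by (simp add: smul_simps)
  qed
  finally show ?thesis by (simp only: mm_assoc)
qed

end

locale lie = mats N for N :: nat +
  fixes t :: ctype and n :: nat
  assumes n_pos: "n \<ge> 1" and N_eq: "N = dimN t n"
begin

definition "tA \<longleftrightarrow> t = TA"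
definition "tC \<longleftrightarrow> t = TC"
definition "tO \<longleftrightarrow> t \<in> {TB, TD}"

lemma t_cases1: "\<not> tA \<longleftrightarrow> tC \<or> tO"
  unfolding tA_def tC_def tO_def by (cases t) simp_all

lemma t_cases2: "tC \<Longrightarrow> \<not> tO"
  unfolding tC_def tO_def by simp

lemmas t_cases = t_cases1 t_cases2

lemma N_C: "tC \<Longrightarrow> N = 2 * n"
  by (simp add: tC_def N_eq)

abbreviation "J \<equiv> Jform t n"
abbreviation "\<gg> \<equiv> lie_alg t n"
abbreviation "\<hh> \<equiv> cartan t n"
abbreviation "GG \<equiv> grp t n"

definition fl :: "nat \<Rightarrow> nat" where "fl i = N - 1 - i"

definition sg :: "nat \<Rightarrow> complex" where "sg i = (if tC \<and> n \<le> i then -1 else 1)"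

lemma N_pos: "N > 0" using n_pos N_eq by (cases t) auto

lemma fl_lt [simp]: "i < N \<Longrightarrow> fl i < N" using N_pos by (auto simp: fl_def)
lemma fl_fl [simp]: "i < N \<Longrightarrow> fl (fl i) = i" by (auto simp: fl_def)
lemma fl_inj: "i < N \<Longrightarrow> j < N \<Longrightarrow> fl i = fl j \<longleftrightarrow> i = j" by (auto simp: fl_def)
lemma fl_swap: "i < N \<Longrightarrow> j < N \<Longrightarrow> fl i = j \<longleftrightarrow> fl j = i" by (auto simp: fl_def)
lemma fl_fix: "i < N \<Longrightarrow> j < N \<Longrightarrow> fl i = i \<Longrightarrow> fl j = j \<Longrightarrow> i = j" by (auto simp: fl_def)
lemma fl_swap': "i < N \<Longrightarrow> j < N \<Longrightarrow> i = fl j \<longleftrightarrow> j = fl i" by (auto simp: fl_def)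
lemma fl_less: "i < N \<Longrightarrow> j < N \<Longrightarrow> fl i < fl j \<longleftrightarrow> j < i" by (auto simp: fl_def)

lemma sg_sq [simp]: "sg i * sg i = 1" "sg i * (sg i * x) = x" by (auto simp: sg_def)
lemma sg_nz [simp]: "sg i \<noteq> 0" by (auto simp: sg_def)
lemma sg_fl: "i < N \<Longrightarrow> j < N \<Longrightarrow> sg (fl i) * sg (fl j) = sg i * sg j"
  by (auto simp: sg_def fl_def N_C)
lemma sg_C: "tC \<Longrightarrow> i < N \<Longrightarrow> sg (fl i) = - sg i"
  unfolding sg_def fl_def using N_C by auto
lemma sg_BD: "\<not> tC \<Longrightarrow> sg i = 1" by (auto simp: sg_def)

lemma J_apply: "\<not> tA \<Longrightarrow> i < N \<Longrightarrow> j < N \<Longrightarrow> J i j = (if j = fl i then sg i else 0)"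
  unfolding fl_def sg_def tA_def tC_def unfolding N_eq by (cases t) (auto simp: Jorth_def Jsp_def)

lemma J_is_mat: "is_mat N J"
  by (cases t) (auto simp: is_mat_def Jorth_def Jsp_def idm_def N_eq)

lemma J_mm: "\<not> tA \<Longrightarrow> i < N \<Longrightarrow> j < N \<Longrightarrow> (J \<odot> A) i j = sg i * A (fl i) j"
proof -
  assume *: "\<not> tA" "i < N" "j < N"
  then have "(J \<odot> A) i j = (\<Sum>k<N. if k = fl i then sg i * A (fl i) j else 0)"
    unfolding mm_apply[OF *(2,3)] by (intro sum.cong) (auto simp: J_apply)
  with * show ?thesis by simp
qed

lemma mm_J: "\<not> tA \<Longrightarrow> i < N \<Longrightarrow> j < N \<Longrightarrow> (A \<odot> J) i j = A i (fl j) * sg (fl j)"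
proof -
  assume *: "\<not> tA" "i < N" "j < N"
  then have "(A \<odot> J) i j = (\<Sum>k<N. if k = fl j then A i (fl j) * sg (fl j) else 0)"
    unfolding mm_apply[OF *(2,3)] by (intro sum.cong) (auto simp: J_apply fl_swap)
  with * show ?thesis by simp
qed

lemma lie_alg_A: "tA \<Longrightarrow> L \<in> \<gg> \<longleftrightarrow> is_mat N L \<and> mtr L = 0"
  unfolding mtr_def tA_def unfolding lie_alg_def N_eq by simp

lemma lie_alg_J: "\<not> tA \<Longrightarrow> L \<in> \<gg> \<longleftrightarrow> is_mat N L \<and> mT L \<odot> J + J \<odot> L = 0"
  by (simp add: lie_alg_def mzero_zero plus_fun_def tA_def N_eq)

text \<open>The form is supported on the antidiagonal, so each entry of
  \<open>mT L \<odot> J + J \<odot> L\<close> couples just two entries of \<open>L\<close>: a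
  position and its mirror image in the antidiagonal.\<close>

lemma lie_alg_entries:
  assumes "\<not> tA"
  shows "L \<in> \<gg> \<longleftrightarrow> is_mat N L \<and> (\<forall>i<N. \<forall>j<N. L (fl j) (fl i) = - (sg i * sg j * L i j))"
proof -
  have e: "(mT L \<odot> J + J \<odot> L) a b = L (fl b) a * sg (fl b) + sg a * L (fl a) b" if "a < N" "b < N" for a b
    using assms that by (simp add: J_mm mm_J mT_def)
  have "mT L \<odot> J + J \<odot> L = 0 \<longleftrightarrow> (\<forall>i<N. \<forall>j<N. L (fl j) (fl i) = - (sg i * sg j * L i j))" (is "?A \<longleftrightarrow> ?B")
  proof
    assume ?A
    show ?B
    proof (intro allI impI)
      fix i j assume ij: "i < N" "j < N"
      have "L (fl j) (fl i) * sg (fl j) + sg (fl i) * L i j = 0"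
        using e[of "fl i" j] ij \<open>?A\<close> by simp
      then have "sg (fl j) * (L (fl j) (fl i) * sg (fl j) + sg (fl i) * L i j) = 0" by simp
      then have "L (fl j) (fl i) + (sg (fl i) * sg (fl j)) * L i j = 0"
        by (simp add: algebra_simps)
      then show "L (fl j) (fl i) = - (sg i * sg j * L i j)" using ij by (simp add: sg_fl add_eq_0_iff2)
    qed
  next
    assume ?B
    show ?A
    proof (rule is_mat_eqI)
      fix a b assume ab: "a < N" "b < N"
      have "L (fl b) a = - (sg (fl a) * sg b * L (fl a) b)" using \<open>?B\<close>[rule_format, of "fl a" b] ab by simp
      moreover have "sg b = sg (fl a) * sg a * sg (fl b)"
        using sg_fl[OF ab] sg_sq(1)[of a] by (metis mult.assoc mult.commute mult.left_commute sg_sq(2))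
      ultimately show "(mT L \<odot> J + J \<odot> L) a b = (0 :: cmat) a b"
        using e[OF ab] by (simp add: algebra_simps)
    qed (auto intro: is_mat_intros)
  qed
  then show ?thesis using lie_alg_J[OF assms] by simp
qed

lemma lie_is_mat: "L \<in> \<gg> \<Longrightarrow> is_mat N L"
  by (simp add: lie_alg_def N_eq)

lemma mtr_linear: "mtr (A + B) = mtr A + mtr B" "mtr (A - B) = mtr A - mtr B" "mtr (c *\<^sub>m A) = c * mtr A"
  by (auto simp: mtr_def cmat_apply sum.distrib sum_subtractf sum_distrib_left)

lemma lie_add: "A \<in> \<gg> \<Longrightarrow> B \<in> \<gg> \<Longrightarrow> A + B \<in> \<gg>"
  by (cases tA) (auto simp: lie_alg_A lie_alg_entries mtr_linear is_mat_intros algebra_simps)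

lemma lie_smul: "A \<in> \<gg> \<Longrightarrow> c *\<^sub>m A \<in> \<gg>"
  by (cases tA) (auto simp: lie_alg_A lie_alg_entries mtr_linear is_mat_intros algebra_simps)

lemma lie_zero: "0 \<in> \<gg>"
  by (cases tA) (auto simp: lie_alg_A lie_alg_entries mtr_def is_mat_intros)

lemma lie_uminus: "A \<in> \<gg> \<Longrightarrow> - A \<in> \<gg>"
  using lie_smul[of A "-1"] by (simp add: smul_simps)

lemma lie_diff: "A \<in> \<gg> \<Longrightarrow> B \<in> \<gg> \<Longrightarrow> A - B \<in> \<gg>"
  using lie_add[OF _ lie_uminus] by fastforce

lemma lie_sum: "(\<And>k. k \<in> K \<Longrightarrow> A k \<in> \<gg>) \<Longrightarrow> (\<Sum>k\<in>K. A k) \<in> \<gg>"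
  by (induction K rule: infinite_finite_induct) (auto simp: lie_zero lie_add)

lemma brk_mm: "brk N A B = A \<odot> B - B \<odot> A"
  by (simp add: brk_def fun_diff_def)

lemma lie_brk: "A \<in> \<gg> \<Longrightarrow> B \<in> \<gg> \<Longrightarrow> A \<odot> B - B \<odot> A \<in> \<gg>"
proof (cases tA)
  case True
  then show ?thesis by (simp add: lie_alg_A mtr_linear is_mat_intros mtr_mm_commute)
next
  case False
  assume "A \<in> \<gg>" "B \<in> \<gg>"
  then have AB: "mT A \<odot> J = - (J \<odot> A)" "mT B \<odot> J = - (J \<odot> B)"
    using False by (auto simp: lie_alg_J add_eq_0_iff2)
  have "mT A \<odot> (J \<odot> Z) = - (J \<odot> (A \<odot> Z))" "mT B \<odot> (J \<odot> Z) = - (J \<odot> (B \<odot> Z))" for Z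
    by (simp_all add: AB mm_linear flip: mm_assoc)
  then have "mT (A \<odot> B - B \<odot> A) \<odot> J = J \<odot> (B \<odot> A) - J \<odot> (A \<odot> B)"
    by (simp add: mT_mm mT_linear mm_linear mm_assoc AB)
  then show ?thesis using False by (simp add: lie_alg_J mm_linear mm_assoc is_mat_intros)
qed

subsection \<open>The Cartan subalgebra\<close>

lemma cartan_lie: "H \<in> \<hh> \<Longrightarrow> H \<in> \<gg>" by (simp add: cartan_def)

lemma cartan_diag: "H \<in> \<hh> \<Longrightarrow> is_diag H"
  by (auto simp: cartan_def is_diag_def lie_is_mat)

lemma cartan_iff_diag: "H \<in> \<hh> \<longleftrightarrow> H \<in> \<gg> \<and> is_diag H"
  by (auto simp: cartan_def is_diag_def lie_is_mat)

lemma cartan_A: "tA \<Longrightarrow> H \<in> \<hh> \<longleftrightarrow> is_diag H \<and> (\<Sum>i<N. H i i) = 0"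
  by (auto simp: cartan_iff_diag lie_alg_A is_diag_def mtr_def)

lemma cartan_nA:
  assumes "\<not> tA"
  shows "H \<in> \<hh> \<longleftrightarrow> is_diag H \<and> (\<forall>i<N. H (fl i) (fl i) = - H i i)"
proof -
  have "(\<forall>i<N. \<forall>j<N. H (fl j) (fl i) = - (sg i * sg j * H i j)) \<longleftrightarrow> (\<forall>i<N. H (fl i) (fl i) = - H i i)"
    if H: "is_diag H"
  proof (intro iffI allI impI)
    fix i assume *: "\<forall>i<N. \<forall>j<N. H (fl j) (fl i) = - (sg i * sg j * H i j)" and i: "i < N"
    then have "H (fl i) (fl i) = - (sg i * sg i * H i i)" by blast
    then show "H (fl i) (fl i) = - H i i" by simp
  next
    fix i j assume *: "\<forall>i<N. H (fl i) (fl i) = - H i i" and ij: "i < N" "j < N"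
    show "H (fl j) (fl i) = - (sg i * sg j * H i j)"
    proof (cases "i = j")
      case True then show ?thesis using * ij by simp
    next
      case False
      then have "fl i \<noteq> fl j" using ij fl_inj by blast
      then show ?thesis using False H by (auto simp: is_diag_def)
    qed
  qed
  then show ?thesis using assms by (auto simp: cartan_iff_diag lie_alg_entries is_diag_def)
qed

lemma cartan_add: "A \<in> \<hh> \<Longrightarrow> B \<in> \<hh> \<Longrightarrow> A + B \<in> \<hh>"
  and cartan_smul: "A \<in> \<hh> \<Longrightarrow> c *\<^sub>m A \<in> \<hh>"
  and cartan_zero: "0 \<in> \<hh>"
  and cartan_diff: "A \<in> \<hh> \<Longrightarrow> B \<in> \<hh> \<Longrightarrow> A - B \<in> \<hh>"
  by (auto simp: cartan_def lie_add lie_smul lie_zero lie_diff cmat_apply)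

text \<open>Outside type A, \<open>fl\<close> negates the coordinates of a Cartan element.
  Differences of two diagonal entries therefore also give sums, single coordinates (type B) and
  doubled ones (type C), so every root has this form.\<close>

definition al :: "nat \<Rightarrow> nat \<Rightarrow> cmat \<Rightarrow> complex" where "al i j H = H i i - H j j"

lemma al_linear: "al i j (A + B) = al i j A + al i j B" "al i j (A - B) = al i j A - al i j B"
  "al i j (c *\<^sub>m A) = c * al i j A"
  by (auto simp: al_def cmat_apply algebra_simps)

definition rvalid :: "nat \<Rightarrow> nat \<Rightarrow> bool" where
  "rvalid i j \<longleftrightarrow> i < N \<and> j < N \<and> i \<noteq> j \<and> (tO \<longrightarrow> j \<noteq> fl i)"

text \<open>Outside type A the involution \<open>fl\<close> reverses the coordinates, \<open>sg\<close> gives the signs of the form,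
  and \<open>Xr i j\<close> and \<open>Xr (fl j) (fl i)\<close> agree up to sign. In the orthogonal types
  \<open>Xr i (fl i) = 0\<close>, which \<open>rvalid\<close> excludes.\<close>
definition Xr :: "nat \<Rightarrow> nat \<Rightarrow> cmat" where
  "Xr i j = (if tA then Em i j else Em i j - (sg i * sg j) *\<^sub>m Em (fl j) (fl i))"

lemma Xr_apply:
  assumes "i < N" "j < N" "a < N" "b < N"
  shows "Xr i j a b = (if a = i \<and> b = j then 1 else 0) -
    (if \<not> tA \<and> a = fl j \<and> b = fl i then sg i * sg j else 0)"
  by (auto simp: Xr_def Em_def cmat_apply)

lemma Xr_is_mat: "i < N \<Longrightarrow> j < N \<Longrightarrow> is_mat N (Xr i j)"
  by (auto simp: Xr_def Em_is_mat is_mat_intros)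

lemma Xr_lie: "i < N \<Longrightarrow> j < N \<Longrightarrow> i \<noteq> j \<Longrightarrow> Xr i j \<in> \<gg>"
proof (cases tA)
  case True
  assume "i < N" "j < N" "i \<noteq> j"
  moreover from this have "mtr (Em i j) = 0" by (auto simp: mtr_def Em_def intro!: sum.neutral)
  ultimately show ?thesis using True by (simp add: lie_alg_A Xr_def Em_is_mat)
next
  case False
  assume ij: "i < N" "j < N" "i \<noteq> j"
  have "Xr i j (fl b) (fl a) = - (sg a * sg b * Xr i j a b)" if ab: "a < N" "b < N" for a b
  proof -
    have 1: "fl b = i \<longleftrightarrow> b = fl i" "fl a = j \<longleftrightarrow> a = fl j" using ab ij fl_swap'[of b i] fl_swap'[of a j] by auto
    have 2: "fl b = fl j \<longleftrightarrow> b = j" "fl a = fl i \<longleftrightarrow> a = i" using ab ij by (auto simp: fl_inj)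
    let ?P = "a = i \<and> b = j" and ?Q = "a = fl j \<and> b = fl i"
    have x1: "Xr i j (fl b) (fl a) = (if ?Q then 1 else 0) - (if ?P then sg i * sg j else 0)"
      using ab ij False by (simp only: Xr_apply fl_lt 1 2 simp_thms conj_commute[of "b = fl i"] conj_commute[of "b = j"])
    have x2: "Xr i j a b = (if ?P then 1 else 0) - (if ?Q then sg i * sg j else 0)"
      using ab ij False by (simp only: Xr_apply simp_thms)
    have c: "?P \<or> ?Q \<Longrightarrow> sg a * sg b = sg i * sg j"
    proof (elim disjE conjE)
      assume "a = fl j" "b = fl i"
      then show ?thesis using sg_fl[OF ij(2,1)] mult.commute[of "sg i" "sg j"] by simp
    qed simp
    have e: "sg i * sg j * (sg i * sg j) = 1" by (simp add: mult_ac)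
    have "(if Q then 1 else 0) - (if P then e else 0) = - (c * ((if P then 1 else 0) - (if Q then e else 0)))"
      if "e * e = 1" "P \<or> Q \<Longrightarrow> c = e" for P Q and c e :: complex
    proof (cases "P \<or> Q")
      case True
      then have "c = e" by (rule that(2))
      have "e * (1 - e) = e - 1" "e * (0 - e) = - 1" using that(1) by (simp_all add: algebra_simps)
      then show ?thesis unfolding \<open>c = e\<close> by (cases P; cases Q) simp_all
    qed simp
    from this[OF e c] show ?thesis unfolding x1 x2 .
  qed
  then show ?thesis using False ij by (auto simp: lie_alg_entries Xr_is_mat)
qed

text \<open>The two matrix units in \<open>Xr i j\<close> can coincide only for
  \<open>j = fl i\<close>, which \<open>rvalid\<close> allows only in type C among the types with a
  form. There the two signs are opposite, so the units add up to \<open>2\<close> instead of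
  cancelling.\<close>

lemma Xr_nz: "rvalid i j \<Longrightarrow> Xr i j i j \<noteq> 0"
proof -
  assume v: "rvalid i j"
  then have ij: "i < N" "j < N" by (auto simp: rvalid_def)
  show ?thesis
  proof (cases "\<not> tA \<and> i = fl j \<and> j = fl i")
    case True
    then have tC using v t_cases1 unfolding rvalid_def by blast
    then have "sg (fl i) = - sg i" using sg_C ij by blast
    then have "sg i * sg (fl i) = - 1" by (simp only: minus_mult_right[symmetric] sg_sq)
    moreover have "j = fl i" using True by blast
    ultimately have "sg i * sg j = - 1" by (simp only:)
    then have "Xr i j i j = 1 - - 1"
      by (simp only: Xr_apply[OF ij ij] if_P[OF True] simp_thms if_True)
    then show ?thesis by simp
  next
    case False
    then have "Xr i j i j = 1" by (simp only: Xr_apply[OF ij ij] simp_thms if_True if_False) simp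
    then show ?thesis by simp
  qed
qed

text \<open>Only the index fixed by \<open>fl\<close>, the middle one in type B, makes the square
  nonzero. The square is then a multiple of one matrix unit, which \<open>Xr i j\<close> kills.
  These short roots are why \<open>ex\<close> has a quadratic term.\<close>

lemma Xr_cube: "i < N \<Longrightarrow> j < N \<Longrightarrow> i \<noteq> j \<Longrightarrow> Xr i j \<odot> (Xr i j \<odot> Xr i j) = 0"
proof (cases tA)
  case True
  assume "i < N" "j < N" "i \<noteq> j"
  then show ?thesis using True by (auto simp: Xr_def Em_mm mm_linear)
next
  case False
  assume ij: "i < N" "j < N" "i \<noteq> j"
  define e where "e = sg i * sg j"
  have X: "Xr i j = Em i j - e *\<^sub>m Em (fl j) (fl i)" using False by (simp add: Xr_def e_def)
  have ne: "j \<noteq> i" "fl i \<noteq> fl j" "fl j \<noteq> fl i" using ij fl_inj by auto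
  consider "fl i = i" "j \<noteq> fl j" "i \<noteq> fl j" | "j = fl j" "fl i \<noteq> i" "fl i \<noteq> j" | "fl i \<noteq> i" "j \<noteq> fl j"
    using ij fl_fix[of i j] fl_inj[of i j] by fastforce
  then show ?thesis
  proof cases
    case 1
    have "Xr i j \<odot> Xr i j = (- e) *\<^sub>m Em (fl j) j"
      unfolding X using 1 ij ne by (simp add: mm_linear Em_mm smul_simps)
    moreover have "Xr i j \<odot> Em (fl j) j = 0"
      unfolding X using 1 ij ne by (simp add: mm_linear Em_mm smul_simps)
    ultimately show ?thesis by (simp add: mm_linear smul_simps)
  next
    case 2
    have "Xr i j \<odot> Xr i j = (- e) *\<^sub>m Em i (fl i)"
      unfolding X using 2(2,3) 2(1)[symmetric] ij ne by (simp add: mm_linear Em_mm smul_simps)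
    moreover have "Xr i j \<odot> Em i (fl i) = 0"
      unfolding X using 2(2,3) 2(1)[symmetric] ij ne by (simp add: mm_linear Em_mm smul_simps)
    ultimately show ?thesis by (simp add: mm_linear smul_simps)
  next
    case 3
    have "Xr i j \<odot> Xr i j = 0"
      unfolding X using 3 ij ne by (simp add: mm_linear Em_mm smul_simps)
    then show ?thesis by (simp add: mm_linear)
  qed
qed

lemma lie_decomp:
  assumes "L \<in> \<gg>"
  shows "\<exists>D\<in>\<hh>. \<exists>c. L = D + (\<Sum>i<N. \<Sum>j\<in>{..<N}-{i}. c i j *\<^sub>m Xr i j)"
proof -
  define D where "D = (\<lambda>i j. if i = j then L i j else 0)"
  have D: "is_diag D" using lie_is_mat[OF assms] by (auto simp: is_diag_def D_def is_mat_def)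
  have Dh: "D \<in> \<hh>"
  proof (cases tA)
    case True
    then show ?thesis using D assms by (simp add: cartan_A lie_alg_A mtr_def D_def)
  next
    case False
    have "L (fl i) (fl i) = - L i i" if "i < N" for i
      using assms that False by (simp add: lie_alg_entries)
    then show ?thesis using D False by (simp add: cartan_nA D_def)
  qed
  \<comment> \<open>Outside type A each off-diagonal entry is produced by \<open>Xr i j\<close> and
    again by \<open>Xr (fl j) (fl i)\<close>. The factor \<open>1/2\<close> undoes this
    doubling.\<close>
  define k :: complex where "k = (if tA then 1 else 1/2)"
  have "L = D + (\<Sum>i<N. \<Sum>j\<in>{..<N}-{i}. (k * L i j) *\<^sub>m Xr i j)"
  proof (rule is_mat_eqI)
    show "is_mat N L" using assms by (rule lie_is_mat)
    show "is_mat N (D + (\<Sum>i<N. \<Sum>j\<in>{..<N}-{i}. (k * L i j) *\<^sub>m Xr i j))"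
      by (intro lie_is_mat lie_add lie_sum lie_smul Xr_lie cartan_lie Dh) auto
    fix a b assume ab: "a < N" "b < N"
    have fab: "fl a = fl b \<longleftrightarrow> a = b" "fl b = fl a \<longleftrightarrow> a = b" using ab fl_inj by auto
    have "(\<Sum>i<N. \<Sum>j\<in>{..<N}-{i}. (k * L i j) *\<^sub>m Xr i j) a b = (\<Sum>i<N. \<Sum>j\<in>{..<N}-{i}. k * L i j * Xr i j a b)"
      by (simp add: cmat_apply)
    also have "\<dots> = (\<Sum>i<N. \<Sum>j\<in>{..<N}-{i}. (if i = a then (if j = b then k * L a b else 0) else 0) -
       (if i = fl b then (if j = fl a then (if \<not> tA then k * L (fl b) (fl a) * (sg (fl b) * sg (fl a)) else 0) else 0) else 0))"
    proof (intro sum.cong refl)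
      fix i j assume "i \<in> {..<N}" "j \<in> {..<N} - {i}"
      then have ij: "i < N" "j < N" by auto
      have "a = fl j \<longleftrightarrow> j = fl a" "b = fl i \<longleftrightarrow> i = fl b" using fl_swap'[of a j] fl_swap'[of b i] ij ab by auto
      then show "k * L i j * Xr i j a b = (if i = a then (if j = b then k * L a b else 0) else 0) -
       (if i = fl b then (if j = fl a then (if \<not> tA then k * L (fl b) (fl a) * (sg (fl b) * sg (fl a)) else 0) else 0) else 0)"
        using ij ab by (auto simp: Xr_apply algebra_simps)
    qed
    also have "\<dots> = (if a = b then 0 else k * L a b - (if \<not> tA then k * L (fl b) (fl a) * (sg (fl b) * sg (fl a)) else 0))"
    proof -
      have s: "(\<Sum>i<N. \<Sum>j\<in>{..<N}-{i}. if i = p then (if j = q then x else 0) else 0) = (if p = q then 0 else x)"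
        if "p < N" "q < N" for p q and x :: complex
      proof -
        have "(\<Sum>i<N. \<Sum>j\<in>{..<N}-{i}. if i = p then (if j = q then x else 0) else 0) =
          (\<Sum>i<N. if i = p then (if p = q then 0 else x) else 0)"
          using that by (intro sum.cong refl) (auto simp: sum.delta)
        then show ?thesis using that by simp
      qed
      show ?thesis unfolding sum_subtractf using ab by (simp only: s fl_lt) (auto simp: fab)
    qed
    finally have e: "(\<Sum>i<N. \<Sum>j\<in>{..<N}-{i}. (k * L i j) *\<^sub>m Xr i j) a b =
      (if a = b then 0 else k * L a b - (if \<not> tA then k * L (fl b) (fl a) * (sg (fl b) * sg (fl a)) else 0))" .
    have "L (fl b) (fl a) * (sg (fl b) * sg (fl a)) = - L a b" if "\<not> tA"
    proof -
      have "L (fl b) (fl a) = - (sg a * sg b * L a b)" using assms that ab by (simp add: lie_alg_entries)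
      moreover have "sg (fl b) * sg (fl a) = sg b * sg a" using sg_fl ab by simp
      ultimately show ?thesis by (simp add: mult_ac)
    qed
    then show "L a b = (D + (\<Sum>i<N. \<Sum>j\<in>{..<N}-{i}. (k * L i j) *\<^sub>m Xr i j)) a b"
      using e by (auto simp: D_def k_def)
  qed
  with Dh show ?thesis by (intro bexI[of _ D] exI[of _ "\<lambda>i j. k * L i j"])
qed

subsection \<open>Coroots and reflections\<close>

definition Kr :: "nat \<Rightarrow> nat \<Rightarrow> cmat" where
  "Kr i j = (if tA then Em i i - Em j j
     else Em i i - Em j j + Em (fl j) (fl j) - Em (fl i) (fl i))"

text \<open>\<open>nal i j\<close> is the value of \<open>al i j\<close> on \<open>Kr i j\<close>, so that \<open>Hc i j\<close> is the coroot.\<close>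
definition nal :: "nat \<Rightarrow> nat \<Rightarrow> complex" where
  "nal i j = (if tA then 2 else if j = fl i then 4 else if i = fl i \<or> j = fl j then 1 else 2)"

definition Hc :: "nat \<Rightarrow> nat \<Rightarrow> cmat" where "Hc i j = (2 / nal i j) *\<^sub>m Kr i j"

text \<open>Scaled so that \<open>Xr i j\<close>, \<open>Hc i j\<close>, \<open>Yr i j\<close> form
  a standard \<open>sl\<^sub>2\<close>-triple. The extra \<open>2\<close> belongs to the long roots
  of type C, where both root vectors are twice a matrix unit and their bracket is
  \<open>2 *\<^sub>m Kr i j\<close>.\<close>

definition Yr :: "nat \<Rightarrow> nat \<Rightarrow> cmat" where
  "Yr i j = (2 / ((if \<not> tA \<and> j = fl i then 2 else 1) * nal i j)) *\<^sub>m Xr j i"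

lemma nal_nz [simp]: "nal i j \<noteq> 0" by (simp add: nal_def)

lemma al_Kr: "i < N \<Longrightarrow> j < N \<Longrightarrow> i \<noteq> j \<Longrightarrow> al i j (Kr i j) = nal i j"
proof -
  assume ij: "i < N" "j < N" "i \<noteq> j"
  then have "i = fl j \<longleftrightarrow> j = fl i" by (intro fl_swap')
  with ij show ?thesis using fl_fix[of i j]
    by (cases "j = fl i"; cases "i = fl i"; cases "j = fl j") (auto simp: al_def Kr_def nal_def Em_def cmat_apply)
qed

lemma al_Hc: "i < N \<Longrightarrow> j < N \<Longrightarrow> i \<noteq> j \<Longrightarrow> al i j (Hc i j) = 2"
  by (simp add: Hc_def al_linear al_Kr)

lemma Kr_diag: "i < N \<Longrightarrow> j < N \<Longrightarrow> is_diag (Kr i j)"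
proof -
  assume "i < N" "j < N"
  then have "is_mat N (Kr i j)" by (auto simp: Kr_def intro!: is_mat_intros Em_is_mat)
  then show ?thesis by (auto simp: is_diag_def Kr_def Em_def cmat_apply)
qed

lemma Kr_cartan:
  assumes "i < N" "j < N"
  shows "Kr i j \<in> \<hh>"
proof (cases tA)
  case True
  then show ?thesis using assms Kr_diag
    by (auto simp: cartan_A Kr_def Em_def cmat_apply sum_subtractf)
next
  case False
  have "Kr i j (fl a) (fl a) = - Kr i j a a" if "a < N" for a
  proof -
    have "fl a = i \<longleftrightarrow> a = fl i" "fl a = j \<longleftrightarrow> a = fl j" "fl a = fl i \<longleftrightarrow> a = i" "fl a = fl j \<longleftrightarrow> a = j"
      using that assms fl_swap'[of a i] fl_swap'[of a j] by (auto simp: fl_inj)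
    then show ?thesis using False by (simp add: Kr_def Em_def cmat_apply)
  qed
  then show ?thesis using False assms Kr_diag by (simp add: cartan_nA)
qed

lemma Hc_cartan: "i < N \<Longrightarrow> j < N \<Longrightarrow> Hc i j \<in> \<hh>"
  unfolding Hc_def by (intro cartan_smul Kr_cartan)

lemma Hc_entry_real: "Hc i j a a \<in> \<real>"
  by (auto simp: Hc_def Kr_def nal_def Em_def cmat_apply)

lemma cartan_Em: "H \<in> \<hh> \<Longrightarrow> i < N \<Longrightarrow> j < N \<Longrightarrow> H \<odot> Em i j = Em i j \<odot> H + al i j H *\<^sub>m Em i j"
proof (rule is_mat_eqI)
  fix a b assume *: "H \<in> \<hh>" "i < N" "j < N" "a < N" "b < N"
  then show "(H \<odot> Em i j) a b = (Em i j \<odot> H + al i j H *\<^sub>m Em i j) a b"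
    by (simp add: diag_mm mm_diag cartan_diag) (simp add: Em_def al_def)
qed (auto simp: is_mat_intros Em_is_mat)

lemma cartan_Xr: "H \<in> \<hh> \<Longrightarrow> i < N \<Longrightarrow> j < N \<Longrightarrow> H \<odot> Xr i j = Xr i j \<odot> H + al i j H *\<^sub>m Xr i j"
proof (cases tA)
  case True
  then show "H \<in> \<hh> \<Longrightarrow> i < N \<Longrightarrow> j < N \<Longrightarrow> ?thesis" by (simp add: Xr_def cartan_Em)
next
  case False
  assume *: "H \<in> \<hh>" "i < N" "j < N"
  then have "al (fl j) (fl i) H = al i j H" using False by (simp add: al_def cartan_nA)
  then show ?thesis using False * cartan_Em[of H i j] cartan_Em[of H "fl j" "fl i"]
    by (simp add: Xr_def mm_linear smul_simps) (simp add: fun_eq_iff cmat_apply algebra_simps)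
qed

lemma al_swap: "al j i H = - al i j H" by (simp add: al_def)

lemma Xr_brk:
  assumes "rvalid i j"
  shows "Xr i j \<odot> Xr j i = Xr j i \<odot> Xr i j + (if \<not> tA \<and> j = fl i then 2 else 1) *\<^sub>m Kr i j"
proof (cases tA)
  case True
  then show ?thesis using assms by (auto simp: rvalid_def Xr_def Em_mm Kr_def smul_simps)
next
  case False
  have ij: "i < N" "j < N" "i \<noteq> j" using assms by (auto simp: rvalid_def)
  show ?thesis
  proof (cases "j = fl i")
    case True
    then have "tC" using assms False t_cases by (auto simp: rvalid_def)
    then have X: "Xr i j = 2 *\<^sub>m Em i (fl i)" "Xr j i = 2 *\<^sub>m Em (fl i) i"
      using True ij False by (simp_all add: Xr_def sg_C fun_eq_iff cmat_apply)
    show ?thesis unfolding X using True ij False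
      by (simp add: Kr_def mm_linear Em_mm smul_simps) (simp add: fun_eq_iff cmat_apply)
  next
    case F: False
    then have fij: "fl j \<noteq> i" "fl i \<noteq> j" using ij fl_swap'[of i j] by auto
    define e where "e = sg i * sg j"
    have e: "e * e = 1" by (simp add: e_def mult_ac)
    have X: "Xr i j = Em i j - e *\<^sub>m Em (fl j) (fl i)" "Xr j i = Em j i - e *\<^sub>m Em (fl i) (fl j)"
      using False by (simp_all add: Xr_def e_def mult.commute)
    show ?thesis unfolding X using False F ij fij
      by (simp add: Kr_def mm_linear Em_mm smul_simps fl_inj e)
  qed
qed

lemma Yr_cube: "i < N \<Longrightarrow> j < N \<Longrightarrow> i \<noteq> j \<Longrightarrow> Yr i j \<odot> (Yr i j \<odot> Yr i j) = 0"
  by (simp add: Yr_def mm_linear Xr_cube smul_simps)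

lemma XY_brk: "rvalid i j \<Longrightarrow> Xr i j \<odot> Yr i j = Yr i j \<odot> Xr i j + Hc i j"
  by (simp add: Yr_def Hc_def mm_linear Xr_brk smul_simps)

lemma Yr_lie: "i < N \<Longrightarrow> j < N \<Longrightarrow> i \<noteq> j \<Longrightarrow> Yr i j \<in> \<gg>"
  unfolding Yr_def by (intro lie_smul Xr_lie) auto

lemma cartan_Yr: "H \<in> \<hh> \<Longrightarrow> i < N \<Longrightarrow> j < N \<Longrightarrow> H \<odot> Yr i j = Yr i j \<odot> H - al i j H *\<^sub>m Yr i j"
  by (simp add: Yr_def mm_linear cartan_Xr al_swap[of j i] smul_simps)
   (simp add: fun_eq_iff cmat_apply algebra_simps)

text \<open>The reflection acts on the Cartan subalgebra rather than on its dual. Functionals are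
  moved by composition with it.\<close>

definition refl :: "nat \<Rightarrow> nat \<Rightarrow> cmat \<Rightarrow> cmat" where
  "refl i j H = H - al i j H *\<^sub>m Hc i j"

definition uu :: "nat \<Rightarrow> nat \<Rightarrow> complex \<Rightarrow> cmat" where
  "uu i j s = ex (s *\<^sub>m Xr i j)"

text \<open>The parameter \<open>a\<close> is chosen before \<open>H\<close>, so that one group
  element realises the reflection on the whole Cartan subalgebra and hence normalises it.\<close>

lemma refl_conj:
  assumes "rvalid i j"
  shows "\<exists>a. \<forall>H\<in>\<hh>. uu i j 1 \<odot> uu j i a \<odot> uu i j 1 \<odot> H = refl i j H \<odot> (uu i j 1 \<odot> uu j i a \<odot> uu i j 1)"
proof -
  have ij: "i < N" "j < N" "i \<noteq> j" using assms by (auto simp: rvalid_def)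
  have Y: "ex (- Yr i j) = uu j i (- (2 / ((if \<not> tA \<and> j = fl i then 2 else 1) * nal i j)))"
    by (simp add: uu_def Yr_def smul_simps)
  have X: "ex (Xr i j) = uu i j 1" by (simp add: uu_def smul_simps)
  have "ex (Xr i j) \<odot> ex (- Yr i j) \<odot> ex (Xr i j) \<odot> H =
      (H - al i j H *\<^sub>m Hc i j) \<odot> (ex (Xr i j) \<odot> ex (- Yr i j) \<odot> ex (Xr i j))" if "H \<in> \<hh>" for H
  proof (rule sl2_reflection)
    show "Hc i j \<odot> Xr i j = Xr i j \<odot> Hc i j + 2 *\<^sub>m Xr i j"
      using cartan_Xr[OF Hc_cartan, of i j i j] ij by (simp add: al_Hc)
    show "Hc i j \<odot> Yr i j = Yr i j \<odot> Hc i j - 2 *\<^sub>m Yr i j"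
      using cartan_Yr[OF Hc_cartan, of i j i j] ij by (simp add: al_Hc)
  qed (use assms ij that in \<open>auto simp: Xr_cube Yr_cube XY_brk cartan_Xr cartan_Yr
        intro: lie_is_mat Xr_lie Yr_lie cartan_lie Hc_cartan\<close>)
  then show ?thesis unfolding X Y refl_def by blast
qed

lemma refl_cartan: "i < N \<Longrightarrow> j < N \<Longrightarrow> H \<in> \<hh> \<Longrightarrow> refl i j H \<in> \<hh>"
  unfolding refl_def by (intro cartan_diff cartan_smul Hc_cartan)

lemma refl_refl: "i < N \<Longrightarrow> j < N \<Longrightarrow> i \<noteq> j \<Longrightarrow> refl i j (refl i j H) = H"
  by (simp add: refl_def al_linear al_Hc smul_simps)

lemma refl_linear: "refl i j (A + B) = refl i j A + refl i j B" "refl i j (c *\<^sub>m A) = c *\<^sub>m refl i j A"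
  by (auto simp: refl_def al_linear smul_simps)

subsection \<open>The group\<close>

lemma grp_iff: "g \<in> GG \<longleftrightarrow> is_mat N g \<and> mdet N g = 1 \<and> (\<not> tA \<longrightarrow> mT g \<odot> J \<odot> g = J)"
  by (simp add: grp_def tA_def N_eq)

lemma grp_is_mat: "g \<in> GG \<Longrightarrow> is_mat N g" and grp_det: "g \<in> GG \<Longrightarrow> mdet N g = 1"
  by (auto simp: grp_def N_eq)

lemma grp_J: "g \<in> GG \<Longrightarrow> \<not> tA \<Longrightarrow> mT g \<odot> (J \<odot> g) = J"
  using mm_assoc by (auto simp: grp_def tA_def N_eq)

lemma grp_mm: "g \<in> GG \<Longrightarrow> g' \<in> GG \<Longrightarrow> g \<odot> g' \<in> GG"
proof -
  assume g: "g \<in> GG" "g' \<in> GG"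
  have "mT (g \<odot> g') \<odot> J \<odot> (g \<odot> g') = J" if "\<not> tA"
  proof -
    have "mT (g \<odot> g') \<odot> J \<odot> (g \<odot> g') = mT g' \<odot> (mT g \<odot> (J \<odot> g)) \<odot> g'"
      by (simp add: mT_mm mm_assoc)
    then show ?thesis using g that by (simp add: grp_J mm_assoc)
  qed
  then show ?thesis using g mdet_mm by (auto simp: grp_iff)
qed

lemma grp_idm: "I\<^sub>m \<in> GG"
  by (simp add: grp_iff J_is_mat)

lemma ex_J:
  assumes X: "X \<in> \<gg>" "X \<odot> (X \<odot> X) = 0" and t: "\<not> tA"
  shows "mT (ex X) \<odot> J \<odot> ex X = J"
proof -
  have Xm: "is_mat N X" using X lie_is_mat by simp
  have XJ: "mT X \<odot> J = - (J \<odot> X)" using X t by (simp add: lie_alg_J add_eq_0_iff2)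
  have XJZ: "mT X \<odot> (J \<odot> Z) = - (J \<odot> (X \<odot> Z))" for Z
    by (simp add: XJ mm_linear flip: mm_assoc)
  have "mT (ex X) \<odot> J = J \<odot> ex (- X)"
    using J_is_mat by (simp add: ex_def mT_linear mT_mm mm_linear mm_assoc XJ XJZ)
  moreover have "ex (- X) \<odot> ex X = I\<^sub>m" using ex_inverse[of "- X"] X Xm by (simp add: is_mat_intros mm_linear)
  ultimately show ?thesis by (simp add: mm_assoc J_is_mat)
qed

lemma uu_grp:
  assumes "i < N" "j < N" "i \<noteq> j"
  shows "uu i j s \<in> GG"
proof -
  have "s *\<^sub>m Xr i j \<in> \<gg>" "is_mat N (s *\<^sub>m Xr i j)"
    "(s *\<^sub>m Xr i j) \<odot> ((s *\<^sub>m Xr i j) \<odot> (s *\<^sub>m Xr i j)) = 0"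
    using assms by (auto simp: lie_smul Xr_lie is_mat_intros Xr_is_mat mm_linear Xr_cube smul_simps)
  then show ?thesis unfolding uu_def grp_iff using ex_J by (simp add: ex_is_mat ex_det)
qed

lemma uu_inverse: "i < N \<Longrightarrow> j < N \<Longrightarrow> i \<noteq> j \<Longrightarrow> uu i j s \<odot> uu i j (- s) = I\<^sub>m"
  using ex_inverse[of "s *\<^sub>m Xr i j"]
  by (simp add: uu_def smul_simps is_mat_intros Xr_is_mat mm_linear Xr_cube)

lemma uu_inverse': "i < N \<Longrightarrow> j < N \<Longrightarrow> i \<noteq> j \<Longrightarrow> uu i j (- s) \<odot> uu i j s = I\<^sub>m"
  using uu_inverse[of i j "- s"] by simp

definition Ad :: "nat \<Rightarrow> nat \<Rightarrow> complex \<Rightarrow> cmat \<Rightarrow> cmat" where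
  "Ad i j s L = uu i j s \<odot> L \<odot> uu i j (- s)"

lemma Ad_linear: "Ad i j s (A + B) = Ad i j s A + Ad i j s B" "Ad i j s (c *\<^sub>m A) = c *\<^sub>m Ad i j s A"
  by (simp_all add: Ad_def mm_linear)

lemma Ad_lie:
  assumes "i < N" "j < N" "i \<noteq> j" "L \<in> \<gg>"
  shows "Ad i j s L \<in> \<gg>"
proof (cases tA)
  case True
  have "mtr (uu i j s \<odot> L \<odot> uu i j (- s)) = mtr (uu i j (- s) \<odot> uu i j s \<odot> L)"
    using mtr_mm_commute[of "uu i j s \<odot> L" "uu i j (- s)"] by (simp add: mm_assoc)
  then show ?thesis using True assms by (simp add: lie_alg_A Ad_def uu_inverse')
next
  case False
  let ?u = "uu i j s" and ?v = "uu i j (- s)"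
  have u: "?u \<in> GG" "?v \<in> GG" "?u \<odot> ?v = I\<^sub>m" "?v \<odot> ?u = I\<^sub>m" using assms by (auto simp: uu_grp uu_inverse uu_inverse')
  have um: "is_mat N ?u" "is_mat N ?v" using u grp_is_mat by auto
  have uJ: "mT w \<odot> J = J \<odot> w'" if "w \<in> GG" "w \<odot> w' = I\<^sub>m" "is_mat N w'" for w w'
  proof -
    have "mT w \<odot> J = mT w \<odot> (J \<odot> w) \<odot> w'" using that by (simp add: mm_assoc J_is_mat)
    then show ?thesis using that False by (simp add: grp_J)
  qed
  have L: "mT L \<odot> J = - (J \<odot> L)" using assms False by (simp add: lie_alg_J add_eq_0_iff2)
  have "mT (?u \<odot> L \<odot> ?v) \<odot> J = mT ?v \<odot> (mT L \<odot> (mT ?u \<odot> J))" by (simp add: mT_mm mm_assoc)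
  also have "\<dots> = mT ?v \<odot> (mT L \<odot> J \<odot> ?v)" using u um by (simp add: uJ mm_assoc)
  also have "\<dots> = - (mT ?v \<odot> J \<odot> (L \<odot> ?v))" by (simp add: L mm_linear mm_assoc)
  also have "\<dots> = - (J \<odot> (?u \<odot> L \<odot> ?v))" using u um by (simp add: uJ mm_assoc)
  finally show ?thesis using False by (simp add: lie_alg_J Ad_def)
qed

lemma Ad_Ad: "i < N \<Longrightarrow> j < N \<Longrightarrow> i \<noteq> j \<Longrightarrow> is_mat N L \<Longrightarrow> Ad i j s (Ad i j (- s) L) = L"
proof -
  assume *: "i < N" "j < N" "i \<noteq> j" "is_mat N L"
  have "Ad i j s (Ad i j (- s) L) = (uu i j s \<odot> uu i j (- s)) \<odot> L \<odot> (uu i j s \<odot> uu i j (- s))"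
    by (simp add: Ad_def mm_assoc)
  then show ?thesis using * by (simp add: uu_inverse)
qed

lemma Ad_deriv:
  assumes "i < N" "j < N" "i \<noteq> j"
  shows "((\<lambda>s. Ad i j s L k l) has_field_derivative (Xr i j \<odot> Ad i j a L - Ad i j a L \<odot> Xr i j) k l) (at a)"
  using ex_curve_deriv[OF Xr_is_mat[OF assms(1,2)] Xr_cube[OF assms], where L=L and i=k and j=l and a=a]
  by (simp add: Ad_def uu_def smul_simps)

lemma Ad_zero: "is_mat N L \<Longrightarrow> Ad i j 0 L = L"
  by (simp add: Ad_def uu_def smul_simps ex_def mm_linear)

end

section \<open>Density of the diagonalisable elements\<close>

context lie
begin

text \<open>Only root subgroups are used for the conjugations: along them an element moves on a
  curve that is polynomial in \<open>s\<close>, with a known velocity.\<close>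

inductive_set Orb :: "cmat set" where
  Orb_base: "H \<in> \<hh> \<Longrightarrow> H \<in> Orb"
| Orb_step: "M \<in> Orb \<Longrightarrow> i < N \<Longrightarrow> j < N \<Longrightarrow> i \<noteq> j \<Longrightarrow> Ad i j s M \<in> Orb"

lemma Orb_lie: "M \<in> Orb \<Longrightarrow> M \<in> \<gg>"
  by (induction rule: Orb.induct) (auto simp: cartan_lie Ad_lie)

lemma conj_Ad:
  assumes g: "g \<in> GG" "H \<in> \<hh>" "g \<odot> M = H \<odot> g" and ij: "i < N" "j < N" "i \<noteq> j" and M: "is_mat N M"
  shows "g \<odot> uu i j (- s) \<in> GG" "g \<odot> uu i j (- s) \<odot> Ad i j s M = H \<odot> (g \<odot> uu i j (- s))"
proof -
  show "g \<odot> uu i j (- s) \<in> GG" by (rule grp_mm[OF g(1) uu_grp[OF ij]])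
  have "g \<odot> uu i j (- s) \<odot> Ad i j s M = g \<odot> (uu i j (- s) \<odot> uu i j s) \<odot> M \<odot> uu i j (- s)"
    by (simp add: Ad_def mm_assoc)
  also have "\<dots> = g \<odot> M \<odot> uu i j (- s)"
    using ij M g grp_is_mat by (simp add: uu_inverse')
  also have "\<dots> = H \<odot> (g \<odot> uu i j (- s))" using g by (simp add: mm_assoc)
  finally show "g \<odot> uu i j (- s) \<odot> Ad i j s M = H \<odot> (g \<odot> uu i j (- s))" .
qed

lemma Orb_conj: "M \<in> Orb \<Longrightarrow> \<exists>g\<in>GG. \<exists>H\<in>\<hh>. g \<odot> M = H \<odot> g"
proof (induction rule: Orb.induct)
  case (Orb_base H)
  then show ?case using grp_idm cartan_lie lie_is_mat by (intro bexI[of _ "I\<^sub>m"] bexI[of _ H]) auto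
next
  case (Orb_step M i j s)
  then obtain g H where gH: "g \<in> GG" "H \<in> \<hh>" "g \<odot> M = H \<odot> g" by blast
  have "is_mat N M" using Orb_step Orb_lie lie_is_mat by blast
  from conj_Ad[OF gH Orb_step(2-4) this] show ?case using gH(2) by blast
qed

lemma Ad_entry_polyf: "(\<lambda>L. Ad i j s L k l) \<in> polyf entries"
  unfolding Ad_def by (intro mm_entry_polyf entry_polyf polyf_const)

lemma Ad_curve_polyf: "(\<lambda>s. Ad i j s L k l) \<in> polyf {\<lambda>s. s}"
proof -
  have "(\<lambda>s. ex ((- s) *\<^sub>m X) k l) \<in> polyf {\<lambda>s. s}" for X k l
  proof (rule polyf_comp[OF ex_entry_polyf, where \<psi>="\<lambda>s. - s"])
    fix g :: "complex \<Rightarrow> complex" assume "g \<in> {\<lambda>s. s}"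
    then show "(\<lambda>x. g (- x)) \<in> polyf {\<lambda>s. s}"
      using polyf_uminus[OF polyf_gen[of "\<lambda>s. s" "{\<lambda>s. s}"]] by simp
  qed
  then show ?thesis unfolding Ad_def uu_def by (intro mm_entry_polyf polyf_const ex_entry_polyf)
qed

lemma polyf_Ad: "f \<in> polyf entries \<Longrightarrow> (\<lambda>L. f (Ad i j s L)) \<in> polyf entries"
  by (erule polyf_comp) (auto intro: Ad_entry_polyf)

lemma polyf_line: "f \<in> polyf entries \<Longrightarrow> \<exists>p. \<forall>s. f (A + s *\<^sub>m B) = poly p s"
proof (erule polyf_curve_poly)
  fix g assume "g \<in> entries"
  then obtain k l where g: "g = (\<lambda>A. A k l)" by auto
  have "(\<lambda>s. A k l + s * B k l) \<in> polyf {\<lambda>s. s}"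
    by (intro polyf_add polyf_mult polyf_const polyf_gen) simp
  then show "(\<lambda>s. g (A + s *\<^sub>m B)) \<in> polyf {\<lambda>s. s}" by (simp add: g)
qed

lemma polyf_Ad_curve: "f \<in> polyf entries \<Longrightarrow> \<exists>p. \<forall>s. f (Ad i j s L) = poly p s"
  by (erule polyf_curve_poly) (auto intro!: Ad_curve_polyf)

lemma finite_entries: "finite entries" by simp

text \<open>If \<open>D\<close> is the gradient of \<open>f\<close>, this is the derivative of
  \<open>f\<close> at \<open>M\<close> in the direction \<open>V\<close>. The generators are the
  matrix entries, so \<open>g V\<close> is a component of \<open>V\<close>.\<close>

definition dirD :: "((cmat \<Rightarrow> complex) \<Rightarrow> cmat \<Rightarrow> complex) \<Rightarrow> cmat \<Rightarrow> cmat \<Rightarrow> complex" where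
  "dirD D V M = (\<Sum>g\<in>entries. g V * D g M)"

lemma dirD_linear: "dirD D (A + B) M = dirD D A M + dirD D B M" "dirD D (c *\<^sub>m A) M = c * dirD D A M"
proof -
  have "g (A + B) = g A + g B" "g (c *\<^sub>m A) = c * g A" if "g \<in> entries" for g
    using that by auto
  then have "dirD D (A + B) M = (\<Sum>g\<in>entries. (g A + g B) * D g M)"
      "dirD D (c *\<^sub>m A) M = (\<Sum>g\<in>entries. c * g A * D g M)"
    unfolding dirD_def by (auto intro!: sum.cong)
  then show "dirD D (A + B) M = dirD D A M + dirD D B M" "dirD D (c *\<^sub>m A) M = c * dirD D A M"
    by (simp_all only: dirD_def distrib_right sum.distrib sum_distrib_left mult.assoc)
qed

lemma dirD_zero: "dirD D 0 M = 0"
  using dirD_linear(2)[of D 0 0 M] by (simp add: smul_simps)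

lemma dirD_sum: "dirD D (\<Sum>k\<in>K. A k) M = (\<Sum>k\<in>K. dirD D (A k) M)"
  by (induction K rule: infinite_finite_induct)
    (simp_all only: sum.infinite sum.empty sum.insert dirD_zero dirD_linear not_False_eq_True)

lemma dirD_polyf: "is_gradient entries f D \<Longrightarrow> dirD D V \<in> polyf entries"
proof -
  assume D: "is_gradient entries f D"
  have "(\<lambda>M. \<Sum>g\<in>entries. g V * D g M) \<in> polyf entries"
    by (rule polyf_sum, rule polyf_cmult, rule is_gradient_polyf[OF D])
  then show ?thesis unfolding dirD_def[abs_def] .
qed

lemma dirD_deriv:
  assumes "is_gradient entries f D"
    "\<And>i j. i < N \<Longrightarrow> j < N \<Longrightarrow> ((\<lambda>s. c s i j) has_field_derivative V i j) (at a)"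
  shows "((\<lambda>s. f (c s)) has_field_derivative dirD D V (c a)) (at a)"
  unfolding dirD_def by (rule is_gradient_deriv[OF assms(1)]) (use assms(2) in auto)

lemma dirD_line:
  assumes "is_gradient entries f D"
  shows "((\<lambda>s. f (M + s *\<^sub>m V)) has_field_derivative dirD D V (M + a *\<^sub>m V)) (at a)"
  by (rule dirD_deriv[OF assms]) (auto intro!: derivative_eq_intros)

lemma add_zero_smul: "M + 0 *\<^sub>m V = M"
  by (simp add: smul_simps)

lemma dirD_line0:
  "is_gradient entries f D \<Longrightarrow> ((\<lambda>s. f (M + s *\<^sub>m V)) has_field_derivative dirD D V M) (at 0)"
  using dirD_line[of f D M V 0] by (simp only: add_zero_smul)

text \<open>The lines inside the Cartan subalgebra and the curves \<open>Ad i j s H\<close> stay in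
  \<open>Orb\<close>, where \<open>f\<close> vanishes. Their velocities are the Cartan directions
  and, off the root hyperplanes, multiples of the root vectors; together these span the Lie
  algebra.\<close>

lemma dirD_cartan_zero:
  assumes D: "is_gradient entries f D" and f: "\<And>M. M \<in> Orb \<Longrightarrow> f M = 0"
    and H: "H \<in> \<hh>" and V: "V \<in> \<gg>"
  shows "dirD D V H = 0"
proof -
  have unique: "d = 0" if "((\<lambda>s. 0) has_field_derivative d) (at (0::complex))" for d :: complex
    using DERIV_unique[OF that DERIV_const] .
  have h: "dirD D A H = 0" if A: "A \<in> \<hh>" for A
  proof -
    have "(\<lambda>s. f (H + s *\<^sub>m A)) = (\<lambda>s. 0)"
      using f H A by (intro ext f Orb_base cartan_add cartan_smul)
    then show ?thesis using dirD_line0[OF D, of H A] unique by (simp only:)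
  qed
  have X: "dirD D (Xr i j) H = 0" if ij: "i < N" "j < N" "i \<noteq> j" for i j
  proof -
    have *: "dirD D (Xr i j) K = 0" if K: "K \<in> \<hh>" "al i j K \<noteq> 0" for K
    proof -
      have Km: "is_mat N K" using K cartan_lie lie_is_mat by blast
      have "(\<lambda>s. f (Ad i j s K)) = (\<lambda>s. 0)"
        using f K(1) ij by (intro ext f Orb_step Orb_base)
      moreover have "((\<lambda>s. f (Ad i j s K)) has_field_derivative
          dirD D (Xr i j \<odot> Ad i j 0 K - Ad i j 0 K \<odot> Xr i j) (Ad i j 0 K)) (at 0)"
        by (rule dirD_deriv[OF D]) (rule Ad_deriv[OF ij])
      moreover have "Xr i j \<odot> K - K \<odot> Xr i j = (- al i j K) *\<^sub>m Xr i j"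
        using cartan_Xr[OF K(1) ij(1,2)] by (simp add: smul_simps)
      ultimately have "dirD D ((- al i j K) *\<^sub>m Xr i j) K = 0" using unique by (simp only: Ad_zero[OF Km])
      then show ?thesis using K by (simp add: dirD_linear)
    qed
    \<comment> \<open>If \<open>al i j H = 0\<close>, the curve through \<open>H\<close> has
      velocity zero. Along \<open>H + s *\<^sub>m Hc i j\<close> the root grows by
      \<open>2 * s\<close>, so the derivative, a polynomial in \<open>s\<close>, vanishes for all
      \<open>s\<close> but one and therefore also at \<open>s = 0\<close>.\<close>
    obtain p where p: "\<And>s. dirD D (Xr i j) (H + s *\<^sub>m Hc i j) = poly p s"
      using polyf_line[OF dirD_polyf[OF D]] by blast
    have "p = 0"
    proof (rule poly_eq_cofinite)
      fix s assume s: "s \<notin> {- al i j H / 2}"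
      have "al i j (H + s *\<^sub>m Hc i j) \<noteq> 0"
      proof
        assume "al i j (H + s *\<^sub>m Hc i j) = 0"
        then have "al i j H + s * 2 = 0" using ij by (simp add: al_linear al_Hc)
        then show False using s by (simp add: field_simps eq_neg_iff_add_eq_0 add.commute)
      qed
      moreover have "H + s *\<^sub>m Hc i j \<in> \<hh>" using H ij by (intro cartan_add cartan_smul Hc_cartan)
      ultimately show "poly p s = poly 0 s" using * p by (metis poly_0)
    qed simp
    then show ?thesis using p[of 0] by (simp add: smul_simps)
  qed
  obtain A c where "A \<in> \<hh>" "V = A + (\<Sum>i<N. \<Sum>j\<in>{..<N}-{i}. c i j *\<^sub>m Xr i j)"
    using lie_decomp[OF V] by auto
  then show ?thesis by (simp add: dirD_linear dirD_sum h X)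
qed

text \<open>A step of \<open>Orb\<close> is undone by replacing \<open>f\<close> with its
  composition with \<open>Ad i j s\<close>, again a polynomial that vanishes on \<open>Orb\<close>,
  and the direction \<open>V\<close> with \<open>Ad i j (- s) V\<close>. This is why the induction
  generalises over \<open>f\<close> and \<open>V\<close>.\<close>

lemma Orb_deriv_zero:
  assumes "M \<in> Orb" "f \<in> polyf entries" "\<And>M. M \<in> Orb \<Longrightarrow> f M = 0" "V \<in> \<gg>"
  shows "((\<lambda>s. f (M + s *\<^sub>m V)) has_field_derivative 0) (at 0)"
  using assms
proof (induction arbitrary: f V rule: Orb.induct)
  case (Orb_base H)
  obtain D where D: "is_gradient entries f D" using polyf_gradient[OF finite_entries Orb_base(2)] by blast
  have "dirD D V H = 0" using dirD_cartan_zero[OF D] Orb_base by blast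
  then show ?case using dirD_line0[OF D, of H V] by (simp only:)
next
  case (Orb_step M i j s)
  have "((\<lambda>\<sigma>. f (Ad i j s (M + \<sigma> *\<^sub>m Ad i j (- s) V))) has_field_derivative 0) (at 0)"
    using Orb_step by (intro Orb_step.IH polyf_Ad Ad_lie) (auto intro: Orb.Orb_step)
  moreover have "Ad i j s (M + \<sigma> *\<^sub>m Ad i j (- s) V) = Ad i j s M + \<sigma> *\<^sub>m V" for \<sigma>
    using Orb_step lie_is_mat by (simp add: Ad_linear Ad_Ad)
  ultimately show ?case by (simp only:)
qed

text \<open>The ideal of polynomials vanishing on \<open>Orb\<close> is closed under derivatives in all
  directions of \<open>\<gg>\<close>, so such a polynomial has vanishing Taylor expansion at \<open>0\<close>.\<close>
theorem density:
  assumes "f \<in> polyf entries" "\<And>M. M \<in> Orb \<Longrightarrow> f M = 0" "V \<in> \<gg>"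
  shows "f V = 0"
proof -
  have main: "p = 0" if "f \<in> polyf entries" "\<And>M. M \<in> Orb \<Longrightarrow> f M = 0" "\<And>s. f (s *\<^sub>m V) = poly p s" for p f
    using that
  proof (induction "degree p" arbitrary: p f rule: less_induct)
    case less
    obtain D where D: "is_gradient entries f D" using polyf_gradient[OF finite_entries less(2)] by blast
    have 1: "dirD D V M = 0" if "M \<in> Orb" for M
    proof -
      from DERIV_unique[OF dirD_line0[OF D] Orb_deriv_zero[OF that less(2,3) assms(3)]] show ?thesis by simp
    qed
    have 2: "dirD D V (s *\<^sub>m V) = poly (pderiv p) s" for s
    proof -
      have "((\<lambda>s. poly p s) has_field_derivative dirD D V (s *\<^sub>m V)) (at s)"
        using dirD_line[OF D, of 0 V s] by (simp only: add_0 less(4))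
      from DERIV_unique[OF this poly_DERIV] show ?thesis .
    qed
    have "poly p 0 = 0" using less(3)[of 0] less(4)[of 0] by (simp add: smul_simps Orb_base cartan_zero)
    have "degree p = 0"
    proof (rule ccontr)
      assume "degree p \<noteq> 0"
      then have "degree (pderiv p) < degree p" by (simp add: degree_pderiv)
      from less(1)[OF this dirD_polyf[OF D] 1 2] have "pderiv p = 0" by blast
      with \<open>degree p \<noteq> 0\<close> show False by (simp add: pderiv_eq_0_iff)
    qed
    then obtain c where "p = [:c:]" by (rule degree_eq_zeroE)
    with \<open>poly p 0 = 0\<close> show ?case by simp
  qed
  obtain p where p: "\<forall>s. f (0 + s *\<^sub>m V) = poly p s" using polyf_line[OF assms(1)] by blast
  then have "\<And>s. f (s *\<^sub>m V) = poly p s" by (simp only: add_0)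
  from main[OF assms(1,2) this] have "p = 0" by simp
  then show ?thesis using p[rule_format, of 1] by (simp add: smul_simps)
qed

corollary density_eq:
  assumes "f \<in> polyf entries" "g \<in> polyf entries" "\<And>M. M \<in> Orb \<Longrightarrow> f M = g M" "V \<in> \<gg>"
  shows "f V = g V"
  using density[OF polyf_diff[OF assms(1,2)]] assms(3,4) by simp

end

section \<open>The Pfaffian\<close>

context mats
begin

text \<open>Up to sign, a polarised and unnormalised Pfaffian: for equal antisymmetric slots it is
  \<open>2 ^ m * fact m\<close> times the Pfaffian. The pairing of \<open>i\<close> with
  \<open>N - 1 - i\<close> fits the antidiagonal form, and separate slots allow changing one matrix
  at a time.\<close>

definition pfaff :: "nat \<Rightarrow> (nat \<Rightarrow> cmat) \<Rightarrow> complex" where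
  "pfaff m A = (\<Sum>p | p permutes {..<N}. of_int (sign p) * (\<Prod>i<m. A i (p i) (p (N - 1 - i))))"

lemma prod_split_reflect:
  assumes "N = 2 * m"
  shows "(\<Prod>j<N. h j) = (\<Prod>i<m. h i * (h (N - 1 - i) :: complex))"
proof -
  have "(\<Prod>j<N. h j) = (\<Prod>j<m. h j) * (\<Prod>j\<in>{m..<N}. h j)"
    using prod.union_disjoint[of "{..<m}" "{m..<N}" h] assms
    by (simp add: ivl_disj_int ivl_disj_un)
  also have "(\<Prod>j\<in>{m..<N}. h j) = (\<Prod>i<m. h (N - 1 - i))"
    by (rule prod.reindex_bij_witness[of _ "\<lambda>i. N - 1 - i" "\<lambda>i. N - 1 - i"]) (use assms in auto)
  finally show ?thesis by (simp add: prod.distrib)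
qed

text \<open>As for \<open>mdet_mm\<close>: expanding all entries leaves, for each choice
  \<open>F\<close> of index pairs, a row-selected determinant of \<open>g\<close>. The remaining
  constant depends only on \<open>A\<close> and is read off from the identity in place of
  \<open>g\<close>.\<close>

lemma pfaff_congruence:
  assumes N: "N = 2 * m"
  shows "pfaff m (\<lambda>_. mT g \<odot> A \<odot> g) = mdet N g * pfaff m (\<lambda>_. A)"
proof -
  let ?P = "{..<N} \<times> {..<N}"
  let ?F = "{..<m} \<rightarrow>\<^sub>E ?P"
  \<comment> \<open>Slot \<open>i\<close> uses the rows \<open>fst (F i)\<close> and
    \<open>snd (F i)\<close> of \<open>g\<close> at the paired positions \<open>i\<close> and
    \<open>N - 1 - i\<close>; gluing them gives one selection of \<open>N\<close> rows.\<close>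
  define fF :: "(nat \<Rightarrow> nat \<times> nat) \<Rightarrow> nat \<Rightarrow> nat" where
    "fF F j = (if j < m then fst (F j) else snd (F (N - 1 - j)))" for F j
  have "\<forall>F\<in>?F. \<exists>e. \<forall>B. (\<Sum>p | p permutes {..<N}. of_int (sign p) * (\<Prod>i<N. B (fF F i) (p i))) = e * mdet N B"
  proof (intro ballI row_det)
    fix F assume F: "F \<in> ?F"
    then have FP: "F i \<in> ?P" if "i < m" for i using that by (auto simp: PiE_iff)
    show "fF F ` {..<N} \<subseteq> {..<N}"
    proof (intro image_subsetI)
      fix j assume "j \<in> {..<N}"
      then show "fF F j \<in> {..<N}"
        using FP[of j] FP[of "N - 1 - j"] N by (cases "j < m") (auto simp: fF_def mem_Times_iff)
    qed
  qed
  from bchoice[OF this] obtain e where e: "\<forall>F\<in>?F. \<forall>B.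
      (\<Sum>p | p permutes {..<N}. of_int (sign p) * (\<Prod>i<N. B (fF F i) (p i))) = e F * mdet N B" ..
  have *: "pfaff m (\<lambda>_. mT g \<odot> A \<odot> g) = mdet N g * (\<Sum>F\<in>?F. (\<Prod>i<m. A (fst (F i)) (snd (F i))) * e F)" for g
  proof -
    have entry: "(mT g \<odot> A \<odot> g) a b = (\<Sum>x\<in>?P. A (fst x) (snd x) * (g (fst x) a * g (snd x) b))"
      if "a < N" "b < N" for a b
    proof -
      have "(mT g \<odot> A \<odot> g) a b = (\<Sum>l<N. \<Sum>k<N. g k a * A k l * g l b)"
        using that by (simp add: mm_apply mT_def sum_distrib_right)
      also have "\<dots> = (\<Sum>k<N. \<Sum>l<N. A k l * (g k a * g l b))"
        by (subst sum.swap) (simp add: mult_ac)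
      finally show ?thesis by (simp add: sum.cartesian_product case_prod_unfold)
    qed
    have "pfaff m (\<lambda>_. mT g \<odot> A \<odot> g) = (\<Sum>p | p permutes {..<N}. of_int (sign p) *
       (\<Prod>i<m. \<Sum>x\<in>?P. A (fst x) (snd x) * (g (fst x) (p i) * g (snd x) (p (N - 1 - i)))))"
      unfolding pfaff_def
    proof (rule sum.cong[OF refl])
      fix p assume "p \<in> {p. p permutes {..<N}}"
      then have p: "p i < N" if "i < N" for i using that permutes_in_image[of p "{..<N}" i] by simp
      have "(\<Prod>i<m. (mT g \<odot> A \<odot> g) (p i) (p (N - 1 - i))) =
         (\<Prod>i<m. \<Sum>x\<in>?P. A (fst x) (snd x) * (g (fst x) (p i) * g (snd x) (p (N - 1 - i))))"
        by (rule prod.cong[OF refl], rule entry) (use p N in auto)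
      then show "of_int (sign p) * (\<Prod>i<m. (mT g \<odot> A \<odot> g) (p i) (p (N - 1 - i))) = of_int (sign p) *
       (\<Prod>i<m. \<Sum>x\<in>?P. A (fst x) (snd x) * (g (fst x) (p i) * g (snd x) (p (N - 1 - i))))" by simp
    qed
    also have "\<dots> = (\<Sum>p | p permutes {..<N}. \<Sum>F\<in>?F. of_int (sign p) *
       (\<Prod>i<m. A (fst (F i)) (snd (F i)) * (g (fst (F i)) (p i) * g (snd (F i)) (p (N - 1 - i)))))"
      by (subst prod_sum_PiE) (simp_all add: sum_distrib_left)
    also have "\<dots> = (\<Sum>F\<in>?F. \<Sum>p | p permutes {..<N}. of_int (sign p) *
       (\<Prod>i<m. A (fst (F i)) (snd (F i)) * (g (fst (F i)) (p i) * g (snd (F i)) (p (N - 1 - i)))))"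
      by (rule sum.swap)
    also have "\<dots> = (\<Sum>F\<in>?F. (\<Prod>i<m. A (fst (F i)) (snd (F i))) * (e F * mdet N g))"
    proof (rule sum.cong[OF refl])
      fix F assume F: "F \<in> ?F"
      have "(\<Prod>i<m. g (fst (F i)) (p i) * g (snd (F i)) (p (N - 1 - i))) = (\<Prod>j<N. g (fF F j) (p j))" for p
      proof -
        have "(\<Prod>j<N. g (fF F j) (p j)) = (\<Prod>i<m. g (fF F i) (p i) * g (fF F (N - 1 - i)) (p (N - 1 - i)))"
          by (rule prod_split_reflect[OF N])
        also have "\<dots> = (\<Prod>i<m. g (fst (F i)) (p i) * g (snd (F i)) (p (N - 1 - i)))"
          by (rule prod.cong) (use N in \<open>auto simp: fF_def\<close>)
        finally show ?thesis by simp
      qed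
      then have eq: "(\<Prod>i<m. A (fst (F i)) (snd (F i)) * (g (fst (F i)) (p i) * g (snd (F i)) (p (N - 1 - i)))) =
          (\<Prod>i<m. A (fst (F i)) (snd (F i))) * (\<Prod>j<N. g (fF F j) (p j))" for p
        by (simp only: prod.distrib[of "\<lambda>i. A (fst (F i)) (snd (F i))"])
      have "(\<Sum>p | p permutes {..<N}. of_int (sign p) *
          (\<Prod>i<m. A (fst (F i)) (snd (F i)) * (g (fst (F i)) (p i) * g (snd (F i)) (p (N - 1 - i))))) =
        (\<Prod>i<m. A (fst (F i)) (snd (F i))) *
          (\<Sum>p | p permutes {..<N}. of_int (sign p) * (\<Prod>j<N. g (fF F j) (p j)))"
        unfolding eq by (simp only: sum_distrib_left mult.left_commute)
      then show "(\<Sum>p | p permutes {..<N}. of_int (sign p) *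
          (\<Prod>i<m. A (fst (F i)) (snd (F i)) * (g (fst (F i)) (p i) * g (snd (F i)) (p (N - 1 - i))))) =
        (\<Prod>i<m. A (fst (F i)) (snd (F i))) * (e F * mdet N g)" using e F by simp
    qed
    finally show ?thesis by (simp add: sum_distrib_left mult_ac)
  qed
  have "pfaff m (\<lambda>_. mT I\<^sub>m \<odot> A \<odot> I\<^sub>m) = pfaff m (\<lambda>_. A)"
    unfolding pfaff_def
  proof (rule sum.cong[OF refl])
    fix p assume "p \<in> {p. p permutes {..<N}}"
    then have p: "p i < N" if "i < N" for i using that permutes_in_image[of p "{..<N}" i] by simp
    have "(mT I\<^sub>m \<odot> A \<odot> I\<^sub>m) a b = A a b" if "a < N" "b < N" for a b
    proof -
      have "\<forall>i j. i \<noteq> j \<longrightarrow> I\<^sub>m i j = 0" by (simp add: idm_def)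
      then have d: "is_diag I\<^sub>m" by (simp only: is_diag_def idm_is_mat simp_thms)
      show ?thesis using that by (simp add: mm_diag[OF d] diag_mm[OF d]) (simp add: idm_def)
    qed
    then have "(\<Prod>i<m. (mT I\<^sub>m \<odot> A \<odot> I\<^sub>m) (p i) (p (N - 1 - i))) = (\<Prod>i<m. A (p i) (p (N - 1 - i)))"
      by (intro prod.cong[OF refl]) (use p N in auto)
    then show "of_int (sign p) * (\<Prod>i<m. (mT I\<^sub>m \<odot> A \<odot> I\<^sub>m) (p i) (p (N - 1 - i))) =
      of_int (sign p) * (\<Prod>i<m. A (p i) (p (N - 1 - i)))" by simp
  qed
  with *[of g] *[of "I\<^sub>m"] show ?thesis by simp
qed

text \<open>Composing with the transposition of \<open>k\<close> and \<open>N - 1 - k\<close> swaps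
  the two arguments in slot \<open>k\<close>, leaves the other slots alone and reverses the
  sign.\<close>

lemma pfaff_transpose:
  assumes N: "N = 2 * m" and k: "k < m"
  shows "pfaff m (A(k := mT B)) = - pfaff m (A(k := B))"
proof -
  let ?t = "Transposition.transpose k (N - 1 - k)"
  have t: "?t permutes {..<N}" using N k by (intro permutes_swap_id) auto
  have "pfaff m (A(k := mT B)) = (\<Sum>p | p permutes {..<N}. of_int (sign (p \<circ> ?t)) *
      (\<Prod>i<m. (A(k := mT B)) i ((p \<circ> ?t) i) ((p \<circ> ?t) (N - 1 - i))))"
    unfolding pfaff_def by (rule sum_permutations_compose_right[OF t])
  also have "\<dots> = (\<Sum>p | p permutes {..<N}. - (of_int (sign p) * (\<Prod>i<m. (A(k := B)) i (p i) (p (N - 1 - i)))))"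
  proof (rule sum.cong[OF refl])
    fix p assume p: "p \<in> {p. p permutes {..<N}}"
    have "(\<Prod>i<m. (A(k := mT B)) i ((p \<circ> ?t) i) ((p \<circ> ?t) (N - 1 - i))) =
        (\<Prod>i<m. (A(k := B)) i (p i) (p (N - 1 - i)))"
    proof (rule prod.cong[OF refl])
      fix i assume i: "i \<in> {..<m}"
      show "(A(k := mT B)) i ((p \<circ> ?t) i) ((p \<circ> ?t) (N - 1 - i)) = (A(k := B)) i (p i) (p (N - 1 - i))"
      proof (cases "i = k")
        case True
        then show ?thesis by (simp add: mT_def)
      next
        case False
        then have "?t i = i" "?t (N - 1 - i) = N - 1 - i"
          using i k N by (auto simp: Transposition.transpose_def)
        then show ?thesis using False by simp
      qed
    qed
    moreover have "k \<noteq> N - 1 - k" using N k by auto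
    then have "sign (p \<circ> ?t) = - sign p"
      using p by (subst sign_compose) (auto simp: sign_swap_id intro: permutation_permutes[THEN iffD2] permutation_swap_id)
    ultimately show "of_int (sign (p \<circ> ?t)) *
      (\<Prod>i<m. (A(k := mT B)) i ((p \<circ> ?t) i) ((p \<circ> ?t) (N - 1 - i))) =
      - (of_int (sign p) * (\<Prod>i<m. (A(k := B)) i (p i) (p (N - 1 - i))))" by simp
  qed
  finally show ?thesis by (simp add: pfaff_def sum_negf)
qed

lemma pfaff_diff:
  assumes k: "k < m"
  shows "pfaff m (A(k := B - C)) = pfaff m (A(k := B)) - pfaff m (A(k := C))"
proof -
  have "(\<Prod>i<m. (A(k := D)) i (p i) (p (N - 1 - i))) =
     D (p k) (p (N - 1 - k)) * (\<Prod>i\<in>{..<m}-{k}. A i (p i) (p (N - 1 - i)))" for D p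
  proof -
    have "(\<Prod>i<m. (A(k := D)) i (p i) (p (N - 1 - i))) =
      (A(k := D)) k (p k) (p (N - 1 - k)) * (\<Prod>i\<in>{..<m}-{k}. (A(k := D)) i (p i) (p (N - 1 - i)))"
      using k by (intro prod.remove) auto
    also have "(\<Prod>i\<in>{..<m}-{k}. (A(k := D)) i (p i) (p (N - 1 - i))) = (\<Prod>i\<in>{..<m}-{k}. A i (p i) (p (N - 1 - i)))"
      by (rule prod.cong) auto
    finally show ?thesis by simp
  qed
  then show ?thesis
    unfolding pfaff_def by (simp only:) (simp add: cmat_apply algebra_simps sum_subtractf)
qed

text \<open>On the upper half \<open>p\<close> is the mirror image of its action \<open>q\<close> on
  the lower half, so \<open>p\<close> is \<open>q\<close> composed with a conjugate of
  \<open>q\<close> by the reversal \<open>r\<close>. Every sign occurs twice.\<close>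

lemma sign_doubled_permutation:
  assumes N: "N = 2 * m" and p: "p permutes {..<N}"
    and d: "\<And>i. i < m \<Longrightarrow> p i < m \<and> p (N - 1 - i) = N - 1 - p i"
  shows "sign p = 1"
proof -
  define r where "r k = (if k < N then N - 1 - k else k)" for k
  define q where "q k = (if k < m then p k else k)" for k
  have r: "r permutes {..<N}"
  proof (rule bij_imp_permutes)
    show "bij_betw r {..<N} {..<N}"
      by (rule bij_betwI[of _ _ _ r]) (auto simp: r_def)
  qed (auto simp: r_def)
  have "inj_on p {..<m}" using p permutes_inj inj_on_subset by blast
  moreover have "p ` {..<m} \<subseteq> {..<m}" using d by auto
  ultimately have "p ` {..<m} = {..<m}" by (intro endo_inj_surj) auto
  with \<open>inj_on p {..<m}\<close> have "bij_betw p {..<m} {..<m}" by (simp add: bij_betw_def)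
  then have "bij_betw q {..<m} {..<m}" by (rule bij_betw_cong[THEN iffD1, rotated]) (simp add: q_def)
  then have "q permutes {..<m}" by (rule bij_imp_permutes) (simp add: q_def)
  then have q: "q permutes {..<N}" by (rule permutes_subset) (use N in auto)
  have "p k = (q \<circ> (r \<circ> q \<circ> r)) k" for k
  proof -
    consider "k < m" | "m \<le> k" "k < N" | "N \<le> k" using N by linarith
    then show ?thesis
    proof cases
      case 1
      then show ?thesis using N d[of k] by (auto simp: q_def r_def)
    next
      case 2
      then have k: "N - 1 - k < m" "N - 1 - (N - 1 - k) = k" using N by auto
      then have pk: "p (N - 1 - k) < m" "p k = N - 1 - p (N - 1 - k)" using d[of "N - 1 - k"] by auto
      have "r k = N - 1 - k" using 2 by (simp add: r_def)
      then have "q (r k) = p (N - 1 - k)" using k by (simp add: q_def)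
      then have "r (q (r k)) = p k" using pk N by (simp add: r_def)
      moreover have "\<not> p k < m" using pk N by auto
      ultimately show ?thesis by (simp add: q_def)
    next
      case 3
      then show ?thesis using N p by (auto simp: q_def r_def permutes_not_in)
    qed
  qed
  then have "p = q \<circ> (r \<circ> q \<circ> r)" by auto
  moreover have "permutation q" "permutation r" using q r by (auto intro: permutes_imp_permutation[of "{..<N}"])
  ultimately have "sign p = sign q * (sign r * sign q * sign r)"
    by (simp add: sign_compose permutation_compose)
  also have "\<dots> = (sign q * sign q) * (sign r * sign r)" by (simp only: mult_ac)
  also have "\<dots> = 1" by simp
  finally show ?thesis .
qed

text \<open>Such an \<open>A\<close> is \<open>U - mT U\<close> with \<open>U\<close> its upper
  half. Replacing the slots by \<open>U\<close> one at a time doubles the value each time, whence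
  \<open>2 ^ m\<close>. With \<open>U\<close> everywhere only the permutations in \<open>P\<close>
  survive, all of sign \<open>1\<close> and with the same product.\<close>

lemma pfaff_antidiagonal:
  assumes N: "N = 2 * m"
  shows "\<exists>c. c \<noteq> 0 \<and> (\<forall>y A. (\<forall>a<N. y (N - 1 - a) = - y a) \<longrightarrow>
     (\<forall>a<N. \<forall>b<N. A a b = (if b = N - 1 - a then - y a else 0)) \<longrightarrow> pfaff m (\<lambda>_. A) = c * (\<Prod>i<m. y i))"
proof -
  define P where "P = {p. p permutes {..<N} \<and> (\<forall>i<m. p i < m \<and> p (N - 1 - i) = N - 1 - p i)}"
  have "finite P" unfolding P_def by (rule finite_subset[OF _ finite_permutations[of "{..<N}"]]) auto
  moreover have "id \<in> P" by (auto simp: P_def permutes_id)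
  ultimately have cP: "card P \<noteq> 0" by auto
  have "pfaff m (\<lambda>_. A) = (2 ^ m * (- 1) ^ m * of_nat (card P)) * (\<Prod>i<m. y i)"
    if y: "\<forall>a<N. y (N - 1 - a) = - y a" and A: "\<forall>a<N. \<forall>b<N. A a b = (if b = N - 1 - a then - y a else 0)" for y A
  proof -
    define U :: cmat where "U a b = (if b = N - 1 - a \<and> a < m then - y a else 0)" for a b
    have pcong: "pfaff m A1 = pfaff m A2"
      if "\<And>i a b. i < m \<Longrightarrow> a < N \<Longrightarrow> b < N \<Longrightarrow> A1 i a b = A2 i a b" for A1 A2 :: "nat \<Rightarrow> cmat"
      unfolding pfaff_def
    proof (rule sum.cong[OF refl])
      fix p assume "p \<in> {p. p permutes {..<N}}"
      then have p: "p i < N" if "i < N" for i using that permutes_in_image[of p "{..<N}" i] by simp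
      have "(\<Prod>i<m. A1 i (p i) (p (N - 1 - i))) = (\<Prod>i<m. A2 i (p i) (p (N - 1 - i)))"
        by (rule prod.cong[OF refl], rule that) (use p N in auto)
      then show "of_int (sign p) * (\<Prod>i<m. A1 i (p i) (p (N - 1 - i))) =
        of_int (sign p) * (\<Prod>i<m. A2 i (p i) (p (N - 1 - i)))" by simp
    qed
    have AU: "A a b = (U - mT U) a b" if "a < N" "b < N" for a b
    proof -
      have "a = N - 1 - b \<longleftrightarrow> b = N - 1 - a" using that by auto
      moreover have "b < m \<longleftrightarrow> \<not> a < m" if "b = N - 1 - a" using that \<open>a < N\<close> N by auto
      ultimately show ?thesis using that A y N
        by (cases "b = N - 1 - a"; cases "a < m") (simp_all add: U_def cmat_apply mT_def)
    qed
    define Q where "Q j = (\<lambda>i. if i < j then U else U - mT U)" for j :: nat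
    have step: "pfaff m (Q j) = 2 * pfaff m (Q (Suc j))" if j: "j < m" for j
    proof -
      have "Q j = (Q j)(j := U - mT U)" by (auto simp: Q_def)
      then have "pfaff m (Q j) = pfaff m ((Q j)(j := U)) - pfaff m ((Q j)(j := mT U))"
        using pfaff_diff[OF j] by metis
      also have "\<dots> = 2 * pfaff m ((Q j)(j := U))" using pfaff_transpose[OF N j] by simp
      also have "(Q j)(j := U) = Q (Suc j)" by (auto simp: Q_def fun_eq_iff)
      finally show ?thesis .
    qed
    have "pfaff m (Q 0) = 2 ^ j * pfaff m (Q j)" if "j \<le> m" for j
      using that by (induction j) (auto simp: step)
    then have 1: "pfaff m (Q 0) = 2 ^ m * pfaff m (Q m)" by simp
    have 2: "pfaff m (\<lambda>_. A) = pfaff m (Q 0)" by (rule pcong) (simp add: AU Q_def)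
    have 3: "pfaff m (Q m) = pfaff m (\<lambda>_. U)" by (rule pcong) (simp add: Q_def)
    have "pfaff m (\<lambda>_. U) = (\<Sum>p\<in>P. (- 1) ^ m * (\<Prod>i<m. y i))"
      unfolding pfaff_def
    proof (rule sum.mono_neutral_cong_right)
      show "finite {p. p permutes {..<N}}" by (simp add: finite_permutations)
      show "P \<subseteq> {p. p permutes {..<N}}" by (auto simp: P_def)
      show "\<forall>p\<in>{p. p permutes {..<N}} - P. of_int (sign p) * (\<Prod>i<m. U (p i) (p (N - 1 - i))) = 0"
      proof
        fix p assume "p \<in> {p. p permutes {..<N}} - P"
        then obtain i where "i < m" "\<not> (p i < m \<and> p (N - 1 - i) = N - 1 - p i)" by (auto simp: P_def)
        then have "i \<in> {..<m}" "U (p i) (p (N - 1 - i)) = 0" by (auto simp: U_def)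
        then have "(\<Prod>i<m. U (p i) (p (N - 1 - i))) = 0" by (intro prod_zero) auto
        then show "of_int (sign p) * (\<Prod>i<m. U (p i) (p (N - 1 - i))) = 0" by simp
      qed
      fix p assume p: "p \<in> P"
      then have "sign p = 1" using sign_doubled_permutation[OF N] by (auto simp: P_def)
      moreover have "(\<Prod>i<m. U (p i) (p (N - 1 - i))) = (\<Prod>i<m. - y (p i))"
        by (rule prod.cong) (use p in \<open>auto simp: U_def P_def\<close>)
      moreover have "(\<Prod>i<m. y (p i)) = (\<Prod>i<m. y i)"
      proof -
        have "inj_on p {..<m}" using p permutes_inj[of p "{..<N}"] inj_on_subset[of p UNIV] by (auto simp: P_def)
        moreover have "p ` {..<m} = {..<m}"
          using p calculation by (intro endo_inj_surj) (auto simp: P_def)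
        ultimately show ?thesis using prod.reindex[of p "{..<m}" y] by simp
      qed
      ultimately show "of_int (sign p) * (\<Prod>i<m. U (p i) (p (N - 1 - i))) = (- 1) ^ m * (\<Prod>i<m. y i)"
        by (simp add: prod_uminus)
    qed
    then show ?thesis using 1 2 3 by simp
  qed
  then show ?thesis using cP by (intro exI[of _ "2 ^ m * (- 1) ^ m * of_nat (card P)"]) auto
qed

end

section \<open>The Weyl group\<close>

text \<open>Monotone and injective give \<open>i \<le> p i\<close>, while the sums of all
  \<open>i\<close> and of all \<open>p i\<close> agree, so no inequality is strict.\<close>

lemma permutes_mono_id:
  fixes p :: "nat \<Rightarrow> nat"
  assumes p: "p permutes {..<N}" and mono: "\<And>i. Suc i < N \<Longrightarrow> p i \<le> p (Suc i)"
  shows "p = id"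
proof -
  have strict: "p i < p (Suc i)" if "Suc i < N" for i
    using mono[OF that] permutes_inj[OF p] by (metis inj_eq le_neq_implies_less n_not_Suc_n)
  have ge: "i < N \<Longrightarrow> i \<le> p i" for i
  proof (induction i)
    case (Suc i)
    then show ?case using strict[of i] by simp
  qed simp
  have "(\<Sum>i<N. p i) = (\<Sum>i<N. i)"
    using sum.permute[OF p, of "\<lambda>i. i"] by (simp add: o_def)
  moreover have "(\<Sum>i<N. i) < (\<Sum>i<N. p i)" if "k < N" "p k \<noteq> k" for k
    using ge that by (intro sum_strict_mono_ex1) (auto intro!: bexI[of _ k] simp: le_neq_implies_less)
  ultimately have "p k = k" if "k < N" for k using that by (metis nat_neq_iff)
  moreover have "p k = k" if "\<not> k < N" for k using permutes_not_in[OF p] that by simp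
  ultimately show ?thesis by (auto simp: fun_eq_iff)
qed

context lie
begin

text \<open>The Weyl group in its reflection form; \<open>normaliser_WG\<close> and
  \<open>WG_grp\<close> connect it with the normaliser behind \<open>weyl_orbit\<close>.\<close>

inductive_set WG :: "(cmat \<Rightarrow> cmat) set" where
  WG_id: "id \<in> WG"
| WG_step: "w \<in> WG \<Longrightarrow> rvalid i j \<Longrightarrow> refl i j \<circ> w \<in> WG"

lemma rvalidD: "rvalid i j \<Longrightarrow> i < N" "rvalid i j \<Longrightarrow> j < N" "rvalid i j \<Longrightarrow> i \<noteq> j"
  by (auto simp: rvalid_def)

lemma WG_refl: "rvalid i j \<Longrightarrow> refl i j \<in> WG"
  using WG_step[OF WG_id] by simp

lemma WG_comp: "w \<in> WG \<Longrightarrow> w' \<in> WG \<Longrightarrow> w \<circ> w' \<in> WG"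
  by (induction rule: WG.induct) (auto simp: comp_assoc intro: WG_step)

lemma WG_linear: "w \<in> WG \<Longrightarrow> w (A + B) = w A + w B" "w \<in> WG \<Longrightarrow> w (c *\<^sub>m A) = c *\<^sub>m w A"
  by (induction rule: WG.induct) (simp_all only: refl_linear id_apply o_apply)

lemma WG_cartan: "w \<in> WG \<Longrightarrow> H \<in> \<hh> \<Longrightarrow> w H \<in> \<hh>"
  by (induction rule: WG.induct) (auto simp: refl_cartan rvalidD)

lemma WG_inverse: "w \<in> WG \<Longrightarrow> \<exists>w'\<in>WG. (\<forall>H. w (w' H) = H) \<and> (\<forall>H. w' (w H) = H)"
proof (induction rule: WG.induct)
  case WG_id
  show ?case by (rule bexI[OF _ WG.WG_id]) auto
next
  case (WG_step w i j)
  then obtain w' where w': "w' \<in> WG" "\<And>H. w (w' H) = H" "\<And>H. w' (w H) = H" by blast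
  have r: "refl i j (refl i j H) = H" for H using WG_step refl_refl rvalidD by blast
  have "w' \<circ> refl i j \<in> WG" using w' WG_step WG_comp WG_refl by blast
  then show ?case by (rule bexI[rotated]) (simp_all add: w' r)
qed

lemma WG_grp: "w \<in> WG \<Longrightarrow> \<exists>g\<in>GG. \<forall>H\<in>\<hh>. g \<odot> H = w H \<odot> g"
proof (induction rule: WG.induct)
  case WG_id
  show ?case using cartan_lie lie_is_mat by (intro bexI[OF _ grp_idm]) auto
next
  case (WG_step w i j)
  then obtain g where g: "g \<in> GG" "\<And>H. H \<in> \<hh> \<Longrightarrow> g \<odot> H = w H \<odot> g" by blast
  obtain a where a: "\<forall>H\<in>\<hh>. uu i j 1 \<odot> uu j i a \<odot> uu i j 1 \<odot> H = refl i j H \<odot> (uu i j 1 \<odot> uu j i a \<odot> uu i j 1)"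
    using refl_conj WG_step by blast
  define m where "m = uu i j 1 \<odot> uu j i a \<odot> uu i j 1"
  have m: "m \<in> GG" unfolding m_def using rvalidD[OF WG_step(2)] by (intro grp_mm uu_grp) auto
  have mH: "m \<odot> H = refl i j H \<odot> m" if "H \<in> \<hh>" for H unfolding m_def using a that by blast
  show ?case
  proof (rule bexI[OF _ grp_mm[OF m g(1)]], rule ballI)
    fix H assume H: "H \<in> \<hh>"
    have "m \<odot> g \<odot> H = m \<odot> w H \<odot> g" using g H by (simp add: mm_assoc)
    also have "\<dots> = (refl i j \<circ> w) H \<odot> (m \<odot> g)" using mH WG_cartan[OF WG_step(1) H] by (simp add: mm_assoc)
    finally show "m \<odot> g \<odot> H = (refl i j \<circ> w) H \<odot> (m \<odot> g)" .
  qed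
qed

text \<open>With this, a function known only to be constant along root subgroups is Weyl invariant
  on the Cartan subalgebra. The factors of an orbital polynomial are functions of this kind.\<close>

lemma refl_Ad:
  assumes "rvalid i j"
  shows "\<exists>a. \<forall>H\<in>\<hh>. refl i j H = Ad i j 1 (Ad j i a (Ad i j 1 H))"
proof -
  have ij: "i < N" "j < N" "i \<noteq> j" "j \<noteq> i" using rvalidD[OF assms] by auto
  obtain a where a: "\<forall>H\<in>\<hh>. uu i j 1 \<odot> uu j i a \<odot> uu i j 1 \<odot> H = refl i j H \<odot> (uu i j 1 \<odot> uu j i a \<odot> uu i j 1)"
    using refl_conj assms by blast
  have "refl i j H = Ad i j 1 (Ad j i a (Ad i j 1 H))" if H: "H \<in> \<hh>" for H
  proof -
    have rm: "is_mat N (refl i j H)" using refl_cartan[OF ij(1,2) H] cartan_lie lie_is_mat by blast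
    have c: "uu i j s \<odot> (uu i j (- s) \<odot> Z) = Z" if "is_mat N Z" for Z s
      using that uu_inverse[OF ij(1-3)] by (simp flip: mm_assoc)
    have c': "uu j i s \<odot> (uu j i (- s) \<odot> Z) = Z" if "is_mat N Z" for Z s
      using that uu_inverse[OF ij(2,1,4)] by (simp flip: mm_assoc)
    have um: "is_mat N (uu i j s)" for s using uu_grp[OF ij(1-3)] grp_is_mat by blast
    have "Ad i j 1 (Ad j i a (Ad i j 1 H)) = (uu i j 1 \<odot> uu j i a \<odot> uu i j 1 \<odot> H) \<odot>
        (uu i j (- 1) \<odot> (uu j i (- a) \<odot> uu i j (- 1)))"
      by (simp add: Ad_def mm_assoc)
    also have "\<dots> = refl i j H \<odot> (uu i j 1 \<odot> uu j i a \<odot> uu i j 1) \<odot>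
        (uu i j (- 1) \<odot> (uu j i (- a) \<odot> uu i j (- 1)))" using a H by simp
    also have "\<dots> = refl i j H" using rm um ij by (simp add: mm_assoc c c' uu_inverse)
    finally show ?thesis by simp
  qed
  then show ?thesis by blast
qed

lemma WG_invariant_of_Ad:
  assumes f: "\<And>i j s L. i < N \<Longrightarrow> j < N \<Longrightarrow> i \<noteq> j \<Longrightarrow> L \<in> \<gg> \<Longrightarrow> f (Ad i j s L) = f L"
    and "w \<in> WG" "H \<in> \<hh>"
  shows "f (w H) = f H"
  using assms(2)
proof (induction rule: WG.induct)
  case (WG_step w i j)
  obtain a where a: "\<forall>H\<in>\<hh>. refl i j H = Ad i j 1 (Ad j i a (Ad i j 1 H))"
    using refl_Ad WG_step by blast
  have "w H \<in> \<hh>" using WG_cartan WG_step assms(3) by blast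
  then show ?case using a WG_step rvalidD[OF WG_step(2)] by (simp add: f Ad_lie cartan_lie)
qed simp

text \<open>Some term of the determinant of \<open>g\<close> is nonzero, so
  \<open>g i (p i) \<noteq> 0\<close> for all \<open>i\<close>. Comparing the entries at
  \<open>(i, p i)\<close> on both sides of \<open>g \<odot> K = H \<odot> g\<close> gives the claim,
  with one \<open>p\<close> for all pairs \<open>K\<close>, \<open>H\<close>.\<close>

lemma conj_perm:
  assumes "g \<in> GG"
  shows "\<exists>p. p permutes {..<N} \<and> (\<forall>K H. K \<in> \<hh> \<and> H \<in> \<hh> \<and> g \<odot> K = H \<odot> g \<longrightarrow> (\<forall>i<N. H i i = K (p i) (p i)))"
proof -
  have "mdet N g \<noteq> 0" using assms grp_det by simp
  then obtain p where p: "p permutes {..<N}" "(\<Prod>i<N. g i (p i)) \<noteq> 0"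
    unfolding mdet_def by (metis (mono_tags, lifting) mem_Collect_eq mult_zero_right sum.not_neutral_contains_not_neutral)
  have "H i i = K (p i) (p i)" if "K \<in> \<hh>" "H \<in> \<hh>" "g \<odot> K = H \<odot> g" "i < N" for K H i
  proof -
    have pi: "p i < N" using p(1) that(4) permutes_in_image[of p "{..<N}" i] by simp
    have "g i (p i) * K (p i) (p i) = H i i * g i (p i)"
      using mm_diag[OF cartan_diag[OF that(1)] that(4) pi, of g]
        diag_mm[OF cartan_diag[OF that(2)] that(4) pi, of g] unfolding that(3) by (rule trans[OF sym])
    moreover have "g i (p i) \<noteq> 0" using p(2) that(4) by auto
    ultimately show ?thesis by simp
  qed
  then show ?thesis using p by blast
qed

lemma cartan_eqI: "H \<in> \<hh> \<Longrightarrow> K \<in> \<hh> \<Longrightarrow> (\<And>i. i < N \<Longrightarrow> H i i = K i i) \<Longrightarrow> H = K"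
  by (rule diag_eqI) (auto simp: cartan_diag)

lemma WG_orbit_finite:
  assumes "H \<in> \<hh>"
  shows "finite {w H | w. w \<in> WG}"
proof (rule finite_subset)
  let ?f = "\<lambda>p i j. if i = j \<and> i < N then H (p i) (p i) else 0"
  show "{w H | w. w \<in> WG} \<subseteq> ?f ` {p. p permutes {..<N}}"
  proof
    fix K assume "K \<in> {w H | w. w \<in> WG}"
    then obtain w where w: "w \<in> WG" "K = w H" by blast
    obtain g where g: "g \<in> GG" "g \<odot> H = w H \<odot> g" using WG_grp w assms by blast
    obtain p where p: "p permutes {..<N}" "\<And>i. i < N \<Longrightarrow> K i i = H (p i) (p i)"
      using conj_perm[OF g(1)] g(2) assms w WG_cartan by metis
    have K: "is_diag K" using w WG_cartan assms cartan_diag by blast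
    have "K i j = ?f p i j" for i j
      using p(2)[of i] K unfolding is_diag_def is_mat_def by (cases "i < N"; cases "i = j") auto
    then have "K = ?f p" by blast
    with p show "K \<in> ?f ` {p. p permutes {..<N}}" by blast
  qed
  show "finite (?f ` {p. p permutes {..<N}})" by (simp add: finite_permutations)
qed

section \<open>Dominant chambers and the normaliser of the Cartan subalgebra\<close>

definition hreal :: "cmat \<Rightarrow> bool" where "hreal H \<longleftrightarrow> H \<in> \<hh> \<and> (\<forall>i. H i i \<in> \<real>)"

text \<open>Unlike in \<open>hdom\<close>, all pairs of indices are compared, also the middle pair
  in type D, which is not a root. This selects one of the elements that differ by the sign of a
  single coordinate.\<close>

definition sdec :: "cmat \<Rightarrow> bool" where
  "sdec H \<longleftrightarrow> hreal H \<and> (\<forall>i j. i < j \<and> j < N \<longrightarrow> Re (H j j) < Re (H i i))"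

definition hdom :: "cmat \<Rightarrow> bool" where
  "hdom H \<longleftrightarrow> (\<forall>i j. rvalid i j \<and> i < j \<longrightarrow> Re (H j j) \<le> Re (H i i))"

lemma hreal_add: "hreal A \<Longrightarrow> hreal B \<Longrightarrow> hreal (A + B)"
  and hreal_smul: "hreal A \<Longrightarrow> c \<in> \<real> \<Longrightarrow> hreal (c *\<^sub>m A)"
  by (auto simp: hreal_def cartan_add cartan_smul)

lemma hreal_diff: "hreal A \<Longrightarrow> hreal B \<Longrightarrow> hreal (A - B)"
  by (auto simp: hreal_def cartan_diff cmat_apply)

lemma hreal_Hc: "i < N \<Longrightarrow> j < N \<Longrightarrow> hreal (Hc i j)"
  by (auto simp: hreal_def Hc_cartan Hc_entry_real)

lemma al_real: "hreal H \<Longrightarrow> al i j H \<in> \<real>"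
  by (auto simp: hreal_def al_def)

lemma WG_hreal: "w \<in> WG \<Longrightarrow> hreal H \<Longrightarrow> hreal (w H)"
proof (induction rule: WG.induct)
  case (WG_step w i j)
  have "hreal (w H - al i j (w H) *\<^sub>m Hc i j)"
    using WG_step rvalidD[OF WG_step(2)] by (intro hreal_diff hreal_smul al_real hreal_Hc) auto
  then show ?case by (simp only: refl_def o_apply)
qed simp

text \<open>The entries \<open>N - 1, N - 3, ..., 1 - N\<close> are distinct, sum to zero and are
  negated by \<open>fl\<close>, so one formula gives a regular element in all four types.\<close>

definition Hrho :: cmat where
  "Hrho = (\<lambda>i j. if i = j \<and> i < N then of_real (real N - 1 - 2 * real i) else 0)"

lemma sdec_Hrho: "sdec Hrho"
proof -
  have d: "is_diag Hrho" by (auto simp: is_diag_def is_mat_def Hrho_def)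
  have "Hrho \<in> \<hh>"
  proof (cases tA)
    case True
    have "(\<Sum>i<N. real N - 1 - 2 * real i) = 0"
      by (induction N) (simp_all add: sum.distrib sum_subtractf algebra_simps)
    moreover have "(\<Sum>i<N. Hrho i i) = of_real (\<Sum>i<N. real N - 1 - 2 * real i)"
      unfolding of_real_sum by (rule sum.cong) (auto simp: Hrho_def)
    ultimately have "(\<Sum>i<N. Hrho i i) = 0" by simp
    then show ?thesis using True d by (simp add: cartan_A)
  next
    case False
    have "Hrho (fl i) (fl i) = - Hrho i i" if "i < N" for i
      using that by (simp add: Hrho_def fl_def of_nat_diff)
    then show ?thesis using False d by (simp add: cartan_nA)
  qed
  then show ?thesis by (auto simp: sdec_def hreal_def Hrho_def)
qed

definition "tB \<longleftrightarrow> t = TB"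
definition "tD \<longleftrightarrow> t = TD"

lemma t_cases3: "tA \<or> tB \<or> tC \<or> tD" "tO \<longleftrightarrow> tB \<or> tD" "tB \<Longrightarrow> \<not> tD" "tA \<Longrightarrow> \<not> tB \<and> \<not> tC \<and> \<not> tD"
  "tC \<Longrightarrow> \<not> tB \<and> \<not> tD"
  unfolding tA_def tB_def tC_def tD_def tO_def by (cases t; simp)+

lemma N_B: "tB \<Longrightarrow> N = 2 * n + 1" and N_D: "tD \<Longrightarrow> N = 2 * n" and N_A: "tA \<Longrightarrow> N = n + 1"
  unfolding N_eq tB_def tD_def tA_def by simp_all

text \<open>The matrix \<open>J \<odot> L\<close> is the congruence of \<open>J \<odot> H\<close> by
  \<open>g\<close>, so the Pfaffian changes by \<open>mdet N g = 1\<close>. This is where SO differs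
  from O, which could reverse the sign.\<close>

lemma pfaffian_invariant:
  assumes D: tD
  shows "\<exists>F\<in>polyf entries. \<forall>g L H. g \<in> GG \<and> L \<in> \<gg> \<and> H \<in> \<hh> \<and> g \<odot> L = H \<odot> g \<longrightarrow> F L = (\<Prod>i<n. H i i)"
proof -
  have nA: "\<not> tA" and O: tO using D t_cases3 by blast+
  obtain c where c: "c \<noteq> 0" "\<And>y A. (\<forall>a<N. y (N - 1 - a) = - y a) \<Longrightarrow>
     (\<forall>a<N. \<forall>b<N. A a b = (if b = N - 1 - a then - y a else 0)) \<Longrightarrow> pfaff n (\<lambda>_. A) = c * (\<Prod>i<n. y i)"
    using pfaff_antidiagonal[OF N_D[OF D]] by blast
  define F where "F L = inverse c * pfaff n (\<lambda>_. J \<odot> L)" for L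
  have "F \<in> polyf entries"
    unfolding F_def[abs_def] pfaff_def
  proof (intro polyf_cmult polyf_sum polyf_prod)
    fix p i
    show "(\<lambda>L. (J \<odot> L) (p i) (p (N - 1 - i))) \<in> polyf entries"
      by (intro mm_entry_polyf entry_polyf polyf_const)
  qed
  moreover have "F L = (\<Prod>i<n. H i i)" if g: "g \<in> GG" and LH: "L \<in> \<gg>" "H \<in> \<hh>" "g \<odot> L = H \<odot> g" for g L H
  proof -
    have "mT g \<odot> (J \<odot> H) \<odot> g = mT g \<odot> J \<odot> (g \<odot> L)" using LH by (simp add: mm_assoc)
    also have "\<dots> = J \<odot> L" using grp_J[OF g nA] by (simp add: mm_assoc[symmetric])
    finally have "pfaff n (\<lambda>_. J \<odot> L) = pfaff n (\<lambda>_. J \<odot> H)"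
      using pfaff_congruence[OF N_D[OF D], of g "J \<odot> H"] grp_det[OF g] by simp
    also have "\<dots> = c * (\<Prod>i<n. H i i)"
    proof (rule c(2))
      have s: "sg a = 1" for a using sg_BD t_cases3 D by blast
      show "\<forall>a<N. H (N - 1 - a) (N - 1 - a) = - H a a"
        using LH nA by (simp add: cartan_nA fl_def)
      show "\<forall>a<N. \<forall>b<N. (J \<odot> H) a b = (if b = N - 1 - a then - H a a else 0)"
      proof (intro allI impI)
        fix a b assume ab: "a < N" "b < N"
        have "(J \<odot> H) a b = H (fl a) b" using J_mm[OF nA ab] s by simp
        also have "\<dots> = (if b = fl a then - H a a else 0)"
          using LH nA ab by (auto simp: cartan_nA is_diag_def)
        finally show "(J \<odot> H) a b = (if b = N - 1 - a then - H a a else 0)" by (simp add: fl_def)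
      qed
    qed
    finally show ?thesis using c(1) by (simp add: F_def)
  qed
  ultimately show ?thesis by blast
qed

text \<open>In type D the dominance conditions leave a sign of the last coordinate
  undetermined; it is fixed by the Pfaffian.\<close>
lemma dominant_conj_unique:
  assumes H: "sdec H" and K: "K \<in> \<hh>" and g: "g \<in> GG" "g \<odot> H = K \<odot> g" and dom: "hdom K"
  shows "K = H"
proof -
  have Hh: "H \<in> \<hh>" using H by (simp add: sdec_def hreal_def)
  obtain p where p: "p permutes {..<N}" and pK: "\<And>i. i < N \<Longrightarrow> K i i = H (p i) (p i)"
    using conj_perm[OF g(1)] g(2) Hh K by blast
  have pN: "p i < N" if "i < N" for i using permutes_in_image[OF p, of i] that by simp
  have le: "p i \<le> p j" if "Re (K j j) \<le> Re (K i i)" "i < N" "j < N" for i j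
  proof (rule ccontr)
    assume "\<not> p i \<le> p j"
    then have "Re (H (p i) (p i)) < Re (H (p j) (p j))" using H pN that by (simp add: sdec_def)
    then show False using that pK by simp
  qed
  have consecutive: "rvalid i (Suc i)" if "Suc i < N" "\<not> (tD \<and> i = n - 1)" for i
  proof -
    have "Suc i \<noteq> fl i" if tO
    proof (cases tB)
      case True
      then have "N = 2 * n + 1" using N_B by blast
      show ?thesis
      proof
        assume "Suc i = fl i"
        then have "N = 2 * i + 2" using \<open>Suc i < N\<close> unfolding fl_def by linarith
        then show False using \<open>N = 2 * n + 1\<close> by presburger
      qed
    next
      case False
      then have tD using \<open>tO\<close> t_cases3 by blast
      then have "N = 2 * n" "i \<noteq> n - 1" using N_D \<open>\<not> (tD \<and> i = n - 1)\<close> by auto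
      show ?thesis
      proof
        assume "Suc i = fl i"
        then have "N = 2 * i + 2" using \<open>Suc i < N\<close> unfolding fl_def by linarith
        then show False using \<open>N = 2 * n\<close> \<open>i \<noteq> n - 1\<close> by simp
      qed
    qed
    then show ?thesis using that by (auto simp: rvalid_def)
  qed
  have step: "p i \<le> p (Suc i)" if "Suc i < N" "\<not> (tD \<and> i = n - 1)" for i
    using dom consecutive[OF that] that by (intro le) (auto simp: hdom_def)
  show ?thesis
  proof (cases "tD \<and> \<not> p (n - 1) \<le> p n")
    case False
    have "p i \<le> p (Suc i)" if "Suc i < N" for i
      using step[of i] False that n_pos by (cases "tD \<and> i = n - 1") auto
    then have "p = id" using permutes_mono_id[OF p] by blast
    then show ?thesis using pK Hh K by (intro cartan_eqI) auto
  next
    case True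
    then have D: tD and gt: "p n < p (n - 1)" by auto
    have Nn: "N = 2 * n" "n - 1 < N" "n < N" using N_D[OF D] n_pos by auto
    let ?t = "Transposition.transpose (n - 1) n"
    have tp: "?t permutes {..<N}" using Nn by (intro permutes_swap_id) auto
    \<comment> \<open>If the middle pair is in the wrong order, exchanging it makes \<open>p\<close>
      monotone; the comparisons across the middle use the roots of \<open>n - 1\<close> with
      \<open>n + 1\<close> and of \<open>n - 2\<close> with \<open>n\<close>. Then \<open>K\<close>
      is \<open>H\<close> with one sign reversed, so the Pfaffian of \<open>H\<close> would be zero,
      against \<open>sdec\<close>.\<close>
    have "p \<circ> ?t = id"
    proof (rule permutes_mono_id[OF permutes_compose[OF tp p]])
      fix i assume i: "Suc i < N"
      have t1: "?t (n - 1) = n" "?t n = n - 1" by simp_all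
      have t2: "?t k = k" if "k \<noteq> n - 1" "k \<noteq> n" for k using that by (simp add: Transposition.transpose_def)
      consider "i = n - 1" | "i = n" | "Suc i = n - 1" | "i \<noteq> n - 1" "i \<noteq> n" "Suc i \<noteq> n - 1" by blast
      then show "(p \<circ> ?t) i \<le> (p \<circ> ?t) (Suc i)"
      proof cases
        case 1
        then have "Suc i = n" using n_pos by simp
        then show ?thesis using 1 gt t1 by simp
      next
        case 2
        have v: "rvalid (n - 1) (Suc n)" unfolding rvalid_def fl_def using Nn i 2 n_pos by auto
        have "Re (K (Suc n) (Suc n)) \<le> Re (K (n - 1) (n - 1))"
          by (rule dom[unfolded hdom_def, rule_format]) (use v in auto)
        then have "p (n - 1) \<le> p (Suc n)" using i 2 Nn by (intro le) auto
        then show ?thesis using 2 t1 t2[of "Suc n"] by simp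
      next
        case 3
        then have v: "rvalid i n" unfolding rvalid_def fl_def using Nn by auto
        have "Re (K n n) \<le> Re (K i i)"
          by (rule dom[unfolded hdom_def, rule_format]) (use v 3 in auto)
        then have "p i \<le> p n" using 3 Nn by (intro le) auto
        then show ?thesis using 3 t1 t2[of i] by simp
      next
        case 4
        then have "Suc i \<noteq> n" using n_pos by auto
        then show ?thesis using 4 t2[of i] t2[of "Suc i"] step[of i] i by simp
      qed
    qed
    then have "p (?t (?t k)) = ?t k" for k by (metis comp_apply id_apply)
    then have pt: "p k = ?t k" for k by simp
    have Hfl: "H (fl i) (fl i) = - H i i" if "i < N" for i
      using Hh cartan_nA t_cases3 D that by blast
    have Kn: "K i i = (if i = n - 1 then - H i i else H i i)" if "i < n" for i
    proof (cases "i = n - 1")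
      case True
      have "fl (n - 1) = n" unfolding fl_def using Nn n_pos by auto
      then have "H n n = - H (n - 1) (n - 1)" using Hfl[OF Nn(2)] by metis
      then show ?thesis using True pK[of i] pt Nn by simp
    next
      case False
      then have "?t i = i" using that by (simp add: Transposition.transpose_def)
      then show ?thesis using False pK[of i] pt that Nn by simp
    qed
    have split: "(\<Prod>i<n. h i) = h (n - 1) * (\<Prod>i\<in>{..<n} - {n - 1}. h i)" for h :: "nat \<Rightarrow> complex"
      using n_pos by (intro prod.remove) auto
    have "(\<Prod>i<n. K i i) = - (\<Prod>i<n. H i i)"
      unfolding split using Kn n_pos by simp
    moreover obtain F where "\<forall>g L H. g \<in> GG \<and> L \<in> \<gg> \<and> H \<in> \<hh> \<and> g \<odot> L = H \<odot> g \<longrightarrow> F L = (\<Prod>i<n. H i i)"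
      using pfaffian_invariant[OF D] by blast
    then have "F H = (\<Prod>i<n. K i i)" "F H = (\<Prod>i<n. H i i)"
      using g K Hh cartan_lie grp_idm lie_is_mat mm_idm by metis+
    ultimately have "(\<Prod>i<n. H i i) = 0" by simp
    moreover have "H i i \<noteq> 0" if "i < n" for i
    proof
      assume "H i i = 0"
      then have "H (fl i) (fl i) = 0" using Hfl[of i] that Nn by simp
      moreover have "Re (H (fl i) (fl i)) < Re (H i i)"
        using H that Nn unfolding sdec_def fl_def by auto
      ultimately show False using \<open>H i i = 0\<close> by simp
    qed
    ultimately show ?thesis by simp
  qed
qed

text \<open>The weights \<open>N - i\<close> decrease, which makes this functional positive on
  positive coroots. It serves as the potential that reflections raise.\<close>

definition rho :: "cmat \<Rightarrow> real" where "rho H = (\<Sum>i<N. (real N - real i) * Re (H i i))"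

lemma rho_diff: "rho (A - B) = rho A - rho B"
  by (simp add: rho_def cmat_apply right_diff_distrib sum_subtractf del: left_diff_distrib)

lemma rho_real_smul: "c \<in> \<real> \<Longrightarrow> rho (c *\<^sub>m A) = Re c * rho A"
  by (auto simp: rho_def sum_distrib_left mult_ac elim: Reals_cases)

lemma rho_Hc:
  assumes "rvalid i j" "i < j"
  shows "rho (Hc i j) > 0"
proof -
  have ij: "i < N" "j < N" using assms rvalidD by auto
  have E: "rho (Em a a) = real N - real a" if "a < N" for a
  proof -
    have "rho (Em a a) = (\<Sum>i<N. if i = a then real N - real a else 0)"
      unfolding rho_def by (rule sum.cong) (auto simp: Em_def)
    then show ?thesis using that by simp
  qed
  have plus: "rho (A + B) = rho A + rho B" for A B
    by (simp add: rho_def distrib_left sum.distrib)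
  have "rho (Kr i j) > 0"
  proof (cases tA)
    case True
    then show ?thesis using ij assms by (simp add: Kr_def rho_diff E)
  next
    case False
    have "fl j < fl i" using ij assms fl_less by blast
    then show ?thesis using False ij assms by (simp add: Kr_def rho_diff plus E)
  qed
  moreover have "2 / nal i j \<in> \<real>" "Re (2 / nal i j) > 0" by (auto simp: nal_def)
  ultimately show ?thesis by (simp add: Hc_def rho_real_smul)
qed

text \<open>Reflections in positive roots that are negative on \<open>H\<close> increase \<open>rho\<close>, so they
  lead to a dominant element of the orbit.\<close>
lemma climb:
  assumes H: "hreal H"
    and \<nu>: "\<And>A B. A \<in> \<hh> \<Longrightarrow> B \<in> \<hh> \<Longrightarrow> \<nu> (A - B) = \<nu> A - \<nu> B" "\<And>c A. A \<in> \<hh> \<Longrightarrow> \<nu> (c *\<^sub>m A) = c * \<nu> A"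
    and pos: "\<And>i j. rvalid i j \<Longrightarrow> i < j \<Longrightarrow> \<nu> (Hc i j) \<in> \<real> \<and> Re (\<nu> (Hc i j)) \<ge> 0"
  shows "\<exists>w\<in>WG. hdom (w H) \<and> Re (\<nu> H) \<le> Re (\<nu> (w H))"
proof -
  \<comment> \<open>The maximum of \<open>rho\<close> is taken only over orbit elements on which
    \<open>Re \<nu>\<close> has not dropped. A reflection in a positive root that is negative at
    \<open>K\<close> adds a nonnegative multiple of \<open>\<nu> (Hc i j)\<close>, so it stays in
    this set.\<close>
  let ?S = "{K \<in> {w H | w. w \<in> WG}. Re (\<nu> H) \<le> Re (\<nu> K)}"
  have fin: "finite ?S" using WG_orbit_finite H by (simp add: hreal_def)
  have "H \<in> ?S" using WG_id by (auto intro!: exI[of _ id])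
  have "Max (rho ` ?S) \<in> rho ` ?S" using fin \<open>H \<in> ?S\<close> by (intro Max_in) auto
  then obtain K where K: "K \<in> ?S" "Max (rho ` ?S) = rho K" by blast
  have max: "rho K' \<le> rho K" if "K' \<in> ?S" for K'
    unfolding K(2)[symmetric] using fin that by (intro Max_ge) auto
  from K obtain w where w: "w \<in> WG" "K = w H" by blast
  have Kr: "hreal K" using w WG_hreal H by blast
  have "hdom K" unfolding hdom_def
  proof (intro allI impI, rule ccontr)
    fix i j assume ij: "rvalid i j \<and> i < j" and "\<not> Re (K j j) \<le> Re (K i i)"
    then have neg: "Re (al i j K) < 0" by (simp add: al_def)
    have Hc: "Hc i j \<in> \<hh>" "hreal (Hc i j)" using ij rvalidD Hc_cartan hreal_Hc by blast+
    have a: "al i j K \<in> \<real>" using al_real Kr by blast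
    have rK: "refl i j K = K - al i j K *\<^sub>m Hc i j" by (simp add: refl_def)
    have "rho (refl i j K) = rho K - Re (al i j K) * rho (Hc i j)"
      using a by (simp add: rK rho_diff rho_real_smul)
    moreover have "Re (al i j K) * rho (Hc i j) < 0" using neg rho_Hc ij by (simp add: mult_less_0_iff)
    ultimately have "rho K < rho (refl i j K)" by simp
    moreover have "refl i j K \<in> ?S"
    proof -
      have "\<nu> (refl i j K) = \<nu> K - al i j K * \<nu> (Hc i j)"
        using \<nu> Hc Kr by (simp add: rK cartan_smul hreal_def)
      moreover have "Re (al i j K * \<nu> (Hc i j)) \<le> 0"
      proof -
        have "\<nu> (Hc i j) \<in> \<real>" "Re (\<nu> (Hc i j)) \<ge> 0" using pos ij by auto
        then show ?thesis using a neg by (auto elim!: Reals_cases simp: mult_le_0_iff)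
      qed
      ultimately have "Re (\<nu> H) \<le> Re (\<nu> (refl i j K))" using K by simp
      moreover have "refl i j K = (refl i j \<circ> w) H" using w by simp
      moreover have "refl i j \<circ> w \<in> WG" using w ij WG_step by blast
      ultimately show ?thesis by blast
    qed
    ultimately show False using max by force
  qed
  then show ?thesis using w K by blast
qed

text \<open>Let \<open>w\<close> move the image of \<open>Hrho\<close> under \<open>g\<close> back
  to a dominant element, which must be \<open>Hrho\<close> itself. The composite fixes
  \<open>Hrho\<close>, whose entries are distinct, so its permutation is the identity and it fixes
  the Cartan subalgebra pointwise. Hence \<open>g\<close> acts as the inverse of
  \<open>w\<close>.\<close>

theorem normaliser_WG:
  assumes g: "g \<in> GG" and norm: "\<And>K. K \<in> \<hh> \<Longrightarrow> \<exists>H\<in>\<hh>. g \<odot> K = H \<odot> g"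
  shows "\<exists>w\<in>WG. \<forall>K\<in>\<hh>. \<forall>H\<in>\<hh>. g \<odot> K = H \<odot> g \<longrightarrow> H = w K"
proof -
  have r: "Hrho \<in> \<hh>" "hreal Hrho" using sdec_Hrho by (auto simp: sdec_def hreal_def)
  obtain H1 where H1: "H1 \<in> \<hh>" "g \<odot> Hrho = H1 \<odot> g" using norm r by blast
  have "hreal H1"
  proof -
    obtain p where "p permutes {..<N}" "\<And>i. i < N \<Longrightarrow> H1 i i = Hrho (p i) (p i)"
      using conj_perm[OF g] H1 r by blast
    moreover have "H1 i i = 0" if "\<not> i < N" for i
      using H1(1) cartan_diag that by (auto simp: is_diag_def is_mat_def)
    ultimately have "H1 i i \<in> \<real>" for i using r(2) by (cases "i < N") (auto simp: hreal_def)
    then show ?thesis using H1 by (simp add: hreal_def)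
  qed
  from climb[OF this, of "\<lambda>_. 0"] obtain w where w: "w \<in> WG" "hdom (w H1)" by auto
  obtain gw where gw: "gw \<in> GG" "\<And>H. H \<in> \<hh> \<Longrightarrow> gw \<odot> H = w H \<odot> gw" using WG_grp w by blast
  have comp: "(gw \<odot> g) \<odot> K = w H \<odot> (gw \<odot> g)" if "K \<in> \<hh>" "H \<in> \<hh>" "g \<odot> K = H \<odot> g" for K H
  proof -
    have "(gw \<odot> g) \<odot> K = gw \<odot> H \<odot> g" using that by (simp add: mm_assoc)
    then show ?thesis using gw that by (simp add: mm_assoc)
  qed
  have gg: "gw \<odot> g \<in> GG" using gw g grp_mm by blast
  have "w H1 = Hrho"
    using dominant_conj_unique[OF sdec_Hrho WG_cartan[OF w(1) H1(1)] gg comp[OF r(1) H1] w(2)] .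
  obtain p where p: "p permutes {..<N}" and pp: "\<forall>K H. K \<in> \<hh> \<and> H \<in> \<hh> \<and> (gw \<odot> g) \<odot> K = H \<odot> (gw \<odot> g) \<longrightarrow> (\<forall>i<N. H i i = K (p i) (p i))"
    using conj_perm[OF gg] by blast
  have pid: "p i = i" if i: "i < N" for i
  proof (rule ccontr)
    assume "p i \<noteq> i"
    moreover have "p i < N" using permutes_in_image[OF p, of i] i by simp
    ultimately have "Re (Hrho (p i) (p i)) \<noteq> Re (Hrho i i)"
      using sdec_Hrho i unfolding sdec_def by (metis nat_neq_iff order_less_irrefl)
    moreover have "Hrho i i = Hrho (p i) (p i)"
      using pp comp[OF r(1) H1] \<open>w H1 = Hrho\<close> r i by metis
    ultimately show False by simp
  qed
  obtain w' where w': "w' \<in> WG" "\<And>H. w' (w H) = H" using WG_inverse[OF w(1)] by blast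
  have "H = w' K" if KH: "K \<in> \<hh>" "H \<in> \<hh>" "g \<odot> K = H \<odot> g" for K H
  proof -
    have wH: "w H \<in> \<hh>" using w WG_cartan KH by blast
    have "w H = K"
    proof (rule cartan_eqI[OF wH KH(1)])
      fix i assume "i < N"
      then show "w H i i = K i i" using pp comp[OF KH] wH KH(1) pid by metis
    qed
    then show ?thesis using w'(2)[of H] by simp
  qed
  then show ?thesis using w' by blast
qed

end

section \<open>Extension of invariant polynomials\<close>

context lie
begin

text \<open>\<open>Inv f\<close>: the function \<open>f\<close> on the Cartan subalgebra extends to an invariant polynomial
  (Chevalley restriction).\<close>
definition Inv :: "(cmat \<Rightarrow> complex) \<Rightarrow> bool" where
  "Inv f \<longleftrightarrow> (\<exists>F\<in>polyf entries. \<forall>g L H. g \<in> GG \<and> L \<in> \<gg> \<and> H \<in> \<hh> \<and> g \<odot> L = H \<odot> g \<longrightarrow> F L = f H)"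

lemma Inv_const: "Inv (\<lambda>_. c)"
  unfolding Inv_def by (rule bexI[OF _ polyf_const[of c]]) simp

lemma Inv_add: "Inv f \<Longrightarrow> Inv g \<Longrightarrow> Inv (\<lambda>H. f H + g H)"
proof -
  assume "Inv f" "Inv g"
  then obtain F G where F: "F \<in> polyf entries" "\<And>g L H. g \<in> GG \<Longrightarrow> L \<in> \<gg> \<Longrightarrow> H \<in> \<hh> \<Longrightarrow> g \<odot> L = H \<odot> g \<Longrightarrow> F L = f H"
    and G: "G \<in> polyf entries" "\<And>h L H. h \<in> GG \<Longrightarrow> L \<in> \<gg> \<Longrightarrow> H \<in> \<hh> \<Longrightarrow> h \<odot> L = H \<odot> h \<Longrightarrow> G L = g H"
    unfolding Inv_def by blast
  show ?thesis unfolding Inv_def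
    by (rule bexI[OF _ polyf_add[OF F(1) G(1)]]) (use F(2) G(2) in metis)
qed

lemma Inv_mult: "Inv f \<Longrightarrow> Inv g \<Longrightarrow> Inv (\<lambda>H. f H * g H)"
proof -
  assume "Inv f" "Inv g"
  then obtain F G where F: "F \<in> polyf entries" "\<And>g L H. g \<in> GG \<Longrightarrow> L \<in> \<gg> \<Longrightarrow> H \<in> \<hh> \<Longrightarrow> g \<odot> L = H \<odot> g \<Longrightarrow> F L = f H"
    and G: "G \<in> polyf entries" "\<And>h L H. h \<in> GG \<Longrightarrow> L \<in> \<gg> \<Longrightarrow> H \<in> \<hh> \<Longrightarrow> h \<odot> L = H \<odot> h \<Longrightarrow> G L = g H"
    unfolding Inv_def by blast
  show ?thesis unfolding Inv_def
    by (rule bexI[OF _ polyf_mult[OF F(1) G(1)]]) (use F(2) G(2) in metis)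
qed

lemma Inv_cong: "Inv f \<Longrightarrow> (\<And>H. H \<in> \<hh> \<Longrightarrow> f H = g H) \<Longrightarrow> Inv g"
  unfolding Inv_def by metis

lemma Inv_sum: "(\<And>i. i \<in> I \<Longrightarrow> Inv (f i)) \<Longrightarrow> Inv (\<lambda>H. \<Sum>i\<in>I. f i H)"
  by (induction I rule: infinite_finite_induct) (auto intro: Inv_const Inv_add)

lemma Inv_sum_list: "(\<And>x. x \<in> set xs \<Longrightarrow> Inv (f x)) \<Longrightarrow> Inv (\<lambda>H. \<Sum>x\<leftarrow>xs. f x H)"
  by (induction xs) (auto intro: Inv_const Inv_add)

lemma Inv_diff: "Inv f \<Longrightarrow> Inv g \<Longrightarrow> Inv (\<lambda>H. f H - g H)"
  using Inv_add[OF _ Inv_mult[OF Inv_const[of "-1"]], of f g] by simp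

definition ell :: nat where "ell = (if tA then N else n)"

text \<open>Outside type A the Weyl group contains sign changes; the squares are insensitive to
  them, and traces of even powers are symmetric functions of the squares.\<close>

definition hy :: "nat \<Rightarrow> cmat \<Rightarrow> complex" where
  "hy i H = (if tA then H i i else H i i ^ 2)"

lemma ell_le: "ell \<le> N"
  unfolding ell_def using N_B N_C N_D t_cases3 by fastforce

lemma Inv_trace: "Inv (\<lambda>H. \<Sum>i<N. H i i ^ k)"
  unfolding Inv_def
proof (rule bexI[of _ "\<lambda>L. mtr (mpow k L)"], intro allI impI)
  fix g L H assume *: "g \<in> GG \<and> L \<in> \<gg> \<and> H \<in> \<hh> \<and> g \<odot> L = H \<odot> g"
  then have "mtr (mpow k L) = mtr (mpow k H)"
    by (intro mtr_mpow_similar[of g]) (auto simp: grp_is_mat grp_det)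
  also have "\<dots> = (\<Sum>i<N. H i i ^ k)"
    unfolding mtr_def by (rule sum.cong) (use * cartan_diag mpow_diag in auto)
  finally show "mtr (mpow k L) = (\<Sum>i<N. H i i ^ k)" .
next
  have "(\<lambda>L. mpow k L i j) \<in> polyf entries" for i j
    by (induction k arbitrary: i j) (auto intro!: polyf_const mm_entry_polyf entry_polyf)
  then show "(\<lambda>L. mtr (mpow k L)) \<in> polyf entries"
    unfolding mtr_def by (intro polyf_sum)
qed

text \<open>Outside type A the diagonal entries come in opposite pairs, besides a middle zero in
  type B, so the trace of the power \<open>2 * k\<close> counts every square twice.\<close>

lemma Inv_power_sum: "Inv (\<lambda>H. \<Sum>i<ell. hy i H ^ k)"
\<comment> \<open>The case \<open>k = 0\<close> is split off because the middle zero of type B would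
  contribute \<open>0 ^ 0 = 1\<close> to the trace.\<close>
proof (cases "tA \<or> k = 0")
  case True
  then show ?thesis
  proof
    assume tA
    then show ?thesis using Inv_trace[of k] by (simp add: ell_def hy_def)
  qed (simp add: Inv_const)
next
  case False
  then have nA: "\<not> tA" and k: "k > 0" by auto
  have "Inv (\<lambda>H. 1/2 * (\<Sum>i<N. H i i ^ (2 * k)))" by (intro Inv_mult Inv_const Inv_trace)
  then show ?thesis
  proof (rule Inv_cong)
    fix H assume H: "H \<in> \<hh>"
    have neg: "H (fl i) (fl i) = - H i i" if "i < N" for i using H nA that by (simp add: cartan_nA)
    let ?h = "\<lambda>i. H i i ^ (2 * k)"
    have N: "N = 2 * n \<or> N = 2 * n + 1" using nA t_cases3 N_B N_C N_D by blast
    have "(\<Sum>i\<in>{N-n..<N}. ?h i) = (\<Sum>i<n. ?h (fl i))"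
      by (rule sum.reindex_bij_witness[of _ fl fl]) (use N in \<open>auto simp: fl_def\<close>)
    also have "\<dots> = (\<Sum>i<n. ?h i)"
      by (rule sum.cong) (use N neg in \<open>auto simp: power_mult\<close>)
    finally have 1: "(\<Sum>i\<in>{N-n..<N}. ?h i) = (\<Sum>i<n. ?h i)" .
    have "(\<Sum>i\<in>{n..<N-n}. ?h i) = 0"
    proof (rule sum.neutral, rule ballI)
      fix i assume "i \<in> {n..<N-n}"
      then have "fl i = i" "i < N" using N by (auto simp: fl_def)
      then have "H i i = - H i i" using neg[of i] by simp
      then show "?h i = 0" using k by simp
    qed
    moreover have "(\<Sum>i<N. ?h i) = (\<Sum>i<n. ?h i) + (\<Sum>i\<in>{n..<N-n}. ?h i) + (\<Sum>i\<in>{N-n..<N}. ?h i)"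
    proof -
      have "n \<le> N - n" "N - n \<le> N" using N by auto
      then show ?thesis unfolding lessThan_atLeast0
        using sum.atLeastLessThan_concat[of 0 n "N - n" ?h] sum.atLeastLessThan_concat[of 0 "N - n" N ?h] by simp
    qed
    ultimately show "1/2 * (\<Sum>i<N. ?h i) = (\<Sum>i<ell. hy i H ^ k)"
      using 1 nA by (simp add: ell_def hy_def power_mult)
  qed
qed

section \<open>Symmetric functions of the coordinates\<close>

text \<open>Injective index sequences. Summing a monomial over all of them, rather than over its
  distinct rearrangements, gives the augmented monomial symmetric function, whose recursion has no
  symmetry factors.\<close>

definition dlists :: "nat \<Rightarrow> nat list set" where
  "dlists k = {xs. length xs = k \<and> distinct xs \<and> set xs \<subseteq> {..<ell}}"

lemma finite_dlists: "finite (dlists k)"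
  unfolding dlists_def
  by (rule finite_subset[OF _ finite_lists_length_eq[of "{..<ell}" k]]) auto

lemma sum_dlists_Suc:
  "(\<Sum>xs\<in>dlists (Suc k). f xs) = (\<Sum>xs\<in>dlists k. \<Sum>x\<in>{..<ell} - set xs. f (x # xs) :: complex)"
proof -
  have "(\<Sum>xs\<in>dlists k. \<Sum>x\<in>{..<ell} - set xs. f (x # xs)) =
    (\<Sum>(xs, x)\<in>(SIGMA xs:dlists k. {..<ell} - set xs). f (x # xs))"
    by (rule sum.Sigma) (auto simp: finite_dlists)
  also have "\<dots> = (\<Sum>xs\<in>dlists (Suc k). f xs)"
    by (rule sum.reindex_bij_witness[of _ "\<lambda>ys. (tl ys, hd ys)" "\<lambda>(xs, x). x # xs"])
      (auto simp: dlists_def length_Suc_conv)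
  finally show ?thesis by simp
qed

text \<open>Augmented monomial symmetric functions are polynomials in the power sums, by
  induction on the number of exponents.\<close>
lemma Inv_augmented_monomial:
  "Inv (\<lambda>H. \<Sum>xs\<in>dlists (length ks). \<Prod>j<length ks. hy (xs ! j) H ^ (ks ! j))"
proof (induction "length ks" arbitrary: ks)
  case 0
  then show ?case by (simp add: Inv_const)
next
  case (Suc m)
  then obtain k ks' where ks: "ks = k # ks'" "length ks' = m" by (metis length_Suc_conv)
  let ?M = "\<lambda>ks H. \<Sum>xs\<in>dlists (length ks). \<Prod>j<length ks. hy (xs ! j) H ^ (ks ! j)"
  \<comment> \<open>The new index ranges over everything outside \<open>xs\<close>, that is, over
    all indices minus those in \<open>xs\<close>. The first part factors off a power sum; in the
    second the new exponent \<open>k\<close> merges with the exponent at position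
    \<open>i\<close>.\<close>
  have "?M ks H = (\<Sum>i<ell. hy i H ^ k) * ?M ks' H - (\<Sum>i<m. ?M (ks'[i := ks' ! i + k]) H)" for H
  proof -
    have "?M ks H = (\<Sum>xs\<in>dlists m. \<Sum>x\<in>{..<ell} - set xs. hy x H ^ k * (\<Prod>j<m. hy (xs ! j) H ^ (ks' ! j)))"
      using ks by (simp add: sum_dlists_Suc prod.lessThan_Suc_shift del: prod.lessThan_Suc)
    also have "\<dots> = (\<Sum>xs\<in>dlists m. ((\<Sum>i<ell. hy i H ^ k) - (\<Sum>i<m. hy (xs ! i) H ^ k)) * (\<Prod>j<m. hy (xs ! j) H ^ (ks' ! j)))"
    proof (rule sum.cong[OF refl])
      fix xs assume xs: "xs \<in> dlists m"
      have "(\<Sum>x\<in>{..<ell} - set xs. hy x H ^ k) = (\<Sum>i<ell. hy i H ^ k) - (\<Sum>x\<in>set xs. hy x H ^ k)"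
        by (rule sum_diff) (use xs in \<open>auto simp: dlists_def\<close>)
      also have "(\<Sum>x\<in>set xs. hy x H ^ k) = (\<Sum>i<m. hy (xs ! i) H ^ k)"
      proof -
        have "inj_on ((!) xs) {..<m}" "(!) xs ` {..<m} = set xs"
          using xs by (auto simp: dlists_def inj_on_nth set_conv_nth)
        then show ?thesis using sum.reindex[of "(!) xs" "{..<m}" "\<lambda>x. hy x H ^ k"] by simp
      qed
      finally show "(\<Sum>x\<in>{..<ell} - set xs. hy x H ^ k * (\<Prod>j<m. hy (xs ! j) H ^ (ks' ! j))) =
        ((\<Sum>i<ell. hy i H ^ k) - (\<Sum>i<m. hy (xs ! i) H ^ k)) * (\<Prod>j<m. hy (xs ! j) H ^ (ks' ! j))"
        by (simp add: sum_distrib_right[symmetric])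
    qed
    also have "\<dots> = (\<Sum>i<ell. hy i H ^ k) * ?M ks' H - (\<Sum>i<m. \<Sum>xs\<in>dlists m. hy (xs ! i) H ^ k * (\<Prod>j<m. hy (xs ! j) H ^ (ks' ! j)))"
      unfolding sum.swap[of _ _ "{..<m}"] using ks
      by (simp add: left_diff_distrib sum_subtractf sum_distrib_left sum_distrib_right)
    also have "(\<Sum>i<m. \<Sum>xs\<in>dlists m. hy (xs ! i) H ^ k * (\<Prod>j<m. hy (xs ! j) H ^ (ks' ! j))) =
       (\<Sum>i<m. ?M (ks'[i := ks' ! i + k]) H)"
    proof (rule sum.cong[OF refl])
      fix i assume i: "i \<in> {..<m}"
      have "hy (xs ! i) H ^ k * (\<Prod>j<m. hy (xs ! j) H ^ (ks' ! j)) = (\<Prod>j<m. hy (xs ! j) H ^ (ks'[i := ks' ! i + k] ! j))" for xs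
      proof -
        have s: "(\<Prod>j<m. h j) = h i * (\<Prod>j\<in>{..<m} - {i}. h j)" for h :: "nat \<Rightarrow> complex"
          using i by (intro prod.remove) auto
        have "(\<Prod>j\<in>{..<m} - {i}. hy (xs ! j) H ^ (ks'[i := ks' ! i + k] ! j)) = (\<Prod>j\<in>{..<m} - {i}. hy (xs ! j) H ^ (ks' ! j))"
          by (rule prod.cong) auto
        then show ?thesis unfolding s using i ks by (simp add: power_add mult_ac)
      qed
      then show "(\<Sum>xs\<in>dlists m. hy (xs ! i) H ^ k * (\<Prod>j<m. hy (xs ! j) H ^ (ks' ! j))) = ?M (ks'[i := ks' ! i + k]) H"
        using ks by simp
    qed
    finally show ?thesis .
  qed
  moreover have "Inv (\<lambda>H. (\<Sum>i<ell. hy i H ^ k) * ?M ks' H - (\<Sum>i<m. ?M (ks'[i := ks' ! i + k]) H))"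
  proof (rule Inv_diff[OF Inv_mult[OF Inv_power_sum] Inv_sum])
    show "Inv (?M ks')" using Suc.hyps(1)[of ks'] ks by simp
    show "Inv (?M (ks'[i := ks' ! i + k]))" for i
      using Suc.hyps(1)[of "ks'[i := ks' ! i + k]"] ks by simp
  qed
  ultimately show ?case by simp
qed

section \<open>Averaging over sign changes and permutations\<close>

definition mono :: "(nat \<Rightarrow> nat) \<Rightarrow> cmat \<Rightarrow> complex" where
  "mono m H = (\<Prod>i<ell. H i i ^ m i)"

text \<open>Invariance holds only on the Cartan subalgebra, where in type A the coordinates are
  dependent. It is therefore exploited by averaging and filtering such lists, not by comparing
  coefficients.\<close>

definition rep :: "(complex \<times> (nat \<Rightarrow> nat)) list \<Rightarrow> cmat \<Rightarrow> complex" where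
  "rep xs H = (\<Sum>(c, m)\<leftarrow>xs. c * mono m H)"

abbreviation diag_entries :: "(cmat \<Rightarrow> complex) set" where
  "diag_entries \<equiv> (\<lambda>i H. H i i) ` {..<ell}"

lemma rep_mult: "\<exists>zs. rep zs = (\<lambda>H. rep xs H * rep ys H)"
proof (induction xs)
  case Nil
  show ?case by (rule exI[of _ "[]"]) (simp add: rep_def fun_eq_iff)
next
  case (Cons x xs)
  obtain c m where x: "x = (c, m)" by (cases x)
  obtain zs where zs: "rep zs = (\<lambda>H. rep xs H * rep ys H)" using Cons by blast
  define us where "us = map (\<lambda>(d, m'). (c * d, \<lambda>i. m i + m' i)) ys"
  have "rep us H = c * mono m H * rep ys H" for H
    unfolding us_def
    by (induction ys) (auto simp: rep_def mono_def power_add prod.distrib algebra_simps)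
  moreover have "rep (us @ zs) H = rep us H + rep zs H" for H by (simp add: rep_def)
  ultimately have "rep (us @ zs) = (\<lambda>H. rep (x # xs) H * rep ys H)"
    by (simp add: fun_eq_iff zs x) (simp add: rep_def algebra_simps)
  then show ?case by blast
qed

lemma polyf_rep: "f \<in> polyf diag_entries \<Longrightarrow> \<exists>xs. f = rep xs"
proof (induction rule: polyf.induct)
  case (polyf_const c)
  show ?case by (rule exI[of _ "[(c, \<lambda>_. 0)]"]) (simp add: rep_def mono_def fun_eq_iff)
next
  case (polyf_gen g)
  then obtain i where i: "i < ell" "g = (\<lambda>H. H i i)" by auto
  have "mono (\<lambda>j. if j = i then 1 else 0) H = H i i" for H
  proof -
    have "mono (\<lambda>j. if j = i then 1 else 0) H = (\<Prod>j<ell. if j = i then H i i else 1)"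
      unfolding mono_def by (rule prod.cong) auto
    then show ?thesis using i by simp
  qed
  then show ?case
    by (intro exI[of _ "[(1, \<lambda>j. if j = i then 1 else 0)]"]) (simp add: rep_def i fun_eq_iff)
next
  case (polyf_add f g)
  then obtain xs ys where "f = rep xs" "g = rep ys" by blast
  then show ?case by (intro exI[of _ "xs @ ys"]) (simp add: rep_def fun_eq_iff)
next
  case (polyf_mult f g)
  then show ?case using rep_mult by metis
qed

text \<open>Averaging over a sign change keeps exactly the monomials that it fixes.\<close>
lemma rep_sign_filter:
  assumes f: "\<And>H. H \<in> \<hh> \<Longrightarrow> f H = rep xs H" and T: "T \<subseteq> {..<ell}"
    and w: "\<And>H. H \<in> \<hh> \<Longrightarrow> w H \<in> \<hh> \<and> f (w H) = f H"
      "\<And>H k. H \<in> \<hh> \<Longrightarrow> k < ell \<Longrightarrow> w H k k = (if k \<in> T then - H k k else H k k)"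
    and H: "H \<in> \<hh>"
  shows "f H = rep (filter (\<lambda>(c, m). even (\<Sum>k\<in>T. m k)) xs) H"
proof -
  have mono: "mono m (w H) = (- 1) ^ (\<Sum>k\<in>T. m k) * mono m H" for m
  proof -
    have "mono m (w H) = (\<Prod>k<ell. (if k \<in> T then (- 1) ^ m k else 1) * H k k ^ m k)"
      unfolding mono_def
    proof (rule prod.cong[OF refl])
      fix k assume "k \<in> {..<ell}"
      then show "w H k k ^ m k = (if k \<in> T then (- 1) ^ m k else 1) * H k k ^ m k"
        using w(2)[OF H, of k] power_minus[of "H k k" "m k"] by auto
    qed
    also have "\<dots> = (\<Prod>k<ell. if k \<in> T then (- 1) ^ m k else 1) * mono m H"
      by (simp add: prod.distrib mono_def)
    also have "(\<Prod>k<ell. if k \<in> T then (- 1) ^ m k else (1 :: complex)) = (\<Prod>k\<in>T. (- 1) ^ m k)"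
      using T by (simp add: prod.If_cases Int_absorb1)
    also have "\<dots> = (- 1) ^ (\<Sum>k\<in>T. m k)" by (simp add: power_sum)
    finally show ?thesis .
  qed
  have "rep xs H + rep xs (w H) = 2 * rep (filter (\<lambda>(c, m). even (\<Sum>k\<in>T. m k)) xs) H" for xs
    by (induction xs) (auto simp: rep_def mono algebra_simps)
  moreover have "f H = rep xs H" "f H = rep xs (w H)" using f w(1) H by metis+
  ultimately show ?thesis by (metis mult_2 mult_cancel_left zero_neq_numeral)
qed

text \<open>Each sign change only filters the list, so the parities already obtained survive the
  next one.\<close>

lemma rep_signs_filter:
  assumes f: "\<And>H. H \<in> \<hh> \<Longrightarrow> f H = rep xs H" and inv: "\<And>w H. w \<in> WG \<Longrightarrow> H \<in> \<hh> \<Longrightarrow> f (w H) = f H"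
    and Ts: "\<And>T. T \<in> set Ts \<Longrightarrow> T \<subseteq> {..<ell} \<and> (\<exists>w\<in>WG. \<forall>H\<in>\<hh>. \<forall>k<ell. w H k k = (if k \<in> T then - H k k else H k k))"
  shows "\<exists>ys. (\<forall>H\<in>\<hh>. f H = rep ys H) \<and> (\<forall>(c, m)\<in>set ys. \<forall>T\<in>set Ts. even (\<Sum>k\<in>T. m k))"
  using Ts
proof (induction Ts)
  case Nil
  then show ?case using f by (intro exI[of _ xs]) auto
next
  case (Cons T Ts)
  then obtain ys where ys: "\<And>H. H \<in> \<hh> \<Longrightarrow> f H = rep ys H"
    "\<forall>(c, m)\<in>set ys. \<forall>T\<in>set Ts. even (\<Sum>k\<in>T. m k)" by auto
  obtain w where T: "T \<subseteq> {..<ell}" and w: "w \<in> WG" "\<And>H k. H \<in> \<hh> \<Longrightarrow> k < ell \<Longrightarrow> w H k k = (if k \<in> T then - H k k else H k k)"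
    using Cons.prems[of T] by auto
  have "f H = rep (filter (\<lambda>(c, m). even (\<Sum>k\<in>T. m k)) ys) H" if "H \<in> \<hh>" for H
  proof (rule rep_sign_filter[where w=w and T=T and xs=ys and f=f])
    show "w H \<in> \<hh> \<and> f (w H) = f H" if "H \<in> \<hh>" for H using that w WG_cartan inv by blast
  qed (use ys T w that in auto)
  then show ?case using ys(2)
    by (intro exI[of _ "filter (\<lambda>(c, m). even (\<Sum>k\<in>T. m k)) ys"]) auto
qed

text \<open>Outside type A, indices below \<open>ell\<close> never meet their mirror images, so in
  all types the root is a difference of two of the chosen coordinates and its reflection exchanges
  them.\<close>

lemma refl_swap:
  assumes ab: "a < ell" "b < ell" "a \<noteq> b" and k: "k < ell"
  shows "rvalid a b \<and> refl a b H k k = H (Transposition.transpose a b k) (Transposition.transpose a b k)"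
proof -
  have N: "a < N" "b < N" "k < N" using ab k ell_le by auto
  have nf: "fl x \<noteq> y" if "x < ell" "y < ell" "\<not> tA" for x y
  proof -
    have "N = 2 * n \<or> N = 2 * n + 1" using that t_cases3 N_B N_C N_D by blast
    then show ?thesis using that by (auto simp: fl_def ell_def)
  qed
  have v: "rvalid a b"
  proof (cases tA)
    case True
    then show ?thesis using N ab t_cases by (auto simp: rvalid_def)
  next
    case False
    then show ?thesis using nf[OF ab(1,2)] N ab by (auto simp: rvalid_def)
  qed
  have "Hc a b k k = (if k = a then 1 else 0) - (if k = b then 1 else 0)"
  proof (cases tA)
    case True
    then show ?thesis by (simp add: Hc_def nal_def Kr_def Em_def cmat_apply)
  next
    case False
    have ne: "fl a \<noteq> b" "fl a \<noteq> a" "fl b \<noteq> b" "fl a \<noteq> k" "fl b \<noteq> k" using nf False ab k by auto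
    then have "nal a b = 2" using False by (metis nal_def)
    then show ?thesis using False ne by (simp add: Hc_def Kr_def Em_def cmat_apply)
  qed
  then show ?thesis using v ab by (auto simp: refl_def al_def cmat_apply Transposition.transpose_def)
qed

lemma WG_permutes:
  assumes "p permutes {..<ell}"
  shows "\<exists>w\<in>WG. \<forall>H. \<forall>i<ell. w H i i = H (p i) (p i)"
  using assms finite_lessThan
proof (induction rule: permutes_induct)
  case id
  show ?case by (rule bexI[OF _ WG_id]) simp
next
  case (swap a b p)
  then obtain w where w: "w \<in> WG" "\<And>H i. i < ell \<Longrightarrow> w H i i = H (p i) (p i)" by blast
  have "rvalid a b" using refl_swap[of a b a] swap by auto
  then have "w \<circ> refl a b \<in> WG" using WG_comp WG_refl w by blast
  moreover have "(w \<circ> refl a b) H i i = H ((Transposition.transpose a b \<circ> p) i) ((Transposition.transpose a b \<circ> p) i)"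
    if "i < ell" for H i
  proof -
    have "p i < ell" using permutes_in_image[OF \<open>p permutes {..<ell}\<close>, of i] that by simp
    then show ?thesis using w(2)[OF that] refl_swap[of a b "p i"] swap by simp
  qed
  ultimately show ?case by blast
qed

lemma WG_dlist:
  assumes "xs \<in> dlists ell"
  shows "\<exists>w\<in>WG. \<forall>H. \<forall>i<ell. w H i i = H (xs ! i) (xs ! i)"
proof -
  define p where "p i = (if i < ell then xs ! i else i)" for i
  have i: "inj_on ((!) xs) {..<ell}" using assms by (auto simp: dlists_def inj_on_nth)
  have s: "(!) xs ` {..<ell} \<subseteq> {..<ell}"
  proof (intro image_subsetI)
    fix k assume "k \<in> {..<ell}"
    then have "xs ! k \<in> set xs" using assms by (simp add: dlists_def)
    then show "xs ! k \<in> {..<ell}" using assms unfolding dlists_def by blast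
  qed
  have "bij_betw ((!) xs) {..<ell} {..<ell}"
    unfolding bij_betw_def by (rule conjI[OF i endo_inj_surj[OF finite_lessThan s i]])
  then have "bij_betw p {..<ell} {..<ell}" by (rule bij_betw_cong[THEN iffD1, rotated]) (simp add: p_def)
  then have "p permutes {..<ell}" by (rule bij_imp_permutes) (simp add: p_def)
  from WG_permutes[OF this] show ?thesis by (auto simp: p_def)
qed

text \<open>In type C this is the reflection in the long root with indices \<open>i\<close> and
  \<open>fl i\<close>; in type B it is the one in the short root that pairs \<open>i\<close> with
  the middle index \<open>n\<close>, where the entry is zero.\<close>

lemma sign_change_BC:
  assumes "tB \<or> tC" "i < ell"
  shows "\<exists>w\<in>WG. \<forall>H\<in>\<hh>. \<forall>k<ell. w H k k = (if k \<in> {i} then - H k k else H k k)"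
proof -
  have nA: "\<not> tA" using assms t_cases3 by blast
  then have i: "i < n" using assms by (simp add: ell_def)
  show ?thesis
  proof (cases tC)
    case True
    have N: "N = 2 * n" using N_C True by blast
    have iN: "i < N" using i N by simp
    have ne: "fl i \<noteq> k" if "k < n" for k unfolding fl_def using that i N by auto
    have v: "rvalid i (fl i)" unfolding rvalid_def using i N fl_lt[OF iN] ne[of i] True t_cases by auto
    have "refl i (fl i) H k k = (if k \<in> {i} then - H k k else H k k)" if "H \<in> \<hh>" "k < n" for H k
    proof -
      have "H (fl i) (fl i) = - H i i" "fl (fl i) = i" using that nA iN by (simp_all add: cartan_nA)
      then show ?thesis using nA ne[of k] ne[of i] that
        by (auto simp: refl_def al_def Hc_def nal_def Kr_def Em_def cmat_apply)
    qed
    then show ?thesis using v WG_refl nA by (intro bexI[of _ "refl i (fl i)"]) (auto simp: ell_def)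
  next
    case False
    then have N: "N = 2 * n + 1" using N_B assms by blast
    have nN: "n < N" using N by simp
    have fn: "fl n = n" and ne: "\<And>k. k < n \<Longrightarrow> fl i \<noteq> k" "fl i \<noteq> n" unfolding fl_def using i N by auto
    have v: "rvalid i n" unfolding rvalid_def using i N ne by auto
    have "refl i n H k k = (if k \<in> {i} then - H k k else H k k)" if "H \<in> \<hh>" "k < n" for H k
    proof -
      have "H (fl n) (fl n) = - H n n" using that nA nN by (simp add: cartan_nA)
      then have "H n n = 0" using fn by simp
      moreover have "nal i n = 1" using nA fn ne i by (simp add: nal_def)
      ultimately show ?thesis using nA ne(1)[of k] that fn i
        by (auto simp: refl_def al_def Hc_def Kr_def Em_def cmat_apply)
    qed
    then show ?thesis using v WG_refl nA by (intro bexI[of _ "refl i n"]) (auto simp: ell_def)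
  qed
qed

text \<open>The reflections in the difference and in the sum of two coordinates compose to the
  change of both signs. The sum is the root with indices \<open>i\<close> and
  \<open>fl j\<close>.\<close>

lemma sign_change_D:
  assumes "tD" "i < ell" "j < ell" "i \<noteq> j"
  shows "\<exists>w\<in>WG. \<forall>H\<in>\<hh>. \<forall>k<ell. w H k k = (if k \<in> {i, j} then - H k k else H k k)"
proof -
  have nA: "\<not> tA" using assms t_cases3 by blast
  then have ij: "i < n" "j < n" using assms by (auto simp: ell_def)
  have N: "N = 2 * n" using N_D assms by blast
  have ne: "fl i \<noteq> k" "fl j \<noteq> k" if "k < n" for k unfolding fl_def using that ij N by auto
  have ffj: "fl (fl j) = j" "fl j \<noteq> fl i" unfolding fl_def using ij N assms by auto
  have v: "rvalid i (fl j)" unfolding rvalid_def using ij N fl_lt[of j] ne[of i] ffj by auto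
  have r: "refl i (fl j) H k k = H k k - (H i i + H j j) * ((if k = i then 1 else 0) + (if k = j then 1 else 0))"
    if "H \<in> \<hh>" "k < n" for H k
  proof -
    have jN: "j < N" using ij N by simp
    have "H (fl j) (fl j) = - H j j" using that nA jN by (simp add: cartan_nA)
    moreover have "nal i (fl j) = 2" using nA ne[of i] ne[of j] ffj ij by (simp add: nal_def)
    ultimately show ?thesis using nA ne[of k] that ffj
      by (auto simp: refl_def al_def Hc_def Kr_def Em_def cmat_apply)
  qed
  have v': "rvalid i j" using refl_swap[OF assms(2,3,4,2)] by blast
  have "(refl i (fl j) \<circ> refl i j) H k k = (if k \<in> {i, j} then - H k k else H k k)" if H: "H \<in> \<hh>" and k: "k < n" for H k
  proof -
    have kl: "k < ell" using k nA by (simp add: ell_def)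
    have "refl i j H \<in> \<hh>" using H v' refl_cartan rvalidD by blast
    then show ?thesis using r[OF _ k] refl_swap[OF assms(2,3,4)] kl assms
      by (auto simp: Transposition.transpose_def)
  qed
  moreover have "refl i (fl j) \<circ> refl i j \<in> WG" using v v' WG_refl WG_step by blast
  ultimately show ?thesis using nA by (intro bexI[of _ "refl i (fl j) \<circ> refl i j"]) (auto simp: ell_def)
qed

lemma prod_dlist: "xs \<in> dlists ell \<Longrightarrow> (\<Prod>i<ell. h (xs ! i)) = (\<Prod>i<ell. h i :: complex)"
proof -
  assume xs: "xs \<in> dlists ell"
  have i: "inj_on ((!) xs) {..<ell}" using xs by (auto simp: dlists_def inj_on_nth)
  have s: "(!) xs ` {..<ell} \<subseteq> {..<ell}"
  proof (intro image_subsetI)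
    fix k assume "k \<in> {..<ell}"
    then have "xs ! k \<in> set xs" using xs by (simp add: dlists_def)
    then show "xs ! k \<in> {..<ell}" using xs unfolding dlists_def by blast
  qed
  have "(!) xs ` {..<ell} = {..<ell}" by (rule endo_inj_surj[OF finite_lessThan s i])
  then show ?thesis using prod.reindex[OF i, of h] by simp
qed

lemma Inv_symmetrised_even:
  assumes "tA \<or> (\<forall>k<ell. even (m k))"
  shows "Inv (\<lambda>H. \<Sum>xs\<in>dlists ell. \<Prod>i<ell. H (xs ! i) (xs ! i) ^ m i)"
proof -
  define ks where "ks = map (\<lambda>i. if tA then m i else m i div 2) [0..<ell]"
  have "length ks = ell" by (simp add: ks_def)
  moreover have "(\<Prod>i<ell. H (xs ! i) (xs ! i) ^ m i) = (\<Prod>j<ell. hy (xs ! j) H ^ (ks ! j))" for xs H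
  proof (rule prod.cong[OF refl])
    fix i assume i: "i \<in> {..<ell}"
    show "H (xs ! i) (xs ! i) ^ m i = hy (xs ! i) H ^ (ks ! i)"
    proof (cases tA)
      case True
      then show ?thesis using i by (simp add: ks_def hy_def)
    next
      case False
      then have "m i = 2 * (m i div 2)" using assms i by auto
      then have "H (xs ! i) (xs ! i) ^ m i = (H (xs ! i) (xs ! i) ^ 2) ^ (m i div 2)"
        by (metis power_mult)
      then show ?thesis using False i by (simp add: ks_def hy_def)
    qed
  qed
  ultimately show ?thesis using Inv_augmented_monomial[of ks] by simp
qed

text \<open>After the sign filter, averaging over permutations writes \<open>f\<close> as a
  combination of symmetrised monomials. Even exponents, or any in type A, give symmetric functions
  of the \<open>hy\<close>. In type D the filter also keeps monomials with all exponents odd, and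
  these contain the Pfaffian as a factor.\<close>

theorem Inv_of_refl_invariant:
  assumes f: "f \<in> polyf diag_entries"
    and rinv: "\<And>i j H. rvalid i j \<Longrightarrow> H \<in> \<hh> \<Longrightarrow> f (refl i j H) = f H"
  shows "Inv f"
proof -
  have inv: "f (w H) = f H" if "w \<in> WG" "H \<in> \<hh>" for w H
    using that
  proof (induction rule: WG.induct)
    case (WG_step w i j)
    then show ?case using rinv[OF WG_step(2) WG_cartan[OF WG_step(1)]] by simp
  qed simp
  obtain xs where xs: "f = rep xs" using polyf_rep[OF f] by blast
  \<comment> \<open>In type D only pairs of signs change; the pairs through \<open>0\<close> already
    force all exponents of a monomial to have the same parity.\<close>
  define Ts where "Ts = (if tA then [] else if tD then map (\<lambda>j. {0, j}) [1..<ell] else map (\<lambda>i. {i}) [0..<ell])"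
  have "\<exists>ys. (\<forall>H\<in>\<hh>. f H = rep ys H) \<and> (\<forall>(c, m)\<in>set ys. \<forall>T\<in>set Ts. even (\<Sum>k\<in>T. m k))"
  proof (rule rep_signs_filter[OF _ inv])
    show "f H = rep xs H" for H by (simp add: xs)
    fix T assume T: "T \<in> set Ts"
    consider tA | tD "\<not> tA" | "tB \<or> tC" "\<not> tA" "\<not> tD" using t_cases3 by blast
    then show "T \<subseteq> {..<ell} \<and> (\<exists>w\<in>WG. \<forall>H\<in>\<hh>. \<forall>k<ell. w H k k = (if k \<in> T then - H k k else H k k))"
    proof cases
      case 1
      then show ?thesis using T by (simp add: Ts_def)
    next
      case 2
      then obtain j where j: "1 \<le> j" "j < ell" "T = {0, j}" using T by (auto simp: Ts_def)
      then show ?thesis using sign_change_D[OF 2(1), of 0 j] by auto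
    next
      case 3
      then obtain i where "i < ell" "T = {i}" using T by (auto simp: Ts_def)
      then show ?thesis using sign_change_BC[OF 3(1), of i] by auto
    qed
  qed
  then obtain ys where ys: "\<And>H. H \<in> \<hh> \<Longrightarrow> f H = rep ys H"
    "\<And>c m T. (c, m) \<in> set ys \<Longrightarrow> T \<in> set Ts \<Longrightarrow> even (\<Sum>k\<in>T. m k)" by fast
  have mono: "Inv (\<lambda>H. \<Sum>zs\<in>dlists ell. \<Prod>i<ell. H (zs ! i) (zs ! i) ^ m i)" if cm: "(c, m) \<in> set ys" for c m
  proof (cases "tA \<or> (\<forall>k<ell. even (m k))")
    case True
    then show ?thesis by (rule Inv_symmetrised_even)
  next
    case False
    then have nA: "\<not> tA" by blast
    have D: tD
    proof (rule ccontr)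
      assume "\<not> tD"
      then have "even (m k)" if "k < ell" for k using ys(2)[OF cm, of "{k}"] nA that by (auto simp: Ts_def)
      then show False using False by blast
    qed
    have "even (m 0 + m j)" if "1 \<le> j" "j < ell" for j
      using ys(2)[OF cm, of "{0, j}"] nA D that by (auto simp: Ts_def)
    then have "even (m 0) \<longleftrightarrow> even (m j)" if "j < ell" for j
      using that by (cases "j = 0") auto
    then have odd: "odd (m j)" if "j < ell" for j using False that by blast
    \<comment> \<open>The product of all coordinates is symmetric, so it can be pulled out of each
      summand; lowering all odd exponents by one leaves even ones.\<close>
    have "Inv (\<lambda>H. \<Prod>i<ell. H i i)"
      using pfaffian_invariant[OF D] nA unfolding Inv_def by (simp add: ell_def)
    moreover have "Inv (\<lambda>H. \<Sum>zs\<in>dlists ell. \<Prod>i<ell. H (zs ! i) (zs ! i) ^ (m i - 1))"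
      by (rule Inv_symmetrised_even) (use odd in auto)
    ultimately have "Inv (\<lambda>H. (\<Prod>i<ell. H i i) * (\<Sum>zs\<in>dlists ell. \<Prod>i<ell. H (zs ! i) (zs ! i) ^ (m i - 1)))"
      by (rule Inv_mult)
    then show ?thesis
    proof (rule Inv_cong)
      fix H :: cmat
      have "(\<Prod>i<ell. H i i) * (\<Prod>i<ell. H (zs ! i) (zs ! i) ^ (m i - 1)) = (\<Prod>i<ell. H (zs ! i) (zs ! i) ^ m i)"
        if "zs \<in> dlists ell" for zs
      proof -
        have "(\<Prod>i<ell. H i i) = (\<Prod>i<ell. H (zs ! i) (zs ! i))"
          using prod_dlist[OF that, of "\<lambda>i. H i i"] by simp
        then have "(\<Prod>i<ell. H i i) * (\<Prod>i<ell. H (zs ! i) (zs ! i) ^ (m i - 1)) =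
          (\<Prod>i<ell. H (zs ! i) (zs ! i) * H (zs ! i) (zs ! i) ^ (m i - 1))"
          by (simp add: prod.distrib)
        also have "\<dots> = (\<Prod>i<ell. H (zs ! i) (zs ! i) ^ m i)"
        proof (rule prod.cong[OF refl])
          fix i assume "i \<in> {..<ell}"
          then have "m i \<noteq> 0" using odd[of i] by (auto intro: Nat.gr0I)
          then show "H (zs ! i) (zs ! i) * H (zs ! i) (zs ! i) ^ (m i - 1) = H (zs ! i) (zs ! i) ^ m i"
            by (simp add: power_eq_if)
        qed
        finally show ?thesis .
      qed
      then show "(\<Prod>i<ell. H i i) * (\<Sum>zs\<in>dlists ell. \<Prod>i<ell. H (zs ! i) (zs ! i) ^ (m i - 1)) =
        (\<Sum>zs\<in>dlists ell. \<Prod>i<ell. H (zs ! i) (zs ! i) ^ m i)"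
        by (simp add: sum_distrib_left)
    qed
  qed
  let ?d = "of_nat (card (dlists ell)) :: complex"
  have "[0..<ell] \<in> dlists ell" by (auto simp: dlists_def)
  then have d: "?d \<noteq> 0" using finite_dlists by auto
  have "Inv (\<lambda>H. \<Sum>x\<leftarrow>ys. (fst x / ?d) * (\<Sum>zs\<in>dlists ell. \<Prod>i<ell. H (zs ! i) (zs ! i) ^ (snd x i)))"
    by (intro Inv_sum_list Inv_mult Inv_const) (use mono in auto)
  then show ?thesis
  proof (rule Inv_cong)
    fix H assume H: "H \<in> \<hh>"
    have "f H = (\<Sum>x\<leftarrow>ys. fst x * (\<Prod>i<ell. H (zs ! i) (zs ! i) ^ (snd x i)))" if zs: "zs \<in> dlists ell" for zs
    proof -
      obtain w where w: "w \<in> WG" "\<And>i. i < ell \<Longrightarrow> w H i i = H (zs ! i) (zs ! i)" using WG_dlist[OF zs] by blast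
      have "f H = rep ys (w H)" using inv[OF w(1) H] ys(1) WG_cartan[OF w(1) H] by simp
      then show ?thesis by (simp add: rep_def mono_def w(2) case_prod_unfold)
    qed
    then have "(\<Sum>zs\<in>dlists ell. f H) = (\<Sum>zs\<in>dlists ell. \<Sum>x\<leftarrow>ys. fst x * (\<Prod>i<ell. H (zs ! i) (zs ! i) ^ (snd x i)))"
      by (intro sum.cong) auto
    also have "\<dots> = (\<Sum>x\<leftarrow>ys. \<Sum>zs\<in>dlists ell. fst x * (\<Prod>i<ell. H (zs ! i) (zs ! i) ^ (snd x i)))"
      by (induction ys) (simp_all add: sum.distrib)
    finally have "?d * f H = (\<Sum>x\<leftarrow>ys. fst x * (\<Sum>zs\<in>dlists ell. \<Prod>i<ell. H (zs ! i) (zs ! i) ^ (snd x i)))"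
      by (simp add: sum_distrib_left)
    then have "f H = (\<Sum>x\<leftarrow>ys. fst x * (\<Sum>zs\<in>dlists ell. \<Prod>i<ell. H (zs ! i) (zs ! i) ^ (snd x i))) / ?d"
      using d by (simp add: field_simps)
    also have "\<dots> = (\<Sum>x\<leftarrow>ys. (fst x / ?d) * (\<Sum>zs\<in>dlists ell. \<Prod>i<ell. H (zs ! i) (zs ! i) ^ (snd x i)))"
      by (induction ys) (simp_all add: add_divide_distrib)
    finally show "(\<Sum>x\<leftarrow>ys. (fst x / ?d) * (\<Sum>zs\<in>dlists ell. \<Prod>i<ell. H (zs ! i) (zs ! i) ^ (snd x i))) = f H" by simp
  qed
qed

end

section \<open>Common eigenvectors\<close>

definition evalp :: "complex^'d^'d \<Rightarrow> complex poly \<Rightarrow> complex^'d \<Rightarrow> complex^'d" where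
  "evalp A p v = (\<Sum>i\<le>degree p. coeff p i *s (((*v) A) ^^ i) v)"

lemma evalp_bound:
  assumes "degree p \<le> m"
  shows "evalp A p v = (\<Sum>i\<le>m. coeff p i *s (((*v) A) ^^ i) v)"
  unfolding evalp_def
  by (rule sum.mono_neutral_left) (use assms in \<open>auto simp: coeff_eq_0\<close>)

lemma evalp_add: "evalp A (p + q) v = evalp A p v + evalp A q v"
proof -
  let ?m = "max (degree p) (degree q)"
  have "degree (p + q) \<le> ?m" by (rule degree_add_le_max)
  then show ?thesis
    by (simp add: evalp_bound[of _ ?m] vec.scale_left_distrib sum.distrib)
qed

lemma evalp_smult: "evalp A (smult c p) v = c *s evalp A p v"
  using degree_smult_le[of c p]
  by (simp add: evalp_bound[of _ "degree p"] vec.scale_sum_right vec.scale_scale)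

lemma evalp_shift: "evalp A (pCons 0 p) v = A *v evalp A p v"
proof -
  have "evalp A (pCons 0 p) v = (\<Sum>i\<le>Suc (degree p). coeff (pCons 0 p) i *s (((*v) A) ^^ i) v)"
    by (rule evalp_bound) (simp add: degree_pCons_le)
  also have "\<dots> = (\<Sum>i\<le>degree p. coeff p i *s (A *v (((*v) A) ^^ i) v))"
    unfolding sum.atMost_Suc_shift by simp
  also have "\<dots> = A *v evalp A p v"
    by (simp add: evalp_def vec.linear_sum[OF matrix_vector_mul_linear_gen] vector_scalar_commute)
  finally show ?thesis .
qed

lemma evalp_factor: "evalp A ([:- l, 1:] * q) v = A *v evalp A q v - l *s evalp A q v"
proof -
  have "[:- l, 1:] * q = smult (- l) q + pCons 0 q" by simp
  then show ?thesis by (simp only: evalp_add evalp_smult evalp_shift) simp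
qed

lemma evalp_invariant_subspace:
  assumes S: "vec.subspace S" "\<And>x. x \<in> S \<Longrightarrow> A *v x \<in> S" and v: "v \<in> S"
  shows "evalp A p v \<in> S"
proof -
  have "(((*v) A) ^^ i) v \<in> S" for i by (induction i) (auto simp: v S)
  then show ?thesis unfolding evalp_def by (intro vec.subspace_sum[OF S(1)] vec.subspace_scale[OF S(1)])
qed

lemma annihilating_polynomial:
  fixes A :: "complex^'d^'d"
  shows "\<exists>p. p \<noteq> 0 \<and> evalp A p v = 0"
proof -
  let ?f = "\<lambda>i. (((*v) A) ^^ i) v"
  let ?m = "CARD('d)"
  show ?thesis
  \<comment> \<open>Linear dependence is a property of the set of iterates, which does not see
    repetitions. Two equal iterates give the polynomial directly.\<close>
  proof (cases "inj_on ?f {..?m}")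
    case False
    then obtain i j where ij: "i \<noteq> j" "?f i = ?f j" by (auto simp: inj_on_def)
    define p :: "complex poly" where "p = monom 1 i - monom 1 j"
    have "coeff p i \<noteq> 0" using ij by (simp add: p_def)
    then have "p \<noteq> 0" by auto
    have m: "evalp A (monom 1 k) v = ?f k" for k
    proof -
      have "evalp A (monom 1 k) v = (\<Sum>i\<le>k. if i = k then ?f k else 0)"
        unfolding evalp_def by (rule sum.cong) (auto simp: degree_monom_eq)
      then show ?thesis by simp
    qed
    have "p = monom 1 i + smult (- 1) (monom 1 j)" by (simp add: p_def)
    then have "evalp A p v = 0" using ij by (simp only: evalp_add evalp_smult m) simp
    with \<open>p \<noteq> 0\<close> show ?thesis by blast
  next
    case True
    let ?B = "?f ` {..?m}"
    have "card ?B = Suc ?m" using True by (simp add: card_image)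
    have "vec.dependent ?B"
    proof (rule ccontr)
      assume "vec.independent ?B"
      from vec.independent_card_le_dim[OF subset_UNIV this] show False
        using \<open>card ?B = Suc ?m\<close> unfolding vec_dim_card by simp
    qed
    then obtain u w where u: "w \<in> ?B" "u w \<noteq> 0" "(\<Sum>x\<in>?B. u x *s x) = 0"
      by (subst (asm) vec.dependent_finite) auto
    define p where "p = (\<Sum>i\<le>?m. monom (u (?f i)) i)"
    have c: "coeff p i = (if i \<le> ?m then u (?f i) else 0)" for i
      by (simp add: p_def coeff_sum)
    have "degree p \<le> ?m" by (rule degree_le) (simp add: c)
    then have "evalp A p v = (\<Sum>i\<le>?m. u (?f i) *s ?f i)" by (simp add: evalp_bound c)
    also have "\<dots> = (\<Sum>x\<in>?B. u x *s x)" by (subst sum.reindex[OF True]) simp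
    finally have "evalp A p v = 0" using u by simp
    moreover obtain i where "i \<le> ?m" "u (?f i) \<noteq> 0" using u by auto
    then have "p \<noteq> 0" using c[of i] by auto
    ultimately show ?thesis by blast
  qed
qed

text \<open>Linear factors are split off an annihilating polynomial of \<open>v\<close>. The first
  cofactor \<open>q\<close> with \<open>evalp A q v \<noteq> 0\<close> gives an eigenvector, which
  lies in \<open>S\<close> by invariance.\<close>

lemma eigenvector_in_invariant_subspace:
  fixes A :: "complex^'d^'d"
  assumes S: "vec.subspace S" "\<And>x. x \<in> S \<Longrightarrow> A *v x \<in> S" and v: "v \<in> S" "v \<noteq> 0"
  shows "\<exists>l w. w \<in> S \<and> w \<noteq> 0 \<and> A *v w = l *s w"
proof -
  have "\<exists>l w. w \<in> S \<and> w \<noteq> 0 \<and> A *v w = l *s w" if "p \<noteq> 0" "evalp A p v = 0" for p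
    using that
  proof (induction "degree p" arbitrary: p rule: less_induct)
    case less
    show ?case
    proof (cases "degree p = 0")
      case True
      then obtain c where "p = [:c:]" by (rule degree_eq_zeroE)
      then show ?thesis using less v by (simp add: evalp_def)
    next
      case False
      then obtain l where "poly p l = 0"
        using fundamental_theorem_of_algebra[of p] constant_degree[of p] by auto
      then obtain q where q: "p = [:- l, 1:] * q" by (auto simp: poly_eq_0_iff_dvd dvd_def)
      with less have "q \<noteq> 0" by auto
      then have "degree p = degree [:- l, 1:] + degree q" unfolding q by (intro degree_mult_eq) auto
      then have dq: "degree q < degree p" by simp
      show ?thesis
      proof (cases "evalp A q v = 0")
        case True
        then show ?thesis using less.hyps[OF dq \<open>q \<noteq> 0\<close>] by blast
      next
        case F: False
        have "A *v evalp A q v = l *s evalp A q v" using less(3) unfolding q evalp_factor by simp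
        then show ?thesis using F evalp_invariant_subspace[OF S v(1)] by blast
      qed
    qed
  qed
  then show ?thesis using annihilating_polynomial by blast
qed

text \<open>In a nonzero invariant subspace of least dimension, an eigenspace of one operator is
  invariant under all the commuting ones, so it is the whole subspace. Every operator then acts
  there as a scalar, however large the family is.\<close>

lemma common_eigenvector:
  fixes F :: "'h \<Rightarrow> complex^'d^'d"
  assumes comm: "\<And>a b. a \<in> I \<Longrightarrow> b \<in> I \<Longrightarrow> F a ** F b = F b ** F a"
  shows "\<exists>\<nu> v. v \<noteq> 0 \<and> (\<forall>a\<in>I. F a *v v = \<nu> a *s v)"
proof -
  define P where "P S \<longleftrightarrow> vec.subspace S \<and> S \<noteq> {0} \<and> (\<forall>a\<in>I. \<forall>x\<in>S. F a *v x \<in> S)" for S :: "(complex^'d) set"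
  have "(1 :: complex^'d) \<noteq> 0" by (simp add: vec_eq_iff)
  then have "P UNIV" unfolding P_def by (metis UNIV_I singletonD vec.subspace_UNIV)
  then obtain S where S: "P S" and min: "\<And>T. P T \<Longrightarrow> vec.dim S \<le> vec.dim T"
    using ex_has_least_nat[of P UNIV vec.dim] by blast
  have sub: "vec.subspace S" and "S \<noteq> {0}" and inv: "\<And>a x. a \<in> I \<Longrightarrow> x \<in> S \<Longrightarrow> F a *v x \<in> S"
    using S by (auto simp: P_def)
  then obtain v where v: "v \<in> S" "v \<noteq> 0" using vec.subspace_0 by blast
  have "\<exists>l. F a *v v = l *s v" if a: "a \<in> I" for a
  proof -
    obtain l w where w: "w \<in> S" "w \<noteq> 0" "F a *v w = l *s w"
      using eigenvector_in_invariant_subspace[OF sub inv[OF a] v] by blast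
    define T where "T = {x \<in> S. F a *v x = l *s x}"
    have "vec.subspace T"
      unfolding vec.subspace_def T_def
      using vec.subspace_0[OF sub] vec.subspace_add[OF sub] vec.subspace_scale[OF sub]
      by (auto simp: matrix_vector_right_distrib vec.scale_right_distrib vector_scalar_commute mult.commute)
    moreover have "F b *v x \<in> T" if "b \<in> I" "x \<in> T" for b x
    proof -
      have x: "x \<in> S" "F a *v x = l *s x" using that by (auto simp: T_def)
      have "F a *v (F b *v x) = F b *v (F a *v x)"
        using comm[OF a that(1)] by (simp add: matrix_vector_mul_assoc)
      also have "\<dots> = l *s (F b *v x)" by (simp add: x vector_scalar_commute)
      finally show ?thesis using inv that x by (simp add: T_def)
    qed
    moreover have "T \<noteq> {0}" using w by (auto simp: T_def)
    ultimately have "P T" by (simp add: P_def)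
    then have "vec.dim S \<le> vec.dim T" by (rule min)
    moreover have "T \<subseteq> S" by (auto simp: T_def)
    ultimately have "T = S" using vec.subspace_dim_equal[of T S] \<open>vec.subspace T\<close> sub by blast
    then show ?thesis using v by (auto simp: T_def)
  qed
  then have "\<forall>a\<in>I. \<exists>l. F a *v v = l *s v" by blast
  from bchoice[OF this] show ?thesis using v by blast
qed

section \<open>Dual functionals of a basis\<close>

context lie
begin

definition pair :: "(nat \<Rightarrow> nat \<Rightarrow> complex) \<Rightarrow> cmat \<Rightarrow> complex" where
  "pair c A = (\<Sum>a<N. \<Sum>b<N. c a b * A a b)"

lemma pair_linear: "pair c (A + B) = pair c A + pair c B" "pair c (x *\<^sub>m A) = x * pair c A"
  "pair c (A - B) = pair c A - pair c B"
  by (simp_all add: pair_def sum.distrib sum_subtractf sum_distrib_left cmat_apply algebra_simps)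

lemma pair_sum: "pair c (\<Sum>k\<in>K. f k) = (\<Sum>k\<in>K. pair c (f k))"
proof (induction K rule: infinite_finite_induct)
  case (insert x F)
  then show ?case by (simp only: sum.insert[OF insert(1,2)] pair_linear)
qed (simp_all only: sum.infinite sum.empty, simp_all add: pair_def)

lemma pair_polyf: "pair c \<in> polyf entries"
  unfolding pair_def[abs_def] by (intro polyf_sum polyf_cmult entry_polyf) auto

text \<open>This provides coordinates in the basis that are polynomial in the matrix entries and
  defined on all matrices, so that density applies to them.\<close>

lemma dual_functionals:
  fixes r :: nat and B :: "nat \<Rightarrow> cmat"
  assumes "\<And>j. j < r \<Longrightarrow> is_mat N (B j)"
    and "\<And>c. (\<Sum>j<r. c j *\<^sub>m B j) = 0 \<Longrightarrow> \<forall>j<r. c j = 0"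
  shows "\<exists>E. \<forall>j<r. \<forall>k<r. pair (E j) (B k) = (if j = k then 1 else 0)"
  using assms
proof (induction r)
  case 0
  show ?case by simp
next
  case (Suc r)
  have ind: "\<forall>j<r. c j = 0" if c: "(\<Sum>j<r. c j *\<^sub>m B j) = 0" for c
  proof -
    let ?c = "\<lambda>j. if j < r then c j else 0"
    have "(\<Sum>j<Suc r. ?c j *\<^sub>m B j) = (\<Sum>j<r. ?c j *\<^sub>m B j) + 0 *\<^sub>m B r" by simp
    also have "(\<Sum>j<r. ?c j *\<^sub>m B j) = (\<Sum>j<r. c j *\<^sub>m B j)" by (rule sum.cong) auto
    finally have "(\<Sum>j<Suc r. ?c j *\<^sub>m B j) = 0" using c by (simp add: smul_simps)
    note * = Suc.prems(2)[OF this]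
    show ?thesis
    proof (intro allI impI)
      fix j assume "j < r"
      then show "c j = 0" using *[rule_format, of j] by simp
    qed
  qed
  obtain E where E: "\<And>j k. j < r \<Longrightarrow> k < r \<Longrightarrow> pair (E j) (B k) = (if j = k then 1 else 0)"
  proof -
    have "\<exists>E. \<forall>j<r. \<forall>k<r. pair (E j) (B k) = (if j = k then 1 else 0)"
    proof (rule Suc.IH)
      show "is_mat N (B j)" if "j < r" for j using Suc.prems(1) that by simp
      show "\<forall>j<r. c j = 0" if "(\<Sum>j<r. c j *\<^sub>m B j) = 0" for c by (rule ind[OF that])
    qed
    then show ?thesis using that by blast
  qed
  define e where "e j = pair (E j) (B r)" for j
  \<comment> \<open>The part of \<open>B r\<close> on which the earlier functionals vanish. Some
    nonzero entry of it yields the new functional \<open>Er\<close>, and the old ones are corrected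
    by multiples of \<open>Er\<close>.\<close>
  define V where "V = B r - (\<Sum>j<r. e j *\<^sub>m B j)"
  have "V \<noteq> 0"
  proof
    assume "V = 0"
    let ?c = "\<lambda>j. if j < r then - e j else 1"
    have "(\<Sum>j<Suc r. ?c j *\<^sub>m B j) = (\<Sum>j<r. ?c j *\<^sub>m B j) + B r" by (simp add: smul_simps)
    also have "(\<Sum>j<r. ?c j *\<^sub>m B j) = (\<Sum>j<r. - (e j *\<^sub>m B j))" by (rule sum.cong) (auto simp: smul_simps)
    also have "\<dots> + B r = V" by (simp add: V_def sum_negf)
    also note \<open>V = 0\<close>
    finally have "(\<Sum>j<Suc r. ?c j *\<^sub>m B j) = 0" .
    from Suc.prems(2)[OF this] have "?c r = 0" by blast
    then show False by simp
  qed
  moreover have "is_mat N (\<Sum>j<r. e j *\<^sub>m B j)"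
    using Suc.prems(1) by (auto simp: is_mat_def cmat_apply)
  then have "is_mat N V" unfolding V_def using Suc.prems(1)[of r] is_mat_diff by blast
  ultimately obtain a b where ab: "a < N" "b < N" "V a b \<noteq> 0"
    by (metis is_mat_eqI is_mat_zero zero_fun_apply)
  define Er where "Er x y = ((if x = a \<and> y = b then 1 else 0) - (\<Sum>j<r. B j a b * E j x y)) / V a b" for x y
  have pEr: "pair Er A = (A a b - (\<Sum>j<r. B j a b * pair (E j) A)) / V a b" for A
  proof -
    have "(\<Sum>x<N. \<Sum>y<N. (if x = a \<and> y = b then 1 else 0) * A x y) = (\<Sum>x<N. if x = a then A a b else 0)"
      by (rule sum.cong) (use ab in \<open>auto simp: if_distrib[of "\<lambda>t. t * _"] cong: if_cong\<close>)
    also have "\<dots> = A a b" using ab by simp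
    finally have 1: "(\<Sum>x<N. \<Sum>y<N. (if x = a \<and> y = b then 1 else 0) * A x y) = A a b" .
    have 2: "(\<Sum>x<N. \<Sum>y<N. (\<Sum>j<r. B j a b * E j x y) * A x y) = (\<Sum>j<r. B j a b * pair (E j) A)"
    proof -
      have "(\<Sum>x<N. \<Sum>y<N. (\<Sum>j<r. B j a b * E j x y) * A x y) = (\<Sum>x<N. \<Sum>j<r. \<Sum>y<N. B j a b * E j x y * A x y)"
        by (simp add: sum_distrib_right sum.swap[of _ "{..<N}" "{..<r}"])
      also have "\<dots> = (\<Sum>j<r. \<Sum>x<N. \<Sum>y<N. B j a b * E j x y * A x y)" by (rule sum.swap)
      finally show ?thesis by (simp add: pair_def sum_distrib_left mult.assoc)
    qed
    have "pair Er A = (\<Sum>x<N. \<Sum>y<N. ((if x = a \<and> y = b then 1 else 0) * A x y - (\<Sum>j<r. B j a b * E j x y) * A x y)) / V a b"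
    proof -
      have "(p - q) / v * x = (p * x - q * x) / v" for p q v x :: complex
        by (simp add: left_diff_distrib)
      then show ?thesis unfolding pair_def Er_def by (simp only: sum_divide_distrib)
    qed
    then show ?thesis by (simp only: sum_subtractf 1 2)
  qed
  have Er: "pair Er (B k) = (if k = r then 1 else 0)" if "k < Suc r" for k
  proof (cases "k = r")
    case True
    have "V a b = B r a b - (\<Sum>j<r. B j a b * e j)" by (simp add: V_def cmat_apply mult.commute)
    then show ?thesis using True ab by (simp add: pEr e_def)
  next
    case False
    then have k: "k < r" using that by simp
    then have "(\<Sum>j<r. B j a b * pair (E j) (B k)) = (\<Sum>j<r. if j = k then B k a b else 0)"
      by (intro sum.cong) (auto simp: E)
    then show ?thesis using False k by (simp add: pEr)
  qed
  define E' where "E' j = (if j < r then (\<lambda>x y. E j x y - e j * Er x y) else Er)" for j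
  have "pair (E' j) (B k) = (if j = k then 1 else 0)" if "j < Suc r" "k < Suc r" for j k
  proof (cases "j < r")
    case True
    have "pair (E' j) A = pair (E j) A - e j * pair Er A" for A
      using True by (simp add: pair_def E'_def left_diff_distrib sum_subtractf sum_distrib_left mult.assoc)
    then show ?thesis using Er[OF that(2)] E[OF True, of k] that True
      by (cases "k = r") (auto simp: e_def)
  next
    case False
    then show ?thesis using Er[OF that(2)] that by (auto simp: E'_def)
  qed
  then show ?case by blast
qed

end

section \<open>Coordinates with respect to the basis\<close>

locale lie_basis = lie +
  fixes r :: nat and B :: "nat \<Rightarrow> cmat"
  assumes basis: "is_basis t n r B"
begin

lemma B_lie: "j < r \<Longrightarrow> B j \<in> \<gg>"
  using basis by (simp add: is_basis_def)

lemma lincomb_sum: "lincomb r B c = (\<Sum>j<r. c j *\<^sub>m B j)"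
  by (intro ext) (simp add: lincomb_def cmat_apply)

lemma lincomb_lie: "lincomb r B c \<in> \<gg>"
  unfolding lincomb_sum by (intro lie_sum lie_smul B_lie) auto

definition EE :: "nat \<Rightarrow> nat \<Rightarrow> nat \<Rightarrow> complex" where
  "EE = (SOME E. \<forall>j<r. \<forall>k<r. pair (E j) (B k) = (if j = k then 1 else 0))"

definition ec :: "nat \<Rightarrow> cmat \<Rightarrow> complex" where "ec j A = pair (EE j) A"

lemma ec_B: "j < r \<Longrightarrow> k < r \<Longrightarrow> ec j (B k) = (if j = k then 1 else 0)"
proof -
  have "\<exists>E. \<forall>j<r. \<forall>k<r. pair (E j) (B k) = (if j = k then 1 else 0)"
  proof (rule dual_functionals)
    show "is_mat N (B j)" if "j < r" for j using B_lie lie_is_mat that by blast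
    show "\<forall>j<r. c j = 0" if "(\<Sum>j<r. c j *\<^sub>m B j) = 0" for c
      using basis that unfolding is_basis_def mzero_zero lincomb_sum by blast
  qed
  from someI_ex[OF this] show "j < r \<Longrightarrow> k < r \<Longrightarrow> ?thesis" by (simp add: ec_def EE_def)
qed

lemma ec_linear: "ec j (A + A') = ec j A + ec j A'" "ec j (x *\<^sub>m A) = x * ec j A" "ec j (A - A') = ec j A - ec j A'"
  by (simp_all add: ec_def pair_linear)

lemma ec_polyf: "ec j \<in> polyf entries"
  unfolding ec_def[abs_def] by (rule pair_polyf)

lemma ec_lincomb: "j < r \<Longrightarrow> ec j (lincomb r B c) = c j"
proof -
  assume j: "j < r"
  have "ec j (lincomb r B c) = (\<Sum>k<r. c k * ec j (B k))"
    unfolding lincomb_sum ec_def pair_sum by (simp add: pair_linear)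
  also have "\<dots> = (\<Sum>k<r. if k = j then c j else 0)"
    by (rule sum.cong) (auto simp: ec_B j)
  finally show ?thesis using j by simp
qed

lemma lincomb_ec: "L \<in> \<gg> \<Longrightarrow> lincomb r B (\<lambda>j. ec j L) = L"
proof -
  assume "L \<in> \<gg>"
  then obtain c where c: "L = lincomb r B c" using basis unfolding is_basis_def by blast
  show ?thesis unfolding lincomb_def by (simp add: c ec_lincomb) (simp add: lincomb_def)
qed

end

section \<open>The determinant of the representation\<close>

locale lie_rep = lie_basis +
  fixes \<phi> :: "cmat \<Rightarrow> complex^'d^'d"
  assumes irr: "irreducible_rep t n \<phi>"
begin

lemma mat_mm_entry: "(mat c ** A) $ a $ b = c * (A :: complex^'d^'d) $ a $ b"
  by (simp add: matrix_matrix_mult_def mat_def if_distrib[of "\<lambda>x. x * _"] cong: if_cong)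

lemma mm_mat_entry: "(A ** mat c) $ a $ b = (A :: complex^'d^'d) $ a $ b * c"
  by (simp add: matrix_matrix_mult_def mat_def if_distrib[of "\<lambda>x. _ * x"] cong: if_cong)

lemma mm_add_right: "(A + A') ** C = A ** C + A' ** (C :: complex^'d^'d)"
  by (simp add: matrix_matrix_mult_def vec_eq_iff sum.distrib distrib_right)

lemma rep_linear: "A \<in> \<gg> \<Longrightarrow> A' \<in> \<gg> \<Longrightarrow> \<phi> (x *\<^sub>m A + y *\<^sub>m A') = mat x ** \<phi> A + mat y ** \<phi> A'"
  using irr unfolding irreducible_rep_def is_rep_def smul_def plus_fun_def by blast

lemma rep_add: "A \<in> \<gg> \<Longrightarrow> A' \<in> \<gg> \<Longrightarrow> \<phi> (A + A') = \<phi> A + \<phi> A'"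
  using rep_linear[of A A' 1 1] by (simp add: smul_simps)

lemma rep_smul: "A \<in> \<gg> \<Longrightarrow> \<phi> (x *\<^sub>m A) $ a $ b = x * \<phi> A $ a $ b"
  using rep_linear[of A A x 0] by (simp add: smul_simps mat_mm_entry)

lemma rep_zero: "\<phi> 0 = 0"
  using rep_smul[OF lie_zero, of 0] by (simp add: smul_simps vec_eq_iff)

lemma rep_sum: "(\<And>k. k \<in> K \<Longrightarrow> A k \<in> \<gg>) \<Longrightarrow> \<phi> (\<Sum>k\<in>K. A k) = (\<Sum>k\<in>K. \<phi> (A k))"
proof (induction K rule: infinite_finite_induct)
  case (insert x F)
  have "\<phi> (A x + (\<Sum>k\<in>F. A k)) = \<phi> (A x) + \<phi> (\<Sum>k\<in>F. A k)"
    using insert by (intro rep_add lie_sum) auto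
  moreover have "\<phi> (\<Sum>k\<in>F. A k) = (\<Sum>k\<in>F. \<phi> (A k))" using insert by blast
  ultimately show ?case by (simp only: sum.insert[OF insert(1,2)])
next
  case (infinite K)
  show ?case unfolding sum.infinite[OF infinite(1)] by (rule rep_zero)
next
  case empty
  show ?case unfolding sum.empty by (rule rep_zero)
qed

lemma rep_brk: "A \<in> \<gg> \<Longrightarrow> A' \<in> \<gg> \<Longrightarrow> \<phi> (A \<odot> A' - A' \<odot> A) = \<phi> A ** \<phi> A' - \<phi> A' ** \<phi> A"
  using irr unfolding irreducible_rep_def is_rep_def by (simp add: N_eq[symmetric] brk_mm)

lemma rep_entry: "L \<in> \<gg> \<Longrightarrow> \<phi> L $ a $ b = (\<Sum>j<r. ec j L * \<phi> (B j) $ a $ b)"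
proof -
  assume L: "L \<in> \<gg>"
  have "\<phi> L = \<phi> (\<Sum>j<r. ec j L *\<^sub>m B j)" using lincomb_ec[OF L] by (simp only: lincomb_sum)
  also have "\<dots> = (\<Sum>j<r. \<phi> (ec j L *\<^sub>m B j))" by (rule rep_sum) (simp add: lie_smul B_lie)
  finally show ?thesis by (simp add: rep_smul B_lie)
qed

text \<open>The values of \<open>\<phi>\<close> outside the Lie algebra are arbitrary, whereas
  density concerns functions that are polynomial on all matrices. Writing \<open>\<phi> L\<close>
  through coordinates supplies such an extension.\<close>

definition detrep :: "complex \<Rightarrow> cmat \<Rightarrow> complex" where
  "detrep z L = det (mat z + (\<chi> a b. \<Sum>j<r. ec j L * \<phi> (B j) $ a $ b))"

lemma detrep_eq: "L \<in> \<gg> \<Longrightarrow> detrep z L = det (mat z + \<phi> L)"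
  unfolding detrep_def by (rule arg_cong[where f=det]) (simp add: vec_eq_iff rep_entry)

lemma det_polyf:
  assumes "\<And>a b. (\<lambda>x. A x $ a $ b) \<in> polyf G"
  shows "(\<lambda>x. det (A x :: complex^'d^'d)) \<in> polyf G"
  unfolding det_def by (intro polyf_sum polyf_mult polyf_const polyf_prod assms)

lemma detrep_polyf: "detrep z \<in> polyf entries"
proof -
  have "(\<lambda>L. det (mat z + (\<chi> a b. \<Sum>j<r. ec j L * \<phi> (B j) $ a $ b))) \<in> polyf entries"
    by (rule det_polyf) (auto intro!: polyf_add polyf_const polyf_sum polyf_mult ec_polyf)
  then show ?thesis unfolding detrep_def[abs_def] .
qed

text \<open>To first order in \<open>s\<close>, moving \<open>L\<close> along \<open>Ad (u(s))\<close> conjugates \<open>\<phi> L\<close> by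
  \<open>1 + s \<phi> X\<close>, which does not change the determinant to first order.\<close>
lemma det_Ad:
  assumes ij: "i < N" "j < N" "i \<noteq> j" and L: "L \<in> \<gg>"
  shows "det (mat z + \<phi> (Ad i j s L)) = det (mat z + \<phi> L)"
proof -
  let ?G = "range (\<lambda>(a, b) (A :: complex^'d^'d). A $ a $ b)"
  have "(det :: complex^'d^'d \<Rightarrow> complex) \<in> polyf ?G"
    using det_polyf[of "\<lambda>x. x" ?G] polyf_gen[of _ ?G] by force
  then obtain D where D: "is_gradient ?G (det :: complex^'d^'d \<Rightarrow> complex) D"
    using polyf_gradient[of ?G] by (metis finite finite_imageI)
  have detD: "((\<lambda>s. det (c s)) has_field_derivative (\<Sum>g\<in>?G. g V * D g (c a))) (at a)"
    if "\<And>k l. ((\<lambda>s. c s $ k $ l) has_field_derivative V $ k $ l) (at a)" for c and V :: "complex^'d^'d" and a :: complex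
    by (rule is_gradient_deriv[OF D]) (use that in auto)
  define X where "X = \<phi> (Xr i j)"
  have XL: "Xr i j \<in> \<gg>" using ij Xr_lie by blast
  have "((\<lambda>s. det (mat z + \<phi> (Ad i j s L))) has_field_derivative 0) (at a)" for a
  proof -
    define M where "M = Ad i j a L"
    have M: "M \<in> \<gg>" using Ad_lie ij L by (simp add: M_def)
    define Y where "Y = mat z + \<phi> M"
    have "((\<lambda>s. (mat z + \<phi> (Ad i j s L)) $ k $ l) has_field_derivative (X ** Y - Y ** X) $ k $ l) (at a)" for k l
    proof -
      have ecd: "((\<lambda>s. ec p (Ad i j s L)) has_field_derivative ec p (Xr i j \<odot> M - M \<odot> Xr i j)) (at a)" for p
        unfolding ec_def pair_def M_def by (intro DERIV_sum DERIV_cmult Ad_deriv ij)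
      have "((\<lambda>s. mat z $ k $ l + (\<Sum>p<r. ec p (Ad i j s L) * \<phi> (B p) $ k $ l)) has_field_derivative
          0 + (\<Sum>p<r. ec p (Xr i j \<odot> M - M \<odot> Xr i j) * \<phi> (B p) $ k $ l)) (at a)"
        by (intro DERIV_add DERIV_const DERIV_sum DERIV_cmult_right ecd)
      moreover have "(\<Sum>p<r. ec p (Xr i j \<odot> M - M \<odot> Xr i j) * \<phi> (B p) $ k $ l) = (X ** \<phi> M - \<phi> M ** X) $ k $ l"
        using rep_entry[OF lie_brk[OF XL M], of k l] rep_brk[OF XL M] by (simp add: X_def)
      moreover have "X ** Y - Y ** X = X ** \<phi> M - \<phi> M ** X"
        by (simp add: vec_eq_iff Y_def matrix_add_ldistrib mm_add_right mat_mm_entry mm_mat_entry mult.commute)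
      ultimately show ?thesis using rep_entry[OF Ad_lie[OF ij L]] by simp
    qed
    from detD[OF this] have 1: "((\<lambda>s. det (mat z + \<phi> (Ad i j s L))) has_field_derivative
        (\<Sum>g\<in>?G. g (X ** Y - Y ** X) * D g Y)) (at a)" by (simp add: Y_def M_def)
    define U where "U s = (\<chi> k l. (if k = l then 1 else 0) + s * X $ k $ l)" for s
    have U0: "U 0 = mat 1" by (simp add: U_def mat_def vec_eq_iff)
    have Ud: "((\<lambda>s. U s $ k $ l) has_field_derivative X $ k $ l) (at 0)" for k l
      unfolding U_def by (auto intro!: derivative_eq_intros)
    have Ud': "((\<lambda>s. U (- s) $ k $ l) has_field_derivative - X $ k $ l) (at 0)" for k l
      unfolding U_def by (auto intro!: derivative_eq_intros)
    have UY: "((\<lambda>s. (U s ** Y) $ k $ l) has_field_derivative (X ** Y) $ k $ l) (at 0)" for k l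
      unfolding matrix_matrix_mult_def by (simp) (intro DERIV_sum DERIV_cmult_right Ud)
    have "((\<lambda>s. (U s ** Y ** U (- s)) $ k $ l) has_field_derivative (X ** Y - Y ** X) $ k $ l) (at 0)" for k l
    proof -
      have "((\<lambda>s. \<Sum>m\<in>UNIV. (U s ** Y) $ k $ m * U (- s) $ m $ l) has_field_derivative
         (\<Sum>m\<in>UNIV. (X ** Y) $ k $ m * U (- 0) $ m $ l + (- X $ m $ l) * (U 0 ** Y) $ k $ m)) (at 0)"
        by (intro DERIV_sum DERIV_mult UY Ud')
      moreover have "(\<Sum>m\<in>UNIV. (X ** Y) $ k $ m * U (- 0) $ m $ l + (- X $ m $ l) * (U 0 ** Y) $ k $ m) =
          ((X ** Y) ** U 0) $ k $ l - ((U 0 ** Y) ** X) $ k $ l"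
        by (simp add: matrix_matrix_mult_def[of "X ** Y"] matrix_matrix_mult_def[of "U 0 ** Y"]
            sum.distrib sum_negf sum_subtractf mult.commute)
      moreover have "(\<lambda>s. (U s ** Y ** U (- s)) $ k $ l) = (\<lambda>s. \<Sum>m\<in>UNIV. (U s ** Y) $ k $ m * U (- s) $ m $ l)"
        by (simp add: matrix_matrix_mult_def[of "U _ ** Y"])
      ultimately show ?thesis by (simp add: U0 matrix_mul_lid matrix_mul_rid)
    qed
    from detD[OF this] have 2: "((\<lambda>s. det (U s ** Y ** U (- s))) has_field_derivative
        (\<Sum>g\<in>?G. g (X ** Y - Y ** X) * D g Y)) (at 0)" by (simp add: U0 matrix_mul_lid matrix_mul_rid)
    \<comment> \<open>The outer factors \<open>U s\<close> and \<open>U (- s)\<close> contribute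
      opposite derivatives at \<open>0\<close>, so \<open>d\<close> cancels without being
      computed.\<close>
    define d where "d = (\<Sum>g\<in>?G. g X * D g (U 0))"
    have d1: "((\<lambda>s. det (U s)) has_field_derivative d) (at 0)" unfolding d_def by (rule detD[OF Ud])
    have "((\<lambda>s. det (U (- s))) has_field_derivative (\<Sum>g\<in>?G. g (- X) * D g (U (- 0)))) (at 0)"
      by (rule detD) (use Ud' in simp)
    moreover have "(\<Sum>g\<in>?G. g (- X) * D g (U (- 0))) = (\<Sum>g\<in>?G. - (g X * D g (U 0)))"
      by (rule sum.cong) auto
    ultimately have d2: "((\<lambda>s. det (U (- s))) has_field_derivative - d) (at 0)"
      by (simp add: d_def sum_negf)
    have "((\<lambda>s. det (U s) * det Y * det (U (- s))) has_field_derivative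
       d * det Y * det (U (- 0)) + (- d) * (det (U 0) * det Y)) (at 0)"
      by (rule DERIV_mult[OF DERIV_cmult_right[OF d1] d2])
    then have "((\<lambda>s. det (U s ** Y ** U (- s))) has_field_derivative 0) (at 0)"
      by (simp add: det_mul U0)
    from DERIV_unique[OF 2 this] 1 show ?thesis by simp
  qed
  then have "((\<lambda>s. det (mat z + \<phi> (Ad i j s L))) has_field_derivative 0) (at a within UNIV)" for a
    by simp
  from has_field_derivative_zero_constant[OF convex_UNIV this]
  obtain c where "\<And>s. det (mat z + \<phi> (Ad i j s L)) = c" by auto
  then have "det (mat z + \<phi> (Ad i j s L)) = det (mat z + \<phi> (Ad i j 0 L))" by simp
  then show ?thesis using Ad_zero[OF lie_is_mat[OF L]] by simp
qed

end

section \<open>Weights\<close>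

text \<open>Both sides count the multiplicity of \<open>- x\<close> as a root of the same monic
  polynomial.\<close>

lemma prod_linear_counts:
  fixes c d :: "'i \<Rightarrow> complex"
  assumes "finite S" "\<And>z. (\<Prod>i\<in>S. z + c i) = (\<Prod>i\<in>S. z + d i)"
  shows "card {i\<in>S. c i = x} = card {i\<in>S. d i = x}"
proof -
  have ord: "order (- x) (\<Prod>i\<in>S. [:e i, 1:]) = card {i\<in>S. e i = x}" for e :: "'i \<Rightarrow> complex"
    using assms(1)
  proof (induction S rule: finite_induct)
    case (insert i S)
    have nz: "(\<Prod>i\<in>S. [:e i, 1:]) \<noteq> 0" using insert by simp
    have "order (- x) [:e i, 1:] = (if e i = x then 1 else 0)"
    proof (cases "e i = x")
      case True
      then show ?thesis using order_power_n_n[of "- x" 1] by simp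
    next
      case False
      then show ?thesis by (simp add: order_0I add_eq_0_iff2)
    qed
    moreover have "{k\<in>insert i S. e k = x} = (if e i = x then insert i {k\<in>S. e k = x} else {k\<in>S. e k = x})"
      by auto
    moreover have "order (- x) ([:e i, 1:] * (\<Prod>i\<in>S. [:e i, 1:])) = order (- x) [:e i, 1:] + order (- x) (\<Prod>i\<in>S. [:e i, 1:])"
      by (rule order_mult, rule no_zero_divisors[OF _ nz]) simp
    ultimately show ?case using insert by simp
  qed (simp add: order_0I)
  have "(\<Prod>i\<in>S. [:c i, 1:]) = (\<Prod>i\<in>S. [:d i, 1:])"
  proof (rule poly_eq_poly_eq_iff[THEN iffD1], rule ext)
    fix z
    show "poly (\<Prod>i\<in>S. [:c i, 1:]) z = poly (\<Prod>i\<in>S. [:d i, 1:]) z"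
      using assms(2)[of z] by (simp add: poly_prod add.commute)
  qed
  then show ?thesis using ord[of c] ord[of d] by simp
qed

context lie
begin

definition linh :: "(cmat \<Rightarrow> complex) \<Rightarrow> bool" where
  "linh f \<longleftrightarrow> (\<forall>A\<in>\<hh>. \<forall>B\<in>\<hh>. f (A + B) = f A + f B) \<and> (\<forall>c. \<forall>A\<in>\<hh>. f (c *\<^sub>m A) = c * f A)"

lemma linh_add: "linh f \<Longrightarrow> A \<in> \<hh> \<Longrightarrow> B \<in> \<hh> \<Longrightarrow> f (A + B) = f A + f B"
  and linh_smul: "linh f \<Longrightarrow> A \<in> \<hh> \<Longrightarrow> f (c *\<^sub>m A) = c * f A"
  by (auto simp: linh_def)

lemma linh_minus: "linh f \<Longrightarrow> A \<in> \<hh> \<Longrightarrow> B \<in> \<hh> \<Longrightarrow> f (A - B) = f A - f B"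
  using linh_add[of f A "(-1) *\<^sub>m B"] linh_smul[of f B "-1"] cartan_smul[of B "-1"] by (simp add: smul_simps)

lemma linh_diff: "linh f \<Longrightarrow> linh g \<Longrightarrow> linh (\<lambda>H. f H - g H)"
  by (auto simp: linh_def algebra_simps)

lemma linh_WG: "linh f \<Longrightarrow> w \<in> WG \<Longrightarrow> linh (\<lambda>H. f (w H))"
proof -
  assume f: "linh f" and w: "w \<in> WG"
  have "f (w (A + B)) = f (w A) + f (w B)" if "A \<in> \<hh>" "B \<in> \<hh>" for A B
    unfolding WG_linear(1)[OF w] by (rule linh_add[OF f]) (use that WG_cartan w in blast)+
  moreover have "f (w (c *\<^sub>m A)) = c * f (w A)" if "A \<in> \<hh>" for c A
    unfolding WG_linear(2)[OF w] by (rule linh_smul[OF f]) (use that WG_cartan w in blast)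
  ultimately show ?thesis unfolding linh_def by blast
qed

text \<open>Along \<open>H + s *\<^sub>m K\<close> each functional is affine in \<open>s\<close> and
  not identically zero: the old ones are nonzero at \<open>H\<close>, the new one has nonzero slope.
  So only finitely many \<open>s\<close> are bad.\<close>

lemma separating_element:
  assumes "finite \<Phi>" "\<And>f. f \<in> \<Phi> \<Longrightarrow> linh f \<and> (\<exists>H\<in>\<hh>. f H \<noteq> 0)"
  shows "\<exists>H\<in>\<hh>. \<forall>f\<in>\<Phi>. f H \<noteq> 0"
  using assms
proof (induction \<Phi> rule: finite_induct)
  case empty
  then show ?case using cartan_zero by blast
next
  case (insert f \<Phi>)
  obtain H where H: "H \<in> \<hh>" "\<And>g. g \<in> \<Phi> \<Longrightarrow> g H \<noteq> 0" using insert by auto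
  obtain K where K: "K \<in> \<hh>" "f K \<noteq> 0" using insert by auto
  let ?Z = "\<Union>g\<in>insert f \<Phi>. {s. g H + s * g K = 0}"
  have "finite {s. g H + s * g K = 0}" if g: "g \<in> insert f \<Phi>" for g
  proof (cases "g K = 0")
    case True
    then show ?thesis using g H K by auto
  next
    case False
    then have "{s. g H + s * g K = 0} \<subseteq> {- g H / g K}" by (auto simp: field_simps add_eq_0_iff2)
    then show ?thesis using finite_subset by blast
  qed
  then have "finite ?Z" using insert by blast
  then obtain s where s: "s \<notin> ?Z" using ex_new_if_finite[OF infinite_UNIV_char_0] by blast
  have nz: "g (H + s *\<^sub>m K) \<noteq> 0" if g: "g \<in> insert f \<Phi>" for g
  proof -
    have "g (H + s *\<^sub>m K) = g H + s * g K"
      using insert.prems[OF g] H K by (simp add: linh_add linh_smul cartan_smul)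
    moreover have "s \<in> ?Z" if "g H + s * g K = 0" using g that by (intro UN_I[of g]) auto
    ultimately show ?thesis using s by metis
  qed
  show ?case
    by (rule bexI[where x="H + s *\<^sub>m K"], rule ballI, erule nz)
      (intro cartan_add cartan_smul H(1) K(1))
qed

text \<open>Normal form of a functional on the Cartan subalgebra. Weights are extended by
  \<open>0\<close>, so equality of normal forms is equality on \<open>\<hh>\<close>.\<close>

definition zx :: "(cmat \<Rightarrow> complex) \<Rightarrow> cmat \<Rightarrow> complex" where
  "zx f H = (if H \<in> \<hh> then f H else 0)"

lemma zx_eq_iff: "zx f = zx g \<longleftrightarrow> (\<forall>H\<in>\<hh>. f H = g H)"
  by (auto simp: zx_def fun_eq_iff)

lemma zx_cartan [simp]: "H \<in> \<hh> \<Longrightarrow> zx f H = f H"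
  by (simp add: zx_def)

lemma conj_unique: "g \<in> GG \<Longrightarrow> H \<in> \<hh> \<Longrightarrow> K \<in> \<hh> \<Longrightarrow> H \<odot> g = K \<odot> g \<Longrightarrow> H = K"
proof -
  assume *: "g \<in> GG" "H \<in> \<hh>" "K \<in> \<hh>" "H \<odot> g = K \<odot> g"
  then obtain a where a: "g \<odot> a = I\<^sub>m" using inverse_exists[of g] grp_is_mat grp_det by fastforce
  have "H \<odot> (g \<odot> a) = K \<odot> (g \<odot> a)" using * by (simp flip: mm_assoc)
  moreover have "is_mat N H" "is_mat N K" using * cartan_lie lie_is_mat by auto
  ultimately show "H = K" using a by simp
qed

text \<open>The orbit is defined by the requirement that \<open>\<nu>\<close> at the conjugate of
  \<open>K\<close> equals \<open>\<mu> K\<close>, so the element obtained from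
  \<open>normaliser_WG\<close> enters through its inverse.\<close>

lemma weyl_orbit_eq:
  "weyl_orbit t n \<mu> = {zx (\<lambda>H. \<mu> (w H)) | w. w \<in> WG}"
proof (intro equalityI subsetI)
  fix \<nu> assume "\<nu> \<in> weyl_orbit t n \<mu>"
  then obtain g where off: "\<And>H. H \<notin> \<hh> \<Longrightarrow> \<nu> H = 0" and g: "g \<in> GG"
    and norm: "\<And>K. K \<in> \<hh> \<Longrightarrow> \<exists>H\<in>\<hh>. conj_by t n g K H"
    and val: "\<And>K H. K \<in> \<hh> \<Longrightarrow> H \<in> \<hh> \<Longrightarrow> conj_by t n g K H \<Longrightarrow> \<nu> H = \<mu> K"
    unfolding weyl_orbit_def by blast
  have conj: "conj_by t n g K H \<longleftrightarrow> g \<odot> K = H \<odot> g" for K H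
    using g by (simp add: conj_by_def N_eq)
  obtain w where w: "w \<in> WG" "\<forall>K\<in>\<hh>. \<forall>H\<in>\<hh>. g \<odot> K = H \<odot> g \<longrightarrow> H = w K"
    using normaliser_WG[OF g] norm unfolding conj by blast
  obtain w' where w': "w' \<in> WG" "\<And>H. w (w' H) = H" using WG_inverse[OF w(1)] by blast
  have "\<nu> H = zx (\<lambda>H. \<mu> (w' H)) H" for H
  proof (cases "H \<in> \<hh>")
    case True
    then have wH: "w' H \<in> \<hh>" using w' WG_cartan by blast
    obtain H' where H': "H' \<in> \<hh>" "g \<odot> w' H = H' \<odot> g" using norm[OF wH] unfolding conj by blast
    then have "H' = H" using w wH w' by metis
    then show ?thesis using val[OF wH True] H' True by (simp add: conj)
  qed (simp add: off zx_def)
  then have "\<nu> = zx (\<lambda>H. \<mu> (w' H))" by blast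
  then show "\<nu> \<in> {zx (\<lambda>H. \<mu> (w H)) | w. w \<in> WG}" using w' by blast
next
  fix \<nu> assume "\<nu> \<in> {zx (\<lambda>H. \<mu> (w H)) | w. w \<in> WG}"
  then obtain w where w: "w \<in> WG" "\<nu> = zx (\<lambda>H. \<mu> (w H))" by blast
  obtain w' where w': "w' \<in> WG" "\<And>H. w (w' H) = H" using WG_inverse[OF w(1)] by blast
  obtain g where g: "g \<in> GG" "\<And>H. H \<in> \<hh> \<Longrightarrow> g \<odot> H = w' H \<odot> g" using WG_grp[OF w'(1)] by blast
  have conj: "conj_by t n g K H \<longleftrightarrow> g \<odot> K = H \<odot> g" for K H
    using g by (simp add: conj_by_def N_eq)
  have "\<nu> H = \<mu> K" if KH: "K \<in> \<hh>" "H \<in> \<hh>" "g \<odot> K = H \<odot> g" for K H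
  proof -
    have "w' K \<odot> g = H \<odot> g" using g(2)[OF KH(1)] KH(3) by simp
    then have "w' K = H" using conj_unique[OF g(1)] w' WG_cartan KH by blast
    then show ?thesis using KH w w' by auto
  qed
  moreover have "\<exists>H\<in>\<hh>. g \<odot> K = H \<odot> g" if "K \<in> \<hh>" for K
    using g that w' WG_cartan by blast
  moreover have "\<nu> H = 0" if "H \<notin> \<hh>" for H using that w by (simp add: zx_def)
  ultimately show "\<nu> \<in> weyl_orbit t n \<mu>"
    unfolding weyl_orbit_def using g(1) conj by blast
qed

text \<open>A weight vector pairing determines the coroot up to a scalar: by invariance of the
  trace form, \<open>tr (H [X, Y]) = \<alpha> H * tr (X Y)\<close>.\<close>
lemma trace_brk:
  assumes "H \<odot> X = X \<odot> H + a *\<^sub>m X"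
  shows "mtr (H \<odot> (X \<odot> Y - Y \<odot> X)) = a * mtr (X \<odot> Y)"
proof -
  have "mtr (H \<odot> (Y \<odot> X)) = mtr (X \<odot> (H \<odot> Y))"
    using mtr_mm_commute[of X "H \<odot> Y"] by (simp add: mm_assoc)
  moreover have "H \<odot> (X \<odot> Y) = X \<odot> (H \<odot> Y) + a *\<^sub>m (X \<odot> Y)"
    using assms by (simp add: mm_linear flip: mm_assoc)
  ultimately show ?thesis by (simp add: mm_linear mtr_linear)
qed

lemma mtr_diag: "is_diag H \<Longrightarrow> mtr (H \<odot> A) = (\<Sum>i<N. H i i * A i i)"
  unfolding mtr_def by (rule sum.cong) (auto simp: diag_mm)

lemma cartan_cnj: "D \<in> \<hh> \<Longrightarrow> (\<lambda>i j. cnj (D i j)) \<in> \<hh>"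
proof -
  assume D: "D \<in> \<hh>"
  have d: "is_diag (\<lambda>i j. cnj (D i j))" using cartan_diag[OF D] by (auto simp: is_diag_def is_mat_def)
  show ?thesis
  proof (cases tA)
    case True
    then have "(\<Sum>i<N. D i i) = 0" using D by (simp add: cartan_A)
    then have "cnj (\<Sum>i<N. D i i) = 0" by simp
    then show ?thesis using True d by (simp add: cartan_A)
  next
    case False
    then show ?thesis using D d by (simp add: cartan_nA)
  qed
qed

text \<open>Pairing \<open>D\<close> with its complex conjugate, again a Cartan element, gives the
  sum of the squared moduli of the diagonal entries.\<close>

lemma trace_form_nondegenerate:
  assumes D: "D \<in> \<hh>" and "\<And>H. H \<in> \<hh> \<Longrightarrow> mtr (H \<odot> D) = 0"
  shows "D = 0"
proof -
  have "(\<Sum>i<N. cnj (D i i) * D i i) = 0"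
    using assms(2)[OF cartan_cnj[OF D]] mtr_diag[OF cartan_diag[OF cartan_cnj[OF D]], of D] by simp
  then have "complex_of_real (\<Sum>i<N. (cmod (D i i))\<^sup>2) = 0"
    unfolding of_real_sum complex_norm_square by (simp add: mult.commute)
  then have "(\<Sum>i<N. (cmod (D i i))\<^sup>2) = 0" using of_real_eq_0_iff by blast
  then have "D i i = 0" if "i < N" for i using that by (simp add: sum_nonneg_eq_0_iff)
  then show ?thesis using D cartan_zero by (intro cartan_eqI) auto
qed

text \<open>For the converse, every bracket \<open>C\<close> allowed in \<open>dominant\<close> is
  shown to be some \<open>Hc i j\<close>. A nonzero entry of \<open>X\<close> identifies
  \<open>\<alpha>\<close> with \<open>al i j\<close>. Then \<open>C\<close> and
  \<open>Hc i j\<close> have proportional trace pairings with all Cartan elements, and the common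
  value \<open>2\<close> of the root fixes the scale.\<close>

lemma dominant_iff:
  assumes off: "\<And>H. H \<notin> \<hh> \<Longrightarrow> \<mu> H = 0"
  shows "dominant t n \<mu> \<longleftrightarrow> (\<forall>i j. rvalid i j \<and> i < j \<longrightarrow> \<mu> (Hc i j) \<in> \<real> \<and> 0 \<le> Re (\<mu> (Hc i j)))"
proof
  assume dom: "dominant t n \<mu>"
  show "\<forall>i j. rvalid i j \<and> i < j \<longrightarrow> \<mu> (Hc i j) \<in> \<real> \<and> 0 \<le> Re (\<mu> (Hc i j))"
  proof (intro allI impI)
    fix i j assume v: "rvalid i j \<and> i < j"
    then have ij: "i < N" "j < N" "i \<noteq> j" using rvalidD by blast+
    have up: "Xr i j a b = 0" if "b \<le> a" for a b
    proof (cases "a < N \<and> b < N")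
      case True
      have "fl j < fl i" using fl_less ij v by blast
      then have n: "\<not> (a = i \<and> b = j)" "\<not> (\<not> tA \<and> a = fl j \<and> b = fl i)" using v that by auto
      show ?thesis using True ij by (simp only: Xr_apply if_not_P[OF n(1)] if_not_P[OF n(2)]) simp
    next
      case False
      then show ?thesis using Xr_is_mat ij by (auto simp: is_mat_def)
    qed
    have nz: "Xr i j \<noteq> mzero" using Xr_nz[of i j] v by (auto simp: mzero_def)
    have C: "brk (dimN t n) (Xr i j) (Yr i j) = Hc i j"
      using XY_brk v by (simp add: N_eq[symmetric] brk_mm)
    have HX: "brk (dimN t n) H (Xr i j) = (\<lambda>a b. al i j H * Xr i j a b)"
      and HY: "brk (dimN t n) H (Yr i j) = (\<lambda>a b. - al i j H * Yr i j a b)" if "H \<in> \<hh>" for H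
      using cartan_Xr[OF that ij(1,2)] cartan_Yr[OF that ij(1,2)]
      by (simp_all add: N_eq[symmetric] brk_mm fun_eq_iff cmat_apply)
    show "\<mu> (Hc i j) \<in> \<real> \<and> 0 \<le> Re (\<mu> (Hc i j))"
      using dom[unfolded dominant_def, rule_format, of "Xr i j" "Yr i j" "al i j"] unfolding C
      using Xr_lie[OF ij] Yr_lie[OF ij] nz up HX HY al_Hc[OF ij] by blast
  qed
next
  assume dom: "\<forall>i j. rvalid i j \<and> i < j \<longrightarrow> \<mu> (Hc i j) \<in> \<real> \<and> 0 \<le> Re (\<mu> (Hc i j))"
  show "dominant t n \<mu>"
    unfolding dominant_def
  proof (intro allI impI)
    fix X Y \<alpha>
    define C where "C = brk (dimN t n) X Y"
    assume "X \<in> \<gg> \<and> Y \<in> \<gg> \<and> X \<noteq> mzero \<and> (\<forall>i j. j \<le> i \<longrightarrow> X i j = 0) \<and>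
      (\<forall>H\<in>\<hh>. brk (dimN t n) H X = (\<lambda>i j. \<alpha> H * X i j) \<and> brk (dimN t n) H Y = (\<lambda>i j. - \<alpha> H * Y i j)) \<and>
      \<alpha> (brk (dimN t n) X Y) = 2"
    then have X: "X \<in> \<gg>" "X \<noteq> 0" and Y: "Y \<in> \<gg>" and up: "\<And>i j. j \<le> i \<Longrightarrow> X i j = 0"
      and HX': "\<And>H. H \<in> \<hh> \<Longrightarrow> brk (dimN t n) H X = \<alpha> H *\<^sub>m X"
      and HY': "\<And>H. H \<in> \<hh> \<Longrightarrow> brk (dimN t n) H Y = - \<alpha> H *\<^sub>m Y"
      and C2: "\<alpha> C = 2"
      by (auto simp: mzero_zero smul_def C_def)
    have HX: "H \<odot> X = X \<odot> H + \<alpha> H *\<^sub>m X" and HY: "H \<odot> Y = Y \<odot> H - \<alpha> H *\<^sub>m Y" if "H \<in> \<hh>" for H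
      using HX'[OF that] HY'[OF that] by (simp_all add: N_eq[symmetric] brk_mm smul_simps algebra_simps)
    have C: "C = X \<odot> Y - Y \<odot> X" by (simp add: C_def N_eq[symmetric] brk_mm)
    obtain i j where Xij: "X i j \<noteq> 0" using X(2) by (auto simp: fun_eq_iff)
    have ij: "i < j" "i < N" "j < N"
      using Xij up[of j i] lie_is_mat[OF X(1)] unfolding is_mat_def by (meson linorder_not_less)+
    have \<alpha>: "\<alpha> H = al i j H" if H: "H \<in> \<hh>" for H
    proof -
      have "(H \<odot> X) i j = (X \<odot> H + \<alpha> H *\<^sub>m X) i j" using HX[OF H] by simp
      then have "(H i i - H j j - \<alpha> H) * X i j = 0"
        using ij H by (simp add: diag_mm mm_diag cartan_diag algebra_simps)
      then show ?thesis using Xij by (simp add: al_def)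
    qed
    have v: "rvalid i j"
    proof (rule ccontr)
      assume "\<not> rvalid i j"
      then have O: tO and ji: "j = fl i" using ij by (auto simp: rvalid_def)
      have nA: "\<not> tA" and nC: "\<not> tC" using O t_cases by blast+
      have "X (fl j) (fl i) = - (sg i * sg j * X i j)" using X(1) nA ij by (simp add: lie_alg_entries)
      moreover have "fl j = i" using ji ij by simp
      ultimately have "X i j = - X i j" using ji nC by (simp add: sg_BD)
      then show False using Xij by simp
    qed
    \<comment> \<open>The eigenvalues of \<open>X\<close> and \<open>Y\<close> are opposite, so
      their bracket commutes with \<open>Hrho\<close>; since the entries of \<open>Hrho\<close> are
      distinct, it is diagonal.\<close>
    have "C \<in> \<hh>"
    proof -
      have Hr: "Hrho \<in> \<hh>" using sdec_Hrho by (simp add: sdec_def hreal_def)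
      have Cg: "C \<in> \<gg>" unfolding C using lie_brk X Y by blast
      have "Hrho \<odot> (X \<odot> Y) = X \<odot> (Hrho \<odot> Y) + \<alpha> Hrho *\<^sub>m (X \<odot> Y)"
        using HX[OF Hr] by (simp add: mm_linear flip: mm_assoc)
      moreover have "Hrho \<odot> (Y \<odot> X) = Y \<odot> (Hrho \<odot> X) - \<alpha> Hrho *\<^sub>m (Y \<odot> X)"
        using HY[OF Hr] by (simp add: mm_linear flip: mm_assoc)
      ultimately have comm: "Hrho \<odot> C = C \<odot> Hrho"
        using HX[OF Hr] HY[OF Hr] by (simp add: C mm_linear mm_assoc)
      have "C a b = 0" if "a \<noteq> b" for a b
      proof (cases "a < N \<and> b < N")
        case True
        have "Hrho a a * C a b = C a b * Hrho b b"
          using diag_mm[OF cartan_diag[OF Hr], of a b C] mm_diag[OF cartan_diag[OF Hr], of a b C] True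
          unfolding comm by auto
        moreover have "Hrho a a \<noteq> Hrho b b" using True that by (simp add: Hrho_def)
        ultimately show ?thesis by (simp add: mult.commute)
      next
        case False
        then show ?thesis using lie_is_mat[OF Cg] by (auto simp: is_mat_def)
      qed
      then show ?thesis using Cg by (simp add: cartan_def)
    qed
    define \<tau> \<tau>' where "\<tau> = mtr (X \<odot> Y)" and "\<tau>' = mtr (Xr i j \<odot> Yr i j)"
    have HcXY: "Hc i j = Xr i j \<odot> Yr i j - Yr i j \<odot> Xr i j" using XY_brk v by simp
    have hc: "Hc i j \<in> \<hh>" using Hc_cartan ij by blast
    have t1: "mtr (H \<odot> C) = al i j H * \<tau>" if "H \<in> \<hh>" for H
      unfolding C \<tau>_def using trace_brk[OF HX[OF that], of Y] \<alpha>[OF that] by simp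
    have t2: "mtr (H \<odot> Hc i j) = al i j H * \<tau>'" if "H \<in> \<hh>" for H
      unfolding HcXY \<tau>'_def using trace_brk[OF cartan_Xr[OF that ij(2,3)]] by simp
    have "\<tau>' \<noteq> 0"
    proof
      assume "\<tau>' = 0"
      then have "Hc i j = 0" using t2 hc by (intro trace_form_nondegenerate) auto
      then show False using al_Hc[of i j] ij by (simp add: al_def)
    qed
    have "\<tau>' *\<^sub>m C - \<tau> *\<^sub>m Hc i j = 0"
    proof (rule trace_form_nondegenerate)
      show "\<tau>' *\<^sub>m C - \<tau> *\<^sub>m Hc i j \<in> \<hh>" using \<open>C \<in> \<hh>\<close> hc by (intro cartan_diff cartan_smul)
      show "mtr (H \<odot> (\<tau>' *\<^sub>m C - \<tau> *\<^sub>m Hc i j)) = 0" if "H \<in> \<hh>" for H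
        using t1[OF that] t2[OF that] by (simp add: mm_linear mtr_linear)
    qed
    then have e: "\<tau>' *\<^sub>m C = \<tau> *\<^sub>m Hc i j" by simp
    have "\<tau>' * al i j C = \<tau> * al i j (Hc i j)" using arg_cong[OF e, of "al i j"] by (simp add: al_linear)
    moreover have "al i j C = 2" using C2 \<alpha>[OF \<open>C \<in> \<hh>\<close>] by simp
    ultimately have "\<tau>' = \<tau>" using ij by (simp add: al_Hc)
    then have "(inverse \<tau>' * \<tau>') *\<^sub>m C = (inverse \<tau>' * \<tau>') *\<^sub>m Hc i j"
      using arg_cong[OF e, of "\<lambda>A. inverse \<tau>' *\<^sub>m A"] by (simp add: smul_simps)
    then have "C = Hc i j" using \<open>\<tau>' \<noteq> 0\<close> by (simp add: smul_simps)
    then show "\<mu> (brk (dimN t n) X Y) \<in> \<real> \<and> 0 \<le> Re (\<mu> (brk (dimN t n) X Y))"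
      using dom v ij by (simp flip: C_def)
  qed
qed

lemma cartan_real_imaginary:
  assumes "H \<in> \<hh>"
  shows "\<exists>A K. hreal A \<and> hreal K \<and> H = A + \<i> *\<^sub>m K"
proof -
  let ?c = "\<lambda>i j. cnj (H i j)"
  have c: "?c \<in> \<hh>" by (rule cartan_cnj[OF assms])
  let ?A = "(1/2) *\<^sub>m (H + ?c)" and ?K = "(- \<i> / 2) *\<^sub>m (H - ?c)"
  have "hreal ?A" "hreal ?K"
    using assms c by (auto simp: hreal_def cmat_apply complex_is_Real_iff complex_eq_iff
      intro!: cartan_smul cartan_add cartan_diff)
  moreover have "H = ?A + \<i> *\<^sub>m ?K"
    by (simp add: fun_eq_iff cmat_apply algebra_simps)
  ultimately show ?thesis by blast
qed

text \<open>The gaps of \<open>Hrho\<close> are at least \<open>2\<close>, so a large multiple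
  outweighs \<open>K\<close>. By linearity, identities on \<open>sdec\<close> elements thereby
  extend to all real elements.\<close>

lemma sdec_shift:
  assumes K: "hreal K"
  shows "\<exists>c\<ge>0. sdec (of_real c *\<^sub>m Hrho + K)"
proof -
  define M where "M = (\<Sum>a<N. \<bar>Re (K a a)\<bar>)"
  have M: "\<bar>Re (K a a)\<bar> \<le> M" if "a < N" for a
    unfolding M_def using that by (intro member_le_sum) auto
  have "M \<ge> 0" unfolding M_def by (intro sum_nonneg) auto
  have "Re ((of_real (M + 1) *\<^sub>m Hrho + K) j j) < Re ((of_real (M + 1) *\<^sub>m Hrho + K) i i)"
    if "i < j" "j < N" for i j
  proof -
    have "(M + 1) * 2 \<le> (M + 1) * (2 * (real j - real i))"
      using that \<open>M \<ge> 0\<close> by (intro mult_left_mono) auto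
    moreover have "\<bar>Re (K i i)\<bar> \<le> M" "\<bar>Re (K j j)\<bar> \<le> M" using M that by auto
    ultimately show ?thesis using that by (simp add: Hrho_def algebra_simps)
  qed
  moreover have "hreal (of_real (M + 1) *\<^sub>m Hrho + K)"
    using K sdec_Hrho by (intro hreal_add hreal_smul) (auto simp: sdec_def)
  ultimately show ?thesis using \<open>M \<ge> 0\<close> by (intro exI[of _ "M + 1"]) (auto simp: sdec_def)
qed

end

section \<open>Weight vectors\<close>

context lie_rep
begin

lemma rep_vec_add: "A \<in> \<gg> \<Longrightarrow> A' \<in> \<gg> \<Longrightarrow> \<phi> (A + A') *v v = \<phi> A *v v + \<phi> A' *v v"
  by (simp only: rep_add matrix_vector_mult_add_rdistrib)

lemma rep_vec_smul: "A \<in> \<gg> \<Longrightarrow> \<phi> (c *\<^sub>m A) *v v = c *s (\<phi> A *v v)"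
  by (simp add: vec_eq_iff matrix_vector_mult_def rep_smul sum_distrib_left mult.assoc)

lemma rep_vec_sum:
  "(\<And>k. k \<in> K \<Longrightarrow> A k \<in> \<gg>) \<Longrightarrow> \<phi> (\<Sum>k\<in>K. A k) *v v = (\<Sum>k\<in>K. \<phi> (A k) *v v)"
proof (induction K rule: infinite_finite_induct)
  case (insert x F)
  have "\<phi> (A x + (\<Sum>k\<in>F. A k)) *v v = \<phi> (A x) *v v + \<phi> (\<Sum>k\<in>F. A k) *v v"
    using insert by (intro rep_vec_add lie_sum) auto
  moreover have "\<phi> (\<Sum>k\<in>F. A k) *v v = (\<Sum>k\<in>F. \<phi> (A k) *v v)" using insert by blast
  ultimately show ?case by (simp only: sum.insert[OF insert(1,2)])
next
  case (infinite K)
  show ?case unfolding sum.infinite[OF infinite(1)] rep_zero by simp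
next
  case empty
  show ?case unfolding sum.empty rep_zero by simp
qed

lemma cartan_rep_commute:
  assumes "H \<in> \<hh>" "K \<in> \<hh>"
  shows "\<phi> H ** \<phi> K = \<phi> K ** \<phi> H"
proof -
  have d: "is_diag H" "is_diag K" using assms cartan_diag by auto
  have "H \<odot> K = K \<odot> H"
    by (rule is_mat_eqI, rule mm_is_mat, rule mm_is_mat)
      (use d(2) in \<open>auto simp: diag_mm[OF d(1)] mm_diag[OF d(1)] is_diag_def, metis\<close>)
  then have "\<phi> (H \<odot> K - K \<odot> H) = 0" by (simp add: rep_zero)
  then show ?thesis using rep_brk assms cartan_lie by simp
qed

definition wvec :: "(cmat \<Rightarrow> complex) \<Rightarrow> complex^'d \<Rightarrow> bool" where
  "wvec \<nu> v \<longleftrightarrow> (\<forall>H\<in>\<hh>. \<phi> H *v v = \<nu> H *s v)"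

lemma wvec_Xr:
  assumes v: "wvec \<nu> v" and ij: "i < N" "j < N" "i \<noteq> j"
  shows "wvec (\<lambda>H. \<nu> H + al i j H) (\<phi> (Xr i j) *v v)"
  unfolding wvec_def
proof
  fix H assume H: "H \<in> \<hh>"
  have X: "Xr i j \<in> \<gg>" by (rule Xr_lie[OF ij])
  have "H \<odot> Xr i j - Xr i j \<odot> H = al i j H *\<^sub>m Xr i j" using cartan_Xr[OF H ij(1,2)] by simp
  then have "\<phi> H ** \<phi> (Xr i j) - \<phi> (Xr i j) ** \<phi> H = \<phi> (al i j H *\<^sub>m Xr i j)"
    using rep_brk[OF cartan_lie[OF H] X] by simp
  then have "(\<phi> H ** \<phi> (Xr i j) - \<phi> (Xr i j) ** \<phi> H) *v v = al i j H *s (\<phi> (Xr i j) *v v)"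
    using rep_vec_smul[OF X] by simp
  then have "\<phi> H *v (\<phi> (Xr i j) *v v) = \<phi> (Xr i j) *v (\<phi> H *v v) + al i j H *s (\<phi> (Xr i j) *v v)"
    by (simp add: matrix_vector_mult_diff_rdistrib matrix_vector_mul_assoc algebra_simps)
  also have "\<phi> H *v v = \<nu> H *s v" using v H by (simp add: wvec_def)
  also have "\<phi> (Xr i j) *v (\<nu> H *s v) = \<nu> H *s (\<phi> (Xr i j) *v v)" by (rule vector_scalar_commute)
  finally show "\<phi> H *v (\<phi> (Xr i j) *v v) = (\<nu> H + al i j H) *s (\<phi> (Xr i j) *v v)"
    by (simp add: vec.scale_left_distrib)
qed

text \<open>A root vector shifts a weight by a root, which is real on real elements, so the span is
  a nonzero invariant subspace and irreducibility applies. Only differences are recorded, because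
  nothing is known yet about \<open>\<nu>0\<close> itself.\<close>

lemma weight_vectors_span:
  assumes v0: "wvec \<nu>0 v0" "v0 \<noteq> 0"
  shows "vec.span {v. \<exists>\<nu>. wvec \<nu> v \<and> (\<forall>H. hreal H \<longrightarrow> \<nu> H - \<nu>0 H \<in> \<real>)} = UNIV" (is "vec.span ?V = UNIV")
proof -
  let ?S = "vec.span ?V"
  have sub: "vec.subspace ?S" by (rule vec.subspace_span)
  have inv: "\<phi> L *v v \<in> ?S" if L: "L \<in> \<gg>" and v: "v \<in> ?V" for L v
  proof -
    obtain \<nu> where \<nu>: "wvec \<nu> v" "\<And>H. hreal H \<Longrightarrow> \<nu> H - \<nu>0 H \<in> \<real>" using v by blast
    have X: "\<phi> (Xr i j) *v v \<in> ?S" if ij: "i < N" "j < N" "i \<noteq> j" for i j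
    proof (rule vec.span_base, rule CollectI, intro exI conjI)
      show "wvec (\<lambda>H. \<nu> H + al i j H) (\<phi> (Xr i j) *v v)" by (rule wvec_Xr[OF \<nu>(1) ij])
      show "\<forall>H. hreal H \<longrightarrow> \<nu> H + al i j H - \<nu>0 H \<in> \<real>"
      proof (intro allI impI)
        fix H assume H: "hreal H"
        have "\<nu> H + al i j H - \<nu>0 H = (\<nu> H - \<nu>0 H) + al i j H" by simp
        then show "\<nu> H + al i j H - \<nu>0 H \<in> \<real>" using \<nu>(2)[OF H] al_real[OF H] by (metis Reals_add)
      qed
    qed
    obtain D c where Dc: "D \<in> \<hh>" "L = D + (\<Sum>i<N. \<Sum>j\<in>{..<N}-{i}. c i j *\<^sub>m Xr i j)"
      using lie_decomp[OF L] by blast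
    have g: "c i j *\<^sub>m Xr i j \<in> \<gg>" if "i \<in> {..<N}" "j \<in> {..<N}-{i}" for i j
      using that by (intro lie_smul Xr_lie) auto
    have "\<phi> L *v v = \<phi> D *v v + (\<Sum>i<N. \<Sum>j\<in>{..<N}-{i}. \<phi> (c i j *\<^sub>m Xr i j) *v v)"
    proof -
      have "\<phi> L *v v = \<phi> D *v v + \<phi> (\<Sum>i<N. \<Sum>j\<in>{..<N}-{i}. c i j *\<^sub>m Xr i j) *v v"
        unfolding Dc(2) by (intro rep_vec_add cartan_lie Dc(1) lie_sum g)
      also have "\<phi> (\<Sum>i<N. \<Sum>j\<in>{..<N}-{i}. c i j *\<^sub>m Xr i j) *v v =
          (\<Sum>i<N. \<phi> (\<Sum>j\<in>{..<N}-{i}. c i j *\<^sub>m Xr i j) *v v)"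
        by (intro rep_vec_sum lie_sum g)
      also have "\<dots> = (\<Sum>i<N. \<Sum>j\<in>{..<N}-{i}. \<phi> (c i j *\<^sub>m Xr i j) *v v)"
        by (intro sum.cong refl rep_vec_sum g)
      finally show ?thesis .
    qed
    moreover have "\<phi> D *v v \<in> ?S"
    proof -
      have "\<phi> D *v v = \<nu> D *s v" using \<nu>(1) Dc(1) by (simp add: wvec_def)
      then show ?thesis using vec.span_scale[OF vec.span_base[OF v]] by simp
    qed
    moreover have "\<phi> (c i j *\<^sub>m Xr i j) *v v \<in> ?S" if "i \<in> {..<N}" "j \<in> {..<N}-{i}" for i j
      using X[of i j] that rep_vec_smul[OF Xr_lie, of i j] vec.span_scale by auto
    ultimately show ?thesis by (simp only:) (intro vec.span_add vec.span_sum)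
  qed
  have inv': "\<phi> L *v x \<in> ?S" if L: "L \<in> \<gg>" and x: "x \<in> ?S" for L x
    using x
  proof (induction rule: vec.span_induct_alt)
    case base
    show ?case by (simp add: vec.span_zero)
  next
    case (step c x y)
    have "\<phi> L *v (c *s x + y) = c *s (\<phi> L *v x) + \<phi> L *v y"
      by (simp add: matrix_vector_right_distrib vector_scalar_commute)
    then show ?case by (simp only:) (intro vec.span_add vec.span_scale inv[OF L step(1)] step(2))
  qed
  have "v0 \<in> ?S" using v0 by (intro vec.span_base CollectI exI[of _ \<nu>0]) simp
  then have "?S \<noteq> {0}" using v0 by blast
  then show ?thesis using irr sub inv' unfolding irreducible_rep_def by blast
qed

text \<open>Indexing by \<open>'d\<close> lists the weights with multiplicity, so the determinant on
  the Cartan subalgebra becomes a product over the index type.\<close>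

theorem weight_basis_exists:
  "\<exists>(b :: 'd \<Rightarrow> complex^'d) \<nu>. inj b \<and> vec.independent (range b) \<and> vec.span (range b) = UNIV \<and>
     (\<forall>i. wvec (\<nu> i) (b i)) \<and> (\<forall>i k H. hreal H \<longrightarrow> \<nu> i H - \<nu> k H \<in> \<real>)"
proof -
  obtain \<nu>0 v0 where v0: "v0 \<noteq> 0" "\<forall>H\<in>\<hh>. \<phi> H *v v0 = \<nu>0 H *s v0"
    using common_eigenvector[of \<hh> \<phi>] cartan_rep_commute by blast
  then have v0': "wvec \<nu>0 v0" by (simp add: wvec_def)
  let ?V = "{v. \<exists>\<nu>. wvec \<nu> v \<and> (\<forall>H. hreal H \<longrightarrow> \<nu> H - \<nu>0 H \<in> \<real>)}"
  obtain T where T: "T \<subseteq> ?V" "vec.independent T" "?V \<subseteq> vec.span T"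
    using vec.maximal_independent_subset by blast
  have spT: "vec.span T = UNIV"
    using vec.span_mono[OF T(3)] weight_vectors_span[OF v0' v0(1)] by (simp add: vec.span_span) blast
  have "vec.dim (vec.span T) = card T" using vec.dim_span_eq_card_independent[OF T(2)] .
  then have card: "card T = CARD('d)" unfolding spT vec_dim_card by simp
  have "finite T" by (rule vec.finiteI_independent[OF T(2)])
  then obtain b :: "'d \<Rightarrow> complex^'d" where b: "bij_betw b UNIV T"
    using finite_same_card_bij[of "UNIV :: 'd set" T] card by auto
  then have inj: "inj b" and rng: "range b = T" by (auto simp: bij_betw_def)
  have "\<forall>i. \<exists>\<nu>. wvec \<nu> (b i) \<and> (\<forall>H. hreal H \<longrightarrow> \<nu> H - \<nu>0 H \<in> \<real>)"
    using rng T(1) by blast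
  from choice[OF this] obtain \<nu> where \<nu>: "\<And>i. wvec (\<nu> i) (b i)" "\<And>i H. hreal H \<Longrightarrow> \<nu> i H - \<nu>0 H \<in> \<real>"
    by blast
  have "\<nu> i H - \<nu> k H \<in> \<real>" if "hreal H" for i k H
    using Reals_diff[OF \<nu>(2)[OF that, of i] \<nu>(2)[OF that, of k]] by simp
  then show ?thesis
    by (intro exI[of _ b] exI[of _ \<nu>] conjI allI impI) (simp_all add: inj rng T(2) spT \<nu>(1))
qed

end

section \<open>Weight multiplicities, Weyl invariance and dominant weights\<close>

locale weights = lie_rep N t n r B \<phi> for N t n r B and \<phi> :: "cmat \<Rightarrow> complex^'d^'d" +
  fixes b :: "'d \<Rightarrow> complex^'d" and \<nu> :: "'d \<Rightarrow> cmat \<Rightarrow> complex"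
  assumes inj_b: "inj b" and indep: "vec.independent (range b)" and span_b: "vec.span (range b) = UNIV"
    and wv: "\<And>i. wvec (\<nu> i) (b i)" and real_diff: "\<And>i k H. hreal H \<Longrightarrow> \<nu> i H - \<nu> k H \<in> \<real>"
begin

lemma b_nz: "b i \<noteq> 0"
proof
  assume "b i = 0"
  then have "0 \<in> range b" by (simp add: image_iff) (rule exI[of _ i], simp)
  from vec.dependent_zero[OF this] indep show False by (simp only: not_True_eq_False)
qed

lemma b_eigen: "H \<in> \<hh> \<Longrightarrow> \<phi> H *v b i = \<nu> i H *s b i"
  using wv by (simp add: wvec_def)

lemma \<nu>_linh: "linh (\<nu> i)"
  unfolding linh_def
proof (intro conjI ballI allI)
  fix A A' assume A: "A \<in> \<hh>" "A' \<in> \<hh>"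
  have "\<nu> i (A + A') *s b i = \<nu> i A *s b i + \<nu> i A' *s b i"
    using rep_vec_add[OF cartan_lie[OF A(1)] cartan_lie[OF A(2)], of "b i"]
    by (simp only: b_eigen A cartan_add)
  then have "\<nu> i (A + A') *s b i = (\<nu> i A + \<nu> i A') *s b i"
    by (simp only: vec.scale_left_distrib)
  then show "\<nu> i (A + A') = \<nu> i A + \<nu> i A'" using b_nz[of i] by (simp only: vec.scale_cancel_right) simp
next
  fix c A assume A: "A \<in> \<hh>"
  have "\<nu> i (c *\<^sub>m A) *s b i = c *s (\<nu> i A *s b i)"
    using rep_vec_smul[OF cartan_lie[OF A], of c "b i"] by (simp only: b_eigen A cartan_smul)
  then have "\<nu> i (c *\<^sub>m A) *s b i = (c * \<nu> i A) *s b i" by (simp only: vec.scale_scale)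
  then show "\<nu> i (c *\<^sub>m A) = c * \<nu> i A" using b_nz[of i] by (simp only: vec.scale_cancel_right) simp
qed

lemma b_independent: "(\<Sum>i\<in>UNIV. c i *s b i) = 0 \<Longrightarrow> c i = 0"
proof -
  assume c: "(\<Sum>i\<in>UNIV. c i *s b i) = 0"
  have "(\<Sum>v\<in>range b. c (inv b v) *s v) = (\<Sum>i\<in>UNIV. c i *s b i)"
    by (subst sum.reindex[OF inj_b]) (simp add: inj_b)
  then have "c (inv b (b i)) = 0"
    using vec.independentD[OF indep, of "range b" "\<lambda>v. c (inv b v)" "b i"] c by simp
  then show ?thesis by (simp add: inj_b)
qed

lemma det_weights:
  assumes H: "H \<in> \<hh>"
  shows "det (mat z + \<phi> H) = (\<Prod>i\<in>UNIV. z + \<nu> i H)"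
proof -
  define P :: "complex^'d^'d" where "P = (\<chi> a i. b i $ a)"
  define D :: "complex^'d^'d" where "D = (\<chi> i j. if i = j then z + \<nu> i H else 0)"
  have "column i P = b i" for i by (simp add: column_def P_def vec_eq_iff)
  then have "\<forall>c. (\<Sum>i\<in>UNIV. c i *s column i P) = 0 \<longrightarrow> (\<forall>i. c i = 0)" using b_independent by auto
  then have "\<exists>Q. Q ** P = mat 1" by (simp only: matrix_left_invertible_independent_columns)
  then have "det P \<noteq> 0" using invertible_left_inverse invertible_det_nz by blast
  have "((mat z + \<phi> H) ** P) $ a $ i = (P ** D) $ a $ i" for a i
  proof -
    have "(\<phi> H ** P) $ a $ i = (\<phi> H *v b i) $ a"
      by (simp add: matrix_matrix_mult_def matrix_vector_mult_def P_def)
    then have "((mat z + \<phi> H) ** P) $ a $ i = z * b i $ a + \<nu> i H * b i $ a"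
      using b_eigen[OF H, of i] by (simp add: mm_add_right mat_mm_entry P_def)
    moreover have "(P ** D) $ a $ i = b i $ a * (z + \<nu> i H)"
      by (simp add: matrix_matrix_mult_def P_def D_def if_distrib[of "\<lambda>x. _ * x"] cong: if_cong)
    ultimately show ?thesis by (simp add: algebra_simps)
  qed
  then have "(mat z + \<phi> H) ** P = P ** D" by (simp add: vec_eq_iff)
  then have "det (mat z + \<phi> H) * det P = det P * det D" by (metis det_mul)
  then have "det (mat z + \<phi> H) = det D" using \<open>det P \<noteq> 0\<close> by simp
  also have "\<dots> = (\<Prod>i\<in>UNIV. z + \<nu> i H)" by (subst det_diagonal) (simp_all add: D_def)
  finally show ?thesis .
qed

definition idx :: "(cmat \<Rightarrow> complex) \<Rightarrow> 'd set" where
  "idx \<mu> = {i. \<forall>H\<in>\<hh>. \<nu> i H = \<mu> H}"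

lemma wspace_span: "wspace t n \<phi> \<mu> = vec.span (b ` idx \<mu>)"
proof
  have sub: "vec.subspace (wspace t n \<phi> \<mu>)"
    unfolding vec.subspace_def wspace_def
    by (auto simp: matrix_vector_right_distrib vec.scale_right_distrib vector_scalar_commute mult.commute)
  show "vec.span (b ` idx \<mu>) \<subseteq> wspace t n \<phi> \<mu>"
    by (rule vec.span_minimal[OF _ sub]) (auto simp: wspace_def idx_def b_eigen)
  show "wspace t n \<phi> \<mu> \<subseteq> vec.span (b ` idx \<mu>)"
  proof
    fix v assume v: "v \<in> wspace t n \<phi> \<mu>"
    have "v \<in> vec.span (range b)" using span_b by simp
    then obtain u where "v = (\<Sum>x\<in>range b. u x *s x)"
      using vec.span_finite[of "range b"] by auto
    then have vc: "v = (\<Sum>i\<in>UNIV. u (b i) *s b i)" by (simp add: sum.reindex[OF inj_b])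
    have "u (b i) = 0" if i: "i \<notin> idx \<mu>" for i
    proof -
      obtain H where H: "H \<in> \<hh>" "\<nu> i H \<noteq> \<mu> H" using i by (auto simp: idx_def)
      have "\<phi> H *v v = (\<Sum>i\<in>UNIV. u (b i) *s (\<phi> H *v b i))"
        unfolding vc by (simp add: vec.linear_sum[OF matrix_vector_mul_linear_gen] vector_scalar_commute)
      then have "(\<Sum>i\<in>UNIV. u (b i) *s (\<nu> i H *s b i)) = \<mu> H *s (\<Sum>i\<in>UNIV. u (b i) *s b i)"
        using v H by (simp add: wspace_def b_eigen flip: vc)
      then have "(\<Sum>i\<in>UNIV. (u (b i) * (\<nu> i H - \<mu> H)) *s b i) = 0"
        by (simp add: vec.scale_sum_right right_diff_distrib vec.scale_left_diff_distrib sum_subtractf mult.commute)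
      from b_independent[OF this, of i] show ?thesis using H by simp
    qed
    then have "v = (\<Sum>i\<in>idx \<mu>. u (b i) *s b i)"
      unfolding vc by (intro sum.mono_neutral_right) auto
    then show "v \<in> vec.span (b ` idx \<mu>)"
      by (simp only:) (intro vec.span_sum vec.span_scale vec.span_base imageI)
  qed
qed

lemma wmult_idx: "wmult t n \<phi> \<mu> = card (idx \<mu>)"
proof -
  have "vec.independent (b ` idx \<mu>)" by (rule vec.independent_mono[OF indep]) (rule image_mono, rule subset_UNIV)
  from vec.dim_span_eq_card_independent[OF this] have "wmult t n \<phi> \<mu> = card (b ` idx \<mu>)"
    by (simp only: wmult_def wspace_span)
  also have "\<dots> = card (idx \<mu>)" by (rule card_image) (use inj_b inj_on_subset in blast)
  finally show ?thesis .
qed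

lemma is_weight_iff: "is_weight t n \<phi> \<mu> \<longleftrightarrow> \<mu> \<in> range (\<lambda>i. zx (\<nu> i))"
proof
  assume w: "is_weight t n \<phi> \<mu>"
  then have "idx \<mu> \<noteq> {}" unfolding is_weight_def wspace_span by auto
  then obtain i where "\<forall>H\<in>\<hh>. \<nu> i H = \<mu> H" by (auto simp: idx_def)
  then have "\<mu> = zx (\<nu> i)" using w by (auto simp: is_weight_def zx_def fun_eq_iff)
  then show "\<mu> \<in> range (\<lambda>i. zx (\<nu> i))" by blast
next
  assume "\<mu> \<in> range (\<lambda>i. zx (\<nu> i))"
  then obtain i where i: "\<mu> = zx (\<nu> i)" by blast
  have "b i \<in> wspace t n \<phi> \<mu>" by (simp add: wspace_def i b_eigen)
  then have "wspace t n \<phi> \<mu> \<noteq> {0}" using b_nz by blast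
  then show "is_weight t n \<phi> \<mu>" by (simp add: is_weight_def i zx_def)
qed

text \<open>Multiplicities can be read off from the determinant at a point of the Cartan
  subalgebra that separates all functionals involved.\<close>
lemma card_idx_WG:
  assumes w: "w \<in> WG" and \<mu>: "linh \<mu>"
  shows "card (idx (\<lambda>H. \<mu> (w H))) = card (idx \<mu>)"
proof -
  let ?\<mu>w = "\<lambda>H. \<mu> (w H)"
  \<comment> \<open>The first family makes \<open>H\<close> detect which weights equal
    \<open>?\<mu>w\<close>; the second makes \<open>w H\<close> detect which weights equal
    \<open>\<mu>\<close>.\<close>
  let ?F = "range (\<lambda>i H. \<nu> i H - ?\<mu>w H) \<union> range (\<lambda>i H. \<nu> i (w H) - ?\<mu>w H)"
  let ?\<Phi> = "{f \<in> ?F. \<exists>H\<in>\<hh>. f H \<noteq> 0}"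
  have "linh f" if "f \<in> ?F" for f
    using that by (auto intro!: linh_diff linh_WG[OF _ w] \<nu>_linh \<mu>)
  moreover have "finite ?F" by (intro finite_UnI finite_imageI finite)
  then have "finite ?\<Phi>" by (rule rev_finite_subset) (rule Collect_restrict)
  ultimately obtain H where H: "H \<in> \<hh>" "\<forall>f\<in>?\<Phi>. f H \<noteq> 0"
    using separating_element[of ?\<Phi>] by blast
  have 1: "idx ?\<mu>w = {i. \<nu> i H = ?\<mu>w H}"
  proof (intro equalityI subsetI)
    fix i assume "i \<in> idx ?\<mu>w" then show "i \<in> {i. \<nu> i H = ?\<mu>w H}" using H by (simp add: idx_def)
  next
    fix i assume i: "i \<in> {i. \<nu> i H = ?\<mu>w H}"
    show "i \<in> idx ?\<mu>w"
    proof (rule ccontr)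
      assume "i \<notin> idx ?\<mu>w"
      then have "\<exists>H\<in>\<hh>. \<nu> i H - ?\<mu>w H \<noteq> 0" by (auto simp: idx_def)
      then have "(\<lambda>H. \<nu> i H - ?\<mu>w H) \<in> ?\<Phi>" by blast
      from bspec[OF H(2) this] show False using i by simp
    qed
  qed
  have 2: "idx \<mu> = {i. \<nu> i (w H) = ?\<mu>w H}"
  proof (intro equalityI subsetI)
    fix i assume "i \<in> idx \<mu>" then show "i \<in> {i. \<nu> i (w H) = ?\<mu>w H}" using WG_cartan[OF w H(1)] by (simp add: idx_def)
  next
    fix i assume i: "i \<in> {i. \<nu> i (w H) = ?\<mu>w H}"
    show "i \<in> idx \<mu>"
    proof (rule ccontr)
      assume "i \<notin> idx \<mu>"
      then obtain K where K: "K \<in> \<hh>" "\<nu> i K \<noteq> \<mu> K" by (auto simp: idx_def)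
      obtain w' where w': "w' \<in> WG" "\<And>H. w (w' H) = H" using WG_inverse[OF w] by blast
      have "w' K \<in> \<hh>" "\<nu> i (w (w' K)) - ?\<mu>w (w' K) \<noteq> 0" using w' K WG_cartan by auto
      then have "(\<lambda>H. \<nu> i (w H) - ?\<mu>w H) \<in> ?\<Phi>" by blast
      from bspec[OF H(2) this] show False using i by simp
    qed
  qed
  have "(\<Prod>i\<in>UNIV. z + \<nu> i H) = (\<Prod>i\<in>UNIV. z + \<nu> i (w H))" for z
  proof -
    have "det (mat z + \<phi> (w H)) = det (mat z + \<phi> H)"
      by (rule WG_invariant_of_Ad[of "\<lambda>L. det (mat z + \<phi> L)", OF _ w H(1)]) (rule det_Ad)
    then show ?thesis using det_weights H(1) WG_cartan[OF w H(1)] by simp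
  qed
  from prod_linear_counts[OF finite this, of "?\<mu>w H"] show ?thesis unfolding 1 2 by simp
qed

lemma weight_WG: "w \<in> WG \<Longrightarrow> \<exists>k. \<forall>H\<in>\<hh>. \<nu> k H = \<nu> i (w H)"
proof -
  assume w: "w \<in> WG"
  have "i \<in> idx (\<nu> i)" by (simp add: idx_def)
  then have "card (idx (\<nu> i)) \<noteq> 0" by auto
  then have "idx (\<lambda>H. \<nu> i (w H)) \<noteq> {}" using card_idx_WG[OF w \<nu>_linh, of i] by auto
  then show ?thesis by (auto simp: idx_def)
qed

text \<open>The reflection negates its own coroot, so the reflected weight takes the opposite value
  there. The difference of the two weights is real and is twice the value in question.\<close>

lemma weight_coroot_real:
  assumes v: "rvalid p q"
  shows "\<nu> i (Hc p q) \<in> \<real>"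
proof -
  have pq: "p < N" "q < N" "p \<noteq> q" using rvalidD v by auto
  have hc: "Hc p q \<in> \<hh>" using Hc_cartan pq by blast
  obtain k where k: "\<And>H. H \<in> \<hh> \<Longrightarrow> \<nu> k H = \<nu> i (refl p q H)" using weight_WG[OF WG_refl[OF v]] by blast
  have "refl p q (Hc p q) = (- 1) *\<^sub>m Hc p q"
    using al_Hc[OF pq] by (simp add: refl_def fun_eq_iff cmat_apply)
  then have "\<nu> k (Hc p q) = - \<nu> i (Hc p q)" using k[OF hc] linh_smul[OF \<nu>_linh hc, of i "- 1"] by simp
  then have "2 * \<nu> i (Hc p q) = \<nu> i (Hc p q) - \<nu> k (Hc p q)" by simp
  also have "\<dots> \<in> \<real>" using real_diff hreal_Hc pq by blast
  finally have "2 * \<nu> i (Hc p q) / 2 \<in> \<real>" by (intro Reals_divide) auto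
  then show ?thesis by simp
qed

lemma dominant_weight_iff:
  "dominant t n (zx (\<nu> i)) \<longleftrightarrow> (\<forall>p q. rvalid p q \<and> p < q \<longrightarrow> 0 \<le> Re (\<nu> i (Hc p q)))"
proof -
  have "zx (\<nu> i) (Hc p q) = \<nu> i (Hc p q)" if "rvalid p q" for p q
    using that rvalidD Hc_cartan by simp
  moreover have "dominant t n (zx (\<nu> i)) \<longleftrightarrow> (\<forall>p q. rvalid p q \<and> p < q \<longrightarrow>
      zx (\<nu> i) (Hc p q) \<in> \<real> \<and> 0 \<le> Re (zx (\<nu> i) (Hc p q)))"
    by (rule dominant_iff) (simp add: zx_def)
  ultimately show ?thesis using weight_coroot_real by auto
qed

text \<open>Among the weights in the orbit, take one with the largest real part at
  \<open>Hrho\<close>. A reflection in a positive root cannot increase that part, and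
  \<open>al p q Hrho > 0\<close>, so the value on the coroot is nonnegative.\<close>

lemma dominant_exists: "\<exists>k. dominant t n (zx (\<nu> k)) \<and> (\<exists>w\<in>WG. \<forall>H\<in>\<hh>. \<nu> i H = \<nu> k (w H))"
proof -
  define K where "K = {k. \<exists>w\<in>WG. \<forall>H\<in>\<hh>. \<nu> k H = \<nu> i (w H)}"
  have r: "Hrho \<in> \<hh>" using sdec_Hrho by (simp add: sdec_def hreal_def)
  have "i \<in> K" unfolding K_def using WG_id by (auto intro!: bexI[of _ id])
  let ?R = "(\<lambda>k. Re (\<nu> k Hrho)) ` K"
  have "Max ?R \<in> ?R" using \<open>i \<in> K\<close> by (intro Max_in) auto
  then obtain k where k: "k \<in> K" "Max ?R = Re (\<nu> k Hrho)" by blast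
  have max: "Re (\<nu> l Hrho) \<le> Re (\<nu> k Hrho)" if "l \<in> K" for l
    unfolding k(2)[symmetric] using that by (intro Max_ge) auto
  obtain w where w: "w \<in> WG" "\<And>H. H \<in> \<hh> \<Longrightarrow> \<nu> k H = \<nu> i (w H)" using k(1) by (auto simp: K_def)
  have "dominant t n (zx (\<nu> k))"
    unfolding dominant_weight_iff
  proof (intro allI impI)
    fix p q assume pq: "rvalid p q \<and> p < q"
    then have v: "p < N" "q < N" using rvalidD by auto
    have hc: "Hc p q \<in> \<hh>" using Hc_cartan v by blast
    obtain l where l: "\<And>H. H \<in> \<hh> \<Longrightarrow> \<nu> l H = \<nu> k (refl p q H)" using weight_WG[OF WG_refl] pq by blast
    have "\<nu> l H = \<nu> i ((w \<circ> refl p q) H)" if "H \<in> \<hh>" for H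
      using l[OF that] w(2) refl_cartan[OF v that] by simp
    then have "l \<in> K" unfolding K_def using WG_comp[OF w(1) WG_refl] pq by blast
    then have "Re (\<nu> l Hrho) \<le> Re (\<nu> k Hrho)" by (rule max)
    moreover have "\<nu> l Hrho = \<nu> k Hrho - al p q Hrho * \<nu> k (Hc p q)"
      using l[OF r] linh_minus[OF \<nu>_linh r cartan_smul[OF hc]] linh_smul[OF \<nu>_linh hc]
      unfolding refl_def by simp
    moreover have "al p q Hrho = of_real (2 * (real q - real p))"
      using v by (simp add: al_def Hrho_def)
    ultimately have "0 \<le> 2 * (real q - real p) * Re (\<nu> k (Hc p q))" by simp
    then show "0 \<le> Re (\<nu> k (Hc p q))" using pq by (simp add: zero_le_mult_iff)
  qed
  moreover obtain w' where w': "w' \<in> WG" "\<And>H. w (w' H) = H" using WG_inverse[OF w(1)] by blast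
  have "\<nu> i H = \<nu> k (w' H)" if "H \<in> \<hh>" for H using w(2)[of "w' H"] w' WG_cartan[OF w'(1) that] by simp
  ultimately show ?thesis using w'(1) by blast
qed

text \<open>Climbing from \<open>w H\<close> never lowers the real part of a dominant weight, and
  the dominant element reached is \<open>H\<close> itself by
  \<open>dominant_conj_unique\<close>.\<close>

lemma dominant_le:
  assumes dom: "dominant t n (zx (\<nu> k))" and w: "w \<in> WG" and H: "sdec H"
  shows "Re (\<nu> k (w H)) \<le> Re (\<nu> k H)"
proof -
  have Hh: "H \<in> \<hh>" "hreal H" using H by (auto simp: sdec_def hreal_def)
  have "\<exists>w'\<in>WG. hdom (w' (w H)) \<and> Re (\<nu> k (w H)) \<le> Re (\<nu> k (w' (w H)))"
  proof (rule climb)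
    show "hreal (w H)" by (rule WG_hreal[OF w Hh(2)])
    show "\<nu> k (A - B) = \<nu> k A - \<nu> k B" if "A \<in> \<hh>" "B \<in> \<hh>" for A B using linh_minus \<nu>_linh that by blast
    show "\<nu> k (c *\<^sub>m A) = c * \<nu> k A" if "A \<in> \<hh>" for c A using linh_smul \<nu>_linh that by blast
    show "\<nu> k (Hc p q) \<in> \<real> \<and> 0 \<le> Re (\<nu> k (Hc p q))" if "rvalid p q" "p < q" for p q
      using dom that weight_coroot_real by (simp add: dominant_weight_iff)
  qed
  then obtain w' where w': "w' \<in> WG" "hdom (w' (w H))" "Re (\<nu> k (w H)) \<le> Re (\<nu> k (w' (w H)))" by blast
  have ww: "w' \<circ> w \<in> WG" using WG_comp w w' by blast
  obtain g where g: "g \<in> GG" "\<forall>H\<in>\<hh>. g \<odot> H = (w' \<circ> w) H \<odot> g" using WG_grp[OF ww] by blast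
  have "(w' \<circ> w) H = H"
    by (rule dominant_conj_unique[OF H WG_cartan[OF ww Hh(1)] g(1)]) (use g(2) Hh w' in auto)
  then show ?thesis using w'(3) by simp
qed

text \<open>Applying \<open>dominant_le\<close> to both weights gives equal real parts on strictly
  decreasing elements. Shifting by \<open>Hrho\<close> extends this to real elements, where the
  difference is real anyway, and complex linearity to all of \<open>\<hh>\<close>.\<close>

lemma dominant_unique:
  assumes dk: "dominant t n (zx (\<nu> k))" and dl: "dominant t n (zx (\<nu> l))"
    and w: "w \<in> WG" "\<And>H. H \<in> \<hh> \<Longrightarrow> \<nu> l H = \<nu> k (w H)"
  shows "zx (\<nu> k) = zx (\<nu> l)"
proof -
  obtain w' where w': "w' \<in> WG" "\<And>H. w (w' H) = H" using WG_inverse[OF w(1)] by blast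
  have lk: "\<nu> k H = \<nu> l (w' H)" if "H \<in> \<hh>" for H using w(2)[of "w' H"] w' WG_cartan[OF w'(1) that] by simp
  have s: "Re (\<nu> k H) = Re (\<nu> l H)" if H: "sdec H" for H
  proof -
    have Hh: "H \<in> \<hh>" using H by (auto simp: sdec_def hreal_def)
    show ?thesis using dominant_le[OF dk w(1) H] dominant_le[OF dl w'(1) H] w(2)[OF Hh] lk[OF Hh] by simp
  qed
  have rl: "\<nu> k K = \<nu> l K" if K: "hreal K" for K
  proof -
    have r: "Hrho \<in> \<hh>" using sdec_Hrho by (simp add: sdec_def hreal_def)
    have Kh: "K \<in> \<hh>" using K by (simp add: hreal_def)
    obtain c where c: "sdec (of_real c *\<^sub>m Hrho + K)" using sdec_shift[OF K] by blast
    have e: "\<nu> i (of_real c *\<^sub>m Hrho + K) = of_real c * \<nu> i Hrho + \<nu> i K" for i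
      using linh_add[OF \<nu>_linh cartan_smul[OF r] Kh] linh_smul[OF \<nu>_linh r] by simp
    have "Re (\<nu> k K) = Re (\<nu> l K)" using s[OF c] s[OF sdec_Hrho] unfolding e by simp
    moreover have "\<nu> k K - \<nu> l K \<in> \<real>" using real_diff K by blast
    ultimately show ?thesis by (auto simp: complex_eq_iff complex_is_Real_iff)
  qed
  have "\<nu> k H = \<nu> l H" if H: "H \<in> \<hh>" for H
  proof -
    obtain A K where AK: "hreal A" "hreal K" "H = A + \<i> *\<^sub>m K" using cartan_real_imaginary[OF H] by blast
    have h: "A \<in> \<hh>" "K \<in> \<hh>" using AK by (auto simp: hreal_def)
    have "\<nu> i H = \<nu> i A + \<i> * \<nu> i K" for i
      unfolding AK(3) using linh_add[OF \<nu>_linh h(1) cartan_smul[OF h(2)]] linh_smul[OF \<nu>_linh h(2)] by simp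
    then show ?thesis using rl AK by simp
  qed
  then show ?thesis by (simp add: zx_eq_iff)
qed

definition Dom :: "(cmat \<Rightarrow> complex) set" where
  "Dom = {\<mu>. is_weight t n \<phi> \<mu> \<and> dominant t n \<mu>}"

lemma Dom_iff: "\<mu> \<in> Dom \<longleftrightarrow> (\<exists>k. \<mu> = zx (\<nu> k) \<and> dominant t n (zx (\<nu> k)))"
  by (auto simp: Dom_def is_weight_iff)

lemma finite_Dom: "finite Dom"
  by (rule finite_subset[of _ "range (\<lambda>i. zx (\<nu> i))"]) (auto simp: Dom_def is_weight_iff)

lemma zx_WG: "w \<in> WG \<Longrightarrow> zx (\<lambda>H. zx f (w H)) = zx (\<lambda>H. f (w H))"
  by (auto simp: zx_eq_iff WG_cartan)

lemma orbit_weights: "weyl_orbit t n (zx (\<nu> k)) \<subseteq> range (\<lambda>i. zx (\<nu> i))"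
proof
  fix \<tau> assume "\<tau> \<in> weyl_orbit t n (zx (\<nu> k))"
  then obtain w where w: "w \<in> WG" "\<tau> = zx (\<lambda>H. \<nu> k (w H))" by (auto simp: weyl_orbit_eq zx_WG)
  then obtain i where "\<forall>H\<in>\<hh>. \<nu> i H = \<nu> k (w H)" using weight_WG by blast
  then have "\<tau> = zx (\<nu> i)" using w by (auto simp: zx_eq_iff)
  then show "\<tau> \<in> range (\<lambda>i. zx (\<nu> i))" by blast
qed

lemma finite_orbit: "finite (weyl_orbit t n (zx (\<nu> k)))"
  using orbit_weights finite_subset by (metis finite finite_imageI)

lemma idx_zx: "idx (zx f) = idx f"
  by (auto simp: idx_def)

lemma wmult_orbit: "\<tau> \<in> weyl_orbit t n (zx (\<nu> k)) \<Longrightarrow> wmult t n \<phi> \<tau> = wmult t n \<phi> (zx (\<nu> k))"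
proof -
  assume "\<tau> \<in> weyl_orbit t n (zx (\<nu> k))"
  then obtain w where w: "w \<in> WG" "\<tau> = zx (\<lambda>H. \<nu> k (w H))" by (auto simp: weyl_orbit_eq zx_WG)
  then show ?thesis using card_idx_WG[OF w(1) \<nu>_linh, of k] by (simp add: wmult_idx idx_zx)
qed

lemma weights_partition:
  "range (\<lambda>i. zx (\<nu> i)) = (\<Union>\<mu>\<in>Dom. weyl_orbit t n \<mu>)"
proof
  show "(\<Union>\<mu>\<in>Dom. weyl_orbit t n \<mu>) \<subseteq> range (\<lambda>i. zx (\<nu> i))"
  proof (rule UN_least)
    fix \<mu> assume "\<mu> \<in> Dom"
    then obtain k where "\<mu> = zx (\<nu> k)" using Dom_iff by blast
    then show "weyl_orbit t n \<mu> \<subseteq> range (\<lambda>i. zx (\<nu> i))" using orbit_weights by (simp only:)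
  qed
  show "range (\<lambda>i. zx (\<nu> i)) \<subseteq> (\<Union>\<mu>\<in>Dom. weyl_orbit t n \<mu>)"
  proof (intro image_subsetI)
    fix i
    obtain k w where k: "dominant t n (zx (\<nu> k))" "w \<in> WG" "\<forall>H\<in>\<hh>. \<nu> i H = \<nu> k (w H)"
      using dominant_exists by blast
    then have "zx (\<nu> i) = zx (\<lambda>H. zx (\<nu> k) (w H))" by (simp add: zx_eq_iff WG_cartan)
    then have "zx (\<nu> i) \<in> weyl_orbit t n (zx (\<nu> k))" unfolding weyl_orbit_eq using k(2) by blast
    then show "zx (\<nu> i) \<in> (\<Union>\<mu>\<in>Dom. weyl_orbit t n \<mu>)" using k(1) Dom_iff by blast
  qed
qed

lemma orbits_disjoint:
  assumes "\<mu> \<in> Dom" "\<mu>' \<in> Dom" "\<mu> \<noteq> \<mu>'"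
  shows "weyl_orbit t n \<mu> \<inter> weyl_orbit t n \<mu>' = {}"
proof (rule ccontr)
  assume "weyl_orbit t n \<mu> \<inter> weyl_orbit t n \<mu>' \<noteq> {}"
  moreover obtain k l where kl: "\<mu> = zx (\<nu> k)" "\<mu>' = zx (\<nu> l)" "dominant t n (zx (\<nu> k))" "dominant t n (zx (\<nu> l))"
    using assms by (auto simp: Dom_iff)
  ultimately obtain w v where wv: "w \<in> WG" "v \<in> WG" "zx (\<lambda>H. \<nu> k (w H)) = zx (\<lambda>H. \<nu> l (v H))"
    by (auto simp: weyl_orbit_eq zx_WG)
  obtain v' where v': "v' \<in> WG" "\<And>H. v (v' H) = H" using WG_inverse[OF wv(2)] by blast
  have "\<nu> l H = \<nu> k ((w \<circ> v') H)" if "H \<in> \<hh>" for H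
    using wv(3) v' WG_cartan[OF v'(1) that] by (auto simp: zx_eq_iff)
  from dominant_unique[OF kl(3,4) WG_comp[OF wv(1) v'(1)] this] show False using assms(3) kl by simp
qed

theorem weights_product:
  assumes H: "H \<in> \<hh>"
  shows "(\<Prod>i\<in>UNIV. z + \<nu> i H) = (\<Prod>\<mu>\<in>Dom. (\<Prod>\<tau>\<in>weyl_orbit t n \<mu>. z + \<tau> H) ^ wmult t n \<phi> \<mu>)"
proof -
  have "(\<Prod>i\<in>UNIV. z + \<nu> i H) = (\<Prod>\<tau>\<in>range (\<lambda>i. zx (\<nu> i)). \<Prod>i\<in>{i\<in>UNIV. zx (\<nu> i) = \<tau>}. z + \<nu> i H)"
    by (rule prod.image_gen) simp
  also have "\<dots> = (\<Prod>\<tau>\<in>range (\<lambda>i. zx (\<nu> i)). (z + \<tau> H) ^ wmult t n \<phi> \<tau>)"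
  proof (rule prod.cong[OF refl])
    fix \<tau> assume "\<tau> \<in> range (\<lambda>i. zx (\<nu> i))"
    then obtain k where k: "\<tau> = zx (\<nu> k)" by blast
    have "{i\<in>UNIV. zx (\<nu> i) = \<tau>} = idx \<tau>" by (auto simp: k zx_eq_iff idx_def)
    moreover have "\<nu> i H = \<tau> H" if "i \<in> idx \<tau>" for i using that H by (simp add: idx_def)
    ultimately show "(\<Prod>i\<in>{i\<in>UNIV. zx (\<nu> i) = \<tau>}. z + \<nu> i H) = (z + \<tau> H) ^ wmult t n \<phi> \<tau>"
      by (simp add: wmult_idx)
  qed
  also have "\<dots> = (\<Prod>\<mu>\<in>Dom. \<Prod>\<tau>\<in>weyl_orbit t n \<mu>. (z + \<tau> H) ^ wmult t n \<phi> \<tau>)"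
    unfolding weights_partition
    by (rule prod.UNION_disjoint) (use finite_Dom finite_orbit orbits_disjoint in \<open>auto simp: Dom_iff\<close>)
  also have "\<dots> = (\<Prod>\<mu>\<in>Dom. (\<Prod>\<tau>\<in>weyl_orbit t n \<mu>. z + \<tau> H) ^ wmult t n \<phi> \<mu>)"
  proof (rule prod.cong[OF refl])
    fix \<mu> assume "\<mu> \<in> Dom"
    then obtain k where "\<mu> = zx (\<nu> k)" by (auto simp: Dom_iff)
    then have "(\<Prod>\<tau>\<in>weyl_orbit t n \<mu>. (z + \<tau> H) ^ wmult t n \<phi> \<tau>) = (\<Prod>\<tau>\<in>weyl_orbit t n \<mu>. (z + \<tau> H) ^ wmult t n \<phi> \<mu>)"
      by (intro prod.cong) (auto simp: wmult_orbit)
    then show "(\<Prod>\<tau>\<in>weyl_orbit t n \<mu>. (z + \<tau> H) ^ wmult t n \<phi> \<tau>) = (\<Prod>\<tau>\<in>weyl_orbit t n \<mu>. z + \<tau> H) ^ wmult t n \<phi> \<mu>"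
      by (simp add: prod_power_distrib)
  qed
  finally show ?thesis .
qed

end

section \<open>Orbital factors\<close>

context lie
begin

lemma linh_zero: "linh f \<Longrightarrow> f 0 = 0"
  using linh_smul[OF _ cartan_zero, of f 0] by (simp only: smul_simps mult_zero_left)

lemma linh_sum:
  assumes f: "linh f"
  shows "(\<And>k. k \<in> K \<Longrightarrow> A k \<in> \<hh>) \<Longrightarrow> (\<Sum>k\<in>K. A k) \<in> \<hh> \<and> f (\<Sum>k\<in>K. A k) = (\<Sum>k\<in>K. f (A k))"
proof (induction K rule: infinite_finite_induct)
  case (infinite K)
  show ?case unfolding sum.infinite[OF infinite(1)] using linh_zero[OF f] cartan_zero by blast
next
  case empty
  show ?case unfolding sum.empty using linh_zero[OF f] cartan_zero by blast
next
  case (insert x F)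
  have x: "A x \<in> \<hh>" and F: "(\<Sum>k\<in>F. A k) \<in> \<hh>" "f (\<Sum>k\<in>F. A k) = (\<Sum>k\<in>F. f (A k))" using insert by auto
  show ?case unfolding sum.insert[OF insert(1,2)]
    by (rule conjI, rule cartan_add[OF x F(1)]) (simp only: linh_add[OF f x F(1)] F(2))
qed

lemma linh_zx: "linh f \<Longrightarrow> linh (zx f)"
  unfolding linh_def by (auto simp: cartan_add cartan_smul)

lemma linh_polyf:
  assumes f: "linh f"
  shows "\<exists>g\<in>polyf diag_entries. \<forall>H\<in>\<hh>. f H = g H"
proof -
  \<comment> \<open>Chosen so that every Cartan element is the combination of the \<open>K i\<close>
    with its own diagonal entries as coefficients. In type A the entry at position \<open>0\<close>
    comes out right because the entries sum to zero.\<close>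
  define K where "K i = (if tA then Em i i - Em 0 0 else Em i i - Em (fl i) (fl i))" for i
  have Kd: "is_diag (K i)" if "i < ell" for i
  proof -
    have "i < N" using that ell_le by simp
    then have "is_mat N (K i)" unfolding K_def by (auto intro!: is_mat_intros Em_is_mat simp: N_pos)
    moreover have "\<forall>a b. a \<noteq> b \<longrightarrow> K i a b = 0" by (auto simp: K_def Em_def cmat_apply)
    ultimately show ?thesis unfolding is_diag_def by blast
  qed
  have K: "K i \<in> \<hh>" if i: "i < ell" for i
  proof (cases tA)
    case True
    have "(\<Sum>a<N. K i a a) = (\<Sum>a<N. (if a = i then 1 else 0) - (if a = 0 then 1 else 0))"
      using True by (intro sum.cong) (auto simp: K_def Em_def cmat_apply)
    also have "\<dots> = 0" using i ell_le N_pos by (simp add: sum_subtractf)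
    finally show ?thesis unfolding cartan_A[OF True] using Kd[OF i] by blast
  next
    case False
    have iN: "i < N" using i ell_le by simp
    show ?thesis unfolding cartan_nA[OF False]
    proof (intro conjI Kd[OF i] allI impI)
      fix a assume a: "a < N"
      show "K i (fl a) (fl a) = - K i a a"
      proof -
        have "fl a = i \<longleftrightarrow> a = fl i" using fl_swap[OF a iN] by (rule trans) (rule eq_commute)
        then show ?thesis using False fl_inj[OF a iN] by (simp add: K_def Em_def cmat_apply)
      qed
    qed
  qed
  have dec: "H = (\<Sum>i<ell. H i i *\<^sub>m K i)" if H: "H \<in> \<hh>" for H
  proof (rule diag_eqI)
    show "is_diag H" by (rule cartan_diag[OF H])
    have "(\<Sum>i<ell. H i i *\<^sub>m K i) \<in> \<hh>"
      by (rule linh_sum[OF f, THEN conjunct1]) (use cartan_smul K in auto)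
    then show "is_diag (\<Sum>i<ell. H i i *\<^sub>m K i)" by (rule cartan_diag)
    fix a assume a: "a < N"
    show "H a a = (\<Sum>i<ell. H i i *\<^sub>m K i) a a"
    proof (cases tA)
      case True
      then have s: "(\<Sum>i<N. H i i) = 0" using H cartan_A by blast
      have "(\<Sum>i<ell. H i i *\<^sub>m K i) a a = (\<Sum>i<N. (if i = a then H i i else 0) - H i i * (if a = 0 then 1 else 0))"
        unfolding cmat_apply
        by (rule sum.cong) (use True in \<open>auto simp: cmat_apply K_def Em_def ell_def\<close>)
      also have "\<dots> = H a a - (\<Sum>i<N. H i i) * (if a = 0 then 1 else 0)"
        using a by (simp add: sum_subtractf sum_distrib_right)
      finally show ?thesis using s by simp
    next
      case False
      have h: "H (fl i) (fl i) = - H i i" if "i < N" for i using H that cartan_nA[OF False] by blast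
      have "(\<Sum>i<ell. H i i *\<^sub>m K i) a a = (\<Sum>i<ell. H i i * K i a a)"
        by (simp add: cmat_apply)
      also have "\<dots> = (\<Sum>i<n. (if i = a then H a a else 0) + (if i = fl a then H a a else 0))"
      proof (rule sum.cong)
        fix i assume "i \<in> {..<n}"
        then have i: "i < N" using ell_le False by (simp add: ell_def)
        show "H i i * K i a a = (if i = a then H a a else 0) + (if i = fl a then H a a else 0)"
        proof -
          have e: "a = fl i \<longleftrightarrow> i = fl a" using trans[OF eq_commute fl_swap[OF i a]] by (rule trans) (rule eq_commute)
          have "H i i * K i a a = (if i = a then H i i else 0) - (if i = fl a then H i i else 0)"
            using False by (auto simp: K_def Em_def cmat_apply e)
          then show ?thesis using h[OF a] by auto
        qed
      qed (use False in \<open>simp add: ell_def\<close>)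
      also have "\<dots> = (if a < n then H a a else 0) + (if fl a < n then H a a else 0)"
        by (simp add: sum.distrib)
      also have "\<dots> = H a a"
      proof (cases "fl a = a")
        case True
        then have "H a a = 0" using h[OF a] by simp
        then show ?thesis by simp
      next
        case ne: False
        have "N = 2 * n \<or> N = 2 * n + 1" using False t_cases3 N_B N_C N_D by blast
        then have "(a < n) \<noteq> (fl a < n)" using ne a unfolding fl_def by auto
        then show ?thesis by auto
      qed
      finally show ?thesis by simp
    qed
  qed
  have "f H = (\<Sum>i<ell. f (K i) * H i i)" if H: "H \<in> \<hh>" for H
  proof -
    have "f H = f (\<Sum>i<ell. H i i *\<^sub>m K i)" by (subst dec[OF H]) rule
    also have "\<dots> = (\<Sum>i<ell. f (H i i *\<^sub>m K i))"
      by (rule linh_sum[OF f, THEN conjunct2]) (use cartan_smul K in auto)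
    also have "\<dots> = (\<Sum>i<ell. f (K i) * H i i)"
      by (rule sum.cong) (use linh_smul[OF f K] in \<open>auto simp: mult.commute\<close>)
    finally show ?thesis .
  qed
  then have "\<forall>H\<in>\<hh>. f H = (\<lambda>H. \<Sum>i<ell. f (K i) * H i i) H" by (intro ballI) simp
  moreover have "(\<lambda>H. \<Sum>i<ell. f (K i) * H i i) \<in> polyf diag_entries"
    by (intro polyf_sum polyf_cmult polyf_gen) auto
  ultimately show ?thesis by (rule bexI)
qed

lemma linear_product_coeff_polyf:
  assumes "finite T" "\<And>\<tau>. \<tau> \<in> T \<Longrightarrow> linh \<tau>"
  shows "\<exists>g\<in>polyf diag_entries. \<forall>H\<in>\<hh>. coeff (\<Prod>\<tau>\<in>T. [:\<tau> H, 1:]) m = g H"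
  using assms
proof (induction T arbitrary: m rule: finite_induct)
  case empty
  show ?case by (rule bexI[of _ "\<lambda>_. coeff 1 m"]) (auto intro: polyf_const)
next
  case (insert \<tau> T)
  obtain h where h: "h \<in> polyf diag_entries" "\<forall>H\<in>\<hh>. \<tau> H = h H"
    using linh_polyf[OF insert.prems[OF insertI1]] by (elim bexE)
  have IH: "\<exists>g\<in>polyf diag_entries. \<forall>H\<in>\<hh>. coeff (\<Prod>\<tau>\<in>T. [:\<tau> H, 1:]) k = g H" for k
    by (rule insert.IH) (simp add: insert.prems)
  obtain g where g: "g \<in> polyf diag_entries" "\<forall>H\<in>\<hh>. coeff (\<Prod>\<tau>\<in>T. [:\<tau> H, 1:]) m = g H"
    using IH[of m] by (elim bexE)
  obtain g' where g': "g' \<in> polyf diag_entries" "\<forall>H\<in>\<hh>. coeff (\<Prod>\<tau>\<in>T. [:\<tau> H, 1:]) (m - 1) = g' H"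
    using IH[of "m - 1"] by (elim bexE)
  \<comment> \<open>The factor \<open>0\<close> masks the shifted coefficient when
    \<open>m = 0\<close>, where \<open>m - 1\<close> would return the constant coefficient.\<close>
  have "coeff (\<Prod>\<tau>\<in>insert \<tau> T. [:\<tau> H, 1:]) m = h H * g H + (if m = 0 then 0 else 1) * g' H" if H: "H \<in> \<hh>" for H
    using insert.hyps h(2) g(2) g'(2) H by (cases m) simp_all
  then show ?case
    by (intro bexI[of _ "\<lambda>H. h H * g H + (if m = 0 then 0 else 1) * g' H"] ballI)
      (assumption, rule polyf_add[OF polyf_mult[OF h(1) g(1)] polyf_cmult[OF g'(1)]])
qed

lemma weyl_orbit_WG:
  assumes w: "w \<in> WG" and fin: "finite (weyl_orbit t n \<mu>)"
  shows "bij_betw (\<lambda>\<tau>. zx (\<lambda>H. \<tau> (w H))) (weyl_orbit t n \<mu>) (weyl_orbit t n \<mu>)"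
proof -
  let ?O = "weyl_orbit t n \<mu>" let ?s = "\<lambda>\<tau>. zx (\<lambda>H. \<tau> (w H))"
  have z: "zx (zx f) = zx f" for f by (simp add: zx_eq_iff)
  have sub: "?s ` ?O \<subseteq> ?O"
  proof (rule image_subsetI)
    fix \<tau> assume "\<tau> \<in> ?O"
    then obtain v where v: "v \<in> WG" "\<tau> = zx (\<lambda>H. \<mu> (v H))" unfolding weyl_orbit_eq by blast
    have "?s \<tau> = zx (\<lambda>H. \<mu> ((v \<circ> w) H))" by (simp add: zx_eq_iff v(2) WG_cartan[OF w])
    then show "?s \<tau> \<in> ?O" unfolding weyl_orbit_eq using WG_comp[OF v(1) w] by blast
  qed
  have "inj_on ?s ?O"
  proof (rule inj_onI)
    fix \<sigma> \<tau> assume st: "\<sigma> \<in> ?O" "\<tau> \<in> ?O" "?s \<sigma> = ?s \<tau>"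
    then have e: "zx \<sigma> = \<sigma>" "zx \<tau> = \<tau>" unfolding weyl_orbit_eq by (auto simp: z)
    obtain w' where w': "w' \<in> WG" "\<And>H. w (w' H) = H" using WG_inverse[OF w] by blast
    have "\<sigma> H = \<tau> H" if "H \<in> \<hh>" for H
      using st(3) WG_cartan[OF w'(1) that] w'(2)[of H] by (metis zx_cartan)
    then show "\<sigma> = \<tau>" using e zx_eq_iff by metis
  qed
  then show ?thesis using endo_inj_surj[OF fin sub] by (simp add: bij_betw_def)
qed

end

section \<open>Points of the coordinate space and uniqueness of polynomials\<close>

context lie_basis
begin

abbreviation coords :: "(nat \<Rightarrow> complex) \<Rightarrow> cmat" where
  "coords \<equiv> coordL r B"

text \<open>Variable \<open>0\<close> is \<open>z\<close> and variable \<open>i\<close> is the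
  coordinate \<open>i - 1\<close>. The polynomial ring has infinitely many variables, and a factor
  of \<open>f_orb\<close> could a priori involve those beyond \<open>r\<close>;
  \<open>\<rho>\<close> supplies their values.\<close>

definition pt :: "complex \<Rightarrow> cmat \<Rightarrow> (nat \<Rightarrow> complex) \<Rightarrow> nat \<Rightarrow> complex" where
  "pt z L \<rho> = (\<lambda>i. if i = 0 then z else if i \<le> r then ec (i - 1) L else \<rho> i)"

lemma pt_0 [simp]: "pt z L \<rho> 0 = z"
  by (simp add: pt_def)

lemma coords_lie: "coords x \<in> \<gg>"
  unfolding coordL_def by (rule lincomb_lie)

lemma coords_pt: "L \<in> \<gg> \<Longrightarrow> coords (pt z L \<rho>) = L"
proof -
  assume L: "L \<in> \<gg>"
  have "coords (pt z L \<rho>) = lincomb r B (\<lambda>j. ec j L)"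
    unfolding coordL_def lincomb_def by (auto simp: pt_def fun_eq_iff intro!: sum.cong)
  then show ?thesis using lincomb_ec[OF L] by simp
qed

lemma pt_coords: "pt (x 0) (coords x) x = x"
proof
  fix i
  show "pt (x 0) (coords x) x i = x i"
    using ec_lincomb[of "i - 1" "\<lambda>j. x (Suc j)"] by (auto simp: pt_def coordL_def)
qed

lemma pt_affine:
  "(\<lambda>i. pt z L \<rho> i + s * pt z' L' \<rho>' i) = pt (z + s * z') (L + s *\<^sub>m L') (\<lambda>i. \<rho> i + s * \<rho>' i)"
  by (rule ext) (simp add: pt_def ec_linear)

lemma pt_scale: "(\<lambda>i. s * pt z L \<rho> i) = pt (s * z) (s *\<^sub>m L) (\<lambda>i. s * \<rho> i)"
  by (rule ext) (simp add: pt_def ec_linear)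

lemma mpeval_line: "\<exists>q. \<forall>s. mpeval p (\<lambda>i. x i + s * y i) = poly q s"
proof (rule polyf_curve_poly[OF mpeval_polyf])
  fix g assume "g \<in> vars"
  then obtain i where g: "g = (\<lambda>x. x i)" by auto
  have "(\<lambda>s. x i + s * y i) \<in> polyf {\<lambda>s. s}"
    by (rule polyf_add[OF polyf_const polyf_mult[OF polyf_gen polyf_const]]) simp
  then show "(\<lambda>s. g (\<lambda>i. x i + s * y i)) \<in> polyf {\<lambda>s. s}" by (simp add: g)
qed

lemma pt_polyf: "(\<lambda>L. pt z L \<rho> i) \<in> polyf entries"
proof -
  consider "i = 0" | "i \<noteq> 0" "i \<le> r" | "i > r" by linarith
  then show ?thesis unfolding pt_def by cases (simp_all add: polyf_const ec_polyf)
qed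

lemma mpeval_pt_polyf: "(\<lambda>L. mpeval p (pt z L \<rho>)) \<in> polyf entries"
proof (rule polyf_comp[OF mpeval_polyf])
  fix g assume "g \<in> vars"
  then obtain i where g: "g = (\<lambda>x. x i)" by auto
  show "(\<lambda>L. g (pt z L \<rho>)) \<in> polyf entries" unfolding g by (rule pt_polyf)
qed

lemma mpeval_pt_line:
  "\<exists>q. \<forall>s. mpeval p (pt (z + s * z') (L + s *\<^sub>m L') (\<lambda>i. \<rho> i + s * \<rho>' i)) = poly q s"
  using mpeval_line[of p "pt z L \<rho>" "pt z' L' \<rho>'"] unfolding pt_affine .

lemma mpeval_pt_z: "\<exists>q. \<forall>z. mpeval p (pt z L \<rho>) = poly q z"
proof -
  have e: "L + s *\<^sub>m 0 = L" for s by (simp only: smul_simps add_0_right)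
  show ?thesis using mpeval_pt_line[of p 0 1 L 0 \<rho> "\<lambda>_. 0"] by (simp add: e)
qed

text \<open>With \<open>z\<close> and the surplus variables frozen, both sides are polynomial in the
  matrix entries, so density applies for each choice separately.\<close>

lemma mpoly_eqI:
  assumes "\<And>x. coords x \<in> Orb \<Longrightarrow> mpeval p x = mpeval q x"
  shows "p = q"
proof (rule mpeval_inject)
  fix x
  have "mpeval p (pt (x 0) (coords x) x) = mpeval q (pt (x 0) (coords x) x)"
  proof (rule density_eq[OF mpeval_pt_polyf mpeval_pt_polyf _ coords_lie])
    fix M assume M: "M \<in> Orb"
    show "mpeval p (pt (x 0) M x) = mpeval q (pt (x 0) M x)"
      by (rule assms) (simp only: coords_pt[OF Orb_lie[OF M]] M)
  qed
  then show "mpeval p x = mpeval q x" by (simp only: pt_coords)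
qed

end

section \<open>The orbital factor: existence, degree and irreducibility\<close>

locale weyl_orbit_factor = lie_basis +
  fixes \<mu> :: "cmat \<Rightarrow> complex"
  assumes lin: "linh \<mu>" and fin: "finite (weyl_orbit t n \<mu>)"
begin

abbreviation "O\<mu> \<equiv> weyl_orbit t n \<mu>"
abbreviation "p\<mu> \<equiv> f_orb t n r B \<mu>"

lemma orbit_linh: "\<tau> \<in> O\<mu> \<Longrightarrow> linh \<tau>"
  unfolding weyl_orbit_eq using linh_zx linh_WG[OF lin] by blast

lemma zx_in_orbit: "zx \<mu> \<in> O\<mu>"
  unfolding weyl_orbit_eq using WG_id by (auto intro!: exI[of _ id])

lemma card_orbit: "card O\<mu> > 0"
  using zx_in_orbit fin card_gt_0_iff by blast

text \<open>A reflection permutes the orbit and so preserves the product over it, coefficient by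
  coefficient. Chevalley restriction is applied to each coefficient of \<open>z\<close>.\<close>

lemma orbit_coeff_Inv: "Inv (\<lambda>H. coeff (\<Prod>\<tau>\<in>O\<mu>. [:\<tau> H, 1:]) m)"
proof -
  obtain g where g: "g \<in> polyf diag_entries" "\<forall>H\<in>\<hh>. coeff (\<Prod>\<tau>\<in>O\<mu>. [:\<tau> H, 1:]) m = g H"
    using linear_product_coeff_polyf[OF fin orbit_linh] by blast
  have "Inv g"
  proof (rule Inv_of_refl_invariant[OF g(1)])
    fix i j H assume ij: "rvalid i j" and H: "H \<in> \<hh>"
    have rH: "refl i j H \<in> \<hh>" using refl_cartan rvalidD[OF ij] H by blast
    have "(\<Prod>\<tau>\<in>O\<mu>. [:\<tau> (refl i j H), 1:]) = (\<Prod>\<tau>\<in>O\<mu>. [:zx (\<lambda>H. \<tau> (refl i j H)) H, 1:])"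
      using H by simp
    also have "\<dots> = (\<Prod>\<tau>\<in>O\<mu>. [:\<tau> H, 1:])"
      by (rule prod.reindex_bij_betw[OF weyl_orbit_WG[OF WG_refl[OF ij] fin]])
    finally have e: "(\<Prod>\<tau>\<in>O\<mu>. [:\<tau> (refl i j H), 1:]) = (\<Prod>\<tau>\<in>O\<mu>. [:\<tau> H, 1:])" .
    show "g (refl i j H) = g H"
      using bspec[OF g(2) H] bspec[OF g(2) rH] by (simp only: e)
  qed
  then show ?thesis by (rule Inv_cong) (use g(2) in simp)
qed

lemma f_orb_exists:
  "\<exists>p. \<forall>x g H. H \<in> \<hh> \<and> conj_by t n g (coords x) H \<longrightarrow> mpeval p x = (\<Prod>\<tau>\<in>O\<mu>. x 0 + \<tau> H)"
proof -
  let ?k = "card O\<mu>"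
  have "\<forall>m. \<exists>F. F \<in> polyf entries \<and> (\<forall>g L H. g \<in> GG \<and> L \<in> \<gg> \<and> H \<in> \<hh> \<and> g \<odot> L = H \<odot> g \<longrightarrow>
      F L = coeff (\<Prod>\<tau>\<in>O\<mu>. [:\<tau> H, 1:]) m)"
  proof
    fix m
    show "\<exists>F. F \<in> polyf entries \<and> (\<forall>g L H. g \<in> GG \<and> L \<in> \<gg> \<and> H \<in> \<hh> \<and> g \<odot> L = H \<odot> g \<longrightarrow>
        F L = coeff (\<Prod>\<tau>\<in>O\<mu>. [:\<tau> H, 1:]) m)"
      using orbit_coeff_Inv[of m] unfolding Inv_def Bex_def .
  qed
  from choice[OF this] obtain F where F: "\<And>m. F m \<in> polyf entries"
    "\<And>m g L H. g \<in> GG \<Longrightarrow> L \<in> \<gg> \<Longrightarrow> H \<in> \<hh> \<Longrightarrow> g \<odot> L = H \<odot> g \<Longrightarrow> F m L = coeff (\<Prod>\<tau>\<in>O\<mu>. [:\<tau> H, 1:]) m"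
    by blast
  have c: "(\<lambda>x. coords x i j) \<in> polyf vars" for i j
    unfolding coordL_def lincomb_def by (intro polyf_sum polyf_mult polyf_const polyf_gen) auto
  have Fc: "(\<lambda>x. F m (coords x)) \<in> polyf vars" for m
    by (rule polyf_comp[OF F(1)]) (auto intro: c)
  have "(\<lambda>x. \<Sum>m\<le>?k. F m (coords x) * x 0 ^ m) \<in> polyf vars"
    by (intro polyf_sum polyf_mult polyf_power Fc polyf_gen) auto
  then obtain p where p: "(\<lambda>x. \<Sum>m\<le>?k. F m (coords x) * x 0 ^ m) = mpeval p"
    using polyf_mpeval by blast
  have "mpeval p x = (\<Prod>\<tau>\<in>O\<mu>. x 0 + \<tau> H)" if H: "H \<in> \<hh>" and g: "conj_by t n g (coords x) H" for x g H
  proof -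
    let ?P = "\<Prod>\<tau>\<in>O\<mu>. [:\<tau> H, 1:]"
    have g': "g \<in> GG" "g \<odot> coords x = H \<odot> g" using g by (auto simp: conj_by_def N_eq)
    have deg: "degree ?P \<le> ?k"
      using degree_prod_sum_le[OF fin, of "\<lambda>\<tau>. [:\<tau> H, 1:]"] by simp
    have "mpeval p x = (\<Sum>m\<le>?k. F m (coords x) * x 0 ^ m)" by (rule fun_cong[OF p, symmetric])
    also have "\<dots> = (\<Sum>m\<le>?k. coeff ?P m * x 0 ^ m)"
      using F(2)[OF g'(1) coords_lie H g'(2)] by simp
    also have "\<dots> = poly ?P (x 0)"
      unfolding poly_altdef
      by (rule sum.mono_neutral_right) (use deg in \<open>auto simp: coeff_eq_0\<close>)
    also have "\<dots> = (\<Prod>\<tau>\<in>O\<mu>. x 0 + \<tau> H)" by (simp add: poly_prod add.commute)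
    finally show ?thesis .
  qed
  then show ?thesis by blast
qed

lemma f_orb_conj:
  assumes "H \<in> \<hh>" "g \<in> GG" "g \<odot> coords x = H \<odot> g"
  shows "mpeval p\<mu> x = (\<Prod>\<tau>\<in>O\<mu>. x 0 + \<tau> H)"
proof -
  let ?Q = "\<lambda>p. \<forall>x g H. H \<in> \<hh> \<and> conj_by t n g (coords x) H \<longrightarrow> mpeval p x = (\<Prod>\<tau>\<in>O\<mu>. x 0 + \<tau> H)"
  obtain p where p: "?Q p" using f_orb_exists by blast
  have "q = p" if q: "?Q q" for q
  proof (rule mpoly_eqI)
    fix x assume "coords x \<in> Orb"
    then obtain g H where "g \<in> GG" "H \<in> \<hh>" "g \<odot> coords x = H \<odot> g" using Orb_conj by blast
    then have "H \<in> \<hh> \<and> conj_by t n g (coords x) H" by (simp add: conj_by_def N_eq)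
    then show "mpeval q x = mpeval p x" using p[rule_format, of H g x] q[rule_format, of H g x] by simp
  qed
  then have "p\<mu> = p" unfolding f_orb_def using p by (intro the_equality)
  then show ?thesis using p assms by (simp add: conj_by_def N_eq)
qed

lemma f_orb_pt:
  assumes "H \<in> \<hh>" "g \<in> GG" "L \<in> \<gg>" "g \<odot> L = H \<odot> g"
  shows "mpeval p\<mu> (pt z L \<rho>) = (\<Prod>\<tau>\<in>O\<mu>. z + \<tau> H)"
  using f_orb_conj[OF assms(1,2), of "pt z L \<rho>"] assms(3,4) by (simp add: coords_pt)

lemma f_orb_cartan: "H \<in> \<hh> \<Longrightarrow> mpeval p\<mu> (pt z H \<rho>) = (\<Prod>\<tau>\<in>O\<mu>. z + \<tau> H)"
  by (rule f_orb_pt[OF _ grp_idm]) (auto simp: cartan_lie lie_is_mat)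

lemma f_orb_Orb: "L \<in> Orb \<Longrightarrow> \<exists>H\<in>\<hh>. \<forall>z \<rho>. mpeval p\<mu> (pt z L \<rho>) = (\<Prod>\<tau>\<in>O\<mu>. z + \<tau> H)"
proof -
  assume L: "L \<in> Orb"
  obtain g H where gH: "g \<in> GG" "H \<in> \<hh>" "g \<odot> L = H \<odot> g" using Orb_conj[OF L] by blast
  show ?thesis by (rule bexI[OF _ gH(2)]) (simp add: f_orb_pt[OF gH(2,1) Orb_lie[OF L] gH(3)])
qed

lemma f_orb_Ad:
  assumes ij: "i < N" "j < N" "i \<noteq> j" and L: "L \<in> \<gg>"
  shows "mpeval p\<mu> (pt z (Ad i j s L) \<rho>) = mpeval p\<mu> (pt z L \<rho>)"
proof (rule density_eq[OF polyf_Ad[OF mpeval_pt_polyf] mpeval_pt_polyf _ L])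
  fix M assume M: "M \<in> Orb"
  obtain g H where gH: "g \<in> GG" "H \<in> \<hh>" "g \<odot> M = H \<odot> g" using Orb_conj[OF M] by blast
  have Ml: "M \<in> \<gg>" by (rule Orb_lie[OF M])
  note c = conj_Ad[OF gH ij lie_is_mat[OF Ml], of s]
  show "mpeval p\<mu> (pt z (Ad i j s M) \<rho>) = mpeval p\<mu> (pt z M \<rho>)"
    using f_orb_pt[OF gH(2) c(1) Ad_lie[OF ij Ml] c(2)] f_orb_pt[OF gH(2,1) Ml gH(3)] by simp
qed

lemma f_orb_homogeneous: "mpeval p\<mu> (\<lambda>i. s * x i) = s ^ card O\<mu> * mpeval p\<mu> x"
proof -
  have "(\<lambda>L. mpeval p\<mu> (\<lambda>i. s * pt (x 0) L x i)) \<in> polyf entries"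
  proof (rule polyf_comp[OF mpeval_polyf])
    fix g assume "g \<in> vars"
    then obtain i where g: "g = (\<lambda>x. x i)" by auto
    show "(\<lambda>L. g (\<lambda>i. s * pt (x 0) L x i)) \<in> polyf entries" unfolding g by (rule polyf_cmult[OF pt_polyf])
  qed
  then have "mpeval p\<mu> (\<lambda>i. s * pt (x 0) (coords x) x i) = s ^ card O\<mu> * mpeval p\<mu> (pt (x 0) (coords x) x)"
  proof (rule density_eq[OF _ polyf_cmult[OF mpeval_pt_polyf] _ coords_lie])
    fix M assume M: "M \<in> Orb"
    obtain g H where gH: "g \<in> GG" "H \<in> \<hh>" "g \<odot> M = H \<odot> g" using Orb_conj[OF M] by blast
    have Ml: "M \<in> \<gg>" by (rule Orb_lie[OF M])
    have "g \<odot> (s *\<^sub>m M) = (s *\<^sub>m H) \<odot> g" unfolding mm_linear gH(3) ..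
    then have "mpeval p\<mu> (pt (s * x 0) (s *\<^sub>m M) (\<lambda>i. s * x i)) = (\<Prod>\<tau>\<in>O\<mu>. s * x 0 + \<tau> (s *\<^sub>m H))"
      by (rule f_orb_pt[OF cartan_smul[OF gH(2)] gH(1) lie_smul[OF Ml]])
    also have "\<dots> = (\<Prod>\<tau>\<in>O\<mu>. s * (x 0 + \<tau> H))"
      by (rule prod.cong) (use linh_smul[OF orbit_linh gH(2)] in \<open>auto simp: algebra_simps\<close>)
    also have "\<dots> = s ^ card O\<mu> * mpeval p\<mu> (pt (x 0) M x)"
      using f_orb_pt[OF gH(2,1) Ml gH(3)] by (simp add: prod.distrib)
    finally show "mpeval p\<mu> (\<lambda>i. s * pt (x 0) M x i) = s ^ card O\<mu> * mpeval p\<mu> (pt (x 0) M x)"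
      by (simp only: pt_scale)
  qed
  then show ?thesis by (simp only: pt_coords)
qed

lemma f_orb_one: "mpeval p\<mu> (pt 1 0 \<rho>) = 1"
  unfolding f_orb_cartan[OF cartan_zero]
  by (rule prod.neutral) (use linh_zero[OF orbit_linh] in simp)

lemma f_orb_nonzero: "p\<mu> \<noteq> 0"
  using f_orb_one mpeval_zero[of "pt 1 0 (\<lambda>_. 0)"] by auto

lemma f_orb_deg: "mpdeg p\<mu> = card O\<mu>"
  by (rule homogeneous_mpdeg[OF f_orb_nonzero f_orb_homogeneous])

text \<open>Along a one-parameter unipotent subgroup two factors of an invariant polynomial are
  univariate polynomials with constant product, hence constant.\<close>
lemma factor_Ad:
  assumes ab: "p\<mu> = a * b" and ij: "i < N" "j < N" "i \<noteq> j" and L: "L \<in> Orb"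
  shows "mpeval a (pt z (Ad i j s L) \<rho>) = mpeval a (pt z L \<rho>)"
proof -
  have Ll: "L \<in> \<gg>" by (rule Orb_lie[OF L])
  obtain H where H: "H \<in> \<hh>" "\<And>z \<rho>. mpeval p\<mu> (pt z L \<rho>) = (\<Prod>\<tau>\<in>O\<mu>. z + \<tau> H)"
    using f_orb_Orb[OF L] by blast
  \<comment> \<open>The product of the two factors is nonzero only for \<open>z\<close> outside
    finitely many values. The others are recovered because both sides are polynomial in
    \<open>z\<close>.\<close>
  have nz: "mpeval a (pt z (Ad i j s L) \<rho>) = mpeval a (pt z L \<rho>)" if z: "z \<notin> (\<lambda>\<tau>. - \<tau> H) ` O\<mu>" for z
  proof -
    obtain qa where qa: "\<And>s. mpeval a (pt z (Ad i j s L) \<rho>) = poly qa s"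
      using polyf_Ad_curve[OF mpeval_pt_polyf[of a z \<rho>]] by blast
    obtain qb where qb: "\<And>s. mpeval b (pt z (Ad i j s L) \<rho>) = poly qb s"
      using polyf_Ad_curve[OF mpeval_pt_polyf[of b z \<rho>]] by blast
    have "poly qa s * poly qb s = mpeval p\<mu> (pt z L \<rho>)" for s
      using f_orb_Ad[OF ij Ll, of z s \<rho>] by (simp add: ab mpeval_mult qa qb)
    moreover have "mpeval p\<mu> (pt z L \<rho>) \<noteq> 0"
      unfolding H(2) using z fin by (auto simp: add_eq_0_iff2)
    ultimately have "poly qa s = poly qa 0" by (rule poly_product_const)
    then show ?thesis using qa[of s] qa[of 0] Ad_zero[OF lie_is_mat[OF Ll]] by simp
  qed
  obtain q where q: "\<And>z. mpeval a (pt z (Ad i j s L) \<rho>) = poly q z" using mpeval_pt_z by blast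
  obtain q' where q': "\<And>z. mpeval a (pt z L \<rho>) = poly q' z" using mpeval_pt_z by blast
  have "q = q'"
    by (rule poly_eq_cofinite[of "(\<lambda>\<tau>. - \<tau> H) ` O\<mu>"]) (use nz q q' fin in auto)
  then show ?thesis by (simp add: q q')
qed

lemma factor_Ad_lie:
  assumes ab: "p\<mu> = a * b" and ij: "i < N" "j < N" "i \<noteq> j" and L: "L \<in> \<gg>"
  shows "mpeval a (pt z (Ad i j s L) \<rho>) = mpeval a (pt z L \<rho>)"
  by (rule density_eq[OF polyf_Ad[OF mpeval_pt_polyf] mpeval_pt_polyf factor_Ad[OF ab ij] L])

lemma factor_WG:
  assumes ab: "p\<mu> = a * b" and w: "w \<in> WG" and H: "H \<in> \<hh>"
  shows "mpeval a (pt z (w H) \<rho>) = mpeval a (pt z H \<rho>)"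
  by (rule WG_invariant_of_Ad[of "\<lambda>L. mpeval a (pt z L \<rho>)", OF factor_Ad_lie[OF ab] w H])

text \<open>The points with \<open>z = - \<mu> H\<close> form a linear space on which
  \<open>a * b\<close> vanishes. Two points witnessing the failure for \<open>a\<close> and for
  \<open>b\<close> are joined by a line inside it, where the claim reduces to univariate polynomials
  having no zero divisors.\<close>

lemma factor_vanishing:
  assumes ab: "p\<mu> = a * b"
  shows "(\<forall>H\<in>\<hh>. \<forall>\<rho>. mpeval a (pt (- \<mu> H) H \<rho>) = 0) \<or> (\<forall>H\<in>\<hh>. \<forall>\<rho>. mpeval b (pt (- \<mu> H) H \<rho>) = 0)"
proof (rule ccontr)
  assume "\<not> ?thesis"
  then obtain H \<rho> K \<sigma> where H: "H \<in> \<hh>" "mpeval a (pt (- \<mu> H) H \<rho>) \<noteq> 0"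
    and K: "K \<in> \<hh>" "mpeval b (pt (- \<mu> K) K \<sigma>) \<noteq> 0" by blast
  \<comment> \<open>The surplus variables are interpolated as well, and linearity of
    \<open>\<mu>\<close> keeps the whole line in the hyperplane.\<close>
  let ?L = "\<lambda>s. pt (- \<mu> H + s * (- \<mu> (K - H))) (H + s *\<^sub>m (K - H)) (\<lambda>i. \<rho> i + s * (\<sigma> i - \<rho> i))"
  obtain qa where qa: "\<And>s. mpeval a (?L s) = poly qa s"
    using mpeval_pt_line[of a "- \<mu> H" "- \<mu> (K - H)" H "K - H" \<rho> "\<lambda>i. \<sigma> i - \<rho> i"] by (elim exE) blast
  obtain qb where qb: "\<And>s. mpeval b (?L s) = poly qb s"
    using mpeval_pt_line[of b "- \<mu> H" "- \<mu> (K - H)" H "K - H" \<rho> "\<lambda>i. \<sigma> i - \<rho> i"] by (elim exE) blast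
  have KH: "K - H \<in> \<hh>" by (rule cartan_diff[OF K(1) H(1)])
  have "poly (qa * qb) s = 0" for s
  proof -
    have h: "H + s *\<^sub>m (K - H) \<in> \<hh>" by (rule cartan_add[OF H(1) cartan_smul[OF KH]])
    have "- \<mu> H + s * (- \<mu> (K - H)) = - \<mu> (H + s *\<^sub>m (K - H))"
      using linh_add[OF lin H(1) cartan_smul[OF KH]] linh_smul[OF lin KH] by simp
    then have "mpeval p\<mu> (?L s) = (\<Prod>\<tau>\<in>O\<mu>. - \<mu> (H + s *\<^sub>m (K - H)) + \<tau> (H + s *\<^sub>m (K - H)))"
      using f_orb_cartan[OF h] by (simp only:)
    also have "\<dots> = 0"
      by (rule prod_zero[OF fin], rule bexI[OF _ zx_in_orbit]) (use h in simp)
    finally show ?thesis by (simp only: ab mpeval_mult qa qb poly_mult)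
  qed
  then have "qa * qb = 0" using poly_all_0_iff_0 by blast
  then have "qa = 0 \<or> qb = 0" by simp
  moreover have "poly qa 0 \<noteq> 0"
  proof -
    have "H + 0 *\<^sub>m (K - H) = H" by (simp only: smul_simps(8) add_0_right)
    then show ?thesis using H(2) qa[of 0] by simp
  qed
  moreover have "poly qb 1 \<noteq> 0"
  proof -
    have "H + 1 *\<^sub>m (K - H) = K" by (simp only: smul_simps) simp
    moreover have "- \<mu> H + 1 * (- \<mu> (K - H)) = - \<mu> K" using linh_minus[OF lin K(1) H(1)] by simp
    ultimately have "?L 1 = pt (- \<mu> K) K \<sigma>" by (simp only:) simp
    then show ?thesis using K(2) qb[of 1] by simp
  qed
  ultimately show False by auto
qed

lemma cofactor_const:
  assumes ab: "p\<mu> = a * b" and v: "\<And>H \<rho>. H \<in> \<hh> \<Longrightarrow> mpeval a (pt (- \<mu> H) H \<rho>) = 0"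
  shows "b dvd 1"
proof -
  have ba: "p\<mu> = b * a" using ab by (simp add: mult.commute)
  have van: "mpeval a (pt (- \<tau> H) H \<rho>) = 0" if \<tau>: "\<tau> \<in> O\<mu>" and H: "H \<in> \<hh>" for \<tau> H \<rho>
  proof -
    obtain w where w: "w \<in> WG" "\<tau> = zx (\<lambda>H. \<mu> (w H))" using \<tau> unfolding weyl_orbit_eq by blast
    have "mpeval a (pt (- \<tau> H) H \<rho>) = mpeval a (pt (- \<mu> (w H)) H \<rho>)" using w H by simp
    also have "\<dots> = mpeval a (pt (- \<mu> (w H)) (w H) \<rho>)" by (rule factor_WG[OF ab w(1) H, symmetric])
    also have "\<dots> = 0" by (rule v[OF WG_cartan[OF w(1) H]])
    finally show ?thesis .
  qed
  \<comment> \<open>Where the orbit takes distinct values, \<open>a\<close> has as many roots in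
    \<open>z\<close> as the orbit has elements. This exhausts the degree of the product, so
    \<open>b\<close> is constant in \<open>z\<close>.\<close>
  have sep: "mpeval b (pt z H \<rho>) = mpeval b (pt 0 H \<rho>)"
    if H: "H \<in> \<hh>" and inj: "inj_on (\<lambda>\<tau>. \<tau> H) O\<mu>" for z H \<rho>
  proof -
    obtain qa where qa: "\<And>z. mpeval a (pt z H \<rho>) = poly qa z" using mpeval_pt_z by blast
    obtain qb where qb: "\<And>z. mpeval b (pt z H \<rho>) = poly qb z" using mpeval_pt_z by blast
    have "poly (qa * qb) z = poly (\<Prod>\<tau>\<in>O\<mu>. [:\<tau> H, 1:]) z" for z
      using f_orb_cartan[OF H, of z \<rho>] by (simp add: ab mpeval_mult qa qb poly_prod add.commute)
    then have e: "qa * qb = (\<Prod>\<tau>\<in>O\<mu>. [:\<tau> H, 1:])" by (simp add: poly_eq_poly_eq_iff[symmetric] fun_eq_iff)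
    have "(\<Prod>\<tau>\<in>O\<mu>. [:\<tau> H, 1:]) \<noteq> 0" using fin by simp
    then have nz: "qa \<noteq> 0" "qb \<noteq> 0" using e by auto
    have "degree qa + degree qb \<le> card O\<mu>"
      using degree_prod_sum_le[OF fin, of "\<lambda>\<tau>. [:\<tau> H, 1:]"] degree_mult_eq[OF nz] e by simp
    moreover have "card O\<mu> \<le> degree qa"
    proof -
      have "card O\<mu> = card ((\<lambda>\<tau>. - \<tau> H) ` O\<mu>)"
        by (rule card_image[symmetric]) (use inj in \<open>auto simp: inj_on_def\<close>)
      also have "\<dots> \<le> card {z. poly qa z = 0}"
        by (rule card_mono[OF poly_roots_finite[OF nz(1)]]) (use van[OF _ H, of _ \<rho>] qa in auto)
      also have "\<dots> \<le> degree qa" by (rule card_poly_roots_bound[OF nz(1)])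
      finally show ?thesis .
    qed
    ultimately have "degree qb = 0" by simp
    then obtain c where "qb = [:c:]" by (rule degree_eq_zeroE)
    then show ?thesis by (simp add: qb)
  qed
  \<comment> \<open>Differences of distinct orbit elements are nonzero functionals, so some
    \<open>H0\<close> separates the orbit. Almost all points \<open>H + s *\<^sub>m H0\<close> do so
    too, which extends \<open>sep\<close> to every \<open>H\<close>.\<close>
  let ?\<Phi> = "(\<lambda>(\<sigma>, \<tau>) H. \<sigma> H - \<tau> H) ` {(\<sigma>, \<tau>) \<in> O\<mu> \<times> O\<mu>. \<sigma> \<noteq> \<tau>}"
  have "\<exists>H\<in>\<hh>. \<forall>f\<in>?\<Phi>. f H \<noteq> 0"
  proof (rule separating_element)
    have "finite {(\<sigma>, \<tau>) \<in> O\<mu> \<times> O\<mu>. \<sigma> \<noteq> \<tau>}"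
      by (rule finite_subset[OF _ finite_cartesian_product[OF fin fin]]) blast
    then show "finite ?\<Phi>" by (rule finite_imageI)
    fix f assume "f \<in> ?\<Phi>"
    then obtain \<sigma> \<tau> where st: "f = (\<lambda>H. \<sigma> H - \<tau> H)" "\<sigma> \<in> O\<mu>" "\<tau> \<in> O\<mu>" "\<sigma> \<noteq> \<tau>" by auto
    have "\<exists>H\<in>\<hh>. \<sigma> H \<noteq> \<tau> H" using st(2-4) unfolding weyl_orbit_eq by (auto simp: zx_eq_iff)
    then show "linh f \<and> (\<exists>H\<in>\<hh>. f H \<noteq> 0)" unfolding st(1) using linh_diff orbit_linh st(2,3) by auto
  qed
  then obtain H0 where H0: "H0 \<in> \<hh>" "\<And>f. f \<in> ?\<Phi> \<Longrightarrow> f H0 \<noteq> 0" by blast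
  have H0': "\<sigma> H0 \<noteq> \<tau> H0" if "\<sigma> \<in> O\<mu>" "\<tau> \<in> O\<mu>" "\<sigma> \<noteq> \<tau>" for \<sigma> \<tau>
    using H0(2)[of "\<lambda>H. \<sigma> H - \<tau> H"] that by force
  have cartan: "mpeval b (pt z H \<rho>) = mpeval b (pt 0 H \<rho>)" if H: "H \<in> \<hh>" for z H \<rho>
  proof -
    have c: "z' + s * 0 = z'" "\<rho> i + s * 0 = \<rho> i" for z' s i by simp_all
    obtain q where q: "\<And>s. mpeval b (pt z (H + s *\<^sub>m H0) \<rho>) = poly q s"
      using mpeval_pt_line[of b z 0 H H0 \<rho> "\<lambda>_. 0"] unfolding c by blast
    obtain q' where q': "\<And>s. mpeval b (pt 0 (H + s *\<^sub>m H0) \<rho>) = poly q' s"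
      using mpeval_pt_line[of b 0 0 H H0 \<rho> "\<lambda>_. 0"] unfolding c by blast
    let ?S = "(\<lambda>(\<sigma>, \<tau>). - (\<sigma> H - \<tau> H) / (\<sigma> H0 - \<tau> H0)) ` (O\<mu> \<times> O\<mu>)"
    have "q = q'"
    proof (rule poly_eq_cofinite[of ?S])
      show "finite ?S" using fin by blast
      fix s assume s: "s \<notin> ?S"
      have "inj_on (\<lambda>\<tau>. \<tau> (H + s *\<^sub>m H0)) O\<mu>"
      proof (rule inj_onI, rule ccontr)
        fix \<sigma> \<tau> assume st: "\<sigma> \<in> O\<mu>" "\<tau> \<in> O\<mu>" "\<sigma> (H + s *\<^sub>m H0) = \<tau> (H + s *\<^sub>m H0)" "\<sigma> \<noteq> \<tau>"
        have l: "\<tau> (H + s *\<^sub>m H0) = \<tau> H + s * \<tau> H0" if "\<tau> \<in> O\<mu>" for \<tau>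
          using linh_add[OF orbit_linh[OF that] H cartan_smul[OF H0(1)]] linh_smul[OF orbit_linh[OF that] H0(1)] by simp
        have "\<sigma> H + s * \<sigma> H0 = \<tau> H + s * \<tau> H0" using st(3) unfolding l[OF st(1)] l[OF st(2)] .
        then have "s * (\<sigma> H0 - \<tau> H0) = - (\<sigma> H - \<tau> H)" by (simp add: algebra_simps)
        then have "s = - (\<sigma> H - \<tau> H) / (\<sigma> H0 - \<tau> H0)" using H0'[OF st(1,2,4)] by (simp add: eq_divide_eq)
        then show False using s st(1,2) by force
      qed
      from sep[OF cartan_add[OF H cartan_smul[OF H0(1)]] this, of z \<rho>]
      show "poly q s = poly q' s" by (simp only: q q')
    qed
    moreover have "H + 0 *\<^sub>m H0 = H" by (simp only: smul_simps add_0_right)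
    ultimately show ?thesis using q[of 0] q'[of 0] by simp
  qed
  have orb: "mpeval b (pt z L \<rho>) = mpeval b (pt 0 L \<rho>)" if "L \<in> Orb" for z L \<rho>
    using that
  proof (induction rule: Orb.induct)
    case (Orb_base H)
    then show ?case by (rule cartan)
  next
    case (Orb_step M i j s)
    then show ?case using factor_Ad[OF ba Orb_step(2-4,1)] by simp
  qed
  define c where "c = mpeval b (pt 0 0 (\<lambda>_. 0))"
  have zero: "pt 0 0 (\<lambda>_. 0) = (\<lambda>_. 0)" using pt_scale[of 0 0 0 "\<lambda>_. 0"] unfolding smul_simps by simp
  have "c = mpeval b (pt 1 0 (\<lambda>_. 0))"
    unfolding c_def by (rule cartan[OF cartan_zero, symmetric])
  then have c: "c \<noteq> 0" using f_orb_one[of "\<lambda>_. 0"] by (auto simp: ab mpeval_mult)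
  have "b = Poly_Mapping.single 0 c"
  proof (rule mpoly_eqI)
    fix x assume x: "coords x \<in> Orb"
    obtain H where H: "H \<in> \<hh>" "\<And>z \<rho>. mpeval p\<mu> (pt z (coords x) \<rho>) = (\<Prod>\<tau>\<in>O\<mu>. z + \<tau> H)"
      using f_orb_Orb[OF x] by blast
    have "finite ((\<lambda>\<tau>. - \<tau> H) ` O\<mu>)" using fin by blast
    then obtain z where z: "z \<notin> (\<lambda>\<tau>. - \<tau> H) ` O\<mu>" using ex_new_if_finite[OF infinite_UNIV_char_0] by blast
    \<comment> \<open>As \<open>b\<close> does not depend on \<open>z\<close>, the point
      \<open>x\<close> may be exchanged for one with another \<open>z\<close> at which
      \<open>p\<mu>\<close> is nonzero. This makes the coefficient of the monomial on the line
      through \<open>y\<close> nonzero.\<close>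
    define y where "y = pt z (coords x) x"
    have y: "mpeval p\<mu> y \<noteq> 0" unfolding y_def H(2) using z fin by (auto simp: add_eq_0_iff2)
    obtain qa where qa: "\<And>s. mpeval a (\<lambda>i. s * y i) = poly qa s" using mpeval_line[of a "\<lambda>_. 0" y] by auto
    obtain qb where qb: "\<And>s. mpeval b (\<lambda>i. s * y i) = poly qb s" using mpeval_line[of b "\<lambda>_. 0" y] by auto
    have "poly qb s * poly qa s = mpeval p\<mu> y * s ^ card O\<mu>" for s
      using f_orb_homogeneous[of s y] unfolding qa[symmetric] qb[symmetric]
      by (simp only: ab mpeval_mult mult.commute)
    moreover have qb0: "poly qb 0 = c" using qb[of 0] by (simp add: c_def zero)
    ultimately have "poly qb 1 = poly qb 0" using y c by (intro poly_dvd_power_const[of qb qa]) auto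
    then have "mpeval b y = c" using qb[of 1] qb0 by simp
    moreover have "mpeval b y = mpeval b x"
      unfolding y_def using orb[OF x, of z x] orb[OF x, of "x 0" x] by (simp add: pt_coords)
    ultimately show "mpeval b x = mpeval (Poly_Mapping.single 0 c) x" by (simp add: mpeval_const)
  qed
  then show ?thesis using mpoly_unit_of_const[of b c] c by (simp add: mpeval_const)
qed

theorem f_orb_irreducible: "irreducible p\<mu>"
proof (rule irreducibleI)
  show "p\<mu> \<noteq> 0" by (rule f_orb_nonzero)
  show "\<not> p\<mu> dvd 1"
  proof
    assume "p\<mu> dvd 1"
    then obtain q where "1 = p\<mu> * q" by (rule dvdE)
    then have "mpeval 1 (\<lambda>_. 0) = mpeval p\<mu> (\<lambda>_. 0) * mpeval q (\<lambda>_. 0)" by (simp flip: mpeval_mult)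
    moreover have "mpeval p\<mu> (\<lambda>_. 0) = 0"
      using f_orb_homogeneous[of 0 "\<lambda>_. 0"] by (simp only: mult_zero_left zero_power[OF card_orbit])
    ultimately show False by (simp add: mpeval_one)
  qed
  fix a b assume ab: "p\<mu> = a * b"
  then have ba: "p\<mu> = b * a" by (simp add: mult.commute)
  show "a dvd 1 \<or> b dvd 1"
    using factor_vanishing[OF ab] cofactor_const[OF ab] cofactor_const[OF ba] by blast
qed

end

context weights
begin

lemma weyl_orbit_factor_weight: "weyl_orbit_factor N t n r B (zx (\<nu> k))"
  by unfold_locales (use linh_zx \<nu>_linh finite_orbit in auto)

theorem f_phi_eq: "f_phi r B \<phi> = (\<Prod>\<mu>\<in>Dom. f_orb t n r B \<mu> ^ wmult t n \<phi> \<mu>)"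
proof -
  let ?q = "\<Prod>\<mu>\<in>Dom. f_orb t n r B \<mu> ^ wmult t n \<phi> \<mu>"
  have Dom: "weyl_orbit_factor N t n r B \<mu>" if "\<mu> \<in> Dom" for \<mu>
    using that weyl_orbit_factor_weight Dom_iff by auto
  have orb: "mpeval ?q (pt z M \<rho>) = detrep z M" if "M \<in> Orb" for z M \<rho>
    using that
  proof (induction rule: Orb.induct)
    case (Orb_base H)
    then show ?case
      using det_weights weights_product
      by (simp add: mpeval_prod mpeval_power detrep_eq cartan_lie weyl_orbit_factor.f_orb_cartan[OF Dom])
  next
    case (Orb_step M i j s)
    have M: "M \<in> \<gg>" using Orb_step Orb_lie by blast
    have "mpeval ?q (pt z (Ad i j s M) \<rho>) = mpeval ?q (pt z M \<rho>)"
      using Orb_step(2-4) M by (simp add: mpeval_prod mpeval_power weyl_orbit_factor.f_orb_Ad[OF Dom])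
    also have "\<dots> = detrep z (Ad i j s M)"
      using Orb_step M det_Ad Ad_lie by (simp add: detrep_eq)
    finally show ?case .
  qed
  have q: "mpeval ?q x = det (mat (x 0) + \<phi> (coords x))" for x
  proof -
    have "mpeval ?q (pt (x 0) (coords x) x) = detrep (x 0) (coords x)"
      by (rule density_eq[OF mpeval_pt_polyf detrep_polyf orb coords_lie])
    then show ?thesis by (simp add: pt_coords detrep_eq[OF coords_lie])
  qed
  show ?thesis unfolding f_phi_def
  proof (rule the_equality)
    show "\<forall>x. mpeval ?q x = det (mat (x 0) + \<phi> (coords x))" using q by blast
    fix p assume "\<forall>x. mpeval p x = det (mat (x 0) + \<phi> (coords x))"
    then show "p = ?q" by (intro mpeval_inject) (simp add: q)
  qed
qed

theorem orbital_factorization: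
  "finite {\<mu>. is_weight t n \<phi> \<mu> \<and> dominant t n \<mu>} \<and>
    f_phi r B \<phi> = (\<Prod>\<mu> \<in> {\<mu>. is_weight t n \<phi> \<mu> \<and> dominant t n \<mu>}. f_orb t n r B \<mu> ^ wmult t n \<phi> \<mu>) \<and>
    (\<forall>\<mu> \<in> {\<mu>. is_weight t n \<phi> \<mu> \<and> dominant t n \<mu>}.
       irreducible (f_orb t n r B \<mu>) \<and> mpdeg (f_orb t n r B \<mu>) = card (weyl_orbit t n \<mu>))"
proof -
  have "irreducible (f_orb t n r B \<mu>) \<and> mpdeg (f_orb t n r B \<mu>) = card (weyl_orbit t n \<mu>)" if \<mu>: "\<mu> \<in> Dom" for \<mu>
  proof -
    obtain k where k: "\<mu> = zx (\<nu> k)" using \<mu> Dom_iff by auto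
    show ?thesis unfolding k
      using weyl_orbit_factor.f_orb_irreducible[OF weyl_orbit_factor_weight]
        weyl_orbit_factor.f_orb_deg[OF weyl_orbit_factor_weight] by blast
  qed
  then show ?thesis using finite_Dom f_phi_eq unfolding Dom_def by blast
qed

end

theorem theorem4p9:
  fixes t :: ctype and n r :: nat and B :: "nat \<Rightarrow> cmat"
    and \<phi> :: "cmat \<Rightarrow> complex^'d^'d"
  assumes "n \<ge> 1" and "t = TD \<longrightarrow> n \<ge> 2"
    and "is_basis t n r B"
    and "irreducible_rep t n \<phi>"
  shows "finite {\<mu>. is_weight t n \<phi> \<mu> \<and> dominant t n \<mu>} \<and>
    f_phi r B \<phi> = (\<Prod>\<mu> \<in> {\<mu>. is_weight t n \<phi> \<mu> \<and> dominant t n \<mu>}.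
                       f_orb t n r B \<mu> ^ wmult t n \<phi> \<mu>) \<and>
    (\<forall>\<mu> \<in> {\<mu>. is_weight t n \<phi> \<mu> \<and> dominant t n \<mu>}.
       irreducible (f_orb t n r B \<mu>) \<and> mpdeg (f_orb t n r B \<mu>) = card (weyl_orbit t n \<mu>))"
proof -
  interpret lie_rep "dimN t n" t n r B \<phi>
    by unfold_locales (use assms in auto)
  obtain b :: "'d \<Rightarrow> complex^'d" and \<nu> where b: "inj b \<and> vec.independent (range b) \<and> vec.span (range b) = UNIV \<and>
     (\<forall>i. wvec (\<nu> i) (b i)) \<and> (\<forall>i k H. hreal H \<longrightarrow> \<nu> i H - \<nu> k H \<in> \<real>)"
    using weight_basis_exists by (elim exE) blast
  interpret weights "dimN t n" t n r B \<phi> b \<nu>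
    by unfold_locales (use b in auto)
  show ?thesis by (rule orbital_factorization)
qed

end
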